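(* For a semantics $\sigma\in\{\mathtt{co},\mathtt{st},\mathtt{pr},\mathtt{sst}\}$, let $\mathsf{SF\text{-}SA}^{\sigma}$ be the following decision problem. Input: an argumentation framework $\Lambda=\langle A,R\rangle$, a goal argument $g\in A$, a $\sigma$-labelling $\mathcal{L}$ of $\Lambda$, and an argument $g'\in A$. Question: is $g'$ accepted in every semifactual in $\mathcal{SF}^{\sigma}(g,\mathcal{L})$, i.e. does $\mathcal{L}'(g')=\mathbf{in}$ hold for every $\mathcal{L}'\in\mathcal{SF}^{\sigma}(g,\mathcal{L})$? Then $\mathsf{SF\text{-}SA}^{\sigma}$ is: (1) $coNP$-hard and in $\Theta_2^p$ for $\sigma\in\{\mathtt{co},\mathtt{st}\}$; and (2) $\Pi_2^p$-hard and in $\Theta_3^p$ for $\sigma\in\{\mathtt{pr},\mathtt{sst}\}$.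
   Context: An argumentation framework (AF) is a pair $\Lambda=\langle A,R\rangle$ with $A$ a (finite) set of arguments and $R\subseteq A\times A$ a set of attacks. For $S\subseteq A$ let $\mathit{Def}(S)=\{a\in A\mid \exists b\in S,\ (b,a)\in R\}$ and $\mathit{Acc}(S)=\{a\in A\mid \forall (b,a)\in R,\ b\in \mathit{Def}(S)\}$. $S$ is conflict-free iff $S\cap \mathit{Def}(S)=\emptyset$, and admissible iff it is conflict-free and $S\subseteq \mathit{Acc}(S)$. A set $S\subseteq A$ is an extension called: complete ($\mathtt{co}$) iff it is admissible and $S=\mathit{Acc}(S)$; preferred ($\mathtt{pr}$) iff it is a $\subseteq$-maximal complete extension; stable ($\mathtt{st}$) iff it is a preferred extension with $S\cup \mathit{Def}(S)=A$; semi-stable ($\mathtt{sst}$) iff it is a preferred extension such that $S\cup \mathit{Def}(S)$ is $\subseteq$-maximal (among preferred extensions). A labelling is a total function $\mathcal{L}:A\to\{\mathbf{in},\mathbf{out},\mathbf{und}\}$. The labelling corresponding to an extension $E$ assigns $\mathbf{in}$ to the elements of $E$, $\mathbf{out}$ to the elements of $\mathit{Def}(E)$, and $\mathbf{und}$ to all other arguments. A $\sigma$-labelling of $\Lambda$ is the labelling corresponding to a $\sigma$-extension of $\Lambda$; $\sigma(\Lambda)$ denotes the set of $\sigma$-labellings of $\Lambda$. The distance between labellings is $\delta(\mathcal{L},\mathcal{L}')=|\{a\in A\mid \mathcal{L}(a)\neq\mathcal{L}'(a)\}|$. Semifactuals: for $g\in A$ and $\mathcal{L}\in\sigma(\Lambda)$,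 a labelling $\mathcal{L}'\in\sigma(\Lambda)$ is a semifactual of $\mathcal{L}$ w.r.t. $g$ if (i) $\mathcal{L}(g)=\mathcal{L}'(g)$, and (ii) there is no $\mathcal{L}''\in\sigma(\Lambda)$ with $\mathcal{L}(g)=\mathcal{L}''(g)$ and $\delta(\mathcal{L},\mathcal{L}'')>\delta(\mathcal{L},\mathcal{L}')$. $\mathcal{SF}^{\sigma}(g,\mathcal{L})$ denotes the set of all of them. Complexity: $\Sigma_1^p=NP$, $\Sigma_2^p=NP^{NP}$, $\Pi_2^p=co\Sigma_2^p$; $\Theta_h^p$ is the class of problems decidable in polynomial time by a deterministic Turing machine performing $O(\log n)$ calls to an oracle in $\Sigma_{h-1}^p$. *)

theory Defs
  imports
    Main
    "HOL-Library.Landau_Symbols"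
    "HOL-Computational_Algebra.Polynomial"
begin

section \<open>Argumentation frameworks\<close>

record 'a af =
  args :: "'a set"
  attacks :: "('a \<times> 'a) set"

definition is_af :: "'a af \<Rightarrow> bool" where
  "is_af \<Lambda> \<longleftrightarrow> finite (args \<Lambda>) \<and> attacks \<Lambda> \<subseteq> args \<Lambda> \<times> args \<Lambda>"

definition Def :: "'a af \<Rightarrow> 'a set \<Rightarrow> 'a set" where
  "Def \<Lambda> S = {a \<in> args \<Lambda>. \<exists>b\<in>S. (b, a) \<in> attacks \<Lambda>}"

definition Acc :: "'a af \<Rightarrow> 'a set \<Rightarrow> 'a set" where
  "Acc \<Lambda> S = {a \<in> args \<Lambda>. \<forall>b. (b, a) \<in> attacks \<Lambda> \<longrightarrow> b \<in> Def \<Lambda> S}"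

definition conflict_free :: "'a af \<Rightarrow> 'a set \<Rightarrow> bool" where
  "conflict_free \<Lambda> S \<longleftrightarrow> S \<inter> Def \<Lambda> S = {}"

definition admissible :: "'a af \<Rightarrow> 'a set \<Rightarrow> bool" where
  "admissible \<Lambda> S \<longleftrightarrow> conflict_free \<Lambda> S \<and> S \<subseteq> Acc \<Lambda> S"

definition complete_ext :: "'a af \<Rightarrow> 'a set \<Rightarrow> bool" where
  "complete_ext \<Lambda> S \<longleftrightarrow> S \<subseteq> args \<Lambda> \<and> admissible \<Lambda> S \<and> S = Acc \<Lambda> S"

definition preferred_ext :: "'a af \<Rightarrow> 'a set \<Rightarrow> bool" where
  "preferred_ext \<Lambda> S \<longleftrightarrow>
     complete_ext \<Lambda> S \<and> \<not> (\<exists>T. complete_ext \<Lambda> T \<and> S \<subset> T)"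

definition stable_ext :: "'a af \<Rightarrow> 'a set \<Rightarrow> bool" where
  "stable_ext \<Lambda> S \<longleftrightarrow> preferred_ext \<Lambda> S \<and> S \<union> Def \<Lambda> S = args \<Lambda>"

definition semi_stable_ext :: "'a af \<Rightarrow> 'a set \<Rightarrow> bool" where
  "semi_stable_ext \<Lambda> S \<longleftrightarrow>
     preferred_ext \<Lambda> S \<and>
     \<not> (\<exists>T. preferred_ext \<Lambda> T \<and> S \<union> Def \<Lambda> S \<subset> T \<union> Def \<Lambda> T)"

datatype semantics = Co | St | Pr | Sst

fun extension :: "semantics \<Rightarrow> 'a af \<Rightarrow> 'a set \<Rightarrow> bool" where
  "extension Co = complete_ext"
| "extension St = stable_ext"
| "extension Pr = preferred_ext"
| "extension Sst = semi_stable_ext"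

datatype label = In | Out | Und

type_synonym 'a labelling = "'a \<Rightarrow> label"

text \<open>For \<open>E \<subseteq> args \<Lambda>\<close> this function is constantly \<^const>\<open>Und\<close> outside \<open>args \<Lambda>\<close>, so
  labellings on \<open>args \<Lambda>\<close> that come from extensions are represented by unique functions.\<close>

definition labelling_of :: "'a af \<Rightarrow> 'a set \<Rightarrow> 'a labelling" where
  "labelling_of \<Lambda> E =
     (\<lambda>a. if a \<in> E then In else if a \<in> Def \<Lambda> E then Out else Und)"

definition labellings :: "semantics \<Rightarrow> 'a af \<Rightarrow> 'a labelling set" where
  "labellings \<sigma> \<Lambda> = {labelling_of \<Lambda> E | E. extension \<sigma> \<Lambda> E}"

definition distance :: "'a af \<Rightarrow> 'a labelling \<Rightarrow> 'a labelling \<Rightarrow> nat" where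
  "distance \<Lambda> L L' = card {a \<in> args \<Lambda>. L a \<noteq> L' a}"

definition semifactuals ::
    "semantics \<Rightarrow> 'a af \<Rightarrow> 'a \<Rightarrow> 'a labelling \<Rightarrow> 'a labelling set" where
  "semifactuals \<sigma> \<Lambda> g L =
     {L' \<in> labellings \<sigma> \<Lambda>. L g = L' g \<and>
        \<not> (\<exists>L''\<in>labellings \<sigma> \<Lambda>. L g = L'' g \<and> distance \<Lambda> L L'' > distance \<Lambda> L L')}"


section \<open>Oracle Turing machines\<close>

type_synonym word = "bool list"
type_synonym lang = "word set"

text \<open>
  Multi-tape nondeterministic oracle machines, given by a finite set of transition rules;
  \<open>State i\<close> and \<open>Mark i\<close> provide additional control states and tape symbols, of which a machine
  uses only the finitely many that occur in its rules. A tape is two-way infinite and is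
  represented relative to its head, which always scans cell 0; moving the head shifts the tape.
  A rule \<open>(q, [(a\<^sub>0, b\<^sub>0, m\<^sub>0), \<dots>], q')\<close> applies in state \<open>q\<close> if tape \<open>i\<close> shows \<open>a\<^sub>i\<close>; it
  writes \<open>b\<^sub>i\<close>, performs the move \<open>m\<^sub>i\<close> and enters \<open>q'\<close>.
  Tape 0 is the input tape, tape 1 the query tape (and the output tape of machines that compute
  functions).
\<close>

datatype state = Start | Accept | Query | Yes | No | State nat
datatype symbol = Blank | Bit bool | Mark nat
datatype move = MoveLeft | Stay | MoveRight

type_synonym rule = "state \<times> (symbol \<times> symbol \<times> move) list \<times> state"
type_synonym tape = "int \<Rightarrow> symbol"
type_synonym config = "state \<times> tape list"

record tm =
  tapes :: nat
  rules :: "rule set"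

definition is_tm :: "tm \<Rightarrow> bool" where
  "is_tm M \<longleftrightarrow> 2 \<le> tapes M \<and> finite (rules M) \<and>
     (\<forall>(q, acts, q') \<in> rules M. length acts = tapes M \<and> q \<noteq> Accept \<and> q \<noteq> Query)"

definition deterministic :: "tm \<Rightarrow> bool" where
  "deterministic M \<longleftrightarrow>
     (\<forall>(q, acts, p) \<in> rules M. \<forall>(q', acts', p') \<in> rules M.
        q = q' \<and> map fst acts = map fst acts' \<longrightarrow> acts = acts' \<and> p = p')"

fun offset :: "move \<Rightarrow> int" where
  "offset MoveLeft = - 1"
| "offset Stay = 0"
| "offset MoveRight = 1"

fun act :: "symbol \<times> symbol \<times> move \<Rightarrow> tape \<Rightarrow> tape" where
  "act (a, b, m) t = (\<lambda>i. (t(0 := b)) (i + offset m))"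

definition word_tape :: "word \<Rightarrow> tape" where
  "word_tape w = (\<lambda>i. if 0 \<le> i \<and> i < int (length w) then Bit (w ! nat i) else Blank)"

text \<open>The word on a tape is the maximal block of bits starting at the head.\<close>

definition shows_word :: "tape \<Rightarrow> word \<Rightarrow> bool" where
  "shows_word t w \<longleftrightarrow>
     (\<forall>i < length w. t (int i) = Bit (w ! i)) \<and> t (int (length w)) \<notin> range Bit"

inductive step :: "tm \<Rightarrow> lang \<Rightarrow> config \<Rightarrow> config \<Rightarrow> bool" for M X where
  rule: "step M X (q, ts) (q', map2 act acts ts)"
    if "(q, acts, q') \<in> rules M" and "map fst acts = map (\<lambda>t. t 0) ts"
| query: "step M X (Query, ts) (if w \<in> X then Yes else No, ts)"
    if "shows_word (ts ! 1) w"

text \<open>\<open>computation M X c n k c'\<close>: with oracle \<open>X\<close>, machine \<open>M\<close> can go from \<open>c\<close> to \<open>c'\<close> in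
  \<open>n\<close> steps, of which \<open>k\<close> are oracle calls.\<close>

inductive computation :: "tm \<Rightarrow> lang \<Rightarrow> config \<Rightarrow> nat \<Rightarrow> nat \<Rightarrow> config \<Rightarrow> bool"
  for M X c where
  refl: "computation M X c 0 0 c"
| step: "computation M X c (Suc n) (if fst c' = Query then Suc k else k) c''"
    if "computation M X c n k c'" and "step M X c' c''"

definition initial :: "tm \<Rightarrow> word \<Rightarrow> config" where
  "initial M w = (Start, word_tape w # replicate (tapes M - 1) (word_tape []))"

definition poly_time :: "tm \<Rightarrow> lang \<Rightarrow> bool" where
  "poly_time M X \<longleftrightarrow>
     (\<exists>p :: nat poly. \<forall>w n k c.
        computation M X (initial M w) n k c \<longrightarrow> n \<le> poly p (length w))"

definition log_queries :: "tm \<Rightarrow> lang \<Rightarrow> bool" where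
  "log_queries M X \<longleftrightarrow>
     (\<exists>f :: nat \<Rightarrow> real. f \<in> O(\<lambda>n. ln (real n)) \<and>
        (\<forall>w n k c. computation M X (initial M w) n k c \<longrightarrow> real k \<le> f (length w)))"

definition accepts :: "tm \<Rightarrow> lang \<Rightarrow> word \<Rightarrow> bool" where
  "accepts M X w \<longleftrightarrow> (\<exists>n k ts. computation M X (initial M w) n k (Accept, ts))"

definition decides :: "tm \<Rightarrow> lang \<Rightarrow> lang \<Rightarrow> bool" where
  "decides M X A \<longleftrightarrow> (\<forall>w. w \<in> A \<longleftrightarrow> accepts M X w)"


section \<open>Complexity classes\<close>

text \<open>Machines without oracle are run with the empty oracle, which answers every call by \<^const>\<open>No\<close>.\<close>

definition PTIME :: "lang set" where
  "PTIME = {A. \<exists>M. is_tm M \<and> deterministic M \<and> poly_time M {} \<and> decides M {} A}"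

definition NP :: "lang set" where
  "NP = {A. \<exists>M. is_tm M \<and> poly_time M {} \<and> decides M {} A}"

definition NP_oracle :: "lang set \<Rightarrow> lang set" where
  "NP_oracle C = {A. \<exists>X\<in>C. \<exists>M. is_tm M \<and> poly_time M X \<and> decides M X A}"

fun Sigma_p :: "nat \<Rightarrow> lang set" where
  "Sigma_p 0 = PTIME"
| "Sigma_p (Suc 0) = NP"
| "Sigma_p (Suc (Suc h)) = NP_oracle (Sigma_p (Suc h))"

definition co_class :: "lang set \<Rightarrow> lang set" where
  "co_class C = {- A | A. A \<in> C}"

abbreviation coNP :: "lang set" where
  "coNP \<equiv> co_class NP"

definition Pi_p :: "nat \<Rightarrow> lang set" where
  "Pi_p h = co_class (Sigma_p h)"

text \<open>Used for \<open>h \<ge> 1\<close> only.\<close>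

definition Theta_p :: "nat \<Rightarrow> lang set" where
  "Theta_p h =
     {A. \<exists>X\<in>Sigma_p (h - 1). \<exists>M. is_tm M \<and> deterministic M \<and>
           poly_time M X \<and> log_queries M X \<and> decides M X A}"

lemma Sigma_p_1: "Sigma_p 1 = NP"
  by simp

lemma Sigma_p_2: "Sigma_p 2 = NP_oracle NP"
  by (simp add: numeral_2_eq_2)

definition poly_time_computable :: "(word \<Rightarrow> word) \<Rightarrow> bool" where
  "poly_time_computable f \<longleftrightarrow>
     (\<exists>M. is_tm M \<and> deterministic M \<and> poly_time M {} \<and>
        (\<forall>w. \<exists>n k ts. computation M {} (initial M w) n k (Accept, ts) \<and>
                      shows_word (ts ! 1) (f w)))"

text \<open>Hardness of the decision problem with (encoded) instances \<open>I\<close> and yes-instances \<open>B \<subseteq> I\<close>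
  under polynomial-time many-one reductions. Reductions have to produce instances of the problem.\<close>

definition hard_for :: "lang set \<Rightarrow> lang \<Rightarrow> lang \<Rightarrow> bool" where
  "hard_for C I B \<longleftrightarrow>
     (\<forall>A\<in>C. \<exists>f. poly_time_computable f \<and> (\<forall>w. f w \<in> I) \<and> (\<forall>w. w \<in> A \<longleftrightarrow> f w \<in> B))"


section \<open>The decision problem\<close>

text \<open>Arguments of input frameworks are named by arbitrary words. All codes are prefix-free, so
  concatenation is uniquely decodable.\<close>

definition code_list :: "('a \<Rightarrow> word) \<Rightarrow> 'a list \<Rightarrow> word" where
  "code_list f xs = concat (map (\<lambda>x. True # f x) xs) @ [False]"

definition code_word :: "word \<Rightarrow> word" where
  "code_word = code_list (\<lambda>b. [b])"

fun code_label :: "label \<Rightarrow> word" where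
  "code_label In = [True, True]"
| "code_label Out = [True, False]"
| "code_label Und = [False, False]"

text \<open>The arguments, each with its label, and the attacks may be listed in any order.\<close>

definition encodes :: "word \<Rightarrow> word af \<Rightarrow> word \<Rightarrow> word labelling \<Rightarrow> word \<Rightarrow> bool" where
  "encodes w \<Lambda> g L g' \<longleftrightarrow>
     (\<exists>as rs. distinct as \<and> set as = args \<Lambda> \<and> distinct rs \<and> set rs = attacks \<Lambda> \<and>
        w = code_list (\<lambda>a. code_word a @ code_label (L a)) as
          @ code_list (\<lambda>(a, b). code_word a @ code_word b) rs
          @ code_word g @ code_word g')"

definition is_instance ::
    "semantics \<Rightarrow> word af \<Rightarrow> word \<Rightarrow> word labelling \<Rightarrow> word \<Rightarrow> bool" where
  "is_instance \<sigma> \<Lambda> g L g' \<longleftrightarrow>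
     is_af \<Lambda> \<and> g \<in> args \<Lambda> \<and> L \<in> labellings \<sigma> \<Lambda> \<and> g' \<in> args \<Lambda>"

definition SF_SA_instances :: "semantics \<Rightarrow> lang" where
  "SF_SA_instances \<sigma> = {w. \<exists>\<Lambda> g L g'. encodes w \<Lambda> g L g' \<and> is_instance \<sigma> \<Lambda> g L g'}"

definition SF_SA :: "semantics \<Rightarrow> lang" where
  "SF_SA \<sigma> =
     {w. \<exists>\<Lambda> g L g'. encodes w \<Lambda> g L g' \<and> is_instance \<sigma> \<Lambda> g L g' \<and>
           (\<forall>L'\<in>semifactuals \<sigma> \<Lambda> g L. L' g' = In)}"

end

theory Submission
  imports Defs
begin

text \<open>Polynomial time is reached through a small programming language on stacks of bits. Its
  programs are compiled to Turing machines, and the functions on tree-coded data that they compute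
  in polynomial time are closed under the usual list operations; machines with guesses and oracle
  calls only add a loop around such functions. In the other direction, guessed computations can be
  verified by such a function.

  Hardness: the run of a compiled verifier is described by a CNF (Cook-Levin). The framework for a
  CNF has one argument per literal and per clause, and an argument that by itself defeats all
  clauses and thus provides a labelling that is known in advance. Many copies of an argument change
  their label exactly when the question about \<open>g'\<close> is answered negatively. They outweigh all other
  arguments, so the most distant labellings reject \<open>g'\<close> whenever some labelling does. With
  universally quantified variables the same works for preferred extensions, where maximality
  replaces the choice of the remaining variables by an existence statement.

  Membership: the maximal distance is found by binary search, and one more query asks for a
  labelling at this distance that does not accept \<open>g'\<close>.\<close>


section \<open>Stack programs\<close>

text \<open>A stack is a tape whose head stands on the top element, with blank cells outside the
  stack, and a tree is a prefix code on a stack. A guess or an oracle answer is one bit handed to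
  the state, so one loop serves nondeterministic machines, oracle machines and the logarithmic
  search. On the way back from an oracle machine to a quantified formula, positive answers carry
  certificates inside the transcript, while one universally quantified word ranges over all possible
  certificates of the queries that were answered negatively; this gives the exists-forall normal
  form. In the first reduction the goal argument forces the clauses to be defeated. In the second
  one it is unattacked, so the condition on it is empty and only maximality acts. The oracle also
  has to confirm that the given labelling is a \<sigma>-labelling; one query ahead of the binary
  search does this.\<close>

datatype com = Skip | Push nat bool | Pop nat | Seq com com (infixr ";;" 60)
  | Case nat com com com | Loop nat com

type_synonym store = "nat \<Rightarrow> word"

text \<open>The counter is the number of instructions executed by the compiled code: a
  \<open>Case\<close> pays 2 for its test and the jump behind the branches, a loop pass pays 2 for
  its test and the jump back.\<close>

inductive exec :: "com \<Rightarrow> store \<Rightarrow> nat \<Rightarrow> store \<Rightarrow> bool" where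
  Skip: "exec Skip s 0 s"
| Push: "exec (Push i b) s 1 (s(i := b # s i))"
| Pop: "exec (Pop i) s 1 (s(i := tl (s i)))"
| Seq: "exec c s m s' \<Longrightarrow> exec d s' n s'' \<Longrightarrow> exec (c ;; d) s (m + n) s''"
| CaseE: "s i = [] \<Longrightarrow> exec c s n s' \<Longrightarrow> exec (Case i c d e) s (n + 2) s'"
| CaseT: "s i = True # w \<Longrightarrow> exec d s n s' \<Longrightarrow> exec (Case i c d e) s (n + 2) s'"
| CaseF: "s i = False # w \<Longrightarrow> exec e s n s' \<Longrightarrow> exec (Case i c d e) s (n + 2) s'"
| LoopE: "s i = [] \<Longrightarrow> exec (Loop i c) s 1 s"
| LoopS: "s i \<noteq> [] \<Longrightarrow> exec c s m s' \<Longrightarrow> exec (Loop i c) s' n s'' \<Longrightarrow>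
    exec (Loop i c) s (m + n + 2) s''"

text \<open>\<open>IStop\<close> makes no step and is compiled to no transition. It reserves
  positions whose machine states get special transitions, and in the formulas it lets a finished run
  idle.\<close>

datatype instr = IPush nat bool | IPop nat | ICase nat nat nat nat | IStop

abbreviation goto :: "nat \<Rightarrow> instr" where "goto x \<equiv> ICase 0 x x x"

fun len :: "com \<Rightarrow> nat" where
  "len Skip = 0"
| "len (Push i b) = 1"
| "len (Pop i) = 1"
| "len (c ;; d) = len c + len d"
| "len (Case i c d e) = len c + len d + len e + 4"
| "len (Loop i c) = len c + 2"

fun comp :: "com \<Rightarrow> nat \<Rightarrow> instr list" where
  "comp Skip a = []"
| "comp (Push i b) a = [IPush i b]"
| "comp (Pop i) a = [IPop i]"
| "comp (c ;; d) a = comp c a @ comp d (a + len c)"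
| "comp (Case i c d e) a =
    (let x = a + 1; y = x + len c + 1; z = y + len d + 1; w = z + len e + 1
     in [ICase i x y z] @ comp c x @ [goto w] @ comp d y @ [goto w] @ comp e z @ [goto w])"
| "comp (Loop i c) a = [ICase i (a + len c + 2) (a + 1) (a + 1)] @ comp c (a + 1) @ [goto a]"

lemma length_comp [simp]: "length (comp c a) = len c"
  by (induction c arbitrary: a) (auto simp: Let_def)

definition located :: "instr list \<Rightarrow> nat \<Rightarrow> instr list \<Rightarrow> bool" where
  "located P a xs \<longleftrightarrow> (\<exists>u v. P = u @ xs @ v \<and> length u = a)"

lemma located_append: "located P a (xs @ ys) \<Longrightarrow> located P a xs \<and> located P (a + length xs) ys"
  unfolding located_def by (metis append.assoc length_append)

lemma located_Cons: "located P a (x # xs) \<Longrightarrow> a < length P \<and> P ! a = x \<and> located P (Suc a) xs"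
proof -
  assume "located P a (x # xs)"
  then obtain u v where "P = u @ (x # xs) @ v" "length u = a" unfolding located_def by blast
  moreover from this have "P = (u @ [x]) @ xs @ v" "length (u @ [x]) = Suc a" by simp_all
  ultimately have "P ! a = x" "a < length P" "P = (u @ [x]) @ xs @ v \<and> length (u @ [x]) = Suc a"
    by (simp_all add: nth_append)
  then show ?thesis unfolding located_def by blast
qed

lemma located_mid: "located (u @ xs @ v) (length u) xs"
  unfolding located_def by blast

fun jump :: "word \<Rightarrow> nat \<Rightarrow> nat \<Rightarrow> nat \<Rightarrow> nat" where
  "jump [] x y z = x"
| "jump (True # w) x y z = y"
| "jump (False # w) x y z = z"

lemma jump_same [simp]: "jump w x x x = x"
proof (cases w)
  case (Cons b v)
  then show ?thesis by (cases b) auto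
qed simp

fun effect :: "instr \<Rightarrow> nat \<times> store \<Rightarrow> nat \<times> store" where
  "effect (IPush i b) (pc, s) = (pc + 1, s(i := b # s i))"
| "effect (IPop i) (pc, s) = (pc + 1, s(i := tl (s i)))"
| "effect (ICase i x y z) (pc, s) = (jump (s i) x y z, s)"
| "effect IStop (pc, s) = (pc, s)"

definition istep :: "instr list \<Rightarrow> nat \<times> store \<Rightarrow> nat \<times> store \<Rightarrow> bool" where
  "istep P c c' \<longleftrightarrow> fst c < length P \<and> P ! fst c \<noteq> IStop \<and> c' = effect (P ! fst c) c"

lemma istep_located: "located P a (i # xs) \<Longrightarrow> i \<noteq> IStop \<Longrightarrow> istep P (a, s) (effect i (a, s))"
  by (auto simp: istep_def dest: located_Cons)

text \<open>Jump targets are absolute addresses, so the induction ranges over all positions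
  \<open>a\<close> at which the code may stand inside a larger program.\<close>

lemma exec_istep:
  "exec c s n s' \<Longrightarrow> located P a (comp c a) \<Longrightarrow> (istep P ^^ n) (a, s) (a + len c, s')"
proof (induction arbitrary: a rule: exec.induct)
  case (Push i b s)
  then show ?case unfolding relpowp_1 using istep_located[of P a "IPush i b" "[]" s]
    by (simp add: fun_upd_def)
next
  case (Pop i s)
  then show ?case unfolding relpowp_1 using istep_located[of P a "IPop i" "[]" s]
    by (simp add: fun_upd_def)
next
  case (Seq c s m s' d n s'')
  from Seq.prems have "located P a (comp c a)" "located P (a + len c) (comp d (a + len c))"
    by (auto dest!: located_append)
  from relpowp_trans[of _ "istep P", OF Seq.IH(1)[OF this(1)] Seq.IH(2)[OF this(2)]] show ?case
    by (simp add: add.assoc)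
next
  case (CaseE s i c n s' d e)
  let ?x = "a + 1" let ?y = "?x + len c + 1" let ?z = "?y + len d + 1" let ?w = "?z + len e + 1"
  have l: "located P a (ICase i ?x ?y ?z # comp c ?x @ goto ?w # comp d ?y @ goto ?w # comp e ?z @ [goto ?w])"
    using CaseE.prems by (simp add: Let_def)
  have l2: "located P ?x (comp c ?x @ goto ?w # comp d ?y @ goto ?w # comp e ?z @ [goto ?w])"
    using located_Cons[OF l] by simp
  have 1: "istep P (a, s) (?x, s)" using istep_located[OF l, of s] CaseE.hyps by simp
  have 2: "(istep P ^^ n) (?x, s) (?x + len c, s')" using located_append[OF l2] CaseE.IH by blast
  have 3: "istep P (?x + len c, s') (?w, s')"
    using located_append[OF l2] istep_located[of P "?x + len c" "goto ?w" _ s'] by auto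
  show ?case using relpowp_Suc_I2[of "istep P", OF 1 relpowp_Suc_I[of _ "istep P", OF 2 3]] by (simp add: eval_nat_numeral add_ac)
next
  case (CaseT s i w d n s' c e)
  let ?x = "a + 1" let ?y = "?x + len c + 1" let ?z = "?y + len d + 1" let ?w = "?z + len e + 1"
  have l: "located P a (ICase i ?x ?y ?z # comp c ?x @ goto ?w # comp d ?y @ goto ?w # comp e ?z @ [goto ?w])"
    using CaseT.prems by (simp add: Let_def)
  have l2: "located P ?x (comp c ?x @ goto ?w # comp d ?y @ goto ?w # comp e ?z @ [goto ?w])"
    using located_Cons[OF l] by simp
  have l3: "located P ?y (comp d ?y @ goto ?w # comp e ?z @ [goto ?w])"
    using located_append[OF l2] by (auto dest!: located_Cons)
  have 1: "istep P (a, s) (?y, s)" using istep_located[OF l, of s] CaseT.hyps by simp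
  have 2: "(istep P ^^ n) (?y, s) (?y + len d, s')" using located_append[OF l3] CaseT.IH by blast
  have 3: "istep P (?y + len d, s') (?w, s')"
    using located_append[OF l3] istep_located[of P "?y + len d" "goto ?w" _ s'] by auto
  show ?case using relpowp_Suc_I2[of "istep P", OF 1 relpowp_Suc_I[of _ "istep P", OF 2 3]] by (simp add: eval_nat_numeral add_ac)
next
  case (CaseF s i w e n s' c d)
  let ?x = "a + 1" let ?y = "?x + len c + 1" let ?z = "?y + len d + 1" let ?w = "?z + len e + 1"
  have l: "located P a (ICase i ?x ?y ?z # comp c ?x @ goto ?w # comp d ?y @ goto ?w # comp e ?z @ [goto ?w])"
    using CaseF.prems by (simp add: Let_def)
  have l2: "located P ?x (comp c ?x @ goto ?w # comp d ?y @ goto ?w # comp e ?z @ [goto ?w])"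
    using located_Cons[OF l] by simp
  have l3: "located P ?y (comp d ?y @ goto ?w # comp e ?z @ [goto ?w])"
    using located_append[OF l2] by (auto dest!: located_Cons)
  have l4: "located P ?z (comp e ?z @ [goto ?w])"
    using located_append[OF l3] by (auto dest!: located_Cons)
  have 1: "istep P (a, s) (?z, s)" using istep_located[OF l, of s] CaseF.hyps by simp
  have 2: "(istep P ^^ n) (?z, s) (?z + len e, s')" using located_append[OF l4] CaseF.IH by blast
  have 3: "istep P (?z + len e, s') (?w, s')"
    using located_append[OF l4] istep_located[of P "?z + len e" "goto ?w" _ s'] by auto
  show ?case using relpowp_Suc_I2[of "istep P", OF 1 relpowp_Suc_I[of _ "istep P", OF 2 3]] by (simp add: eval_nat_numeral add_ac)
next
  case (LoopE s i c)
  from LoopE istep_located[of P a "ICase i (a + len c + 2) (a + 1) (a + 1)" _ s] show ?case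
    unfolding relpowp_1 by simp
next
  case (LoopS s i c m s' n s'')
  have l: "located P a (ICase i (a + len c + 2) (a + 1) (a + 1) # comp c (a + 1) @ [goto a])"
    using LoopS.prems by simp
  have l2: "located P (a + 1) (comp c (a + 1) @ [goto a])" using located_Cons[OF l] by simp
  have "jump (s i) (a + len c + 2) (a + 1) (a + 1) = a + 1"
    using LoopS.hyps(1) by (cases "s i") (metis (full_types) jump.simps(2,3))+
  then have 1: "istep P (a, s) (a + 1, s)" using istep_located[OF l, of s] by simp
  have 2: "(istep P ^^ m) (a + 1, s) (a + 1 + len c, s')" using located_append[OF l2] LoopS.IH(1) by blast
  have 3: "istep P (a + 1 + len c, s') (a, s')"
    using located_append[OF l2] istep_located[of P "a + 1 + len c" "goto a" _ s'] by auto
  have 4: "(istep P ^^ n) (a, s') (a + len (Loop i c), s'')" using LoopS.IH(2) LoopS.prems by blast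
  show ?case
    using relpowp_trans[of _ "istep P", OF relpowp_Suc_I2[of "istep P", OF 1 relpowp_Suc_I[of _ "istep P", OF 2 3]] 4] by simp
qed (auto)

fun stacks :: "com \<Rightarrow> nat set" where
  "stacks Skip = {}"
| "stacks (Push i b) = {i}"
| "stacks (Pop i) = {i}"
| "stacks (c ;; d) = stacks c \<union> stacks d"
| "stacks (Case i c d e) = insert i (stacks c \<union> stacks d \<union> stacks e)"
| "stacks (Loop i c) = insert i (stacks c)"

lemma finite_stacks: "finite (stacks c)"
  by (induction c) auto

fun istack :: "instr \<Rightarrow> nat" where
  "istack (IPush i b) = i"
| "istack (IPop i) = i"
| "istack (ICase i x y z) = i"
| "istack IStop = 0"

text \<open>Stack 0 is added because \<open>goto\<close> is a case distinction on stack 0 with equal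
  targets.\<close>

lemma istack_comp: "x \<in> set (comp c a) \<Longrightarrow> istack x \<in> insert 0 (stacks c)"
proof (induction c arbitrary: a)
  case (Seq c d)
  from Seq.prems have "x \<in> set (comp c a) \<or> x \<in> set (comp d (a + len c))" by simp
  with Seq.IH show ?case by (metis Un_iff insert_iff stacks.simps(4))
next
  case (Case i c d e)
  from Case.prems have "x \<in> {ICase i y z w | y z w. True} \<union> {goto y | y. True} \<or>
      (\<exists>b. x \<in> set (comp c b)) \<or> (\<exists>b. x \<in> set (comp d b)) \<or> (\<exists>b. x \<in> set (comp e b))"
    unfolding comp.simps Let_def set_append set_simps by blast
  with Case.IH show ?case by fastforce
next
  case (Loop i c)
  from Loop.prems have "x \<in> {ICase i y z w | y z w. True} \<union> {goto y | y. True} \<or>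
      (\<exists>b. x \<in> set (comp c b))"
    unfolding comp.simps set_append set_simps by blast
  with Loop.IH show ?case by fastforce
qed auto

section \<open>Stack programs on Turing machines\<close>

text \<open>An entry acts on a single tape, whereas a rule lists every tape. Each entry stands for
  all rules that leave the other tapes unchanged, one for every possible reading of the
  heads.\<close>

type_synonym entry = "state \<times> nat \<times> (symbol \<Rightarrow> symbol \<times> move \<times> state)"

definition entry_acts :: "nat \<Rightarrow> nat \<Rightarrow> (symbol \<Rightarrow> symbol \<times> move \<times> state) \<Rightarrow> symbol list
    \<Rightarrow> (symbol \<times> symbol \<times> move) list" where
  "entry_acts K i f g = map (\<lambda>j. (g ! j, if j = i then fst (f (g ! i)) else g ! j,
     if j = i then fst (snd (f (g ! i))) else Stay)) [0..<K]"

abbreviation alphabet :: "symbol set" where "alphabet \<equiv> {Blank, Bit True, Bit False}"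

definition entry_rules :: "nat \<Rightarrow> entry list \<Rightarrow> rule set" where
  "entry_rules K D = {(q, acts, q'). \<exists>i f g. (q, i, f) \<in> set D \<and> i < K \<and> length g = K \<and>
     set g \<subseteq> alphabet \<and> acts = entry_acts K i f g \<and> q' = snd (snd (f (g ! i)))}"

definition machine :: "nat \<Rightarrow> entry list \<Rightarrow> tm" where
  "machine K D = \<lparr>tapes = K, rules = entry_rules K D\<rparr>"

lemma map_fst_entry_acts: "length g = K \<Longrightarrow> map fst (entry_acts K i f g) = g"
  by (rule nth_equalityI) (auto simp: entry_acts_def)

text \<open>Only readings over the three letters of \<open>alphabet\<close> are expanded; this keeps
  the rule set finite.\<close>

lemma finite_entry_rules: "finite (entry_rules K D)"
proof -
  have "entry_rules K D \<subseteq> (\<Union>(q, i, f)\<in>set D. (\<lambda>g. (q, entry_acts K i f g, snd (snd (f (g ! i))))) `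
      {g. set g \<subseteq> alphabet \<and> length g = K})"
    unfolding entry_rules_def by fast
  moreover have "finite {g. set g \<subseteq> alphabet \<and> length g = K}" by (rule finite_lists_length_eq) auto
  ultimately show ?thesis by (elim finite_subset) (intro finite_UN_I, auto)
qed

lemma is_tm_machine:
  assumes "2 \<le> K" "\<And>q i f. (q, i, f) \<in> set D \<Longrightarrow> q \<noteq> Accept \<and> q \<noteq> Query"
  shows "is_tm (machine K D)"
proof -
  have "length acts = K \<and> q \<noteq> Accept \<and> q \<noteq> Query" if "(q, acts, q') \<in> entry_rules K D" for q acts q'
    using that assms(2) unfolding entry_rules_def entry_acts_def by force
  then show ?thesis using assms(1) finite_entry_rules[of K D]
    unfolding is_tm_def machine_def by auto
qed

definition unique_entry :: "entry list \<Rightarrow> state \<Rightarrow> bool" where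
  "unique_entry D q \<longleftrightarrow> (\<forall>x\<in>set D. \<forall>y\<in>set D. fst x = q \<longrightarrow> fst y = q \<longrightarrow> x = y)"

lemma deterministic_machine:
  assumes "\<And>q. unique_entry D q"
  shows "deterministic (machine K D)"
proof -
  have "acts = acts' \<and> p = p'"
    if r: "(q, acts, p) \<in> entry_rules K D" "(q, acts', p') \<in> entry_rules K D"
      and eq: "map fst acts = map fst acts'" for q acts p acts' p'
  proof -
    from r(1) obtain i f g where 1: "(q, i, f) \<in> set D" "length g = K"
        "acts = entry_acts K i f g" "p = snd (snd (f (g ! i)))"
      by (auto simp: entry_rules_def)
    from r(2) obtain j h g' where 2: "(q, j, h) \<in> set D" "length g' = K"
        "acts' = entry_acts K j h g'" "p' = snd (snd (h (g' ! j)))"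
      by (auto simp: entry_rules_def)
    have "i = j" "f = h" using assms[of q] 1(1) 2(1) unfolding unique_entry_def by force+
    moreover have "g = g'" using eq 1 2 by (simp add: map_fst_entry_acts)
    ultimately show ?thesis using 1 2 by simp
  qed
  then show ?thesis unfolding deterministic_def machine_def by (simp; blast)
qed

lemma act_same [simp]: "act (t 0, t 0, Stay) t = t"
  by (auto simp: fun_eq_iff)

text \<open>As all heads show letters of \<open>alphabet\<close>, every entry has a rule for the
  current reading, so a step amounts to the choice of an entry for the state.\<close>

lemma step_machine:
  assumes "length ts = K" "\<forall>t\<in>set ts. t 0 \<in> alphabet" "q \<noteq> Query"
  shows "step (machine K D) X (q, ts) c' \<longleftrightarrow>
    (\<exists>i f. (q, i, f) \<in> set D \<and> i < K \<and>
      c' = (snd (snd (f ((ts ! i) 0))),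
            ts[i := act ((ts ! i) 0, fst (f ((ts ! i) 0)), fst (snd (f ((ts ! i) 0)))) (ts ! i)]))"
    (is "?L \<longleftrightarrow> ?R")
proof -
  let ?g = "map (\<lambda>t. t 0) ts"
  have upd: "map2 act (entry_acts K i f ?g) ts =
      ts[i := act ((ts ! i) 0, fst (f ((ts ! i) 0)), fst (snd (f ((ts ! i) 0)))) (ts ! i)]"
    if "i < K" for i f
    by (rule nth_equalityI) (use that assms(1) in \<open>auto simp: entry_acts_def nth_list_update
        simp del: act.simps\<close>)
  show ?thesis
  proof
    assume ?L
    then show ?R
    proof cases
      case (rule acts q')
      then obtain i f g where *: "(q, i, f) \<in> set D" "i < K" "length g = K"
          "acts = entry_acts K i f g" "q' = snd (snd (f (g ! i)))"
        by (auto simp: machine_def entry_rules_def)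
      have "g = ?g" using rule(3) * map_fst_entry_acts by metis
      then show ?R using * rule upd[of i f] assms(1) by (intro exI[of _ i] exI[of _ f]) auto
    next
      case (query w) then show ?R using assms(3) by simp
    qed
  next
    assume ?R
    then obtain i f where *: "(q, i, f) \<in> set D" "i < K"
      "c' = (snd (snd (f ((ts ! i) 0))),
            ts[i := act ((ts ! i) 0, fst (f ((ts ! i) 0)), fst (snd (f ((ts ! i) 0)))) (ts ! i)])"
      by blast
    have "(q, entry_acts K i f ?g, snd (snd (f ((ts ! i) 0)))) \<in> rules (machine K D)"
    proof -
      have "length ?g = K" "set ?g \<subseteq> alphabet" "?g ! i = (ts ! i) 0" using assms * by auto
      then show ?thesis unfolding machine_def entry_rules_def using *
        by (simp only: mem_Collect_eq case_prod_conv tm.simps) metis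
    qed
    from step.rule[OF this, of ts X] show ?L
      using * assms upd[of i f] by (simp add: map_fst_entry_acts del: act.simps)
  qed
qed

text \<open>\<open>computation\<close> grows at its end. Here the first step is split off, the
  direction in which bounds and acceptance propagate backwards.\<close>

lemma computation_iff:
  "computation M X c n k c'' \<longleftrightarrow> n = 0 \<and> k = 0 \<and> c'' = c \<or>
    (\<exists>c' n' k'. step M X c c' \<and> computation M X c' n' k' c'' \<and> n = Suc n' \<and>
       k = (if fst c = Query then Suc k' else k'))" (is "?L n k c'' \<longleftrightarrow> ?R n k c''")
proof
  assume "?L n k c''"
  then show "?R n k c''"
  proof induction
    case refl
    then show ?case by simp
  next
    case (step n k c' c'')
    from step.IH show ?case
    proof
      assume "n = 0 \<and> k = 0 \<and> c' = c"
      with step.hyps show ?case using computation.refl[of M X c''] by (metis One_nat_def)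
    next
      assume "\<exists>c1 n' k'. step M X c c1 \<and> computation M X c1 n' k' c' \<and> n = Suc n' \<and>
        k = (if fst c = Query then Suc k' else k')"
      then obtain c1 n' k' where "step M X c c1" "computation M X c1 n' k' c'" "n = Suc n'"
        "k = (if fst c = Query then Suc k' else k')" by blast
      with computation.step[OF this(2) step.hyps(2)] show ?case
        by (intro disjI2 exI[of _ c1] exI[of _ n] exI[of _ "if fst c' = Query then Suc k' else k'"]) auto
    qed
  qed
next
  have *: "computation M X c (Suc n) (if fst c = Query then Suc k else k) c''"
    if "computation M X c' n k c''" "step M X c c'" for n k c' c''
    using that
  proof (induction)
    case refl
    then show ?case using computation.step[OF computation.refl, of M X c] by (metis)
  next
    case (step n k c1 c2)
    from computation.step[OF step.IH[OF step.prems] step.hyps(2)] show ?case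
      by (cases "fst c = Query"; cases "fst c1 = Query"; simp)
  qed
  assume "?R n k c''"
  then show "?L n k c''" 
  proof
    assume "n = 0 \<and> k = 0 \<and> c'' = c"
    then show ?thesis using computation.refl by simp
  next
    assume "\<exists>c' n' k'. step M X c c' \<and> computation M X c' n' k' c'' \<and> n = Suc n' \<and>
      k = (if fst c = Query then Suc k' else k')"
    then show ?thesis using * by blast
  qed
qed

section \<open>Time bounds, query bounds and acceptance from arbitrary configurations\<close>

definition bounded_from :: "tm \<Rightarrow> lang \<Rightarrow> config \<Rightarrow> nat \<Rightarrow> nat \<Rightarrow> bool" where
  "bounded_from M X c T Q \<longleftrightarrow> (\<forall>n k c'. computation M X c n k c' \<longrightarrow> n \<le> T \<and> k \<le> Q)"

definition accepts_from :: "tm \<Rightarrow> lang \<Rightarrow> config \<Rightarrow> bool" where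
  "accepts_from M X c \<longleftrightarrow> (\<exists>n k ts. computation M X c n k (Accept, ts))"

lemma bounded_fromI:
  assumes "\<And>c'. step M X c c' \<Longrightarrow> bounded_from M X c' T Q"
  shows "bounded_from M X c (Suc T) (if fst c = Query then Suc Q else Q)"
  unfolding bounded_from_def
proof (intro allI impI)
  fix n k c'' assume "computation M X c n k c''"
  then consider "n = 0" "k = 0" |
    c' n' k' where "step M X c c'" "computation M X c' n' k' c''" "n = Suc n'"
       "k = (if fst c = Query then Suc k' else k')"
    using computation_iff[of M X c n k c''] by blast
  then show "n \<le> Suc T \<and> k \<le> (if fst c = Query then Suc Q else Q)"
  proof cases
    case 2
    with assms[OF 2(1)] have "n' \<le> T \<and> k' \<le> Q" unfolding bounded_from_def by blast
    with 2 show ?thesis by simp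
  qed simp
qed

lemma bounded_from_mono: "bounded_from M X c T Q \<Longrightarrow> T \<le> T' \<Longrightarrow> Q \<le> Q' \<Longrightarrow> bounded_from M X c T' Q'"
  unfolding bounded_from_def by (meson order_trans)

lemma accepts_from_iff:
  assumes "fst c \<noteq> Accept"
  shows "accepts_from M X c \<longleftrightarrow> (\<exists>c'. step M X c c' \<and> accepts_from M X c')"
proof
  assume "accepts_from M X c"
  then obtain n k ts where "computation M X c n k (Accept, ts)" unfolding accepts_from_def by blast
  then show "\<exists>c'. step M X c c' \<and> accepts_from M X c'"
    using computation_iff[of M X c n k "(Accept, ts)"] assms unfolding accepts_from_def by fastforce
next
  assume "\<exists>c'. step M X c c' \<and> accepts_from M X c'"
  then obtain c' n k ts where "step M X c c'" "computation M X c' n k (Accept, ts)"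
    unfolding accepts_from_def by blast
  then show "accepts_from M X c" unfolding accepts_from_def using computation_iff by blast
qed

text \<open>The successor is unique; as \<open>Query\<close> and \<open>Accept\<close> are excluded,
  the step costs no oracle call and acceptance can only lie ahead. Bounds and acceptance at the end
  of a chain of such steps therefore carry over to its start.\<close>

definition dstep :: "tm \<Rightarrow> lang \<Rightarrow> config \<Rightarrow> config \<Rightarrow> bool" where
  "dstep M X c c' \<longleftrightarrow> fst c \<noteq> Query \<and> fst c \<noteq> Accept \<and> (\<forall>x. step M X c x \<longleftrightarrow> x = c')"

lemma dstep_run:
  assumes "(dstep M X ^^ n) c c'"
  shows "bounded_from M X c' T Q \<Longrightarrow> bounded_from M X c (n + T) Q"
    and "accepts_from M X c \<longleftrightarrow> accepts_from M X c'"
    and "computation M X c' m k c'' \<Longrightarrow> computation M X c (n + m) k c''"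
proof -
  have "(bounded_from M X c' T Q \<longrightarrow> bounded_from M X c (n + T) Q) \<and>
     (accepts_from M X c \<longleftrightarrow> accepts_from M X c') \<and>
     (computation M X c' m k c'' \<longrightarrow> computation M X c (n + m) k c'')"
    using assms
  proof (induction n arbitrary: c)
    case (Suc n)
    from relpowp_Suc_D2[OF Suc.prems] obtain c1 where c1: "dstep M X c c1" "(dstep M X ^^ n) c1 c'"
      by blast
    from c1(1) have *: "fst c \<noteq> Query" "fst c \<noteq> Accept" "\<And>x. step M X c x \<longleftrightarrow> x = c1"
      by (auto simp: dstep_def)
    note IH = Suc.IH[OF c1(2)]
    have "bounded_from M X c (Suc n + T) Q" if "bounded_from M X c' T Q"
      using bounded_fromI[of M X c "n + T" Q] IH that * by simp
    moreover have "accepts_from M X c \<longleftrightarrow> accepts_from M X c'"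
      using accepts_from_iff[OF *(2), of M X] *(3) IH by simp
    moreover have "computation M X c (Suc n + m) k c''" if "computation M X c' m k c''"
      using computation_iff[of M X c "Suc n + m" k c''] * IH that by auto
    ultimately show ?case by blast
  qed simp
  then show "bounded_from M X c' T Q \<Longrightarrow> bounded_from M X c (n + T) Q"
    and "accepts_from M X c \<longleftrightarrow> accepts_from M X c'"
    and "computation M X c' m k c'' \<Longrightarrow> computation M X c (n + m) k c''" by auto
qed

section \<open>Stacks as tapes\<close>

definition stapes :: "nat \<Rightarrow> store \<Rightarrow> tape list" where
  "stapes K s = map (\<lambda>i. word_tape (s i)) [0..<K]"

lemma length_stapes [simp]: "length (stapes K s) = K"
  by (simp add: stapes_def)

lemma nth_stapes [simp]: "i < K \<Longrightarrow> stapes K s ! i = word_tape (s i)"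
  by (simp add: stapes_def)

lemma stapes_update: "i < K \<Longrightarrow> (stapes K s)[i := word_tape w] = stapes K (s(i := w))"
  by (rule nth_equalityI) (auto simp: nth_list_update)

lemma word_tape_0: "word_tape w 0 = (case w of [] \<Rightarrow> Blank | b # _ \<Rightarrow> Bit b)"
  by (cases w) (auto simp: word_tape_def)

lemma word_tape_alphabet: "word_tape w i \<in> alphabet"
  by (auto simp: word_tape_def)

lemma stapes_alphabet: "\<forall>t\<in>set (stapes K s). t 0 \<in> alphabet"
  using word_tape_alphabet by (fastforce simp: stapes_def)

lemma shows_word_word_tape: "shows_word (word_tape w) v \<longleftrightarrow> v = w"
proof
  assume v: "shows_word (word_tape w) v"
  then have 1: "\<forall>i<length v. word_tape w (int i) = Bit (v ! i)"
    and 2: "word_tape w (int (length v)) \<notin> range Bit" by (auto simp: shows_word_def)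
  have "length v = length w"
  proof (rule ccontr)
    assume "length v \<noteq> length w"
    then consider "length v < length w" | "length w < length v" by linarith
    then show False using 1 2 by cases (force simp: word_tape_def)+
  qed
  with 1 show "v = w" by (intro nth_equalityI) (auto simp: word_tape_def)
qed (auto simp: shows_word_def word_tape_def)

text \<open>Erasing the cell before leaving it keeps all cells left of the head blank, so the tape
  has the form \<open>word_tape\<close> again.\<close>

lemma act_pop: "act (x, Blank, MoveRight) (word_tape w) = word_tape (tl w)"
proof
  fix i
  show "act (x, Blank, MoveRight) (word_tape w) i = word_tape (tl w) i"
  proof (cases "0 \<le> i")
    case True
    then have "nat (i + 1) = Suc (nat i)" by simp
    then show ?thesis using True by (cases w) (auto simp: word_tape_def)
  qed (auto simp: word_tape_def)
qed

lemma act_push: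
  "act (x, Bit b, Stay) (act (word_tape w 0, word_tape w 0, MoveLeft) (word_tape w)) = word_tape (b # w)"
proof
  fix i
  show "act (x, Bit b, Stay) (act (word_tape w 0, word_tape w 0, MoveLeft) (word_tape w)) i = word_tape (b # w) i"
  proof (cases "0 < i")
    case True
    then have "nat i = Suc (nat (i - 1))" by simp
    then show ?thesis using True by (auto simp: word_tape_def)
  qed (auto simp: word_tape_def)
qed

text \<open>Instruction \<open>pc\<close> owns the states 2 pc and 2 pc + 1. The odd one is the
  middle of a push, which must move left before it can write.\<close>

fun lower :: "nat \<Rightarrow> instr \<Rightarrow> entry list" where
  "lower pc (IPush i b) = [(State (2 * pc), i, \<lambda>a. (a, MoveLeft, State (2 * pc + 1))),
     (State (2 * pc + 1), i, \<lambda>a. (Bit b, Stay, State (2 * (pc + 1))))]"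
| "lower pc (IPop i) = [(State (2 * pc), i, \<lambda>a. (Blank, MoveRight, State (2 * (pc + 1))))]"
| "lower pc (ICase i x y z) = [(State (2 * pc), i,
     \<lambda>a. (a, Stay, State (2 * (if a = Bit True then y else if a = Bit False then z else x))))]"
| "lower pc IStop = []"

lemma dstep_machine:
  assumes "length ts = K" "\<forall>t\<in>set ts. t 0 \<in> alphabet" "q \<noteq> Query" "q \<noteq> Accept"
    and "(q, i, f) \<in> set D" "unique_entry D q" "i < K" "f ((ts ! i) 0) = (b, m, q')"
  shows "dstep (machine K D) X (q, ts) (q', ts[i := act ((ts ! i) 0, b, m) (ts ! i)])"
proof -
  have "i' = i \<and> f' = f" if "(q, i', f') \<in> set D" for i' f'
    using assms(5,6) that unfolding unique_entry_def by force
  then have "step (machine K D) X (q, ts) x \<longleftrightarrow> x = (snd (snd (f ((ts ! i) 0))),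
            ts[i := act ((ts ! i) 0, fst (f ((ts ! i) 0)), fst (snd (f ((ts ! i) 0)))) (ts ! i)])" for x
    unfolding step_machine[OF assms(1-3)] using assms(5,7) by blast
  then show ?thesis unfolding dstep_def using assms(3,4,8) by (simp del: act.simps)
qed

lemma dstep_istep:
  assumes "istep P (pc, s) (pc', s')" "set (lower pc (P ! pc)) \<subseteq> set D" "istack (P ! pc) < K"
    and "unique_entry D (State (2 * pc))" "unique_entry D (State (2 * pc + 1))"
  shows "\<exists>n\<le>2. (dstep (machine K D) X ^^ n) (State (2 * pc), stapes K s) (State (2 * pc'), stapes K s')"
proof (cases "P ! pc")
  case (IPush i b)
  have K: "i < K" using assms(3) IPush by simp
  let ?t = "act (word_tape (s i) 0, word_tape (s i) 0, MoveLeft) (word_tape (s i))"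
  let ?ts = "(stapes K s)[i := ?t]"
  have 1: "dstep (machine K D) X (State (2 * pc), stapes K s) (State (2 * pc + 1), ?ts)"
    using dstep_machine[of "stapes K s" K "State (2 * pc)" i
        "\<lambda>a. (a, MoveLeft, State (2 * pc + 1))" D, OF _ stapes_alphabet] assms IPush K
    by (simp del: act.simps)
  have "?t 0 \<in> alphabet" using word_tape_alphabet by simp
  then have a: "\<forall>t\<in>set ?ts. t 0 \<in> alphabet"
    using stapes_alphabet[of K s] set_update_subset_insert[of "stapes K s" i ?t] by blast
  have 2: "dstep (machine K D) X (State (2 * pc + 1), ?ts)
     (State (2 * (pc + 1)), ?ts[i := act ((?ts ! i) 0, Bit b, Stay) (?ts ! i)])"
    by (rule dstep_machine[OF _ a, where f="\<lambda>a. (Bit b, Stay, State (2 * (pc + 1)))"])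
      (use assms IPush K in auto)
  have "?ts[i := act ((?ts ! i) 0, Bit b, Stay) (?ts ! i)] = stapes K s'"
    using K assms(1) IPush by (simp add: act_push stapes_update istep_def del: act.simps)
  then have "(dstep (machine K D) X ^^ 2) (State (2 * pc), stapes K s) (State (2 * (pc + 1)), stapes K s')"
    using 1 2 by (auto simp: numeral_2_eq_2 simp del: act.simps)
  then show ?thesis using assms(1) IPush by (auto simp: istep_def)
next
  case (IPop i)
  have K: "i < K" using assms(3) IPop by simp
  have "dstep (machine K D) X (State (2 * pc), stapes K s)
     (State (2 * (pc + 1)), (stapes K s)[i := act ((stapes K s ! i) 0, Blank, MoveRight) (stapes K s ! i)])"
    by (rule dstep_machine[where f="\<lambda>a. (Blank, MoveRight, State (2 * (pc + 1)))"])
      (use assms IPop K stapes_alphabet in auto)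
  then have "(dstep (machine K D) X ^^ 1) (State (2 * pc), stapes K s) (State (2 * pc'), stapes K s')"
    using assms(1) IPop K unfolding relpowp_1 by (simp add: act_pop stapes_update istep_def del: act.simps)
  then show ?thesis by (intro exI[of _ 1]) simp
next
  case (ICase i x y z)
  have K: "i < K" using assms(3) ICase by simp
  let ?f = "\<lambda>a. (a, Stay, State (2 * (if a = Bit True then y else if a = Bit False then z else x)))"
  have "(if word_tape (s i) 0 = Bit True then y else if word_tape (s i) 0 = Bit False then z else x) =
     jump (s i) x y z"
    by (cases "(s i, x, y, z)" rule: jump.cases) (auto simp: word_tape_0)
  then have f: "?f (word_tape (s i) 0) = (word_tape (s i) 0, Stay, State (2 * jump (s i) x y z))"
    by simp
  have "dstep (machine K D) X (State (2 * pc), stapes K s)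
     (State (2 * jump (s i) x y z), (stapes K s)[i := act ((stapes K s ! i) 0, word_tape (s i) 0, Stay) (stapes K s ! i)])"
    by (rule dstep_machine[where f="?f"])
      (use assms ICase K stapes_alphabet f in auto)
  then have "(dstep (machine K D) X ^^ 1) (State (2 * pc), stapes K s) (State (2 * pc'), stapes K s')"
    using assms(1) ICase K unfolding relpowp_1 by (simp add: stapes_update istep_def del: act.simps)
  then show ?thesis by (intro exI[of _ 1]) simp
next
  case IStop
  then show ?thesis using assms(1) by (simp add: istep_def)
qed

lemma dstep_isteps:
  assumes "(istep P ^^ n) (pc, s) (pc', s')"
    and D: "\<And>pc. pc < length P \<Longrightarrow> P ! pc \<noteq> IStop \<Longrightarrow> set (lower pc (P ! pc)) \<subseteq> set D \<and>
      istack (P ! pc) < K \<and> unique_entry D (State (2 * pc)) \<and> unique_entry D (State (2 * pc + 1))"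
  shows "\<exists>m\<le>2 * n. (dstep (machine K D) X ^^ m) (State (2 * pc), stapes K s) (State (2 * pc'), stapes K s')"
  using assms(1)
proof (induction n arbitrary: pc s)
  case (Suc n)
  from relpowp_Suc_D2[OF Suc.prems] obtain pc1 s1 where
    1: "istep P (pc, s) (pc1, s1)" "(istep P ^^ n) (pc1, s1) (pc', s')" by auto
  then obtain k where "k \<le> 2" "(dstep (machine K D) X ^^ k) (State (2 * pc), stapes K s) (State (2 * pc1), stapes K s1)"
    using dstep_istep[OF 1(1), of D K X] D[of pc] unfolding istep_def by auto
  moreover obtain m where "m \<le> 2 * n" "(dstep (machine K D) X ^^ m) (State (2 * pc1), stapes K s1) (State (2 * pc'), stapes K s')"
    using Suc.IH[OF 1(2)] by auto
  ultimately show ?case by (intro exI[of _ "k + m"]) (auto intro: relpowp_trans)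
qed auto

section \<open>Polynomial-time functions on binary trees\<close>

datatype tree = Lf | Nd tree tree

text \<open>Polish notation, a prefix-free code: the end of a tree is recognised without a
  delimiter.\<close>

fun code :: "tree \<Rightarrow> word" where
  "code Lf = [False]"
| "code (Nd l r) = True # code l @ code r"

abbreviation csize :: "tree \<Rightarrow> nat" where "csize t \<equiv> length (code t)"

fun nodes :: "tree \<Rightarrow> nat" where
  "nodes Lf = 0"
| "nodes (Nd l r) = Suc (nodes l + nodes r)"

lemma csize_nodes: "csize t = 2 * nodes t + 1"
  by (induction t) auto

lemma code_append_inject: "code t @ u = code t' @ u' \<Longrightarrow> t = t' \<and> u = u'"
proof (induction t arbitrary: t' u u')
  case Lf
  then show ?case by (cases t') auto
next
  case (Nd l r)
  show ?case
  proof (cases t')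
    case Lf
    then show ?thesis using Nd.prems by simp
  next
    case (Nd l' r')
    then have "code l @ (code r @ u) = code l' @ (code r' @ u')" using Nd.prems by simp
    from Nd.IH(1)[OF this] Nd.IH(2) show ?thesis using \<open>t' = Nd l' r'\<close> by blast
  qed
qed

lemma code_inject [simp]: "code t = code t' \<longleftrightarrow> t = t'"
  using code_append_inject[of t "[]" t' "[]"] by auto

section \<open>Polynomial bounds\<close>

definition polyb :: "(nat \<Rightarrow> nat) \<Rightarrow> bool" where
  "polyb F \<longleftrightarrow> (\<exists>p. \<forall>n. F n \<le> poly p n)"

text \<open>Coefficients are natural numbers, hence the monotonicity on which every composition of
  bounds rests.\<close>

lemma poly_mono_nat: "x \<le> y \<Longrightarrow> poly p x \<le> poly p (y::nat)"
  by (induction p) (auto intro!: add_mono mult_mono)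

lemma polyb_const [intro!]: "polyb (\<lambda>n. c)"
  unfolding polyb_def by (rule exI[of _ "[:c:]"]) simp

lemma polyb_id [intro!]: "polyb (\<lambda>n. n)"
  unfolding polyb_def by (rule exI[of _ "[:0,1:]"]) simp

lemma polyb_add [intro!]: "polyb F \<Longrightarrow> polyb G \<Longrightarrow> polyb (\<lambda>n. F n + G n)"
  unfolding polyb_def by (metis add_mono poly_add)

lemma polyb_Suc [intro!]: "polyb F \<Longrightarrow> polyb (\<lambda>n. Suc (F n))"
  using polyb_add[OF polyb_const[of 1]] by simp

lemma polyb_mult [intro!]: "polyb F \<Longrightarrow> polyb G \<Longrightarrow> polyb (\<lambda>n. F n * G n)"
  unfolding polyb_def by (metis mult_le_mono poly_mult)

lemma polyb_poly [intro!]: "polyb F \<Longrightarrow> polyb (\<lambda>n. poly p (F n))"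
  unfolding polyb_def by (metis poly_mono_nat poly_pcompose)

section \<open>Runs with time bounds and basic stack routines\<close>

definition run :: "com \<Rightarrow> store \<Rightarrow> nat \<Rightarrow> store \<Rightarrow> bool" where
  "run c s T s' \<longleftrightarrow> (\<exists>n\<le>T. exec c s n s')"

lemma run_mono: "run c s T s' \<Longrightarrow> T \<le> U \<Longrightarrow> run c s U s'"
  unfolding run_def by (meson order_trans)

lemma run_Skip: "run Skip s 0 s"
  unfolding run_def using exec.Skip by blast

lemma run_Push: "run (Push i b) s 1 (s(i := b # s i))"
  unfolding run_def using exec.Push by blast

lemma run_Pop: "run (Pop i) s 1 (s(i := tl (s i)))"
  unfolding run_def using exec.Pop by blast

lemma run_Seq: "run c s T s' \<Longrightarrow> run d s' U s'' \<Longrightarrow> run (c ;; d) s (T + U) s''"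
  unfolding run_def by (meson add_mono exec.Seq)

lemma run_Case: 
  assumes "s i = [] \<Longrightarrow> run c s T s'" "\<And>w. s i = True # w \<Longrightarrow> run d s T s'"
    "\<And>w. s i = False # w \<Longrightarrow> run e s T s'"
  shows "run (Case i c d e) s (T + 2) s'"
proof (cases "s i")
  case Nil
  then show ?thesis using assms(1) unfolding run_def by (meson add_le_mono1 exec.CaseE)
next
  case (Cons b w)
  show ?thesis
  proof (cases b)
    case True
    with Cons have "s i = True # w" by simp
    then show ?thesis using assms(2)[of w] exec.CaseT[of s i w d _ s' c e] unfolding run_def
      by (meson add_le_mono1)
  next
    case False
    with Cons have "s i = False # w" by simp
    then show ?thesis using assms(3)[of w] exec.CaseF[of s i w e _ s' c d] unfolding run_def
      by (meson add_le_mono1)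
  qed
qed

lemma run_LoopE: "s i = [] \<Longrightarrow> run (Loop i c) s 1 s"
  unfolding run_def using exec.LoopE by blast

lemma run_LoopS: "s i \<noteq> [] \<Longrightarrow> run c s T s' \<Longrightarrow> run (Loop i c) s' U s'' \<Longrightarrow>
   run (Loop i c) s (T + U + 2) s''"
  unfolding run_def by (meson add_mono exec.LoopS order_refl)

text \<open>A step pushes at most one bit, so every time bound is also a bound on the size of
  results.\<close>

lemma exec_length: "exec c s n s' \<Longrightarrow> length (s' i) \<le> length (s i) + n"
proof (induction rule: exec.induct)
qed auto

lemma run_length: "run c s T s' \<Longrightarrow> length (s' i) \<le> length (s i) + T"
  unfolding run_def using exec_length by (metis add_le_cancel_left order_trans)

definition clear :: "nat \<Rightarrow> com" where "clear i = Loop i (Pop i)"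

lemma run_clear: "run (clear i) s (3 * length (s i) + 1) (s(i := []))"
proof (induction "s i" arbitrary: s)
  case Nil
  then show ?case unfolding clear_def using run_LoopE[of s i] by (metis fun_upd_triv le_add2 run_mono)
next
  case (Cons b w)
  have "run (Loop i (Pop i)) (s(i := tl (s i))) (3 * length w + 1) (s(i := []))"
    using Cons(1)[of "s(i := tl (s i))"] Cons(2)[symmetric] by (simp add: clear_def)
  from run_LoopS[OF _ run_Pop this] show ?case
    using Cons(2)[symmetric] by (auto simp: clear_def elim: run_mono)
qed

definition move :: "nat \<Rightarrow> nat \<Rightarrow> com" where
  "move i j = Loop i (Case i Skip (Push j True) (Push j False) ;; Pop i)"

lemma run_move:
  assumes "i \<noteq> j"
  shows "run (move i j) s (6 * length (s i) + 1) (s(i := [], j := rev (s i) @ s j))"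
proof (induction "s i" arbitrary: s)
  case Nil
  then have "s(i := [], j := rev (s i) @ s j) = s" by auto
  then show ?case unfolding move_def using run_LoopE[of s i] Nil by (metis le_add2 run_mono)
next
  case (Cons b w)
  let ?s = "s(j := b # s j)"
  let ?s' = "?s(i := tl (?s i))"
  have "run (Case i Skip (Push j True) (Push j False)) s (1 + 2) ?s"
    by (rule run_Case) (use Cons(2) run_Push[of j b s] in \<open>auto simp: run_def\<close>)
  from run_Seq[OF this run_Pop[of i ?s]]
  have 1: "run (Case i Skip (Push j True) (Push j False) ;; Pop i) s 4 ?s'"
    by (rule run_mono) simp
  have "run (move i j) ?s' (6 * length w + 1) (?s'(i := [], j := rev (?s' i) @ ?s' j))"
    using Cons(1)[of ?s'] Cons(2)[symmetric] assms by simp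
  moreover have "?s'(i := [], j := rev (?s' i) @ ?s' j) = s(i := [], j := rev (s i) @ s j)"
    using Cons(2)[symmetric] assms by auto
  ultimately have 2: "run (move i j) ?s' (6 * length w + 1) (s(i := [], j := rev (s i) @ s j))" by simp
  show ?case unfolding move_def
    using run_LoopS[OF _ 1 2[unfolded move_def]] Cons(2)[symmetric] by (auto elim: run_mono)
qed

definition move2 :: "nat \<Rightarrow> nat \<Rightarrow> nat \<Rightarrow> com" where
  "move2 i j k = Loop i (Case i Skip (Push j True ;; Push k True) (Push j False ;; Push k False) ;; Pop i)"

lemma run_move2:
  assumes "i \<noteq> j" "i \<noteq> k" "j \<noteq> k"
  shows "run (move2 i j k) s (7 * length (s i) + 1) (s(i := [], j := rev (s i) @ s j, k := rev (s i) @ s k))"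
proof (induction "s i" arbitrary: s)
  case Nil
  then have "s(i := [], j := rev (s i) @ s j, k := rev (s i) @ s k) = s" by auto
  then show ?case unfolding move2_def using run_LoopE[of s i] Nil by (metis le_add2 run_mono)
next
  case (Cons b w)
  let ?s = "s(j := b # s j, k := b # s k)"
  let ?s' = "?s(i := tl (?s i))"
  have "run (Push j b ;; Push k b) s 2 ?s"
    using run_Seq[OF run_Push[of j b s] run_Push[of k b "s(j := b # s j)"]] assms
    by (simp add: numeral_2_eq_2)
  then have "run (Case i Skip (Push j True ;; Push k True) (Push j False ;; Push k False)) s (2 + 2) ?s"
    by (intro run_Case) (use Cons(2) in auto)
  from run_Seq[OF this run_Pop[of i ?s]]
  have 1: "run (Case i Skip (Push j True ;; Push k True) (Push j False ;; Push k False) ;; Pop i) s 5 ?s'"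
    by (rule run_mono) simp
  have "run (move2 i j k) ?s' (7 * length w + 1) (?s'(i := [], j := rev (?s' i) @ ?s' j, k := rev (?s' i) @ ?s' k))"
    using Cons(1)[of ?s'] Cons(2)[symmetric] assms by simp
  moreover have "?s'(i := [], j := rev (?s' i) @ ?s' j, k := rev (?s' i) @ ?s' k) =
      s(i := [], j := rev (s i) @ s j, k := rev (s i) @ s k)"
    using Cons(2)[symmetric] assms by auto
  ultimately have 2: "run (move2 i j k) ?s' (7 * length w + 1)
      (s(i := [], j := rev (s i) @ s j, k := rev (s i) @ s k))" by simp
  show ?case unfolding move2_def
    using run_LoopS[OF _ 1 2[unfolded move2_def]] Cons(2)[symmetric] by (auto elim: run_mono)
qed

text \<open>Stack 0 is copied to stack \<open>m\<close>, or refilled from it; stack \<open>k\<close> is scratch space.\<close>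

definition save :: "nat \<Rightarrow> nat \<Rightarrow> com" where "save m k = move 0 k ;; move2 k 0 m"
definition restore :: "nat \<Rightarrow> nat \<Rightarrow> com" where "restore m k = move m k ;; move k 0"

lemma run_save:
  assumes "s m = []" "s k = []" "0 < m" "0 < k" "m \<noteq> k"
  shows "run (save m k) s (13 * length (s 0) + 2) (s(m := s 0))"
proof -
  let ?s = "s(0 := [], k := rev (s 0) @ s k)"
  have "run (move 0 k) s (6 * length (s 0) + 1) ?s" by (rule run_move) (use assms in auto)
  from run_Seq[OF this run_move2[of k 0 m ?s]] assms
  have "run (save m k) s (13 * length (s 0) + 2)
     (?s(k := [], 0 := rev (?s k) @ ?s 0, m := rev (?s k) @ ?s m))"
    by (auto simp: save_def elim!: run_mono)
  also have "?s(k := [], 0 := rev (?s k) @ ?s 0, m := rev (?s k) @ ?s m) = s(m := s 0)"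
    using assms by auto
  finally show ?thesis .
qed

lemma run_restore:
  assumes "s k = []" "s 0 = []" "0 < m" "0 < k" "m \<noteq> k"
  shows "run (restore m k) s (12 * length (s m) + 2) (s(m := [], 0 := s m))"
proof -
  let ?s = "s(m := [], k := rev (s m) @ s k)"
  have "run (move m k) s (6 * length (s m) + 1) ?s" by (rule run_move) (use assms in auto)
  from run_Seq[OF this run_move[of k 0 ?s]] assms
  have "run (restore m k) s (12 * length (s m) + 2) (?s(k := [], 0 := rev (?s k) @ ?s 0))"
    by (auto simp: restore_def elim!: run_mono)
  also have "?s(k := [], 0 := rev (?s k) @ ?s 0) = s(m := [], 0 := s m)"
    using assms by auto
  finally show ?thesis .
qed

section \<open>Types coded as trees and functions computable in polynomial time\<close>

class enc =
  fixes tr :: "'a \<Rightarrow> tree"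
  assumes tr_inject [simp]: "tr x = tr y \<longleftrightarrow> x = y"

abbreviation cd :: "'a::enc \<Rightarrow> word" where "cd x \<equiv> code (tr x)"
abbreviation tsz :: "'a::enc \<Rightarrow> nat" where "tsz x \<equiv> length (cd x)"

instantiation tree :: enc
begin
definition tr_tree :: "tree \<Rightarrow> tree" where [simp]: "tr_tree t = t"
instance by standard simp
end

instantiation bool :: enc
begin
definition tr_bool :: "bool \<Rightarrow> tree" where "tr_bool b = (if b then Nd Lf Lf else Lf)"
instance by standard (simp add: tr_bool_def)
end

instantiation prod :: (enc, enc) enc
begin
definition tr_prod :: "'a \<times> 'b \<Rightarrow> tree" where "tr_prod p = Nd (tr (fst p)) (tr (snd p))"
instance by standard (simp add: tr_prod_def prod_eq_iff)
end

lemma tr_bool_simps [simp]: "tr True = Nd Lf Lf" "tr False = Lf"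
  by (simp_all add: tr_bool_def)

lemma tr_Pair [simp]: "tr (a, b) = Nd (tr a) (tr b)"
  by (simp add: tr_prod_def)

text \<open>In the end only stack 0 has changed: the scratch stacks below \<open>m\<close> start and
  finish empty, and the stacks from \<open>m\<close> on may hold parked data. This makes programs
  composable.\<close>

definition computes :: "com \<Rightarrow> nat \<Rightarrow> nat poly \<Rightarrow> ('a::enc \<Rightarrow> 'b::enc) \<Rightarrow> bool" where
  "computes c m p f \<longleftrightarrow> 0 < m \<and> (\<forall>t s. s 0 = cd t \<longrightarrow> (\<forall>i. 0 < i \<and> i < m \<longrightarrow> s i = []) \<longrightarrow>
     run c s (poly p (tsz t)) (s(0 := cd (f t))))"

definition ptime :: "('a::enc \<Rightarrow> 'b::enc) \<Rightarrow> bool" where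
  "ptime f \<longleftrightarrow> (\<exists>c m p. computes c m p f)"

lemma ptimeI:
  assumes "polyb F" "0 < m"
    and "\<And>t s. s 0 = cd t \<Longrightarrow> (\<And>i. 0 < i \<Longrightarrow> i < m \<Longrightarrow> s i = []) \<Longrightarrow>
      run c s (F (tsz t)) (s(0 := cd (f t)))"
  shows "ptime f"
proof -
  obtain p where "\<And>n. F n \<le> poly p n" using assms(1) unfolding polyb_def by blast
  then have "computes c m p f" unfolding computes_def using assms(2,3) run_mono by blast
  then show ?thesis unfolding ptime_def by blast
qed

lemma computesD:
  assumes "computes c m p f" "s 0 = cd t" "\<And>i. 0 < i \<Longrightarrow> i < m \<Longrightarrow> s i = []"
  shows "run c s (poly p (tsz t)) (s(0 := cd (f t)))"
  using assms unfolding computes_def by blast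

lemma computes_tsz:
  assumes "computes c m p f"
  shows "tsz (f t) \<le> tsz t + poly p (tsz t)"
proof -
  let ?s = "(\<lambda>i. []) (0 := cd t) :: store"
  have "run c ?s (poly p (tsz t)) (?s(0 := cd (f t)))"
    by (rule computesD[OF assms]) auto
  from run_length[OF this, of 0] show ?thesis by simp
qed

lemma ptime_tsz:
  assumes "ptime f"
  obtains p where "\<And>t. tsz (f t) \<le> poly p (tsz t)"
proof -
  from assms obtain c m p where "computes c m p f" unfolding ptime_def by blast
  from computes_tsz[OF this] show ?thesis using that[of "[:0,1:] + p"] by simp
qed

lemma ptime_id: "ptime (\<lambda>t::'a::enc. t)"
proof (rule ptimeI[where F="\<lambda>n. 0" and m=1 and c=Skip])
  fix t :: 'a and s :: store assume "s 0 = cd t"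
  then show "run Skip s 0 (s(0 := cd t))" using run_Skip[of s] by (metis fun_upd_triv)
qed auto

lemma ptime_Lf: "ptime (\<lambda>t::'a::enc. Lf)"
proof (rule ptimeI[where F="\<lambda>n. 3 * n + 2" and m=1 and c="clear 0 ;; Push 0 False"])
  fix t :: 'a and s :: store assume "s 0 = cd t"
  then show "run (clear 0 ;; Push 0 False) s (3 * tsz t + 2) (s(0 := cd Lf))"
    using run_Seq[OF run_clear[of 0 s] run_Push[of 0 False "s(0 := [])"]]
    by (auto elim!: run_mono)
qed auto

text \<open>A time bound for \<open>f\<close> bounds its output by \<open>n + poly p n\<close>, and
  the bound of \<open>g\<close> is evaluated there.\<close>

lemma ptime_comp:
  fixes f :: "'a::enc \<Rightarrow> 'b::enc" and g :: "'b \<Rightarrow> 'c::enc"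
  assumes "ptime f" "ptime g"
  shows "ptime (\<lambda>t. g (f t))"
proof -
  obtain c m p d k q where f: "computes c m p f" and g: "computes d k q g"
    using assms unfolding ptime_def by blast
  show ?thesis
  proof (rule ptimeI[where F="\<lambda>n. poly p n + poly q (n + poly p n)" and m="max m k" and c="c ;; d"])
    fix t :: 'a and s :: store
    assume s: "s 0 = cd t" "\<And>i. 0 < i \<Longrightarrow> i < max m k \<Longrightarrow> s i = []"
    have 1: "run c s (poly p (tsz t)) (s(0 := cd (f t)))"
      using computesD[OF f, of s t] s by simp
    have 2: "run d (s(0 := cd (f t))) (poly q (tsz (f t))) (s(0 := cd (g (f t))))"
      using computesD[OF g, of "s(0 := cd (f t))" "f t"] s(2) by simp
    show "run (c ;; d) s (poly p (tsz t) + poly q (tsz t + poly p (tsz t))) (s(0 := cd (g (f t))))"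
      using run_Seq[OF 1 2] by (rule run_mono) (auto intro!: poly_mono_nat computes_tsz[OF f])
  qed (use f in \<open>auto simp: computes_def\<close>)
qed

text \<open>The common start of the next constructions: compute \<open>f\<close>, park its result reversed on
  stack \<open>m + 1\<close>, then compute \<open>g\<close>.\<close>

lemma run_two:
  assumes f: "computes c k p f" and g: "computes d l q g" and m: "k \<le> m" "l \<le> m"
    and s: "s 0 = cd t" "\<And>i. 0 < i \<Longrightarrow> i < m + 3 \<Longrightarrow> s i = []"
  shows "run (save m (m + 1) ;; c ;; move 0 (m + 1) ;; restore m (m + 2) ;; d) s
     (31 * tsz t + 5 + 7 * poly p (tsz t) + poly q (tsz t))
     (s(0 := cd (g t), m + 1 := rev (cd (f t))))"
proof -
  have m0: "0 < m" using f m unfolding computes_def by simp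
  let ?L = "tsz t"
  let ?s1 = "s(m := cd t)" let ?s2 = "s(m := cd t, 0 := cd (f t))"
  let ?s3 = "s(m := cd t, 0 := [], m + 1 := rev (cd (f t)))"
  let ?s4 = "s(m + 1 := rev (cd (f t)), 0 := cd t)"
  let ?s5 = "s(0 := cd (g t), m + 1 := rev (cd (f t)))"
  have 1: "run (save m (m + 1)) s (13 * ?L + 2) ?s1"
    using run_save[of s m "m + 1"] s m0 by simp
  have 2: "run c ?s1 (poly p ?L) ?s2"
    using computesD[OF f, of ?s1 t] s m m0 by simp
  have 3: "run (move 0 (m + 1)) ?s2 (6 * tsz (f t) + 1) ?s3"
    using run_move[of 0 "m + 1" ?s2] s m0 by (simp add: fun_upd_twist)
  have "run (restore m (m + 2)) ?s3 (12 * ?L + 2) (?s3(m := [], 0 := ?s3 m))"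
    using run_restore[of ?s3 "m + 2" m] s m0 by simp
  moreover have "?s3(m := [], 0 := ?s3 m) = ?s4" using s m0 by (auto simp: fun_eq_iff)
  ultimately have 4: "run (restore m (m + 2)) ?s3 (12 * ?L + 2) ?s4" by simp
  have 5: "run d ?s4 (poly q ?L) (?s4(0 := cd (g t)))"
    using computesD[OF g, of ?s4 t] s m m0 by simp
  have 6: "?s4(0 := cd (g t)) = ?s5" by (auto simp: fun_eq_iff)
  have "run (save m (m + 1) ;; c ;; move 0 (m + 1) ;; restore m (m + 2) ;; d) s
    (13 * ?L + 2 + (poly p ?L + (6 * tsz (f t) + 1 + (12 * ?L + 2 + poly q ?L)))) ?s5"
    using run_Seq[OF 1 run_Seq[OF 2 run_Seq[OF 3 run_Seq[OF 4 5[unfolded 6]]]]] by simp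
  then show ?thesis by (rule run_mono) (use computes_tsz[OF f, of t] in simp)
qed

lemma ptime_Pair:
  fixes f :: "'a::enc \<Rightarrow> 'b::enc" and g :: "'a \<Rightarrow> 'c::enc"
  assumes "ptime f" "ptime g"
  shows "ptime (\<lambda>t. (f t, g t))"
proof -
  obtain c k p d l q where f: "computes c k p f" and g: "computes d l q g"
    using assms unfolding ptime_def by blast
  obtain m where m: "k \<le> m" "l \<le> m" by (meson max.cobounded1 max.cobounded2)
  let ?c = "(save m (m + 1) ;; c ;; move 0 (m + 1) ;; restore m (m + 2) ;; d) ;;
     move (m + 1) 0 ;; Push 0 True"
  show ?thesis
  proof (rule ptimeI[where F="\<lambda>n. 37 * n + 7 + 13 * poly p n + poly q n" and m="m + 3" and c="?c"])
    fix t :: 'a and s :: store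
    assume s: "s 0 = cd t" "\<And>i. 0 < i \<Longrightarrow> i < m + 3 \<Longrightarrow> s i = []"
    let ?s1 = "s(0 := cd (g t), m + 1 := rev (cd (f t)))"
    let ?s2 = "s(0 := cd (f t) @ cd (g t))"
    note 1 = run_two[OF f g m, of s t, OF s]
    have "run (move (m + 1) 0) ?s1 (6 * tsz (f t) + 1) (?s1(m + 1 := [], 0 := rev (?s1 (m + 1)) @ ?s1 0))"
      using run_move[of "m + 1" 0 ?s1] by simp
    moreover have "?s1(m + 1 := [], 0 := rev (?s1 (m + 1)) @ ?s1 0) = ?s2"
      using s(2)[of "m + 1"] by (auto simp: fun_eq_iff)
    ultimately have 2: "run (move (m + 1) 0) ?s1 (6 * tsz (f t) + 1) ?s2" by simp
    have 3: "run (Push 0 True) ?s2 1 (s(0 := cd ((f t, g t))))"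
      using run_Push[of 0 True ?s2] by simp
    have "tsz (f t) \<le> tsz t + poly p (tsz t)" by (rule computes_tsz[OF f])
    then have "31 * tsz t + 5 + 7 * poly p (tsz t) + poly q (tsz t) + (6 * tsz (f t) + 1 + 1)
        \<le> 37 * tsz t + 7 + 13 * poly p (tsz t) + poly q (tsz t)" by simp
    then show "run ?c s (37 * tsz t + 7 + 13 * poly p (tsz t) + poly q (tsz t))
        (s(0 := cd ((f t, g t))))"
      using run_Seq[OF 1 run_Seq[OF 2 3]] run_mono by blast
  qed auto
qed

text \<open>Stack \<open>j\<close> collects a mark for every mismatch, and the second loop marks
  what is left of stack \<open>i\<close>; so \<open>j\<close> ends empty exactly for equal
  words.\<close>

definition compare :: "nat \<Rightarrow> nat \<Rightarrow> com" where
  "compare i j = Loop 0 (Case 0 Skip (Case i (Push j True) Skip (Push j True))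
     (Case i (Push j True) (Push j True) Skip) ;; Pop 0 ;; Pop i) ;; Loop i (Push j True ;; Pop i)"

lemma run_compare_rest:
  assumes "i \<noteq> j"
  shows "run (Loop i (Push j True ;; Pop i)) s (4 * length (s i) + 1)
    (s(i := [], j := replicate (length (s i)) True @ s j))"
proof (induction "s i" arbitrary: s)
  case Nil
  then have "s(i := [], j := replicate (length (s i)) True @ s j) = s" by auto
  then show ?case using run_LoopE[of s i] Nil by (metis le_add2 run_mono)
next
  case (Cons b w)
  let ?s' = "s(j := True # s j, i := w)"
  have 1: "run (Push j True ;; Pop i) s 2 ?s'"
    using run_Seq[OF run_Push[of j True s] run_Pop[of i "s(j := True # s j)"]] Cons(2)[symmetric] assms
    by (simp add: numeral_2_eq_2)
  have "run (Loop i (Push j True ;; Pop i)) ?s' (4 * length w + 1)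
     (?s'(i := [], j := replicate (length (?s' i)) True @ ?s' j))"
    using Cons(1)[of ?s'] assms by simp
  moreover have "?s'(i := [], j := replicate (length (?s' i)) True @ ?s' j) =
      s(i := [], j := replicate (length (s i)) True @ s j)"
    using Cons(2)[symmetric] assms by (auto simp: fun_eq_iff replicate_app_Cons_same)
  ultimately have 2: "run (Loop i (Push j True ;; Pop i)) ?s' (4 * length w + 1)
      (s(i := [], j := replicate (length (s i)) True @ s j))" by simp
  show ?case using run_LoopS[OF _ 1 2] Cons(2)[symmetric] by (auto elim: run_mono)
qed

lemma run_compare:
  assumes "0 < i" "0 < j" "i \<noteq> j" "s j = []"
  shows "\<exists>w. run (compare i j) s (10 * length (s 0) + 4 * length (s i) + 2) (s(0 := [], i := [], j := w)) \<and>
    (w = [] \<longleftrightarrow> s 0 = s i) \<and> length w \<le> length (s 0) + length (s i)"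
proof -
  let ?b = "Case 0 Skip (Case i (Push j True) Skip (Push j True))
     (Case i (Push j True) (Push j True) Skip) ;; Pop 0 ;; Pop i"
  \<comment> \<open>The loop stops with stack 0, so it compares with a prefix of stack
    \<open>i\<close> only. Popping an empty stack \<open>i\<close> is harmless, and the missing bit
    has been marked as a mismatch.\<close>
  have *: "\<exists>w. run (Loop 0 ?b) s (10 * length (s 0) + 1)
     (s(0 := [], i := drop (length (s 0)) (s i), j := w @ s j)) \<and>
    (w = [] \<longleftrightarrow> take (length (s 0)) (s i) = s 0) \<and> length w \<le> length (s 0)" for s
  proof (induction "s 0" arbitrary: s)
    case Nil
    then have "s(0 := [], i := drop (length (s 0)) (s i), j := [] @ s j) = s" by auto
    then show ?case using run_LoopE[of s 0 ?b] Nil[symmetric]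
      by (intro exI[of _ "[]"]) (simp only: list.size, simp)
  next
    case (Cons b v)
    let ?x = "if s i \<noteq> [] \<and> hd (s i) = b then [] else [True]"
    let ?s1 = "s(j := ?x @ s j)"
    let ?s2 = "s(j := ?x @ s j, 0 := v, i := tl (s i))"
    have T: "run (Case i (Push j True) Skip (Push j True)) s (1 + 2) ?s1" if "b"
      by (rule run_Case) (use that run_Push[of j True s] run_Skip[of s] in \<open>auto simp: run_def\<close>)
    have F: "run (Case i (Push j True) (Push j True) Skip) s (1 + 2) ?s1" if "\<not> b"
      by (rule run_Case) (use that run_Push[of j True s] run_Skip[of s] in \<open>auto simp: run_def\<close>)
    have C: "run (Case 0 Skip (Case i (Push j True) Skip (Push j True))
     (Case i (Push j True) (Push j True) Skip)) s (1 + 2 + 2) ?s1"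
      by (rule run_Case) (use Cons(2) T F in auto)
    have 1: "run ?b s 7 ?s2"
      using run_Seq[OF C run_Seq[OF run_Pop[of 0 ?s1] run_Pop[of i "?s1(0 := tl (?s1 0))"]]]
        Cons(2)[symmetric] assms by (simp add: eval_nat_numeral)
    obtain w where w: "run (Loop 0 ?b) ?s2 (10 * length v + 1)
        (?s2(0 := [], i := drop (length v) (?s2 i), j := w @ ?s2 j))"
      "w = [] \<longleftrightarrow> take (length v) (?s2 i) = v" "length w \<le> length v"
      using Cons(1)[of ?s2] assms by auto
    have eq: "?s2(0 := [], i := drop (length v) (?s2 i), j := w @ ?s2 j) =
        s(0 := [], i := drop (length (s 0)) (s i), j := (w @ ?x) @ s j)"
      using Cons(2)[symmetric] assms by (auto simp: fun_eq_iff drop_Suc)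
    have "run (Loop 0 ?b) s (10 * length (s 0) + 1)
        (s(0 := [], i := drop (length (s 0)) (s i), j := (w @ ?x) @ s j))"
    proof -
      have "s 0 \<noteq> []" "7 + (10 * length v + 1) + 2 \<le> 10 * length (s 0) + 1"
        using Cons(2)[symmetric] by simp_all
      then show ?thesis using run_LoopS[of s 0, OF _ 1 w(1)[unfolded eq]] run_mono by blast
    qed
    moreover have "w @ ?x = [] \<longleftrightarrow> take (length (s 0)) (s i) = s 0"
      using w(2) Cons(2)[symmetric] assms by (cases "s i") auto
    moreover have "length (w @ ?x) \<le> length (s 0)" using w(3) Cons(2)[symmetric] by auto
    ultimately show ?case by blast
  qed
  obtain w where w: "run (Loop 0 ?b) s (10 * length (s 0) + 1)
     (s(0 := [], i := drop (length (s 0)) (s i), j := w))"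
    "w = [] \<longleftrightarrow> take (length (s 0)) (s i) = s 0" "length w \<le> length (s 0)"
    using *[of s] assms(4) by auto
  let ?s1 = "s(0 := [], i := drop (length (s 0)) (s i), j := w)"
  let ?w = "replicate (length (s i) - length (s 0)) True @ w"
  have eq: "?s1(i := [], j := replicate (length (s i) - length (s 0)) True @ ?s1 j) = s(0 := [], i := [], j := ?w)"
    using assms by (auto simp: fun_eq_iff)
  have l: "length (?s1 i) = length (s i) - length (s 0)" using assms by simp
  have "run (compare i j) s (10 * length (s 0) + 1 + (4 * (length (s i) - length (s 0)) + 1))
      (s(0 := [], i := [], j := ?w))"
    using run_Seq[OF w(1) run_compare_rest[OF assms(3), of ?s1, unfolded l eq]]
    unfolding compare_def .
  then have "run (compare i j) s (10 * length (s 0) + 4 * length (s i) + 2) (s(0 := [], i := [], j := ?w))"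
    by (rule run_mono) simp
  moreover have "?w = [] \<longleftrightarrow> s 0 = s i" using w(2) by (cases "length (s i) \<le> length (s 0)") auto
  moreover have "length ?w \<le> length (s 0) + length (s i)" using w(3) by simp
  ultimately show ?thesis by blast
qed

lemma ptime_eq:
  fixes f g :: "'a::enc \<Rightarrow> 'b::enc"
  assumes "ptime f" "ptime g"
  shows "ptime (\<lambda>t. f t = g t)"
proof -
  obtain c k p d l q where f: "computes c k p f" and g: "computes d l q g"
    using assms unfolding ptime_def by blast
  obtain m where m: "k \<le> m" "l \<le> m" by (meson max.cobounded1 max.cobounded2)
  let ?c = "(save m (m + 1) ;; c ;; move 0 (m + 1) ;; restore m (m + 2) ;; d) ;;
     move (m + 1) (m + 2) ;; compare (m + 2) (m + 3) ;;
     Case (m + 3) (Push 0 False ;; Push 0 False ;; Push 0 True) (Push 0 False) (Push 0 False) ;; clear (m + 3)"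
  have m0: "0 < m" using f m unfolding computes_def by auto
  let ?F = "\<lambda>n. 31 * n + 5 + 7 * poly p n + poly q n + (6 * (n + poly p n) + 1 +
     (10 * (n + poly q n) + 4 * (n + poly p n) + 2 + (5 + (3 * (n + poly q n + (n + poly p n)) + 1))))"
  show ?thesis
  proof (rule ptimeI[where F="?F" and m="m + 4" and c="?c"])
    fix t :: 'a and s :: store
    assume s: "s 0 = cd t" "\<And>i. 0 < i \<Longrightarrow> i < m + 4 \<Longrightarrow> s i = []"
    let ?L = "tsz t"
    note F = computes_tsz[OF f, of t] and G = computes_tsz[OF g, of t]
    let ?s1 = "s(0 := cd (g t), m + 1 := rev (cd (f t)))"
    let ?s2 = "s(0 := cd (g t), m + 2 := cd (f t))"
    have 1: "run (save m (m + 1) ;; c ;; move 0 (m + 1) ;; restore m (m + 2) ;; d) s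
       (31 * ?L + 5 + 7 * poly p ?L + poly q ?L) ?s1"
      by (rule run_two[OF f g m]) (use s in auto)
    have "run (move (m + 1) (m + 2)) ?s1 (6 * tsz (f t) + 1)
        (?s1(m + 1 := [], m + 2 := rev (?s1 (m + 1)) @ ?s1 (m + 2)))"
      using run_move[of "m + 1" "m + 2" ?s1] by simp
    moreover have "?s1(m + 1 := [], m + 2 := rev (?s1 (m + 1)) @ ?s1 (m + 2)) = ?s2"
      using s(2)[of "m + 1"] s(2)[of "m + 2"] by (simp add: fun_eq_iff)
    ultimately have "run (move (m + 1) (m + 2)) ?s1 (6 * tsz (f t) + 1) ?s2" by simp
    then have 2: "run (move (m + 1) (m + 2)) ?s1 (6 * (?L + poly p ?L) + 1) ?s2"
      by (rule run_mono) (use F in simp)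
    obtain w where w: "run (compare (m + 2) (m + 3)) ?s2 (10 * length (?s2 0) + 4 * length (?s2 (m + 2)) + 2)
       (?s2(0 := [], m + 2 := [], m + 3 := w))" "w = [] \<longleftrightarrow> ?s2 0 = ?s2 (m + 2)"
       "length w \<le> length (?s2 0) + length (?s2 (m + 2))"
      using run_compare[of "m + 2" "m + 3" ?s2] s(2)[of "m + 3"] by auto
    have w': "w = [] \<longleftrightarrow> f t = g t" "length w \<le> tsz (g t) + tsz (f t)"
      using w(2,3) by auto
    let ?s3 = "s(0 := [], m + 3 := w)"
    have "?s2(0 := [], m + 2 := [], m + 3 := w) = ?s3"
      using s(2)[of "m + 2"] by (simp add: fun_eq_iff)
    with w(1) have 3: "run (compare (m + 2) (m + 3)) ?s2 (10 * (?L + poly q ?L) + 4 * (?L + poly p ?L) + 2) ?s3"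
      using F G by (auto elim!: run_mono)
    let ?r = "f t = g t"
    let ?s4 = "?s3(0 := cd ?r)"
    have T: "run (Push 0 False ;; Push 0 False ;; Push 0 True) ?s3 3 ?s4" if "w = []"
    proof -
      have a: "run (Push 0 False) ?s3 1 (?s3(0 := [False]))"
        and b: "run (Push 0 False) (?s3(0 := [False])) 1 (?s3(0 := [False, False]))"
        and c: "run (Push 0 True) (?s3(0 := [False, False])) 1 (?s3(0 := [True, False, False]))"
        using run_Push[of 0 False ?s3] run_Push[of 0 False "?s3(0 := [False])"]
          run_Push[of 0 True "?s3(0 := [False, False])"] by simp_all
      show ?thesis using run_Seq[OF a run_Seq[OF b c]] that w'(1) by (simp add: eval_nat_numeral)
    qed
    have N: "run (Push 0 False) ?s3 3 ?s4" if "w \<noteq> []"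
      using run_mono[OF run_Push[of 0 False ?s3], of 3] that w'(1) by simp
    have 4: "run (Case (m + 3) (Push 0 False ;; Push 0 False ;; Push 0 True) (Push 0 False) (Push 0 False))
       ?s3 (3 + 2) ?s4"
      by (rule run_Case) (use T N in auto)
    have "run (clear (m + 3)) ?s4 (3 * length w + 1) (s(0 := cd ?r))"
      using run_clear[of "m + 3" ?s4] s(2)[of "m + 3"] by (simp add: fun_upd_twist fun_upd_idem)
    then have 5: "run (clear (m + 3)) ?s4 (3 * (?L + poly q ?L + (?L + poly p ?L)) + 1) (s(0 := cd ?r))"
      by (rule run_mono) (use w'(2) F G in simp)
    show "run ?c s (?F ?L) (s(0 := cd ?r))"
      using run_Seq[OF 1 run_Seq[OF 2 run_Seq[OF 3 run_Seq[OF 4 5]]]] by simp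
  qed auto
qed

lemma ptime_If:
  fixes f :: "'a::enc \<Rightarrow> bool" and g h :: "'a \<Rightarrow> 'b::enc"
  assumes "ptime f" "ptime h" "ptime g"
  shows "ptime (\<lambda>t. if f t then h t else g t)"
proof -
  obtain c k p d l q e j r where f: "computes c k p f" and g: "computes d l q g" and h: "computes e j r h"
    using assms unfolding ptime_def by blast
  obtain m where m: "k \<le> m" "l \<le> m" "j \<le> m"
    by (meson max.bounded_iff max.cobounded1 max.cobounded2 order_refl)
  let ?re = "clear 0 ;; restore m (m + 1)"
  let ?c = "save m (m + 1) ;; c ;; Case 0 Skip (?re ;; e) (?re ;; d)"
  have m0: "0 < m" using f m unfolding computes_def by auto
  let ?F = "\<lambda>n. 13 * n + 2 + (poly p n + (3 * (n + poly p n) + 1 + (12 * n + 2) + (poly q n + poly r n) + 2))"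
  show ?thesis
  proof (rule ptimeI[where F="?F" and m="m + 2" and c="?c"])
    fix t :: 'a and s :: store
    assume s: "s 0 = cd t" "\<And>i. 0 < i \<Longrightarrow> i < m + 2 \<Longrightarrow> s i = []"
    let ?L = "tsz t"
    let ?s1 = "s(m := cd t)" let ?s2 = "?s1(0 := cd (f t))"
    have 1: "run (save m (m + 1)) s (13 * ?L + 2) ?s1"
      using run_save[of s m "m + 1"] s m0 by simp
    have 2: "run c ?s1 (poly p ?L) ?s2"
      using computesD[OF f, of ?s1 t] s m m0 by simp
    have "run (clear 0) ?s2 (3 * tsz (f t) + 1) (?s2(0 := []))" using run_clear[of 0 ?s2] by simp
    moreover have "run (restore m (m + 1)) (?s2(0 := [])) (12 * ?L + 2) (?s2(0 := [], m := [], 0 := cd t))"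
      using run_restore[of "?s2(0 := [])" "m + 1" m] s m0 by simp
    moreover have "?s2(0 := [], m := [], 0 := cd t) = s"
      using s m0 by (auto simp: fun_eq_iff)
    ultimately have "run ?re ?s2 (3 * tsz (f t) + 1 + (12 * ?L + 2)) s"
      using run_Seq by metis
    then have 3: "run ?re ?s2 (3 * (?L + poly p ?L) + 1 + (12 * ?L + 2)) s"
      by (rule run_mono) (use computes_tsz[OF f, of t] in simp)
    have g': "run d s (poly q ?L) (s(0 := cd (g t)))" using computesD[OF g, of s t] s m by simp
    have h': "run e s (poly r ?L) (s(0 := cd (h t)))" using computesD[OF h, of s t] s m by simp
    let ?T = "3 * (?L + poly p ?L) + 1 + (12 * ?L + 2) + (poly q ?L + poly r ?L)"
    have 4: "run (Case 0 Skip (?re ;; e) (?re ;; d)) ?s2 (?T + 2) (s(0 := cd (if f t then h t else g t)))"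
    proof (rule run_Case)
      fix w assume "?s2 0 = True # w"
      then have "f t" by (cases "f t") auto
      then show "run (?re ;; e) ?s2 ?T (s(0 := cd (if f t then h t else g t)))"
        using run_Seq[OF 3 h'] by (auto elim: run_mono)
    next
      fix w assume "?s2 0 = False # w"
      then have "\<not> f t" by (cases "f t") auto
      then show "run (?re ;; d) ?s2 ?T (s(0 := cd (if f t then h t else g t)))"
        using run_Seq[OF 3 g'] by (auto elim: run_mono)
    next
      assume "?s2 0 = []" then show "run Skip ?s2 ?T (s(0 := cd (if f t then h t else g t)))"
        by (cases "f t") auto
    qed
    show "run ?c s (?F ?L) (s(0 := cd (if f t then h t else g t)))"
      using run_Seq[OF 1 run_Seq[OF 2 4]] by simp
  qed auto
qed

subsection \<open>Projections\<close>

fun lft :: "tree \<Rightarrow> tree" where "lft Lf = Lf" | "lft (Nd l r) = l"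
fun rgt :: "tree \<Rightarrow> tree" where "rgt Lf = Lf" | "rgt (Nd l r) = r"

text \<open>In Polish notation an inner node replaces one pending subtree by two, and a leaf settles
  one.\<close>

definition shift_tree :: com where
  "shift_tree = Loop 2 (Case 0 Skip (Push 1 True ;; Push 2 True) (Push 1 False ;; Pop 2) ;; Pop 0)"

text \<open>Stack 2 counts the subtrees that are still to be read.\<close>

lemma run_shift_tree_aux:
  assumes "s 0 = code t @ u" "s 2 = True # w"
    and "run shift_tree (s(0 := u, 1 := rev (code t) @ s 1, 2 := w)) T s''"
  shows "run shift_tree s (7 * csize t + T) s''"
  using assms
\<comment> \<open>The run after the subtree is an arbitrary continuation with bound
  \<open>T\<close>, since the loop does not stop between two pending subtrees.\<close>
proof (induction t arbitrary: s u w T)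
  case Lf
  let ?B = "Case 0 Skip (Push 1 True ;; Push 2 True) (Push 1 False ;; Pop 2)"
  let ?s = "s(1 := False # s 1, 2 := w)"
  have "run (Push 1 False ;; Pop 2) s 2 ?s"
    using run_Seq[OF run_Push[of 1 False s] run_Pop[of 2 "s(1 := False # s 1)"]] Lf
    by (simp add: eval_nat_numeral)
  then have 1: "run ?B s (2 + 2) ?s" by (intro run_Case) (use Lf in auto)
  have "?s(0 := tl (?s 0)) = s(0 := u, 1 := False # s 1, 2 := w)"
    using Lf by (auto simp: fun_eq_iff)
  with run_Seq[OF 1 run_Pop[of 0 ?s]]
  have 2: "run (?B ;; Pop 0) s 5 (s(0 := u, 1 := False # s 1, 2 := w))" by (simp add: eval_nat_numeral)
  have 3: "run (Loop 2 (?B ;; Pop 0)) (s(0 := u, 1 := False # s 1, 2 := w)) T s''"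
    using Lf(3) by (simp add: shift_tree_def fun_upd_def)
  show ?case using run_LoopS[OF _ 2 3] Lf(2)
    unfolding shift_tree_def by (auto elim!: run_mono)
next
  case (Nd l r)
  let ?B = "Case 0 Skip (Push 1 True ;; Push 2 True) (Push 1 False ;; Pop 2)"
  let ?s = "s(1 := True # s 1, 2 := True # True # w)"
  have "run (Push 1 True ;; Push 2 True) s 2 ?s"
    using run_Seq[OF run_Push[of 1 True s] run_Push[of 2 True "s(1 := True # s 1)"]] Nd.prems
    by (simp add: eval_nat_numeral)
  then have 1: "run ?B s (2 + 2) ?s" by (intro run_Case) (use Nd.prems in auto)
  let ?s1 = "s(0 := code l @ code r @ u, 1 := True # s 1, 2 := True # True # w)"
  have "?s(0 := tl (?s 0)) = ?s1"
    using Nd.prems by (auto simp: fun_eq_iff)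
  with run_Seq[OF 1 run_Pop[of 0 ?s]] have 2: "run (?B ;; Pop 0) s 5 ?s1" by (simp add: eval_nat_numeral)
  let ?s2 = "?s1(0 := code r @ u, 1 := rev (code l) @ ?s1 1, 2 := True # w)"
  have e: "?s2(0 := u, 1 := rev (code r) @ ?s2 1, 2 := w) =
      s(0 := u, 1 := rev (code (Nd l r)) @ s 1, 2 := w)" by (auto simp: fun_eq_iff)
  have 4: "run shift_tree ?s2 (7 * csize r + T) s''"
  proof (rule Nd.IH(2)[of ?s2 u w T])
    show "run shift_tree (?s2(0 := u, 1 := rev (code r) @ ?s2 1, 2 := w)) T s''"
      unfolding e by (rule Nd.prems(3))
  qed simp_all
  have 3: "run shift_tree ?s1 (7 * csize l + (7 * csize r + T)) s''"
  proof (rule Nd.IH(1)[of ?s1 "code r @ u" "True # w"])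
    show "run shift_tree ?s2 (7 * csize r + T) s''" by (rule 4)
  qed simp_all
  show ?case using run_LoopS[OF _ 2 3[unfolded shift_tree_def]] Nd.prems(2)
    unfolding shift_tree_def by (auto elim!: run_mono)
qed

lemma run_shift_tree:
  assumes "s 0 = code t @ u" "s 2 = []" "s 1 = []"
  shows "run (Push 2 True ;; shift_tree) s (7 * csize t + 2) (s(0 := u, 1 := rev (code t)))"
proof -
  let ?s = "s(2 := [True])"
  have eq: "?s(0 := u, 1 := rev (code t) @ ?s 1, 2 := []) = s(0 := u, 1 := rev (code t))"
    using assms by (auto simp: fun_eq_iff)
  have "run shift_tree (s(0 := u, 1 := rev (code t))) 1 (s(0 := u, 1 := rev (code t)))"
    unfolding shift_tree_def by (rule run_LoopE) (use assms in simp)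
  then have 1: "run shift_tree ?s (7 * csize t + 1) (s(0 := u, 1 := rev (code t)))"
    by (intro run_shift_tree_aux[where u=u and w="[]"]) (use assms eq in simp_all)
  from run_Seq[OF run_Push[of 2 True s, unfolded assms] 1] show ?thesis by (auto elim!: run_mono)
qed

lemma ptime_lft: "ptime lft"
proof (rule ptimeI[where F="\<lambda>n. 20 * n + 10" and m=3 and
    c="Case 0 Skip (Pop 0 ;; (Push 2 True ;; shift_tree) ;; clear 0 ;; move 1 0) Skip"])
  fix t :: tree and s :: store
  assume s: "s 0 = cd t" "\<And>i. 0 < i \<Longrightarrow> i < 3 \<Longrightarrow> s i = []"
  have s12: "s 1 = []" "s 2 = []" using s(2) by simp_all
  show "run (Case 0 Skip (Pop 0 ;; (Push 2 True ;; shift_tree) ;; clear 0 ;; move 1 0) Skip) s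
     (20 * tsz t + 10) (s(0 := cd (lft t)))"
  proof (cases t)
    case Lf
    have "run (Case 0 Skip (Pop 0 ;; (Push 2 True ;; shift_tree) ;; clear 0 ;; move 1 0) Skip) s (0 + 2) s"
      by (rule run_Case) (use run_Skip s Lf in auto)
    moreover have "s(0 := cd (lft t)) = s" using s Lf by auto
    ultimately show ?thesis using run_mono by fastforce
  next
    case (Nd l r)
    let ?s = "s(0 := code l @ code r)"
    have 1: "run (Pop 0) s 1 ?s" using run_Pop[of 0 s] s Nd by simp
    have 2: "run (Push 2 True ;; shift_tree) ?s (7 * csize l + 2) (s(0 := code r, 1 := rev (code l)))"
      using run_shift_tree[of ?s l "code r"] s12 by simp
    have 3: "run (clear 0) (s(0 := code r, 1 := rev (code l))) (3 * csize r + 1) (s(0 := [], 1 := rev (code l)))"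
      using run_clear[of 0 "s(0 := code r, 1 := rev (code l))"] by (simp add: fun_upd_twist)
    have "s(0 := [], 1 := [], 0 := code l) = s(0 := code l)" using s12 by (auto simp: fun_eq_iff)
    then have 4: "run (move 1 0) (s(0 := [], 1 := rev (code l))) (6 * csize l + 1) (s(0 := code l))"
      using run_move[of 1 0 "s(0 := [], 1 := rev (code l))"] by simp
    note 5 = run_Seq[OF 1 run_Seq[OF 2 run_Seq[OF 3 4]]]
    have "run (Case 0 Skip (Pop 0 ;; (Push 2 True ;; shift_tree) ;; clear 0 ;; move 1 0) Skip) s
       (1 + (7 * csize l + 2 + (3 * csize r + 1 + (6 * csize l + 1))) + 2) (s(0 := code l))"
      by (rule run_Case) (use 5 s Nd in auto)
    then have "run (Case 0 Skip (Pop 0 ;; (Push 2 True ;; shift_tree) ;; clear 0 ;; move 1 0) Skip) s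
       (20 * tsz t + 10) (s(0 := code l))" by (rule run_mono) (use Nd in simp)
    then show ?thesis using Nd by simp
  qed
qed auto

lemma ptime_rgt: "ptime rgt"
proof (rule ptimeI[where F="\<lambda>n. 20 * n + 10" and m=3 and
    c="Case 0 Skip (Pop 0 ;; (Push 2 True ;; shift_tree) ;; clear 1) Skip"])
  fix t :: tree and s :: store
  assume s: "s 0 = cd t" "\<And>i. 0 < i \<Longrightarrow> i < 3 \<Longrightarrow> s i = []"
  have s12: "s 1 = []" "s 2 = []" using s(2) by simp_all
  show "run (Case 0 Skip (Pop 0 ;; (Push 2 True ;; shift_tree) ;; clear 1) Skip) s
     (20 * tsz t + 10) (s(0 := cd (rgt t)))"
  proof (cases t)
    case Lf
    have "run (Case 0 Skip (Pop 0 ;; (Push 2 True ;; shift_tree) ;; clear 1) Skip) s (0 + 2) s"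
      by (rule run_Case) (use run_Skip s Lf in auto)
    moreover have "s(0 := cd (rgt t)) = s" using s Lf by auto
    ultimately show ?thesis using run_mono by fastforce
  next
    case (Nd l r)
    let ?s = "s(0 := code l @ code r)"
    have 1: "run (Pop 0) s 1 ?s" using run_Pop[of 0 s] s Nd by simp
    have 2: "run (Push 2 True ;; shift_tree) ?s (7 * csize l + 2) (s(0 := code r, 1 := rev (code l)))"
      using run_shift_tree[of ?s l "code r"] s12 by simp
    have "s(0 := code r, 1 := []) = s(0 := code r)" using s12 by (auto simp: fun_eq_iff)
    then have 3: "run (clear 1) (s(0 := code r, 1 := rev (code l))) (3 * csize l + 1) (s(0 := code r))"
      using run_clear[of 1 "s(0 := code r, 1 := rev (code l))"] by (simp add: fun_upd_twist)
    note 5 = run_Seq[OF 1 run_Seq[OF 2 3]]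
    have "run (Case 0 Skip (Pop 0 ;; (Push 2 True ;; shift_tree) ;; clear 1) Skip) s
       (1 + (7 * csize l + 2 + (3 * csize l + 1)) + 2) (s(0 := code r))"
      by (rule run_Case) (use 5 s Nd in auto)
    then have "run (Case 0 Skip (Pop 0 ;; (Push 2 True ;; shift_tree) ;; clear 1) Skip) s
       (20 * tsz t + 10) (s(0 := code r))" by (rule run_mono) (use Nd in simp)
    then show ?thesis using Nd by simp
  qed
qed auto

subsection \<open>Iteration\<close>

text \<open>Only \<open>True\<close> bits on stack \<open>i\<close> trigger \<open>c\<close>. A tree
  code can thus serve as a counter: its \<open>True\<close> bits are its inner nodes.\<close>

definition repeat :: "nat \<Rightarrow> com \<Rightarrow> com" where
  "repeat i c = Loop i (Case i Skip (Pop i ;; c) (Pop i))"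

lemma run_repeat:
  assumes g: "computes c k q (g :: 'a::enc \<Rightarrow> 'a)" and "k \<le> i" "0 < i"
    and "s 0 = cd x" "\<And>j. 0 < j \<Longrightarrow> j < k \<Longrightarrow> s j = []"
    and B: "\<And>j. j \<le> length (filter id (s i)) \<Longrightarrow> tsz ((g ^^ j) x) \<le> B"
  shows "run (repeat i c) s (length (s i) * (poly q B + 5) + 1)
    (s(0 := cd ((g ^^ length (filter id (s i))) x), i := []))"
  using assms(4-6)
proof (induction "s i" arbitrary: s x)
  case Nil
  then have "s(0 := cd ((g ^^ length (filter id (s i))) x), i := []) = s" by (auto simp: fun_eq_iff)
  then show ?case unfolding repeat_def using run_LoopE[of s i] Nil(1) by (metis le_add2 run_mono)
next
  case (Cons b w)
  have w: "s i = b # w" using Cons(2) by simp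
  let ?x = "if b then g x else x"
  let ?s = "s(i := w, 0 := cd ?x)"
  have T: "run (Pop i ;; c) s (1 + poly q B) ?s" if b
  proof -
    have 1: "run (Pop i) s 1 (s(i := w))" using run_Pop[of i s] w by simp
    have "run c (s(i := w)) (poly q (tsz x)) (s(i := w, 0 := cd (g x)))"
      using computesD[OF g, of "s(i := w)" x] Cons(3,4) assms(2,3) by simp
    then have "run c (s(i := w)) (poly q B) (s(i := w, 0 := cd (g x)))"
      by (rule run_mono) (use Cons(5)[of 0] in \<open>simp add: poly_mono_nat\<close>)
    from run_Seq[OF 1 this] that show ?thesis by simp
  qed
  have F: "run (Pop i) s (1 + poly q B) ?s" if "\<not> b"
  proof -
    have "s(i := w, 0 := cd x) = s(i := w)" using Cons(3) assms(3) by (auto simp: fun_eq_iff)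
    then show ?thesis using run_mono[OF run_Pop[of i s]] w that by simp
  qed
  have 1: "run (Case i Skip (Pop i ;; c) (Pop i)) s (1 + poly q B + 2) ?s"
    by (rule run_Case) (use w T F in auto)
  have B': "tsz ((g ^^ j) ?x) \<le> B" if "j \<le> length (filter id (?s i))" for j
  proof (cases b)
    case True
    then show ?thesis using Cons(5)[of "Suc j"] that w assms(3) by (simp add: funpow_swap1)
  next
    case False
    then show ?thesis using Cons(5)[of "j"] that w assms(3) by simp
  qed
  have "run (repeat i c) ?s (length (?s i) * (poly q B + 5) + 1)
      (?s(0 := cd ((g ^^ length (filter id (?s i))) ?x), i := []))"
    by (rule Cons(1)) (use assms(2,3) Cons(4) B' in auto)
  moreover have "?s(0 := cd ((g ^^ length (filter id (?s i))) ?x), i := []) =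
     s(0 := cd ((g ^^ length (filter id (s i))) x), i := [])"
    using assms(3) w by (auto simp: fun_eq_iff funpow_swap1)
  ultimately have 2: "run (repeat i c) ?s (length w * (poly q B + 5) + 1)
      (s(0 := cd ((g ^^ length (filter id (s i))) x), i := []))" using assms(3) by simp
  show ?case unfolding repeat_def
    using run_LoopS[OF _ 1 2[unfolded repeat_def]] w by (auto elim!: run_mono)
qed

lemma length_filter_code: "length (filter id (rev (code t))) = nodes t"
proof -
  have "length (filter id (code t)) = nodes t" by (induction t) auto
  then show ?thesis by (metis length_rev rev_filter)
qed

text \<open>Iterating a polynomial-time function can blow up the size, so all intermediate values
  are required to be polynomial in the original input; this is bounded recursion in the sense of
  Cobham.\<close>

lemma ptime_funpow:
  fixes f :: "'a::enc \<Rightarrow> 'b::enc" and g :: "'b \<Rightarrow> 'b" and h :: "'a \<Rightarrow> 'c::enc"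
  assumes "ptime f" "ptime g" "ptime h" "polyb B"
    and bound: "\<And>x i. i \<le> nodes (tr (h x)) \<Longrightarrow> tsz ((g ^^ i) (f x)) \<le> B (tsz x)"
  shows "ptime (\<lambda>x. (g ^^ nodes (tr (h x))) (f x))"
proof -
  obtain c k p d l q e j r where f: "computes c k p f" and g: "computes d l q g" and h: "computes e j r h"
    using assms(1-3) unfolding ptime_def by blast
  obtain b where b: "\<And>n. B n \<le> poly b n" using assms(4) unfolding polyb_def by blast
  obtain m where m: "k \<le> m" "l \<le> m" "j \<le> m"
    by (meson max.bounded_iff max.cobounded1 max.cobounded2 order_refl)
  have m0: "0 < m" using f m unfolding computes_def by auto
  let ?c = "(save m (m + 1) ;; e ;; move 0 (m + 1) ;; restore m (m + 2) ;; c) ;; repeat (m + 1) d"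
  let ?F = "\<lambda>n. 31 * n + 5 + 7 * poly r n + poly p n + ((n + poly r n) * (poly q (poly b n) + 5) + 1)"
  show ?thesis
  proof (rule ptimeI[where F="?F" and m="m + 3" and c="?c"])
    fix t :: 'a and s :: store
    assume s: "s 0 = cd t" "\<And>i. 0 < i \<Longrightarrow> i < m + 3 \<Longrightarrow> s i = []"
    let ?L = "tsz t"
    let ?s1 = "s(0 := cd (f t), m + 1 := rev (cd (h t)))"
    let ?r = "(g ^^ nodes (tr (h t))) (f t)"
    note 1 = run_two[OF h f m(3,1), of s t, OF s]
    have "run (repeat (m + 1) d) ?s1 (length (?s1 (m + 1)) * (poly q (poly b ?L) + 5) + 1)
      (?s1(0 := cd ((g ^^ length (filter id (?s1 (m + 1)))) (f t)), m + 1 := []))"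
    proof (rule run_repeat[OF g])
      fix i assume "i \<le> length (filter id (?s1 (m + 1)))"
      then have "i \<le> nodes (tr (h t))" using length_filter_code[of "tr (h t)"] by simp
      from bound[OF this] show "tsz ((g ^^ i) (f t)) \<le> poly b ?L" using b order_trans by blast
    qed (use m m0 s in auto)
    moreover have "?s1(0 := cd ((g ^^ length (filter id (?s1 (m + 1)))) (f t)), m + 1 := []) = s(0 := cd ?r)"
      using s(2)[of "m + 1"] length_filter_code[of "tr (h t)"] by (auto simp: fun_eq_iff)
    ultimately have "run (repeat (m + 1) d) ?s1 (tsz (h t) * (poly q (poly b ?L) + 5) + 1) (s(0 := cd ?r))"
      by simp
    moreover have "tsz (h t) * (poly q (poly b ?L) + 5) \<le> (?L + poly r ?L) * (poly q (poly b ?L) + 5)"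
      by (rule mult_right_mono[OF computes_tsz[OF h]]) simp
    ultimately have 2: "run (repeat (m + 1) d) ?s1 ((?L + poly r ?L) * (poly q (poly b ?L) + 5) + 1) (s(0 := cd ?r))"
      by (elim run_mono) simp
    show "run ?c s (?F ?L) (s(0 := cd ?r))" using run_Seq[OF 1 2] .
  qed auto
qed

subsection \<open>Closure properties\<close>

named_theorems ptime_intros

text \<open>Only tree codes matter, so types with equal codes inherit each other's operations: a
  pair is a node, a nonempty list a pair, a number a list of units.\<close>

lemma ptime_same_code:
  assumes "ptime f" "\<And>x. tr (g x) = tr (f x)"
  shows "ptime g"
  using assms unfolding ptime_def computes_def by auto

lemma ptime_same: "ptime f \<Longrightarrow> (\<And>x. g x = f x) \<Longrightarrow> ptime g"
  by (rule ptime_same_code) auto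

lemma ptime_tr: "ptime f \<Longrightarrow> ptime (\<lambda>x. tr (f x))"
  by (erule ptime_same_code) simp

lemmas [ptime_intros] = ptime_id ptime_Pair ptime_eq ptime_If

lemma ptime_lft' : "ptime f \<Longrightarrow> ptime (\<lambda>x. lft (f x))"
  using ptime_comp[OF _ ptime_lft] .

lemma ptime_rgt' : "ptime f \<Longrightarrow> ptime (\<lambda>x. rgt (f x))"
  using ptime_comp[OF _ ptime_rgt] .

lemma ptime_fst [ptime_intros]: "ptime f \<Longrightarrow> ptime (\<lambda>x. fst (f x))"
  by (rule ptime_same_code[OF ptime_lft'[OF ptime_tr]]) (auto simp: tr_prod_def)

lemma ptime_snd [ptime_intros]: "ptime f \<Longrightarrow> ptime (\<lambda>x. snd (f x))"
  by (rule ptime_same_code[OF ptime_rgt'[OF ptime_tr]]) (auto simp: tr_prod_def)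

lemma ptime_const_tree: "ptime (\<lambda>x. t :: tree)"
proof (induction t)
  case (Nd l r)
  show ?case by (rule ptime_same_code[OF ptime_Pair[OF Nd]]) simp
qed (rule ptime_Lf)

lemma ptime_const [ptime_intros]: "ptime (\<lambda>x. c)"
  by (rule ptime_same_code[OF ptime_const_tree[of "tr c"]]) simp

lemma ptime_Not [ptime_intros]:
  assumes "ptime f"
  shows "ptime (\<lambda>x. \<not> f x)"
proof -
  have "ptime (\<lambda>x. if f x then False else True)" by (intro ptime_If ptime_const assms)
  then show ?thesis by (rule ptime_same) auto
qed

lemma ptime_conj [ptime_intros]:
  assumes "ptime f" "ptime g"
  shows "ptime (\<lambda>x. f x \<and> g x)"
proof -
  have "ptime (\<lambda>x. if f x then g x else False)" by (intro ptime_If ptime_const assms)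
  then show ?thesis by (rule ptime_same) auto
qed

lemma ptime_disj [ptime_intros]:
  assumes "ptime f" "ptime g"
  shows "ptime (\<lambda>x. f x \<or> g x)"
proof -
  have "ptime (\<lambda>x. if f x then True else g x)" by (intro ptime_If ptime_const assms)
  then show ?thesis by (rule ptime_same) auto
qed

lemma ptime_imp [ptime_intros]:
  assumes "ptime f" "ptime g"
  shows "ptime (\<lambda>x. f x \<longrightarrow> g x)"
proof -
  have "ptime (\<lambda>x. if f x then g x else True)" by (intro ptime_If ptime_const assms)
  then show ?thesis by (rule ptime_same) auto
qed

instantiation unit :: enc
begin
definition tr_unit :: "unit \<Rightarrow> tree" where [simp]: "tr_unit x = Lf"
instance by standard simp
end

text \<open>Unary notation: the size of a number is linear in its value, and its code is that of a
  list of units of this length.\<close>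

instantiation nat :: enc
begin
primrec tr_nat :: "nat \<Rightarrow> tree" where "tr_nat 0 = Lf" | "tr_nat (Suc n) = Nd Lf (tr_nat n)"
lemma tr_nat_inject: "tr (x::nat) = tr y \<longleftrightarrow> x = y"
proof (induction x arbitrary: y)
  case 0
  then show ?case by (cases y) auto
next
  case (Suc x)
  then show ?case by (cases y) auto
qed
instance by standard (rule tr_nat_inject)
end

instantiation list :: (enc) enc
begin
primrec tr_list :: "'a list \<Rightarrow> tree" where "tr_list [] = Lf" | "tr_list (x # xs) = Nd (tr x) (tr_list xs)"
lemma tr_list_inject: "tr (xs::'a list) = tr ys \<longleftrightarrow> xs = ys"
proof (induction xs arbitrary: ys)
  case Nil
  then show ?case by (cases ys) auto
next
  case (Cons x xs)
  then show ?case by (cases ys) auto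
qed
instance by standard (rule tr_list_inject)
end

lemma tsz_nat [simp]: "tsz (n::nat) = 2 * n + 1"
  by (induction n) auto

lemma tsz_bool: "tsz (b::bool) \<le> 3"
  by (cases b) auto

lemma tsz_append: "tsz (xs @ ys) + 1 = tsz xs + tsz ys"
  by (induction xs) auto

lemma tsz_drop: "tsz (drop n xs) \<le> tsz xs"
  by (induction xs arbitrary: n) (auto simp: drop_Cons split: nat.split intro: le_SucI trans_le_add2)

lemma tsz_tl: "tsz (tl xs) \<le> tsz xs"
  by (cases xs) auto

lemma tsz_mem: "x \<in> set xs \<Longrightarrow> tsz x < tsz xs"
  by (induction xs) auto

lemma length_le_tsz: "length xs < tsz xs"
  by (induction xs) auto

lemma length_le_nodes: "length xs \<le> nodes (tr xs)"
  by (induction xs) auto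

lemma tsz_list_le: "(\<And>x. x \<in> set xs \<Longrightarrow> tsz x \<le> B) \<Longrightarrow> tsz xs \<le> length xs * Suc B + 1"
  by (induction xs) (auto, fastforce)

lemma ptime_Cons [ptime_intros]: "ptime f \<Longrightarrow> ptime g \<Longrightarrow> ptime (\<lambda>x. f x # g x)"
  by (rule ptime_same_code[OF ptime_Pair]) auto

lemma ptime_Suc [ptime_intros]: "ptime f \<Longrightarrow> ptime (\<lambda>x. Suc (f x))"
  by (rule ptime_same_code[OF ptime_Pair[OF ptime_const[of Lf]]]) auto

lemma ptime_tl [ptime_intros]:
  assumes "ptime f"
  shows "ptime (\<lambda>x. tl (f x))"
proof (rule ptime_same_code[OF ptime_rgt'[OF ptime_tr[OF assms]]])
  show "tr (tl (f x)) = tr (rgt (tr (f x)))" for x by (cases "f x") auto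
qed

lemma ptime_hd [ptime_intros]:
  fixes f :: "'a::enc \<Rightarrow> 'b::enc list"
  assumes "ptime f"
  shows "ptime (\<lambda>x. hd (f x))"
\<comment> \<open>\<open>hd []\<close> is unspecified but fixed, so its code is a constant.\<close>
proof (rule ptime_same_code[OF ptime_If[OF ptime_eq[OF assms ptime_const[of "[]"]]
        ptime_const[of "tr (hd [] :: 'b)"] ptime_lft'[OF ptime_tr[OF assms]]]])
  show "tr (hd (f x)) = tr (if f x = [] then tr (hd [] :: 'b) else lft (tr (f x)))" for x
    by (cases "f x") auto
qed

lemma tsz_foldl_le:
  assumes "\<And>a y. y \<in> set ys \<Longrightarrow> tsz (h a y) \<le> tsz a + B"
  shows "tsz (foldl h a ys) \<le> tsz a + length ys * B"
  using assms
proof (induction ys arbitrary: a)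
  case (Cons y ys)
  have "tsz (foldl h (h a y) ys) \<le> tsz (h a y) + length ys * B" using Cons by auto
  then show ?case using Cons.prems[of y a] by simp
qed simp

text \<open>The fold is an iteration on triples of parameter, remaining list and accumulator. The
  size bound concerns only accumulators reached after a prefix of the list.\<close>

lemma ptime_foldl_bound:
  fixes i :: "'a::enc \<Rightarrow> 'b::enc" and l :: "'a \<Rightarrow> 'c::enc list" and h :: "'a \<Rightarrow> 'b \<Rightarrow> 'c \<Rightarrow> 'b"
  assumes "ptime (\<lambda>p. h (fst p) (fst (snd p)) (snd (snd p)))" "ptime i" "ptime l" "polyb B"
    and bound: "\<And>x ys zs. l x = ys @ zs \<Longrightarrow> tsz (foldl (h x) (i x) ys) \<le> B (tsz x)"
  shows "ptime (\<lambda>x. foldl (h x) (i x) (l x))"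
proof -
  define g :: "'a \<times> 'c list \<times> 'b \<Rightarrow> 'a \<times> 'c list \<times> 'b" where
    "g p = (if fst (snd p) = [] then p else
       (fst p, tl (fst (snd p)), h (fst p) (snd (snd p)) (hd (fst (snd p)))))" for p
  define f where "f x = (x, l x, i x)" for x
  have pow: "(g ^^ k) (x, ys, a) = (x, drop k ys, foldl (h x) a (take k ys))" for k x ys a
  proof (induction k arbitrary: ys a)
    case (Suc k)
    then show ?case by (cases ys) (auto simp: g_def funpow_Suc_right simp del: funpow.simps)
  qed simp
  have g: "ptime g" unfolding g_def
    by (intro ptime_intros
      ptime_comp[OF _ assms(1), of "\<lambda>p. (fst p, snd (snd p), hd (fst (snd p)))", simplified])
  have f: "ptime f" unfolding f_def by (intro ptime_intros assms)
  obtain pl where pl: "\<And>x. tsz (l x) \<le> poly pl (tsz x)" using ptime_tsz[OF assms(3)] by blast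
  \<comment> \<open>\<open>nodes (tr (l x))\<close> is at least the length of the list; surplus
    iterations are idle, as \<open>g\<close> fixes every state with an empty remaining list.\<close>
  have "ptime (\<lambda>x. (g ^^ nodes (tr (l x))) (f x))"
  proof (rule ptime_funpow[OF f g assms(3), where B="\<lambda>n. 2 + n + poly pl n + B n"])
    fix x k
    have "tsz (foldl (h x) (i x) (take k (l x))) \<le> B (tsz x)"
      by (rule bound[of _ _ "drop k (l x)"]) simp
    then show "tsz ((g ^^ k) (f x)) \<le> 2 + tsz x + poly pl (tsz x) + B (tsz x)"
      using pl[of x] tsz_drop[of k "l x"] by (simp add: f_def pow)
  qed (use assms(4) in auto)
  then have "ptime (\<lambda>x. snd (snd ((g ^^ nodes (tr (l x))) (f x))))" by (intro ptime_intros)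
  then show ?thesis by (rule ptime_same) (simp add: f_def pow length_le_nodes)
qed

text \<open>A step may enlarge the accumulator by an amount that depends on parameter and element
  but not on the accumulator itself; then growth adds up instead of multiplying.\<close>

lemma ptime_foldl:
  fixes i :: "'a::enc \<Rightarrow> 'b::enc" and l :: "'a \<Rightarrow> 'c::enc list" and h :: "'a \<Rightarrow> 'b \<Rightarrow> 'c \<Rightarrow> 'b"
  assumes "ptime (\<lambda>p. h (fst p) (fst (snd p)) (snd (snd p)))" "ptime i" "ptime l"
    and inc: "\<And>x a y. tsz (h x a y) \<le> tsz a + poly c (tsz x + tsz y)"
  shows "ptime (\<lambda>x. foldl (h x) (i x) (l x))"
proof -
  obtain pl where pl: "\<And>x. tsz (l x) \<le> poly pl (tsz x)" using ptime_tsz[OF assms(3)] by blast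
  obtain pi where pi: "\<And>x. tsz (i x) \<le> poly pi (tsz x)" using ptime_tsz[OF assms(2)] by blast
  show ?thesis
  proof (rule ptime_foldl_bound[OF assms(1-3)])
    fix x ys zs assume l: "l x = ys @ zs"
    let ?B = "poly c (tsz x + poly pl (tsz x))"
    have "tsz (foldl (h x) (i x) ys) \<le> tsz (i x) + length ys * ?B"
    proof (rule tsz_foldl_le)
      fix a y assume "y \<in> set ys"
      then have "tsz y \<le> poly pl (tsz x)" using pl[of x] tsz_mem[of y "l x"] l by simp
      then have "poly c (tsz x + tsz y) \<le> ?B" by (intro poly_mono_nat) simp
      then show "tsz (h x a y) \<le> tsz a + ?B" using inc[of x a y] by linarith
    qed
    moreover have "length ys \<le> poly pl (tsz x)" using pl[of x] length_le_tsz[of "l x"] l by simp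
    ultimately show "tsz (foldl (h x) (i x) ys) \<le> poly pi (tsz x) + poly pl (tsz x) * ?B"
      using pi[of x] mult_le_mono1[of "length ys" "poly pl (tsz x)" ?B] by linarith
  qed auto
qed

lemma foldl_Cons: "foldl (\<lambda>a y. h y # a) a ys = rev (map h ys) @ a"
  by (induction ys arbitrary: a) auto

lemma foldl_append: "foldl (@) a ys = a @ concat ys"
  by (induction ys arbitrary: a) auto

lemma foldl_conj: "foldl (\<lambda>a y. a \<and> h y) a ys \<longleftrightarrow> a \<and> (\<forall>y\<in>set ys. h y)"
  by (induction ys arbitrary: a) auto

lemma foldl_Suc: "foldl (\<lambda>a y. Suc a) a ys = a + length ys"
  by (induction ys arbitrary: a) auto

lemma foldl_tl: "foldl (\<lambda>a y. tl a) a (replicate n ()) = drop n a"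
  by (induction n arbitrary: a) (auto simp: drop_Suc)

lemma ptime_rev [ptime_intros]:
  assumes "ptime l"
  shows "ptime (\<lambda>x. rev (l x))"
proof -
  have "ptime (\<lambda>x. foldl (\<lambda>a y. y # a) [] (l x))"
    by (rule ptime_foldl[where c="[:1,1:]"]) (intro ptime_intros assms | simp)+
  then show ?thesis by (simp add: foldl_Cons[where h="\<lambda>y. y", simplified] foldl_Cons foldl_append foldl_conj foldl_Suc foldl_tl)
qed

lemma ptime_map [ptime_intros]:
  assumes "ptime (\<lambda>p. h (fst p) (snd p))" "ptime l"
  shows "ptime (\<lambda>x. map (h x) (l x))"
proof -
  obtain p where p: "\<And>z. tsz (h (fst z) (snd z)) \<le> poly p (tsz z)" using ptime_tsz[OF assms(1)] by blast
  have "ptime (\<lambda>x. rev (foldl (\<lambda>a y. h x y # a) [] (l x)))"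
  proof (intro ptime_rev ptime_foldl[where c="1 + pcompose p [:1,1:]"])
    show "ptime (\<lambda>q. h (fst q) (snd (snd q)) # fst (snd q))"
      by (intro ptime_intros ptime_comp[OF _ assms(1), of "\<lambda>p. (fst p, snd (snd p))", simplified])
    show "tsz (h x y # a) \<le> tsz a + poly (1 + p \<circ>\<^sub>p [:1, 1:]) (tsz x + tsz y)" for x y a
      using p[of "(x, y)"] by (simp add: poly_pcompose)
  qed (intro ptime_intros assms(2))+
  then show ?thesis by (simp add: foldl_Cons[where h="\<lambda>y. y", simplified] foldl_Cons foldl_append foldl_conj foldl_Suc foldl_tl)
qed

lemma ptime_append [ptime_intros]:
  assumes "ptime f" "ptime g"
  shows "ptime (\<lambda>x. f x @ g x)"
proof -
  have "ptime (\<lambda>x. foldl (\<lambda>a y. y # a) (g x) (rev (f x)))"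
    by (rule ptime_foldl[where c="[:1,1:]"]) (intro ptime_intros assms | simp)+
  then show ?thesis by (simp add: foldl_Cons[where h="\<lambda>y. y", simplified] foldl_Cons foldl_append foldl_conj foldl_Suc foldl_tl)
qed

lemma ptime_concat [ptime_intros]:
  assumes "ptime f"
  shows "ptime (\<lambda>x. concat (f x))"
proof -
  have "tsz (a @ y) \<le> tsz a + poly [:0,1:] (tsz x + tsz y)" for x a y
    using tsz_append[of a y] by simp
  then have "ptime (\<lambda>x. foldl (@) [] (f x))"
    by (intro ptime_foldl[where c="[:0,1:]"]) (intro ptime_intros assms)+
  then show ?thesis by (simp add: foldl_Cons[where h="\<lambda>y. y", simplified] foldl_Cons foldl_append foldl_conj foldl_Suc foldl_tl)
qed

lemma ptime_Ball [ptime_intros]: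
  assumes "ptime (\<lambda>p. h (fst p) (snd p))" "ptime l"
  shows "ptime (\<lambda>x. \<forall>y\<in>set (l x). h x y)"
proof -
  have "tsz (a \<and> h x y) \<le> tsz a + poly [:3:] (tsz x + tsz y)" for x a y
    using tsz_bool[of "a \<and> h x y"] by simp
  then have "ptime (\<lambda>x. foldl (\<lambda>a y. a \<and> h x y) True (l x))"
    by (intro ptime_foldl[where c="[:3:]"])
      (intro ptime_intros assms(2) ptime_comp[OF _ assms(1), of "\<lambda>p. (fst p, snd (snd p))", simplified])+
  then show ?thesis by (simp add: foldl_Cons[where h="\<lambda>y. y", simplified] foldl_Cons foldl_append foldl_conj foldl_Suc foldl_tl)
qed

lemma ptime_Bex [ptime_intros]:
  assumes "ptime (\<lambda>p. h (fst p) (snd p))" "ptime l"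
  shows "ptime (\<lambda>x. \<exists>y\<in>set (l x). h x y)"
proof -
  have "ptime (\<lambda>x. \<not> (\<forall>y\<in>set (l x). \<not> h x y))" by (intro ptime_intros assms)
  then show ?thesis by simp
qed

lemma ptime_mem [ptime_intros]:
  assumes "ptime f" "ptime l"
  shows "ptime (\<lambda>x. f x \<in> set (l x))"
proof -
  have "ptime (\<lambda>x. \<exists>y\<in>set (l x). f x = y)"
    by (intro ptime_intros assms(2) ptime_comp[OF _ assms(1)])
  then show ?thesis by (rule ptime_same) auto
qed

lemma ptime_filter [ptime_intros]:
  assumes "ptime (\<lambda>p. h (fst p) (snd p))" "ptime l"
  shows "ptime (\<lambda>x. filter (h x) (l x))"
proof -
  have "ptime (\<lambda>x. concat (map (\<lambda>y. if h x y then [y] else []) (l x)))"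
    by (intro ptime_intros assms)
  moreover have "concat (map (\<lambda>y. if h x y then [y] else []) ys) = filter (h x) ys" for x ys
    by (induction ys) auto
  ultimately show ?thesis by simp
qed

lemma ptime_length [ptime_intros]:
  assumes "ptime l"
  shows "ptime (\<lambda>x. length (l x))"
proof -
  have "ptime (\<lambda>x. foldl (\<lambda>a y. Suc a) 0 (l x))"
    by (rule ptime_foldl[where c="[:2:]"]) (intro ptime_intros assms | simp)+
  then show ?thesis by (simp add: foldl_Cons[where h="\<lambda>y. y", simplified] foldl_Cons foldl_append foldl_conj foldl_Suc foldl_tl)
qed

lemma tr_replicate: "tr (replicate n ()) = tr n"
  by (induction n) auto

lemma ptime_units: "ptime f \<Longrightarrow> ptime (\<lambda>x. replicate (f x) ())"
  by (erule ptime_same_code) (simp add: tr_replicate)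

lemma ptime_replicate [ptime_intros]:
  assumes "ptime f" "ptime g"
  shows "ptime (\<lambda>x. replicate (f x) (g x))"
proof -
  have "ptime (\<lambda>x. map (\<lambda>u. g x) (replicate (f x) ()))"
    by (intro ptime_intros ptime_units assms(1) ptime_comp[OF _ assms(2)])
  then show ?thesis by simp
qed

lemma ptime_add [ptime_intros]:
  assumes "ptime f" "ptime g"
  shows "ptime (\<lambda>x. f x + g x :: nat)"
proof -
  have "ptime (\<lambda>x. length (replicate (f x) () @ replicate (g x) ()))"
    by (intro ptime_intros assms)
  then show ?thesis by simp
qed

lemma ptime_mult [ptime_intros]:
  assumes "ptime f" "ptime g"
  shows "ptime (\<lambda>x. f x * g x :: nat)"
proof -
  have "ptime (\<lambda>x. length (concat (replicate (f x) (replicate (g x) ()))))"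
    by (intro ptime_intros assms)
  then show ?thesis by (rule ptime_same) (simp add: length_concat sum_list_replicate)
qed

lemma ptime_drop [ptime_intros]:
  assumes "ptime f" "ptime l"
  shows "ptime (\<lambda>x. drop (f x) (l x))"
proof -
  have "ptime (\<lambda>x. foldl (\<lambda>a y. tl a) (l x) (replicate (f x) ()))"
    by (rule ptime_foldl[where c=0]) (intro ptime_intros assms | simp add: tsz_tl)+
  then show ?thesis by (simp add: foldl_Cons[where h="\<lambda>y. y", simplified] foldl_Cons foldl_append foldl_conj foldl_Suc foldl_tl)
qed

lemma ptime_take [ptime_intros]:
  assumes "ptime f" "ptime l"
  shows "ptime (\<lambda>x. take (f x) (l x))"
proof -
  have "ptime (\<lambda>x. rev (drop (length (drop (f x) (l x))) (rev (l x))))"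
    by (intro ptime_intros assms)
  then show ?thesis
  proof (rule ptime_same)
    fix x show "take (f x) (l x) = rev (drop (length (drop (f x) (l x))) (rev (l x)))"
      by (cases "f x \<le> length (l x)") (simp_all add: rev_drop)
  qed
qed

lemma ptime_minus [ptime_intros]:
  assumes "ptime f" "ptime g"
  shows "ptime (\<lambda>x. f x - g x :: nat)"
proof -
  have "ptime (\<lambda>x. length (drop (g x) (replicate (f x) ())))"
    by (intro ptime_intros assms)
  then show ?thesis by simp
qed

lemma ptime_le [ptime_intros]:
  assumes "ptime f" "ptime g"
  shows "ptime (\<lambda>x. f x \<le> (g x :: nat))"
proof -
  have "ptime (\<lambda>x. f x - g x = 0)" by (intro ptime_intros assms)
  then show ?thesis by simp
qed

lemma ptime_less [ptime_intros]:
  assumes "ptime f" "ptime g"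
  shows "ptime (\<lambda>x. f x < (g x :: nat))"
proof -
  have "ptime (\<lambda>x. Suc (f x) \<le> g x)" by (intro ptime_intros assms)
  then show ?thesis by (simp add: Suc_le_eq)
qed

lemma ptime_poly [ptime_intros]:
  assumes "ptime f"
  shows "ptime (\<lambda>x. poly p (f x) :: nat)"
proof (induction p)
  case (pCons a p)
  have "ptime (\<lambda>x. a + f x * poly p (f x))" by (intro ptime_intros assms pCons)
  then show ?case by simp
qed (simp add: ptime_const)

text \<open>The appended number depends on the accumulator, so \<open>ptime_foldl\<close> does not
  apply; the size of the initial segments is bounded directly.\<close>

lemma ptime_upt [ptime_intros]:
  assumes "ptime f"
  shows "ptime (\<lambda>x. [0..<f x])"
proof -
  have fold: "foldl (\<lambda>a y. a @ [length a]) [] (replicate n ()) = [0..<n]" for n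
    by (induction n) (auto simp: replicate_append_same[symmetric])
  obtain p where p: "\<And>x. tsz (f x) \<le> poly p (tsz x)" using ptime_tsz[OF assms] by blast
  have "ptime (\<lambda>x. foldl (\<lambda>a y. a @ [length a]) [] (replicate (f x) ()))"
  proof (rule ptime_foldl_bound[where B="\<lambda>n. poly p n * Suc (2 * poly p n + 1) + 1"])
    fix x ys zs assume "replicate (f x) () = ys @ zs"
    then have "ys = replicate (length ys) ()" "length ys \<le> f x"
      by (auto simp: append_eq_conv_conj dest!: arg_cong[of _ _ length] intro: replicate_eqI)
    then have "foldl (\<lambda>a y. a @ [length a]) [] ys = [0..<length ys]" using fold by metis
    moreover have "tsz [0..<length ys] \<le> length ys * Suc (2 * poly p (tsz x) + 1) + 1"
      using tsz_list_le[of "[0..<length ys]" "2 * poly p (tsz x) + 1"] p[of x] \<open>length ys \<le> f x\<close> by auto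
    moreover have "length ys * Suc (2 * poly p (tsz x) + 1) \<le> poly p (tsz x) * Suc (2 * poly p (tsz x) + 1)"
      using p[of x] \<open>length ys \<le> f x\<close> by (intro mult_le_mono1) simp
    ultimately show "tsz (foldl (\<lambda>a y. a @ [length a]) [] ys) \<le>
        poly p (tsz x) * Suc (2 * poly p (tsz x) + 1) + 1" by simp
  qed (intro ptime_intros assms | intro polyb_add polyb_mult polyb_Suc polyb_poly polyb_id polyb_const)+
  then show ?thesis by (simp add: fold)
qed

section \<open>Interactive machines\<close>

text \<open>Input words come raw, while functions work on tree codes, where the list cell of a bit
  is 1100 for \<open>True\<close> and 10 for \<open>False\<close>. After the initial reversal the
  list is built from its end.\<close>

definition read_word :: com where
  "read_word = move 0 1 ;; Push 0 False ;;
     Loop 1 (Case 1 Skip (Push 0 False ;; Push 0 False ;; Push 0 True ;; Push 0 True)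
       (Push 0 False ;; Push 0 True) ;; Pop 1)"

lemma run_Push_upd: "run (Push i b) s 1 s'" if "s' = s(i := b # s i)"
  using run_Push[of i b s] that by simp

lemma run_Pop_upd: "run (Pop i) s 1 s'" if "s' = s(i := tl (s i))"
  using run_Pop[of i s] that by simp

lemma run_read_word_loop:
  assumes "s 0 = cd u"
  shows "run (Loop 1 (Case 1 Skip (Push 0 False ;; Push 0 False ;; Push 0 True ;; Push 0 True)
       (Push 0 False ;; Push 0 True) ;; Pop 1)) s (9 * length (s 1) + 1) (s(0 := cd (rev (s 1) @ u), 1 := []))"
  using assms
proof (induction "s 1" arbitrary: s u)
  case Nil
  then have "s(0 := cd (rev (s 1) @ u), 1 := []) = s" by (auto simp: fun_eq_iff)
  then show ?case using run_LoopE[of s 1] Nil(1) by (metis le_add2 run_mono)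
next
  case (Cons b w)
  let ?B = "Case 1 Skip (Push 0 False ;; Push 0 False ;; Push 0 True ;; Push 0 True) (Push 0 False ;; Push 0 True)"
  let ?s = "s(0 := cd (b # u))" let ?s' = "s(0 := cd (b # u), 1 := w)"
  have w: "s 1 = b # w" using Cons(2) by simp
  have T: "run (Push 0 False ;; Push 0 False ;; Push 0 True ;; Push 0 True) s 4 ?s" if b
  proof -
    have 1: "run (Push 0 False) s 1 (s(0 := False # cd u))" by (rule run_Push_upd) (simp add: Cons)
    have 2: "run (Push 0 False) (s(0 := False # cd u)) 1 (s(0 := False # False # cd u))"
      by (rule run_Push_upd) simp
    have 3: "run (Push 0 True) (s(0 := False # False # cd u)) 1 (s(0 := True # False # False # cd u))"
      by (rule run_Push_upd) simp
    have 4: "run (Push 0 True) (s(0 := True # False # False # cd u)) 1 ?s"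
      by (rule run_Push_upd) (use that in simp)
    show ?thesis using run_Seq[OF 1 run_Seq[OF 2 run_Seq[OF 3 4]]] by (simp add: eval_nat_numeral)
  qed
  have F: "run (Push 0 False ;; Push 0 True) s 4 ?s" if "\<not> b"
  proof -
    have 1: "run (Push 0 False) s 1 (s(0 := False # cd u))" by (rule run_Push_upd) (simp add: Cons)
    have 2: "run (Push 0 True) (s(0 := False # cd u)) 1 ?s" by (rule run_Push_upd) (use that in simp)
    show ?thesis using run_Seq[OF 1 2] by (rule run_mono) simp
  qed
  have 1: "run ?B s (4 + 2) ?s" by (rule run_Case) (use w T F in auto)
  have "run (Pop 1) ?s 1 ?s'" by (rule run_Pop_upd) (use w in simp)
  from run_Seq[OF 1 this] have 2: "run (?B ;; Pop 1) s 7 ?s'" by simp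
  have "run (Loop 1 (?B ;; Pop 1)) ?s' (9 * length (?s' 1) + 1) (?s'(0 := cd (rev (?s' 1) @ b # u), 1 := []))"
    by (rule Cons(1)) simp_all
  moreover have "?s'(0 := cd (rev (?s' 1) @ b # u), 1 := []) = s(0 := cd (rev (s 1) @ u), 1 := [])"
    using w by (simp add: fun_eq_iff)
  ultimately have 3: "run (Loop 1 (?B ;; Pop 1)) ?s' (9 * length w + 1) (s(0 := cd (rev (s 1) @ u), 1 := []))"
    by simp
  show ?case using run_LoopS[OF _ 2 3] w by (auto elim!: run_mono)
qed

lemma run_read_word:
  assumes "s 0 = w" "s 1 = []"
  shows "run read_word s (15 * length w + 3) (s(0 := cd w))"
proof -
  let ?s1 = "s(0 := [], 1 := rev w)" let ?s2 = "s(0 := cd ([] :: word), 1 := rev w)"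
  have 1: "run (move 0 1) s (6 * length w + 1) ?s1" using run_move[of 0 1 s] assms by simp
  have 2: "run (Push 0 False) ?s1 1 ?s2" by (rule run_Push_upd) (simp add: fun_eq_iff)
  have "?s2(0 := cd (rev (?s2 1) @ []), 1 := []) = s(0 := cd w)" using assms by (simp add: fun_eq_iff)
  then have 3: "run (Loop 1 (Case 1 Skip (Push 0 False ;; Push 0 False ;; Push 0 True ;; Push 0 True)
       (Push 0 False ;; Push 0 True) ;; Pop 1)) ?s2 (9 * length w + 1) (s(0 := cd w))"
    using run_read_word_loop[of ?s2 "[]"] by simp
  show ?thesis unfolding read_word_def using run_Seq[OF 1 run_Seq[OF 2 3]] by (auto elim!: run_mono)
qed

text \<open>The loop produces the bits in reverse order. Three moves reverse them an odd number of
  times and leave the word on stack 1, the query and output tape.\<close>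

definition write_word :: com where
  "write_word = Loop 0 (Case 0 Skip (Pop 0 ;; Case 0 Skip (Pop 0 ;; Pop 0 ;; Pop 0 ;; Push 1 True)
      (Pop 0 ;; Push 1 False)) (Pop 0)) ;; move 1 2 ;; move 2 0 ;; move 0 1"

lemma run_write_word_loop:
  assumes "s 0 = cd w"
  shows "run (Loop 0 (Case 0 Skip (Pop 0 ;; Case 0 Skip (Pop 0 ;; Pop 0 ;; Pop 0 ;; Push 1 True)
      (Pop 0 ;; Push 1 False)) (Pop 0))) s (11 * length w + 6) (s(0 := [], 1 := rev w @ s 1))"
  using assms
proof (induction w arbitrary: s)
  case Nil
  have 1: "run (Pop 0) s 1 (s(0 := []))" by (rule run_Pop_upd) (use Nil in simp)
  have 2: "run (Case 0 Skip (Pop 0 ;; Case 0 Skip (Pop 0 ;; Pop 0 ;; Pop 0 ;; Push 1 True)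
      (Pop 0 ;; Push 1 False)) (Pop 0)) s (1 + 2) (s(0 := []))"
    by (rule run_Case) (use Nil 1 in auto)
  have "s(0 := [], 1 := rev [] @ s 1) = s(0 := [])" by (simp add: fun_eq_iff)
  moreover have "s 0 \<noteq> []" using Nil by simp
  ultimately show ?case using run_LoopS[OF _ 2 run_LoopE[of "s(0 := [])" 0]]
    by (simp add: fun_upd_def eval_nat_numeral)
next
  case (Cons b w)
  let ?s = "s(0 := tl (s 0))" let ?s' = "s(0 := cd w, 1 := b # s 1)"
  have T: "run (Pop 0 ;; Pop 0 ;; Pop 0 ;; Push 1 True) ?s 4 ?s'" if b
  proof -
    have s: "?s = s(0 := True # False # False # cd w)" using Cons(2) that by simp
    have 1: "run (Pop 0) ?s 1 (s(0 := False # False # cd w))" unfolding s by (rule run_Pop_upd) simp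
    have 2: "run (Pop 0) (s(0 := False # False # cd w)) 1 (s(0 := False # cd w))" by (rule run_Pop_upd) simp
    have 3: "run (Pop 0) (s(0 := False # cd w)) 1 (s(0 := cd w))" by (rule run_Pop_upd) simp
    have 4: "run (Push 1 True) (s(0 := cd w)) 1 ?s'" by (rule run_Push_upd) (use that in simp)
    show ?thesis using run_Seq[OF 1 run_Seq[OF 2 run_Seq[OF 3 4]]] by (simp add: eval_nat_numeral)
  qed
  have F: "run (Pop 0 ;; Push 1 False) ?s 4 ?s'" if "\<not> b"
  proof -
    have s: "?s = s(0 := False # cd w)" using Cons(2) that by simp
    have 1: "run (Pop 0) ?s 1 (s(0 := cd w))" unfolding s by (rule run_Pop_upd) simp
    have 2: "run (Push 1 False) (s(0 := cd w)) 1 ?s'" by (rule run_Push_upd) (use that in simp)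
    show ?thesis using run_Seq[OF 1 2] by (rule run_mono) simp
  qed
  have 0: "run (Pop 0) s 1 ?s" by (rule run_Pop_upd) simp
  have 1: "run (Case 0 Skip (Pop 0 ;; Pop 0 ;; Pop 0 ;; Push 1 True) (Pop 0 ;; Push 1 False)) ?s (4 + 2) ?s'"
    by (rule run_Case) (use Cons(2) T F in \<open>cases b; auto\<close>)+
  have 2: "run (Case 0 Skip (Pop 0 ;; Case 0 Skip (Pop 0 ;; Pop 0 ;; Pop 0 ;; Push 1 True)
      (Pop 0 ;; Push 1 False)) (Pop 0)) s (1 + (4 + 2) + 2) ?s'"
    by (rule run_Case) (use Cons(2) run_Seq[OF 0 1] in auto)
  have "run (Loop 0 (Case 0 Skip (Pop 0 ;; Case 0 Skip (Pop 0 ;; Pop 0 ;; Pop 0 ;; Push 1 True)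
      (Pop 0 ;; Push 1 False)) (Pop 0))) ?s' (11 * length w + 6) (?s'(0 := [], 1 := rev w @ ?s' 1))"
    by (rule Cons(1)) simp
  moreover have "?s'(0 := [], 1 := rev w @ ?s' 1) = s(0 := [], 1 := rev (b # w) @ s 1)"
    by (simp add: fun_eq_iff)
  ultimately have 3: "run (Loop 0 (Case 0 Skip (Pop 0 ;; Case 0 Skip (Pop 0 ;; Pop 0 ;; Pop 0 ;; Push 1 True)
      (Pop 0 ;; Push 1 False)) (Pop 0))) ?s' (11 * length w + 6) (s(0 := [], 1 := rev (b # w) @ s 1))" by simp
  have "s 0 \<noteq> []" using Cons(2) by simp
  from run_LoopS[OF this 2 3] show ?case by (simp add: fun_upd_def)
qed

lemma run_write_word:
  assumes "s 0 = cd w" "s 1 = []" "s 2 = []"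
  shows "run write_word s (29 * length w + 9) (s(0 := [], 1 := w))"
proof -
  have 1: "run (Loop 0 (Case 0 Skip (Pop 0 ;; Case 0 Skip (Pop 0 ;; Pop 0 ;; Pop 0 ;; Push 1 True)
      (Pop 0 ;; Push 1 False)) (Pop 0))) s (11 * length w + 6) (s(0 := [], 1 := rev w))"
    using run_write_word_loop[of s w] assms by simp
  have "s(0 := [], 1 := [], 2 := w) = s(0 := [], 2 := w)" using assms by (simp add: fun_eq_iff)
  then have 2: "run (move 1 2) (s(0 := [], 1 := rev w)) (6 * length w + 1) (s(0 := [], 2 := w))"
    using run_move[of 1 2 "s(0 := [], 1 := rev w)"] assms by simp
  have "s(0 := [], 2 := [], 0 := rev w) = s(0 := rev w)" using assms by (simp add: fun_eq_iff)
  then have 3: "run (move 2 0) (s(0 := [], 2 := w)) (6 * length w + 1) (s(0 := rev w))"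
    using run_move[of 2 0 "s(0 := [], 2 := w)"] by simp
  have 4: "run (move 0 1) (s(0 := rev w)) (6 * length w + 1) (s(0 := [], 1 := w))"
    using run_move[of 0 1 "s(0 := rev w)"] assms by simp
  show ?thesis unfolding write_word_def
    using run_Seq[OF 1 run_Seq[OF 2 run_Seq[OF 3 4]]] by (auto elim!: run_mono)
qed

abbreviation only :: "word \<Rightarrow> store" where "only w \<equiv> (\<lambda>i. []) (0 := w)"

lemma length_le_tsz_word: "length w \<le> tsz (w :: word)"
  using length_le_tsz[of w] by simp

lemma tsz_word: "tsz (w :: word) \<le> 4 * length w + 1"
  using tsz_list_le[of w 3] tsz_bool by auto

section \<open>The three programs of an interactive machine\<close>

lemma init_program:
  fixes init :: "word \<Rightarrow> 'a::enc"
  assumes "ptime init"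
  obtains c p where "\<And>w. run c (only w) (poly p (length w)) (only (cd (init w)))"
proof -
  obtain c m p where c: "computes c m p init" using assms unfolding ptime_def by blast
  have "run (read_word ;; c) (only w) (poly ([:3, 15:] + pcompose p [:1,4:]) (length w)) (only (cd (init w)))" for w
  proof -
    have 1: "run read_word (only w) (15 * length w + 3) (only (cd w))" using run_read_word[of "only w" w] by simp
    have 2: "run c (only (cd w)) (poly p (tsz w)) (only (cd (init w)))"
      using computesD[OF c, of "only (cd w)" w] by simp
    have "poly p (tsz w) \<le> poly p (4 * length w + 1)" by (rule poly_mono_nat) (rule tsz_word)
    then show ?thesis using run_Seq[OF 1 2] by (auto elim!: run_mono simp: poly_pcompose algebra_simps)
  qed
  then show ?thesis using that by blast
qed

lemma out_program:
  fixes out :: "'a::enc \<Rightarrow> word"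
  assumes "ptime out"
  obtains c p where "\<And>x. run c (only (cd x)) (poly p (tsz x)) ((only (cd x))(1 := out x))"
proof -
  obtain c m p where c: "computes c m p out" using assms unfolding ptime_def by blast
  define k where "k = m + 3"
  let ?c = "save k (k + 1) ;; c ;; write_word ;; restore k (k + 1)"
  let ?p = "[:13, 25:] + p + smult 29 ([:0, 1:] + p)"
  have "run ?c (only (cd x)) (poly ?p (tsz x)) ((only (cd x))(1 := out x))" for x
  proof -
    let ?s1 = "(only (cd x))(k := cd x)" let ?s2 = "(only (cd (out x)))(k := cd x)"
    let ?s3 = "(only [])(k := cd x, 1 := out x)"
    have 1: "run (save k (k + 1)) (only (cd x)) (13 * tsz x + 2) ?s1"
      using run_save[of "only (cd x)" k "k + 1"] by (simp add: k_def)
    have 2: "run c ?s1 (poly p (tsz x)) ?s2"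
    proof -
      have "?s1(0 := cd (out x)) = ?s2" by (simp add: fun_eq_iff k_def)
      then show ?thesis using computesD[OF c, of ?s1 x] by (simp add: k_def)
    qed
    have 3: "run write_word ?s2 (29 * length (out x) + 9) ?s3"
    proof -
      have "?s2(0 := [], 1 := out x) = ?s3" by (simp add: fun_eq_iff k_def)
      then show ?thesis using run_write_word[of ?s2 "out x"] by (simp add: k_def)
    qed
    have 4: "run (restore k (k + 1)) ?s3 (12 * tsz x + 2) ((only (cd x))(1 := out x))"
    proof -
      have "?s3(k := [], 0 := cd x) = (only (cd x))(1 := out x)" by (auto simp: fun_eq_iff k_def)
      then show ?thesis using run_restore[of ?s3 "k + 1" k] by (simp add: k_def)
    qed
    have "length (out x) \<le> tsz x + poly p (tsz x)"
      using length_le_tsz_word[of "out x"] computes_tsz[OF c, of x] by simp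
    then show ?thesis using run_Seq[OF 1 run_Seq[OF 2 run_Seq[OF 3 4]]]
      by (auto elim!: run_mono simp: algebra_simps)
  qed
  then show ?thesis using that by blast
qed

text \<open>The answer bit arrives on stack 2 while the old query still lies on stack 1 and has to
  be removed.\<close>

lemma upd_program:
  fixes upd :: "'a::enc \<times> bool \<Rightarrow> 'a"
  assumes "ptime upd"
  obtains c p where "\<And>x q b. run c ((only (cd x))(1 := q, 2 := [b])) (poly p (tsz x + length q)) (only (cd (upd (x, b))))"
proof -
  obtain c m p where c: "computes c m p upd" using assms unfolding ptime_def by blast
  let ?B = "Case 2 Skip (Push 0 False ;; Push 0 False ;; Push 0 True) (Push 0 False)"
  let ?c = "clear 1 ;; move 0 1 ;; ?B ;; move 1 0 ;; Push 0 True ;; Pop 2 ;; c"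
  let ?p = "[:10, 20:] + pcompose p [:4, 1:]"
  have "run ?c ((only (cd x))(1 := q, 2 := [b])) (poly ?p (tsz x + length q)) (only (cd (upd (x, b))))" for x q b
  proof -
    let ?s0 = "(only (cd x))(1 := q, 2 := [b])"
    let ?s1 = "(only (cd x))(2 := [b])" let ?s2 = "(only [])(1 := rev (cd x), 2 := [b])"
    let ?s3 = "(only (cd b))(1 := rev (cd x), 2 := [b])"
    let ?s4 = "(only (cd x @ cd b))(2 := [b])" let ?s5 = "(only (cd (x, b)))(2 := [b])"
    have 1: "run (clear 1) ?s0 (3 * length q + 1) ?s1"
    proof -
      have "?s0(1 := []) = ?s1" by (simp add: fun_eq_iff)
      then show ?thesis using run_clear[of 1 ?s0] by simp
    qed
    have 2: "run (move 0 1) ?s1 (6 * tsz x + 1) ?s2"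
    proof -
      have "?s1(0 := [], 1 := rev (cd x)) = ?s2" by (simp add: fun_eq_iff)
      then show ?thesis using run_move[of 0 1 ?s1] by simp
    qed
    have T: "run (Push 0 False ;; Push 0 False ;; Push 0 True) ?s2 3 ?s3" if b
    proof -
      have 1: "run (Push 0 False) ?s2 1 (?s2(0 := [False]))" by (rule run_Push_upd) (simp add: fun_eq_iff)
      have 2: "run (Push 0 False) (?s2(0 := [False])) 1 (?s2(0 := [False, False]))"
        by (rule run_Push_upd) (simp add: fun_eq_iff)
      have 3: "run (Push 0 True) (?s2(0 := [False, False])) 1 ?s3"
        by (rule run_Push_upd) (use that in \<open>simp add: fun_eq_iff\<close>)
      show ?thesis using run_Seq[OF 1 run_Seq[OF 2 3]] by (simp add: eval_nat_numeral)
    qed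
    have F: "run (Push 0 False) ?s2 3 ?s3" if "\<not> b"
    proof -
      have "run (Push 0 False) ?s2 1 ?s3" by (rule run_Push_upd) (use that in \<open>simp add: fun_eq_iff\<close>)
      then show ?thesis by (rule run_mono) simp
    qed
    have 3: "run ?B ?s2 (3 + 2) ?s3" by (rule run_Case) (use T F in auto)
    have 4: "run (move 1 0) ?s3 (6 * tsz x + 1) ?s4"
    proof -
      have "?s3(1 := [], 0 := cd x @ cd b) = ?s4" by (simp add: fun_eq_iff)
      then show ?thesis using run_move[of 1 0 ?s3] by simp
    qed
    have 5: "run (Push 0 True) ?s4 1 ?s5" by (rule run_Push_upd) (simp add: fun_eq_iff)
    have 6: "run (Pop 2) ?s5 1 (only (cd (x, b)))" by (rule run_Pop_upd) (simp add: fun_eq_iff)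
    have 7: "run c (only (cd (x, b))) (poly p (tsz (x, b))) (only (cd (upd (x, b))))"
    proof -
      have "(only (cd (x, b)))(0 := cd (upd (x, b))) = only (cd (upd (x, b)))" by (simp add: fun_eq_iff)
      then show ?thesis using computesD[OF c, of "only (cd (x, b))" "(x, b)"] by simp
    qed
    have "poly p (tsz (x, b)) \<le> poly p (4 + (tsz x + length q))"
      by (rule poly_mono_nat) (use tsz_bool[of b] in simp)
    then show ?thesis
      using run_Seq[OF 1 run_Seq[OF 2 run_Seq[OF 3 run_Seq[OF 4 run_Seq[OF 5 run_Seq[OF 6 7]]]]]]
      by (auto elim!: run_mono simp: poly_pcompose algebra_simps)
  qed
  then show ?thesis using that by blast
qed

text \<open>An interactive machine repeatedly computes an action word from its current state: \<open>[]\<close> means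
  rejection, \<open>True # v\<close> acceptance with output \<open>v\<close>, \<open>False # True # q\<close> the oracle query \<open>q\<close>, and
  \<open>[False]\<close> a nondeterministic guess. The state is updated with the answer or the guess.\<close>

fun arun :: "('a \<Rightarrow> word) \<Rightarrow> ('a \<times> bool \<Rightarrow> 'a) \<Rightarrow> lang \<Rightarrow> nat \<Rightarrow> 'a \<Rightarrow> bool" where
  "arun out upd X 0 x \<longleftrightarrow> (\<exists>v. out x = True # v)"
| "arun out upd X (Suc n) x \<longleftrightarrow> (\<exists>v. out x = True # v) \<or>
     (\<exists>q. out x = False # True # q \<and> arun out upd X n (upd (x, q \<in> X))) \<or>
     (out x = [False] \<and> (\<exists>b. arun out upd X n (upd (x, b))))"

fun ainv :: "('a::enc \<Rightarrow> word) \<Rightarrow> ('a \<times> bool \<Rightarrow> 'a) \<Rightarrow> lang \<Rightarrow> bool \<Rightarrow> nat \<Rightarrow> nat \<Rightarrow> 'a \<Rightarrow> bool" where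
  "ainv out upd X nd S 0 x \<longleftrightarrow> tsz x \<le> S \<and> (out x = [] \<or> (\<exists>v. out x = True # v))"
| "ainv out upd X nd S (Suc n) x \<longleftrightarrow> tsz x \<le> S \<and> (out x = [] \<or> (\<exists>v. out x = True # v) \<or>
     (\<exists>q. out x = False # True # q \<and> ainv out upd X nd S n (upd (x, q \<in> X))) \<or>
     (nd \<and> out x = [False] \<and> (\<forall>b. ainv out upd X nd S n (upd (x, b)))))"

section \<open>The machine around the three programs\<close>

locale interactive =
  fixes init :: "word \<Rightarrow> 'a::enc" and out :: "'a \<Rightarrow> word" and upd :: "'a \<times> bool \<Rightarrow> 'a" and nd :: bool
    and cA cB cC :: com and pA pB pC :: "nat poly" and K :: nat
  assumes A: "run cA (only w) (poly pA (length w)) (only (cd (init w)))"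
    and B: "run cB (only (cd x)) (poly pB (tsz x)) ((only (cd x))(1 := out x))"
    and C: "run cC ((only (cd x))(1 := q, 2 := [b])) (poly pC (tsz x + length q)) (only (cd (upd (x, b))))"
    and K: "\<And>i. i \<in> stacks cA \<union> stacks cB \<union> stacks cC \<Longrightarrow> i < K" "3 \<le> K"
begin

definition "posB = len cA"
definition "posD = posB + len cB"
definition "posC = posD + 2"
text \<open>At the two \<open>IStop\<close> positions special transitions decode the first and the
  second bit of the action word.\<close>

definition "prog = comp cA 0 @ comp cB posB @ [IStop, IStop] @ comp cC posC @ [goto posB]"

text \<open>Moving right drops the leading bit, so that the output starts at the head. The odd state
  of an \<open>IStop\<close> position has no transition and serves as rejection.\<close>

definition dispatch :: "symbol \<Rightarrow> symbol \<times> move \<times> state" where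
  "dispatch x = (if x = Bit True then (Blank, MoveRight, Accept)
     else if x = Bit False then (Blank, MoveRight, State (2 * (posD + 1))) else (Blank, Stay, State (2 * posD + 1)))"

definition choose_answer :: "state \<Rightarrow> symbol \<Rightarrow> symbol \<times> move \<times> state" where
  "choose_answer q x = (if x = Bit True then (Blank, MoveRight, Query) else (x, Stay, q))"

text \<open>A guess is treated as an oracle answer without a query: the machine enters
  \<open>Yes\<close> or \<open>No\<close> at will. Both answer states write the bit to the empty
  stack 2.\<close>

definition specials :: "entry list" where
  "specials = [(Start, 0, \<lambda>x. (x, Stay, State 0)),
    (State (2 * posD), 1, dispatch),
    (State (2 * (posD + 1)), 1, choose_answer Yes),
    (Yes, 2, \<lambda>x. (Bit True, Stay, State (2 * posC))),
    (No, 2, \<lambda>x. (Bit False, Stay, State (2 * posC)))] @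
    (if nd then [(State (2 * (posD + 1)), 1, choose_answer No)]
     else [])"

definition entries :: "entry list" where
  "entries = concat (map (\<lambda>pc. lower pc (prog ! pc)) [0..<length prog]) @ specials"

definition M :: tm where "M = machine K entries"

lemma prog_stop: "prog ! posD = IStop" "prog ! (posD + 1) = IStop"
  by (simp_all add: prog_def posD_def posB_def nth_append)

lemma set_entries: "x \<in> set entries \<longleftrightarrow> (\<exists>pc<length prog. x \<in> set (lower pc (prog ! pc))) \<or> x \<in> set specials"
  by (auto simp: entries_def)

lemma lower_state: "(q, i, f) \<in> set (lower pc ins) \<Longrightarrow> q = State (2 * pc) \<or> q = State (2 * pc + 1)"
  by (cases ins) auto

lemma lower_unique: "x \<in> set (lower pc ins) \<Longrightarrow> y \<in> set (lower pc ins) \<Longrightarrow> fst x = fst y \<Longrightarrow> x = y"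
  by (cases ins) auto

lemma lower_pc:
  assumes "x \<in> set (lower pc ins)" "fst x = State k"
  shows "pc = k div 2"
proof -
  have "k = 2 * pc \<or> k = 2 * pc + 1"
    using lower_state[of "State k" "fst (snd x)" "snd (snd x)" pc ins] assms by (cases x) auto
  then show ?thesis by auto
qed

lemma lower_ex_state: "x \<in> set (lower pc ins) \<Longrightarrow> \<exists>k. fst x = State k"
  by (cases ins) auto

lemma special_state: "x \<in> set specials \<Longrightarrow> fst x \<in> {Start, Yes, No, State (2 * posD), State (2 * (posD + 1))}"
  by (auto simp: specials_def split: if_splits)

lemma not_both:
  assumes "x \<in> set specials" "pc < length prog" "y \<in> set (lower pc (prog ! pc))"
  shows "fst x \<noteq> fst y"
proof
  assume eq: "fst x = fst y"
  obtain k where k: "fst y = State k" using lower_ex_state[OF assms(3)] by blast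
  have "k = 2 * posD \<or> k = 2 * (posD + 1)" using special_state[OF assms(1)] eq k by auto
  moreover have "pc = k div 2" using lower_pc[OF assms(3) k] .
  ultimately have "prog ! pc = IStop" using prog_stop by auto
  then show False using assms(3) by simp
qed

text \<open>Two entries share a state only where the machine guesses, at position
  \<open>posD + 1\<close>.\<close>

lemma unique_entries:
  assumes "q \<noteq> State (2 * (posD + 1)) \<or> \<not> nd"
  shows "unique_entry entries q"
  unfolding unique_entry_def
proof (intro ballI impI)
  fix x y assume x: "x \<in> set entries" and y: "y \<in> set entries" and q: "fst x = q" "fst y = q"
  consider "x \<in> set specials" "y \<in> set specials"
    | pc pc' where "pc < length prog" "x \<in> set (lower pc (prog ! pc))" "pc' < length prog" "y \<in> set (lower pc' (prog ! pc'))"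
    using x y q not_both unfolding set_entries by metis
  then show "x = y"
  proof cases
    case 1
    then show ?thesis using q assms by (auto simp: specials_def split: if_splits)
  next
    case 2
    obtain k where k: "q = State k" using lower_ex_state[OF 2(2)] q by auto
    have "pc = pc'" using lower_pc[OF 2(2)] lower_pc[OF 2(4)] q k by auto
    then show ?thesis using lower_unique[OF 2(2)] 2(4) q by auto
  qed
qed

lemma is_tm_M: "is_tm M"
proof -
  have "q \<noteq> Accept \<and> q \<noteq> Query" if "(q, i, f) \<in> set entries" for q i f
    using that lower_ex_state[of "(q, i, f)"] special_state[of "(q, i, f)"] unfolding set_entries by auto
  then show ?thesis unfolding M_def using K(2) by (intro is_tm_machine) auto
qed

lemma deterministic_M: "\<not> nd \<Longrightarrow> deterministic M"
  unfolding M_def by (rule deterministic_machine, rule unique_entries, simp)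

lemma segment:
  assumes "located prog a (comp c a)" "run c s T s'"
  obtains n where "n \<le> 2 * T" "(dstep M X ^^ n) (State (2 * a), stapes K s) (State (2 * (a + len c)), stapes K s')"
proof -
  obtain n where n: "n \<le> T" "exec c s n s'" using assms(2) unfolding run_def by blast
  from exec_istep[OF n(2) assms(1)] have "(istep prog ^^ n) (a, s) (a + len c, s')" .
  then have "\<exists>m\<le>2 * n. (dstep M X ^^ m) (State (2 * a), stapes K s) (State (2 * (a + len c)), stapes K s')"
    unfolding M_def
  proof (rule dstep_isteps)
    fix pc assume pc: "pc < length prog" "prog ! pc \<noteq> IStop"
    have "prog ! pc \<in> set prog" using pc by simp
    moreover have "set prog = set (comp cA 0) \<union> set (comp cB posB) \<union> {IStop, goto posB} \<union> set (comp cC posC)"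
      by (auto simp: prog_def)
    ultimately have "istack (prog ! pc) \<in> insert 0 (stacks cA \<union> stacks cB \<union> stacks cC)"
      using istack_comp[of "prog ! pc"] by auto
    then have "istack (prog ! pc) < K" using K by auto
    moreover have "set (lower pc (prog ! pc)) \<subseteq> set entries" using pc by (auto simp: set_entries)
    moreover have "pc \<noteq> posD + 1" using pc(2) prog_stop by metis
    then have "State (2 * pc) \<noteq> State (2 * (posD + 1))" "State (2 * pc + 1) \<noteq> State (2 * (posD + 1))"
      by simp_all
    ultimately show "set (lower pc (prog ! pc)) \<subseteq> set entries \<and> istack (prog ! pc) < K \<and>
        unique_entry entries (State (2 * pc)) \<and> unique_entry entries (State (2 * pc + 1))"
      using unique_entries by blast
  qed
  then show ?thesis using that n(1) by (meson mult_le_mono2 order_trans)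
qed

lemma locA: "located prog 0 (comp cA 0)"
  using located_mid[of "[]" "comp cA 0"] by (simp add: prog_def)

lemma locB: "located prog posB (comp cB posB)"
  using located_mid[of "comp cA 0" "comp cB posB"] by (simp add: prog_def posB_def)

lemma locC: "located prog posC (comp cC posC @ [goto posB])"
  using located_mid[of "comp cA 0 @ comp cB posB @ [IStop, IStop]" "comp cC posC @ [goto posB]" "[]"]
  by (simp add: prog_def posB_def posC_def posD_def)

lemma special_dstep:
  assumes "(q, i, f) \<in> set specials" "unique_entry entries q" "i < 3" "f (word_tape (s i) 0) = (b, m, q')"
    and "act (word_tape (s i) 0, b, m) (word_tape (s i)) = word_tape w"
  shows "dstep M X (q, stapes K s) (q', stapes K (s(i := w)))"
proof -
  have i: "i < K" using assms(3) K(2) by simp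
  have "q \<noteq> Query" "q \<noteq> Accept" using special_state[OF assms(1)] by auto
  then have "dstep M X (q, stapes K s) (q', (stapes K s)[i := act ((stapes K s ! i) 0, b, m) (stapes K s ! i)])"
    unfolding M_def
    by (intro dstep_machine[where f=f]) (use assms i set_entries stapes_alphabet in auto)
  then show ?thesis using i assms(5) by (simp add: stapes_update del: act.simps)
qed

lemma no_step:
  assumes "\<And>i f. (q, i, f) \<notin> set entries" "q \<noteq> Query"
  shows "\<not> step M X (q, stapes K s) c'"
  unfolding M_def using assms step_machine[of "stapes K s" K q entries X c'] stapes_alphabet by simp

lemma halted:
  assumes "\<And>c'. \<not> step M X c c'"
  shows "bounded_from M X c 0 0" "fst c \<noteq> Accept \<Longrightarrow> \<not> accepts_from M X c"
  using assms computation_iff[of M X c] unfolding bounded_from_def accepts_from_def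
  by auto

lemma no_Accept: "(Accept, i, f) \<notin> set entries" and no_Query: "(Query, i, f) \<notin> set entries"
  using lower_ex_state[of "(Accept, i, f)"] special_state[of "(Accept, i, f)"]
    lower_ex_state[of "(Query, i, f)"] special_state[of "(Query, i, f)"]
  by (auto simp: set_entries)

lemma no_dead: "(State (2 * posD + 1), i, f) \<notin> set entries"
proof
  assume "(State (2 * posD + 1), i, f) \<in> set entries"
  moreover have "(State (2 * posD + 1), i, f) \<notin> set specials" 
    using special_state[of "(State (2 * posD + 1), i, f)"] by auto
  ultimately obtain pc where pc: "pc < length prog" "(State (2 * posD + 1), i, f) \<in> set (lower pc (prog ! pc))"
    by (auto simp: set_entries)
  have "pc = posD" using lower_pc[OF pc(2)] by simp
  then show False using pc prog_stop by simp
qed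

abbreviation at_B :: "'a \<Rightarrow> config" where "at_B x \<equiv> (State (2 * posB), stapes K (only (cd x)))"

abbreviation answered :: "bool \<Rightarrow> 'a \<Rightarrow> word \<Rightarrow> config" where
  "answered b x q \<equiv> (if b then Yes else No, stapes K ((only (cd x))(1 := q)))"

lemma start_run:
  obtains n where "n \<le> 2 * poly pA (length w) + 1" "(dstep M X ^^ n) (initial M w) (at_B (init w))"
proof -
  have i: "initial M w = (Start, stapes K (only w))"
  proof -
    have "word_tape w # replicate (K - 1) (word_tape []) = stapes K (only w)"
      by (rule nth_equalityI) (use K(2) in \<open>auto simp: nth_Cons'\<close>)
    then show ?thesis by (simp add: initial_def M_def machine_def)
  qed
  obtain n where n: "n \<le> 2 * poly pA (length w)"
    "(dstep M X ^^ n) (State (2 * 0), stapes K (only w)) (State (2 * (0 + len cA)), stapes K (only (cd (init w))))"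
    using segment[OF locA A[of w]] by blast
  have "dstep M X (Start, stapes K (only w)) (State 0, stapes K ((only w)(0 := w)))"
    by (rule special_dstep[where f="\<lambda>x. (x, Stay, State 0)" and b="word_tape w 0"])
      (auto simp: specials_def unique_entries)
  then have "(dstep M X ^^ Suc n) (initial M w) (at_B (init w))"
    using n(2) unfolding i by (intro relpowp_Suc_I2) (auto simp: posB_def)
  then show ?thesis using that n(1) by (metis Suc_eq_plus1 add_le_mono1)
qed

lemma out_run:
  obtains n where "n \<le> 2 * poly pB (tsz x)"
    "(dstep M X ^^ n) (at_B x) (State (2 * posD), stapes K ((only (cd x))(1 := out x)))"
  using segment[OF locB B[of x]] by (auto simp: posD_def)

lemma upd_run:
  obtains n where "n \<le> 2 * poly pC (tsz x + length q) + 3" "(dstep M X ^^ n) (answered b x q) (at_B (upd (x, b)))"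
proof -
  obtain n where n: "n \<le> 2 * poly pC (tsz x + length q)"
    "(dstep M X ^^ n) (State (2 * posC), stapes K ((only (cd x))(1 := q, 2 := [b])))
      (State (2 * (posC + len cC)), stapes K (only (cd (upd (x, b)))))"
    using segment[OF conjunct1[OF located_append[OF locC]] C[of x q b]] by blast
  have a: "act (word_tape [] 0, Bit b, Stay) (word_tape []) = word_tape [b]" for b
    by (auto simp: word_tape_def fun_eq_iff)
  have 1: "dstep M X (answered b x q) (State (2 * posC), stapes K ((only (cd x))(1 := q, 2 := [b])))"
  proof (cases b)
    case True
    then show ?thesis using special_dstep[of Yes 2 "\<lambda>x. (Bit True, Stay, State (2 * posC))" "(only (cd x))(1 := q)"
        "Bit True" Stay "State (2 * posC)" "[True]"] a by (simp add: specials_def unique_entries)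
  next
    case False
    then show ?thesis using special_dstep[of No 2 "\<lambda>x. (Bit False, Stay, State (2 * posC))" "(only (cd x))(1 := q)"
        "Bit False" Stay "State (2 * posC)" "[False]"] a by (simp add: specials_def unique_entries)
  qed
  have g: "located prog (posC + len cC) [goto posB]" using located_append[OF locC] by simp
  have 3: "run (Skip) s 0 s" for s by (rule run_Skip)
  have "istep prog (posC + len cC, only (cd (upd (x, b)))) (posB, only (cd (upd (x, b))))"
    using istep_located[OF g, of "only (cd (upd (x, b)))"] by simp
  then have "(istep prog ^^ 1) (posC + len cC, only (cd (upd (x, b)))) (posB, only (cd (upd (x, b))))"
    unfolding relpowp_1 .
  have gp: "prog ! (posC + len cC) = goto posB" "posC + len cC < length prog" using located_Cons[OF g] by auto
  have "\<exists>n\<le>2. (dstep M X ^^ n) (State (2 * (posC + len cC)), stapes K (only (cd (upd (x, b)))))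
     (State (2 * posB), stapes K (only (cd (upd (x, b)))))"
    unfolding M_def
  proof (rule dstep_istep)
    show "istep prog (posC + len cC, only (cd (upd (x, b)))) (posB, only (cd (upd (x, b))))"
      using istep_located[OF g, of "only (cd (upd (x, b)))"] by simp
    show "set (lower (posC + len cC) (prog ! (posC + len cC))) \<subseteq> set entries"
      using gp(2) by (auto simp: set_entries)
    show "istack (prog ! (posC + len cC)) < K" using gp K by simp
  qed (rule unique_entries, use posC_def in \<open>auto, presburger?\<close>)+
  then obtain k where k: "k \<le> 2" "(dstep M X ^^ k) (State (2 * (posC + len cC)), stapes K (only (cd (upd (x, b)))))
     (at_B (upd (x, b)))" by blast
  have 4: "(dstep M X ^^ (Suc n + k)) (answered b x q) (at_B (upd (x, b)))"
    by (rule relpowp_trans[of _ "dstep M X", OF relpowp_Suc_I2[of "dstep M X", OF 1 n(2)] k(2)])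
  show ?thesis by (rule that[OF _ 4]) (use n(1) k(1) in simp)
qed

lemma dispatch_reject:
  assumes "out x = []"
  shows "dstep M X (State (2 * posD), stapes K ((only (cd x))(1 := out x)))
    (State (2 * posD + 1), stapes K ((only (cd x))(1 := out x)))"
proof -
  have "dstep M X (State (2 * posD), stapes K ((only (cd x))(1 := out x)))
    (State (2 * posD + 1), stapes K ((only (cd x))(1 := out x, 1 := [])))"
    by (rule special_dstep[where b=Blank and m=Stay and f=dispatch]) (auto simp: specials_def dispatch_def unique_entries assms word_tape_def)
  then show ?thesis by (simp add: assms)
qed

lemma dispatch_accept:
  assumes "out x = True # v"
  shows "dstep M X (State (2 * posD), stapes K ((only (cd x))(1 := out x)))
    (Accept, stapes K ((only (cd x))(1 := v)))"
proof -
  have "dstep M X (State (2 * posD), stapes K ((only (cd x))(1 := out x)))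
    (Accept, stapes K ((only (cd x))(1 := out x, 1 := v)))"
    by (rule special_dstep[where b=Blank and m=MoveRight and f=dispatch])
      (auto simp: specials_def dispatch_def unique_entries assms word_tape_0 act_pop simp del: act.simps)
  then show ?thesis by simp
qed

lemma dispatch_ask:
  assumes "out x = False # v"
  shows "dstep M X (State (2 * posD), stapes K ((only (cd x))(1 := out x)))
    (State (2 * (posD + 1)), stapes K ((only (cd x))(1 := v)))"
proof -
  have "dstep M X (State (2 * posD), stapes K ((only (cd x))(1 := out x)))
    (State (2 * (posD + 1)), stapes K ((only (cd x))(1 := out x, 1 := v)))"
    by (rule special_dstep[where b=Blank and m=MoveRight and f=dispatch])
      (auto simp: specials_def dispatch_def unique_entries assms word_tape_0 act_pop simp del: act.simps)
  then show ?thesis by simp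
qed

lemma step_ask:
  "step M X (State (2 * (posD + 1)), stapes K ((only (cd x))(1 := v))) c' \<longleftrightarrow>
   (case v of True # q \<Rightarrow> c' = (Query, stapes K ((only (cd x))(1 := q)))
    | [] \<Rightarrow> c' = answered True x [] \<or> nd \<and> c' = answered False x []
    | False # q \<Rightarrow> c' = answered True x v \<or> nd \<and> c' = answered False x v)"
proof -
  let ?q = "State (2 * (posD + 1))" let ?s = "(only (cd x))(1 := v)"
  have e: "(?q, i, f) \<in> set entries \<longleftrightarrow> i = 1 \<and> (f = choose_answer Yes \<or> nd \<and> f = choose_answer No)" for i f
  proof -
    have "(?q, i, f) \<notin> set (lower pc (prog ! pc))" for pc
    proof
      assume a: "(?q, i, f) \<in> set (lower pc (prog ! pc))"
      have "pc = posD + 1" using lower_pc[OF a] by simp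
      then show False using a prog_stop by simp
    qed
    then have "(?q, i, f) \<in> set entries \<longleftrightarrow> (?q, i, f) \<in> set specials" by (simp add: set_entries)
    then show ?thesis by (auto simp: specials_def)
  qed
  have 1: "(1::nat) < K" using K(2) by simp
  have q: "?q \<noteq> Query" by simp
  have eff: "(stapes K ?s)[1 := act ((stapes K ?s ! 1) 0, fst (choose_answer r ((stapes K ?s ! 1) 0)),
        fst (snd (choose_answer r ((stapes K ?s ! 1) 0)))) (stapes K ?s ! 1)] =
      (case v of True # u \<Rightarrow> stapes K ((only (cd x))(1 := u)) | _ \<Rightarrow> stapes K ?s)"
    "snd (snd (choose_answer r ((stapes K ?s ! 1) 0))) = (case v of True # u \<Rightarrow> Query | _ \<Rightarrow> r)" for r
  proof -
    have "act (a, Blank, Stay) (word_tape []) = word_tape []"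
      "act (a, Bit b, Stay) (word_tape (b # w)) = word_tape (b # w)" for a b w
      by (auto simp: fun_eq_iff word_tape_def)
    then show "(stapes K ?s)[1 := act ((stapes K ?s ! 1) 0, fst (choose_answer r ((stapes K ?s ! 1) 0)),
        fst (snd (choose_answer r ((stapes K ?s ! 1) 0)))) (stapes K ?s ! 1)] =
      (case v of True # u \<Rightarrow> stapes K ((only (cd x))(1 := u)) | _ \<Rightarrow> stapes K ?s)"
      "snd (snd (choose_answer r ((stapes K ?s ! 1) 0))) = (case v of True # u \<Rightarrow> Query | _ \<Rightarrow> r)"
      using 1 by (auto simp: choose_answer_def word_tape_0 act_pop stapes_update split: list.split bool.split
        simp del: act.simps)
  qed
  define F where "F f i = (snd (snd (f ((stapes K ?s ! i) 0))),
     (stapes K ?s)[i := act ((stapes K ?s ! i) 0, fst (f ((stapes K ?s ! i) 0)),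
        fst (snd (f ((stapes K ?s ! i) 0)))) (stapes K ?s ! i)])" for f :: "symbol \<Rightarrow> symbol \<times> move \<times> state" and i
  have F: "F (choose_answer r) 1 = (case v of True # u \<Rightarrow> Query | _ \<Rightarrow> r,
      case v of True # u \<Rightarrow> stapes K ((only (cd x))(1 := u)) | _ \<Rightarrow> stapes K ?s)" for r
    unfolding F_def eff ..
  have "step M X (?q, stapes K ?s) c' \<longleftrightarrow> (\<exists>i f. (?q, i, f) \<in> set entries \<and> i < K \<and> c' = F f i)"
    unfolding M_def F_def by (rule step_machine[OF length_stapes stapes_alphabet q])
  also have "\<dots> \<longleftrightarrow> c' = F (choose_answer Yes) 1 \<or> nd \<and> c' = F (choose_answer No) 1"
    unfolding e using 1 by blast
  finally have "step M X (?q, stapes K ?s) c' \<longleftrightarrow> c' = F (choose_answer Yes) 1 \<or> nd \<and> c' = F (choose_answer No) 1" .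
  then show ?thesis unfolding F by (auto split: list.split bool.split)
qed

lemma step_query:
  "step M X (Query, stapes K ((only (cd x))(1 := q))) c' \<longleftrightarrow> c' = answered (q \<in> X) x q"
proof -
  have K1: "stapes K ((only (cd x))(1 := q)) ! 1 = word_tape q" using K(2) by simp
  have "rules M = entry_rules K entries" by (simp add: M_def machine_def)
  then have "(Query, acts, q') \<notin> rules M" for acts q'
    using no_Query unfolding entry_rules_def by auto
  then show ?thesis
    unfolding step.simps[of M X "(Query, stapes K ((only (cd x))(1 := q)))"]
    using K1 by (auto simp: shows_word_word_tape)
qed

text \<open>The 6 extra steps are the dispatch, the choice between query and guess, the oracle call,
  the writing of the answer and up to two for the jump back to the start of the loop.\<close>

definition round_time :: "nat \<Rightarrow> nat \<Rightarrow> nat" where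
  "round_time S L = 2 * poly pB S + 6 + 2 * poly pC (S + L)"

text \<open>A round takes at most \<open>round_time\<close> steps and makes at most one oracle call.
  The factor \<open>Suc n\<close> includes the final round, in which the machine decides without a
  call.\<close>

lemma arun_M:
  assumes "ainv out upd X nd S n x" "\<And>x. tsz x \<le> S \<Longrightarrow> length (out x) \<le> L"
  shows "bounded_from M X (at_B x) (Suc n * round_time S L) n \<and> (accepts_from M X (at_B x) \<longleftrightarrow> arun out upd X n x)"
  using assms(1)
proof (induction n arbitrary: x)
  fix n x
  have *: "bounded_from M X (at_B x) (Suc n * round_time S L) n \<and> (accepts_from M X (at_B x) \<longleftrightarrow> arun out upd X n x)"
    if S: "tsz x \<le> S" and o: "out x = [] \<or> (\<exists>v. out x = True # v)" for n x
  proof -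
    obtain k where k: "k \<le> 2 * poly pB (tsz x)"
      "(dstep M X ^^ k) (at_B x) (State (2 * posD), stapes K ((only (cd x))(1 := out x)))" using out_run by blast
    have kS: "k + 1 \<le> Suc n * round_time S L" using k(1) poly_mono_nat[OF S, of pB] by (simp add: round_time_def)
    show ?thesis
    proof (cases "out x")
      case Nil
      let ?c = "(State (2 * posD + 1), stapes K ((only (cd x))(1 := out x)))"
      have 1: "(dstep M X ^^ (Suc k)) (at_B x) ?c" using k(2) dispatch_reject[OF Nil] by (rule relpowp_Suc_I)
      have "\<not> step M X ?c c'" for c' by (rule no_step) (use no_dead in auto)
      note h = halted[OF this]
      show ?thesis using dstep_run(1)[OF 1 h(1)] dstep_run(2)[OF 1] h(2) kS Nil
        by (cases n) (auto elim: bounded_from_mono)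
    next
      case (Cons b v)
      then have v: "out x = True # v" using o by auto
      let ?c = "(Accept, stapes K ((only (cd x))(1 := v)))"
      have 1: "(dstep M X ^^ (Suc k)) (at_B x) ?c" using k(2) dispatch_accept[OF v] by (rule relpowp_Suc_I)
      have "\<not> step M X ?c c'" for c' by (rule no_step) (use no_Accept in auto)
      note h = halted[OF this]
      have "accepts_from M X ?c" unfolding accepts_from_def using computation.refl by blast
      then show ?thesis using dstep_run(1)[OF 1 h(1)] dstep_run(2)[OF 1] kS v
        by (cases n) (auto elim: bounded_from_mono)
    qed
  qed
  {
    case 0
    then show ?case using *[of x 0] by (simp add: fun_upd_def)
  next
    case (Suc n)
    have S: "tsz x \<le> S" using Suc.prems by simp
    obtain k where k: "k \<le> 2 * poly pB (tsz x)"
      "(dstep M X ^^ k) (at_B x) (State (2 * posD), stapes K ((only (cd x))(1 := out x)))" using out_run by blast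
    from Suc.prems consider "out x = [] \<or> (\<exists>v. out x = True # v)"
      | q where "out x = False # True # q" "ainv out upd X nd S n (upd (x, q \<in> X))"
      | "nd" "out x = [False]" "\<And>b. ainv out upd X nd S n (upd (x, b))" by auto
    then show ?case
    proof cases
      case 1
      then show ?thesis using *[OF S, of "Suc n"] by (simp add: fun_upd_def)
    next
      case (2 q)
      note IH = Suc.IH[OF 2(2)]
      have L: "length q \<le> L" using assms(2)[OF S] 2(1) by simp
      obtain l where l: "l \<le> 2 * poly pC (tsz x + length q) + 3"
        "(dstep M X ^^ l) (answered (q \<in> X) x q) (at_B (upd (x, q \<in> X)))" using upd_run by blast
      let ?Q = "(Query, stapes K ((only (cd x))(1 := q)))"
      let ?R = "Suc n * round_time S L"
      have "dstep M X (State (2 * (posD + 1)), stapes K ((only (cd x))(1 := True # q))) ?Q"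
        unfolding dstep_def by (simp add: step_ask[unfolded One_nat_def, simplified] step_ask)
      then have 1: "(dstep M X ^^ (Suc (Suc k))) (at_B x) ?Q"
        using relpowp_Suc_I[OF k(2) dispatch_ask[OF 2(1)]] by (rule relpowp_Suc_I[rotated])
      have b: "bounded_from M X (answered (q \<in> X) x q) (l + ?R) n"
        using dstep_run(1)[OF l(2)] IH by blast
      have "bounded_from M X ?Q (Suc (l + ?R)) (Suc n)"
        using bounded_fromI[of M X ?Q "l + ?R" n] b unfolding step_query by simp
      from dstep_run(1)[OF 1 this] have "bounded_from M X (at_B x) (Suc (Suc k) + Suc (l + ?R)) (Suc n)" .
      moreover have "Suc (Suc k) + Suc (l + ?R) \<le> Suc (Suc n) * round_time S L"
      proof -
        have "poly pB (tsz x) \<le> poly pB S" "poly pC (tsz x + length q) \<le> poly pC (S + L)"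
          using S L by (auto intro!: poly_mono_nat)
        then show ?thesis using k(1) l(1) by (simp add: round_time_def)
      qed
      ultimately have bd: "bounded_from M X (at_B x) (Suc (Suc n) * round_time S L) (Suc n)"
        by (rule bounded_from_mono) simp
      have "accepts_from M X (at_B x) \<longleftrightarrow> accepts_from M X ?Q" by (rule dstep_run(2)[OF 1])
      also have "\<dots> \<longleftrightarrow> accepts_from M X (answered (q \<in> X) x q)"
      proof -
        have "fst ?Q \<noteq> Accept" by simp
        from accepts_from_iff[OF this, of M X] show ?thesis unfolding step_query by blast
      qed
      also have "\<dots> \<longleftrightarrow> arun out upd X n (upd (x, q \<in> X))" using dstep_run(2)[OF l(2)] IH by blast
      finally show ?thesis using bd 2(1) by (simp add: fun_upd_def)
    next
      case 3
      let ?D = "(State (2 * (posD + 1)), stapes K ((only (cd x))(1 := [])))"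
      let ?R = "Suc n * round_time S L"
      have 1: "(dstep M X ^^ (Suc k)) (at_B x) ?D"
        using relpowp_Suc_I[OF k(2) dispatch_ask[OF 3(2)]] .
      have st: "step M X ?D c' \<longleftrightarrow> (\<exists>b. c' = answered b x [])" for c'
        unfolding step_ask using 3(1) by (simp add: ex_bool_eq)
      let ?l = "2 * poly pC (tsz x + 0) + 3"
      have b: "bounded_from M X (answered b x []) (?l + ?R) n"
        and a: "accepts_from M X (answered b x []) \<longleftrightarrow> arun out upd X n (upd (x, b))" for b
      proof -
        obtain l where l: "l \<le> ?l" "(dstep M X ^^ l) (answered b x []) (at_B (upd (x, b)))"
          using upd_run[of x "[]" X b] by auto
        show "bounded_from M X (answered b x []) (?l + ?R) n"
          using dstep_run(1)[OF l(2)] Suc.IH[OF 3(3)[of b]] l(1) by (meson add_le_mono1 bounded_from_mono order_refl)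
        show "accepts_from M X (answered b x []) \<longleftrightarrow> arun out upd X n (upd (x, b))"
          using dstep_run(2)[OF l(2)] Suc.IH[OF 3(3)[of b]] by blast
      qed
      have "bounded_from M X ?D (Suc (?l + ?R)) n"
        using bounded_fromI[of M X ?D "?l + ?R" n] b unfolding st by fastforce
      from dstep_run(1)[OF 1 this] have "bounded_from M X (at_B x) (Suc k + Suc (?l + ?R)) n" .
      moreover have "Suc k + Suc (?l + ?R) \<le> Suc (Suc n) * round_time S L"
      proof -
        have "poly pB (tsz x) \<le> poly pB S" "poly pC (tsz x) \<le> poly pC (S + L)"
          using S by (auto intro!: poly_mono_nat)
        then show ?thesis using k(1) by (simp add: round_time_def)
      qed
      ultimately have bd: "bounded_from M X (at_B x) (Suc (Suc n) * round_time S L) (Suc n)"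
        by (rule bounded_from_mono) simp
      have "accepts_from M X (at_B x) \<longleftrightarrow> accepts_from M X ?D" by (rule dstep_run(2)[OF 1])
      also have "\<dots> \<longleftrightarrow> (\<exists>b. accepts_from M X (answered b x []))"
      proof -
        have "fst ?D \<noteq> Accept" by simp
        from accepts_from_iff[OF this, of M X] show ?thesis unfolding st by blast
      qed
      finally show ?thesis using bd 3(2) a by (simp add: fun_upd_def)
    qed
  }
qed

lemma output_M:
  assumes "out (init w) = True # v"
  shows "\<exists>n k ts. computation M X (initial M w) n k (Accept, ts) \<and> shows_word (ts ! 1) v"
proof -
  let ?x = "init w" let ?c = "(Accept, stapes K ((only (cd ?x))(1 := v)))"
  obtain n where n: "(dstep M X ^^ n) (initial M w) (at_B ?x)" using start_run by blast
  obtain k where k: "(dstep M X ^^ k) (at_B ?x) (State (2 * posD), stapes K ((only (cd ?x))(1 := out ?x)))"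
    using out_run by blast
  have 1: "(dstep M X ^^ (n + Suc k)) (initial M w) ?c"
    using n relpowp_Suc_I[OF k dispatch_accept[OF assms]] by (rule relpowp_trans)
  from dstep_run(3)[OF 1 computation.refl] have "computation M X (initial M w) (n + Suc k + 0) 0 ?c" .
  moreover have "shows_word (stapes K ((only (cd ?x))(1 := v)) ! 1) v"
    using K(2) by (simp add: shows_word_word_tape)
  ultimately show ?thesis by blast
qed

end

text \<open>Machine and polynomial depend neither on the oracle nor on \<open>S\<close> and
  \<open>n\<close>; size and round bounds may therefore vary with the input word.\<close>

theorem interactive_machine:
  fixes init :: "word \<Rightarrow> 'a::enc"
  assumes "ptime init" "ptime out" "ptime upd"
  obtains M p where "is_tm M" "\<not> nd \<Longrightarrow> deterministic M"
    "\<And>X w S n. ainv out upd X nd S n (init w) \<Longrightarrow>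
       bounded_from M X (initial M w) (poly p (length w) + Suc n * poly p S) n \<and>
       (accepts M X w \<longleftrightarrow> arun out upd X n (init w))"
    "\<And>X w v. out (init w) = True # v \<Longrightarrow>
       \<exists>n k ts. computation M X (initial M w) n k (Accept, ts) \<and> shows_word (ts ! 1) v"
proof -
  obtain cA pA where A: "\<And>w. run cA (only w) (poly pA (length w)) (only (cd (init w)))"
    using init_program[OF assms(1)] by blast
  obtain cB pB where B: "\<And>x. run cB (only (cd x)) (poly pB (tsz x)) ((only (cd x))(1 := out x))"
    using out_program[OF assms(2)] by blast
  obtain cC pC where C: "\<And>x q b. run cC ((only (cd x))(1 := q, 2 := [b])) (poly pC (tsz x + length q))
     (only (cd (upd (x, b))))"
    using upd_program[OF assms(3)] by blast
  obtain pL where L: "\<And>x. tsz (out x) \<le> poly pL (tsz x)" using ptime_tsz[OF assms(2)] by blast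
  have "finite (stacks cA \<union> stacks cB \<union> stacks cC)" by (simp add: finite_stacks)
  then obtain K0 where "\<And>i. i \<in> stacks cA \<union> stacks cB \<union> stacks cC \<Longrightarrow> i < K0"
    using finite_nat_set_iff_bounded by meson
  then interpret interactive init out upd nd cA cB cC pA pB pC "K0 + 3"
    by unfold_locales (use A B C in \<open>auto intro: trans_less_add1\<close>)
  let ?r = "[:6:] + smult 2 pB + smult 2 (pcompose pC ([:0, 1:] + pL))"
  let ?p = "smult 2 pA + [:1:] + ?r"
  have main: "bounded_from M X (initial M w) (poly ?p (length w) + Suc n * poly ?p S) n \<and>
       (accepts M X w \<longleftrightarrow> arun out upd X n (init w))"
    if inv: "ainv out upd X nd S n (init w)" for X w S n
  proof -
    have "length (out x) \<le> poly pL S" if "tsz x \<le> S" for x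
      using length_le_tsz_word[of "out x"] L[of x] poly_mono_nat[OF that, of pL] by linarith
    note * = arun_M[OF inv this]
    obtain k where k: "k \<le> 2 * poly pA (length w) + 1" "(dstep M X ^^ k) (initial M w) (at_B (init w))"
      using start_run by blast
    have "round_time S (poly pL S) = poly ?r S"
      by (simp add: round_time_def poly_pcompose)
    then have "round_time S (poly pL S) \<le> poly ?p S" by simp
    then have "k + Suc n * round_time S (poly pL S) \<le> poly ?p (length w) + Suc n * poly ?p S"
      using k(1) by (intro add_mono mult_le_mono2) simp_all
    then show ?thesis
      using dstep_run(1,2)[OF k(2)] * unfolding accepts_def accepts_from_def[symmetric]
      by (meson bounded_from_mono order_refl)
  qed
  show ?thesis by (rule that[of M ?p]) (use is_tm_M deterministic_M main output_M in auto)
qed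

section \<open>Membership in complexity classes\<close>

lemma poly_time_machine:
  assumes "\<And>w. bounded_from M X (initial M w) (poly p (length w)) (Q w)"
  shows "poly_time M X"
  using assms unfolding poly_time_def bounded_from_def by blast

text \<open>The initial state is already \<open>f w\<close>, and the first action word accepts with
  it as output; there are no rounds.\<close>

theorem poly_time_computable_ptime:
  assumes "ptime f"
  shows "poly_time_computable f"
proof -
  obtain M p where M: "is_tm M" "\<not> False \<Longrightarrow> deterministic M"
    "\<And>X w S n. ainv (\<lambda>x. True # x) fst X False S n (f w) \<Longrightarrow>
       bounded_from M X (initial M w) (poly p (length w) + Suc n * poly p S) n \<and>
       (accepts M X w \<longleftrightarrow> arun (\<lambda>x. True # x) fst X n (f w))"
    "\<And>X w v. True # f w = True # v \<Longrightarrow>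
       \<exists>n k ts. computation M X (initial M w) n k (Accept, ts) \<and> shows_word (ts ! 1) v"
  proof (rule interactive_machine[of f "\<lambda>x. True # x" fst False])
    show "ptime (\<lambda>x :: word. True # x)" "ptime (fst :: word \<times> bool \<Rightarrow> word)" by (intro ptime_intros)+
  qed (use assms in auto)
  obtain q where q: "\<And>w. tsz (f w) \<le> poly q (tsz w)" using ptime_tsz[OF assms] by blast
  have "bounded_from M {} (initial M w) (poly (p + pcompose p (pcompose q [:1, 4:])) (length w)) 0" for w
  proof -
    have "poly q (tsz w) \<le> poly q (4 * length w + 1)" by (rule poly_mono_nat) (rule tsz_word)
    then have "ainv (\<lambda>x. True # x) fst {} False (poly q (4 * length w + 1)) 0 (f w)"
      using q[of w] by simp
    from M(3)[OF this] show ?thesis by (simp add: poly_pcompose algebra_simps)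
  qed
  then have "poly_time M {}" by (rule poly_time_machine)
  then show ?thesis unfolding poly_time_computable_def using M(1,2,4) by blast
qed

subsection \<open>Decoding\<close>

fun spine :: "tree \<Rightarrow> tree list" where
  "spine Lf = []"
| "spine (Nd l r) = l # spine r"

lemma tr_spine: "tr (spine t) = t"
  by (induction t) auto

lemma ptime_spine [ptime_intros]: "ptime f \<Longrightarrow> ptime (\<lambda>x. spine (f x))"
  by (erule ptime_same_code) (simp add: tr_spine)

lemma ptime_Nd [ptime_intros]:
  assumes "ptime f" "ptime g"
  shows "ptime (\<lambda>x. Nd (f x) (g x))"
  by (rule ptime_same_code[OF ptime_Pair[OF assms]]) simp

text \<open>\<open>unt\<close> also assigns a value to trees that code nothing, so every guessed
  word can be read as a typed certificate.\<close>

class dec = enc +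
  fixes unt :: "tree \<Rightarrow> 'a"
  assumes unt_tr [simp]: "unt (tr x) = x"
    and ptime_tr_unt: "ptime (\<lambda>t. tr (unt t))"

lemma ptime_unt: "ptime (unt :: tree \<Rightarrow> 'a::dec)"
  by (rule ptime_same_code[OF ptime_tr_unt[where 'a='a]]) simp

lemma ptime_unt' [ptime_intros]: "ptime f \<Longrightarrow> ptime (\<lambda>x. unt (f x) :: 'a::dec)"
  using ptime_comp[OF _ ptime_unt] .

instantiation tree :: dec
begin
definition unt_tree :: "tree \<Rightarrow> tree" where "unt_tree t = t"
instance
proof
  show "ptime (\<lambda>t. tr (unt t :: tree))" unfolding unt_tree_def by (intro ptime_intros ptime_tr)
qed (simp add: unt_tree_def)
end

instantiation bool :: dec
begin
definition unt_bool :: "tree \<Rightarrow> bool" where "unt_bool t = (t \<noteq> Lf)"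
instance
proof
  show "ptime (\<lambda>t. tr (unt t :: bool))" unfolding unt_bool_def by (intro ptime_intros ptime_tr)
qed (simp add: unt_bool_def tr_bool_def)
end

instantiation unit :: dec
begin
definition unt_unit :: "tree \<Rightarrow> unit" where "unt_unit t = ()"
instance
proof
  show "ptime (\<lambda>t. tr (unt t :: unit))" unfolding unt_unit_def by (intro ptime_intros ptime_tr)
qed simp
end

instantiation nat :: dec
begin
definition unt_nat :: "tree \<Rightarrow> nat" where "unt_nat t = length (spine t)"
instance
proof
  show "ptime (\<lambda>t. tr (unt t :: nat))" unfolding unt_nat_def by (intro ptime_intros ptime_tr)
  show "unt (tr x) = x" for x :: nat by (induction x) (auto simp: unt_nat_def)
qed
end

instantiation list :: (dec) dec
begin
definition unt_list :: "tree \<Rightarrow> 'a list" where "unt_list t = map unt (spine t)"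
instance
proof
  show "ptime (\<lambda>t. tr (unt t :: 'a list))" unfolding unt_list_def by (intro ptime_intros ptime_tr)
  show "unt (tr x) = x" for x :: "'a list" by (induction x) (auto simp: unt_list_def)
qed
end

instantiation prod :: (dec, dec) dec
begin
definition unt_prod :: "tree \<Rightarrow> 'a \<times> 'b" where "unt_prod t = (unt (lft t), unt (rgt t))"
instance
proof
  show "ptime (\<lambda>t. tr (unt t :: 'a \<times> 'b))" unfolding unt_prod_def
    by (intro ptime_intros ptime_tr ptime_lft' ptime_rgt')
  show "unt (tr x) = x" for x :: "'a \<times> 'b" by (cases x) (auto simp: unt_prod_def)
qed
end

text \<open>Polish notation is read from right to left with a stack: \<open>False\<close> pushes a
  leaf, \<open>True\<close> joins the two topmost trees. Bits to the right of a code only leave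
  trees deeper in the stack, so padding is ignored.\<close>

definition parse_step :: "tree list \<Rightarrow> bool \<Rightarrow> tree list" where
  "parse_step st b = (if b then (if tl st = [] then st else Nd (hd st) (hd (tl st)) # tl (tl st)) else Lf # st)"

definition parse :: "word \<Rightarrow> tree" where
  "parse y = (let st = foldl parse_step [] (rev y) in if st = [] then Lf else hd st)"

lemma foldl_parse_code: "foldl parse_step st (rev (code t)) = t # st"
  by (induction t arbitrary: st) (auto simp: parse_step_def)

lemma parse_code: "parse (code t @ u) = t"
  by (simp add: parse_def foldl_parse_code)

lemma ptime_parse [ptime_intros]:
  assumes "ptime f"
  shows "ptime (\<lambda>x. parse (f x))"
  unfolding parse_def Let_def
proof (intro ptime_intros)
  show "ptime (\<lambda>x. foldl parse_step [] (rev (f x)))"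
  proof (rule ptime_foldl[where c="[:2:]"])
    show "ptime (\<lambda>p. parse_step (fst (snd p)) (snd (snd p)))"
      unfolding parse_step_def by (intro ptime_intros ptime_tr)
    show "tsz (parse_step a y) \<le> tsz a + poly [:2:] (tsz x + tsz y)" for x :: 'a and a y
      by (cases a rule: list.exhaust[case_product list.exhaust[of "tl a"]]) (auto simp: parse_step_def neq_Nil_conv)
  qed (intro ptime_intros assms)+
  then show "ptime (\<lambda>x. foldl parse_step [] (rev (f x)))" .
qed

subsection \<open>Nondeterministic classes\<close>

text \<open>The word \<open>y\<close> is guessed bit by bit, \<open>R\<close> is checked, and a
  single query is asked whose negative answer accepts. With the empty oracle this is the form of NP,
  with an NP oracle that of the second level.\<close>

lemma oracle_machine_raw:
  fixes R :: "word \<times> word \<Rightarrow> bool" and Q :: "word \<times> word \<Rightarrow> word"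
  assumes R: "ptime R" and Q: "ptime Q"
  obtains M where "is_tm M" "\<And>X. poly_time M X"
    "\<And>X. decides M X {w. \<exists>y. length y = poly q (length w) \<and> R (w, y) \<and> Q (w, y) \<notin> X}"
proof -
  \<comment> \<open>The counter starts one above the number of bits: at 1 the query is asked, at 0
    its answer is evaluated.\<close>
  define init where "init w = ((w, [] :: word), Suc (poly q (length w)), True)" for w :: word
  define out where "out st = (if 1 < fst (snd st) then [False]
     else if fst (snd st) = 1 then if R (fst st) then False # True # Q (fst st) else []
     else if snd (snd st) then [] else [True])" for st :: "(word \<times> word) \<times> nat \<times> bool"
  define upd where "upd p = (if 1 < fst (snd (fst p))
     then ((fst (fst (fst p)), snd p # snd (fst (fst p))), fst (snd (fst p)) - 1, snd (snd (fst p)))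
     else (fst (fst p), 0, snd p))" for p :: "((word \<times> word) \<times> nat \<times> bool) \<times> bool"
  have "ptime init" unfolding init_def by (intro ptime_intros ptime_tr)
  moreover have "ptime out" unfolding out_def
    by (intro ptime_intros ptime_comp[OF _ R] ptime_comp[OF _ Q])
  moreover have "ptime upd" unfolding upd_def by (intro ptime_intros ptime_tr)
  ultimately obtain M p where M: "is_tm M"
    "\<And>X w S n. ainv out upd X True S n (init w) \<Longrightarrow>
       bounded_from M X (initial M w) (poly p (length w) + Suc n * poly p S) n \<and>
       (accepts M X w \<longleftrightarrow> arun out upd X n (init w))"
    by (rule interactive_machine[of init out upd True]) auto
  have out: "out ((w, y), Suc (Suc n), b) = [False]"
    "out ((w, y), Suc 0, b) = (if R (w, y) then False # True # Q (w, y) else [])"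
    "out ((w, y), 0, b) = (if b then [] else [True])" for w y n b by (auto simp: out_def)
  have upd: "upd (((w, y), Suc (Suc n), b), a) = ((w, a # y), Suc n, b)"
    "upd (((w, y), Suc 0, b), a) = ((w, y), 0, a)" for w y n b a by (auto simp: upd_def)
  have arun: "arun out upd X (Suc n) ((w, y), Suc n, b) \<longleftrightarrow>
      (\<exists>z. length z = n \<and> R (w, z @ y) \<and> Q (w, z @ y) \<notin> X)" for X n w y b
  proof (induction n arbitrary: y)
    case 0
    then show ?case by (auto simp: out upd)
  next
    case (Suc n)
    have "arun out upd X (Suc (Suc n)) ((w, y), Suc (Suc n), b) \<longleftrightarrow>
       (\<exists>a. arun out upd X (Suc n) ((w, a # y), Suc n, b))"
      by (subst arun.simps(2)) (simp add: out upd del: arun.simps)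
    also have "\<dots> \<longleftrightarrow> (\<exists>a z. length z = n \<and> R (w, (z @ [a]) @ y) \<and> Q (w, (z @ [a]) @ y) \<notin> X)"
      by (simp add: Suc del: arun.simps)
    also have "\<dots> \<longleftrightarrow> (\<exists>z. length z = Suc n \<and> R (w, z @ y) \<and> Q (w, z @ y) \<notin> X)"
      unfolding length_Suc_conv_rev by blast
    finally show ?case .
  qed
  have ainv: "ainv out upd X True S (Suc n) ((w, y), Suc n, b)"
    if "4 * length w + 4 * (length y + n) + 2 * n + 20 \<le> S" for X S n w y b
    using that
  proof (induction n arbitrary: y)
    case 0
    then show ?case using tsz_word[of w] tsz_word[of y] tsz_bool[of b] tsz_bool[of "Q (w, y) \<in> X"]
      by (auto simp: out upd)
  next
    case (Suc n)
    have "tsz ((w, y), Suc (Suc n), b) \<le> S"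
      using Suc.prems tsz_word[of w] tsz_word[of y] tsz_bool[of b] by simp
    moreover have "ainv out upd X True S (Suc n) ((w, a # y), Suc n, b)" for a
      using Suc.prems by (intro Suc.IH) simp
    ultimately show ?case by (subst ainv.simps(2)) (simp add: out upd del: ainv.simps)
  qed
  let ?S = "[:20, 4:] + smult 6 q"
  let ?A = "\<lambda>X. {w. \<exists>y. length y = poly q (length w) \<and> R (w, y) \<and> Q (w, y) \<notin> X}"
  have M': "bounded_from M X (initial M w) (poly (p + (q + [:2:]) * pcompose p ?S) (length w)) (Suc (poly q (length w))) \<and>
       (accepts M X w \<longleftrightarrow> w \<in> ?A X)" for X w
  proof -
    have "ainv out upd X True (poly ?S (length w)) (Suc (poly q (length w))) (init w)"
      unfolding init_def by (rule ainv) simp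
    from M(2)[OF this] show ?thesis
      unfolding init_def arun by (simp add: poly_pcompose algebra_simps mult_2)
  qed
  show ?thesis
  proof (rule that[of M])
    show "poly_time M X" for X using M' by (intro poly_time_machine) blast
    show "decides M X (?A X)" for X using M' unfolding decides_def by blast
  qed (rule M(1))
qed

text \<open>A certificate of bounded size becomes a word of exactly the guessed length by padding,
  which \<open>parse\<close> ignores.\<close>

theorem oracle_machine:
  fixes R :: "word \<times> 'b::dec \<Rightarrow> bool" and Q :: "word \<times> 'b \<Rightarrow> word"
  assumes R: "ptime R" and Q: "ptime Q"
    and sound: "\<And>w y. R (w, y) \<Longrightarrow> Q (w, y) \<notin> X \<Longrightarrow> w \<in> A"
    and complete: "\<And>w. w \<in> A \<Longrightarrow> \<exists>y. tsz y \<le> poly q (length w) \<and> R (w, y) \<and> Q (w, y) \<notin> X"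
  shows "\<exists>M. is_tm M \<and> poly_time M X \<and> decides M X A"
proof -
  let ?u = "\<lambda>p :: word \<times> word. (fst p, unt (parse (snd p)) :: 'b)"
  have "ptime (\<lambda>p. R (?u p))" "ptime (\<lambda>p. Q (?u p))"
    by (intro ptime_intros ptime_comp[OF _ R] ptime_comp[OF _ Q])+
  then obtain M where M: "is_tm M" "poly_time M X"
    "decides M X {w. \<exists>y. length y = poly q (length w) \<and> R (?u (w, y)) \<and> Q (?u (w, y)) \<notin> X}"
    by (rule oracle_machine_raw[of _ _ q]) auto
  moreover have "{w. \<exists>y. length y = poly q (length w) \<and> R (?u (w, y)) \<and> Q (?u (w, y)) \<notin> X} = A"
  proof (intro equalityI subsetI)
    fix w assume "w \<in> A"
    then obtain y where y: "tsz y \<le> poly q (length w)" "R (w, y)" "Q (w, y) \<notin> X" using complete by blast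
    let ?y = "cd y @ replicate (poly q (length w) - tsz y) False"
    have "length ?y = poly q (length w)" "?u (w, ?y) = (w, y)" using y(1) by (simp_all add: parse_code)
    then show "w \<in> {w. \<exists>y. length y = poly q (length w) \<and> R (?u (w, y)) \<and> Q (?u (w, y)) \<notin> X}"
      using y by (simp only: mem_Collect_eq) metis
  qed (use sound in auto)
  ultimately show ?thesis by metis
qed

theorem NP_I:
  fixes R :: "word \<times> 'b::dec \<Rightarrow> bool"
  assumes "ptime R" "\<And>w y. R (w, y) \<Longrightarrow> w \<in> A"
    and "\<And>w. w \<in> A \<Longrightarrow> \<exists>y. tsz y \<le> poly q (length w) \<and> R (w, y)"
  shows "A \<in> NP"
proof -
  have "\<exists>M. is_tm M \<and> poly_time M {} \<and> decides M {} A"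
    by (rule oracle_machine[OF assms(1) ptime_const[of "[]"], where q=q]) (use assms in auto)
  then show ?thesis unfolding NP_def by blast
qed

theorem NP_oracle_I:
  fixes R :: "word \<times> 'b::dec \<Rightarrow> bool" and Q :: "word \<times> 'b \<Rightarrow> word"
  assumes "ptime R" "ptime Q" "X \<in> C" "\<And>w y. R (w, y) \<Longrightarrow> Q (w, y) \<notin> X \<Longrightarrow> w \<in> A"
    and "\<And>w. w \<in> A \<Longrightarrow> \<exists>y. tsz y \<le> poly q (length w) \<and> R (w, y) \<and> Q (w, y) \<notin> X"
  shows "A \<in> NP_oracle C"
proof -
  have "\<exists>M. is_tm M \<and> poly_time M X \<and> decides M X A"
    by (rule oracle_machine[OF assms(1,2), where q=q]) (use assms(4,5) in auto)
  then show ?thesis using assms(3) unfolding NP_oracle_def by blast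
qed

subsection \<open>Logarithmically many queries\<close>

lemma log_bigo:
  assumes "1 \<le> C"
  shows "(\<lambda>n. log 2 (real C * (real n + 1))) \<in> O(\<lambda>n. ln (real n))"
proof (rule bigoI)
  show "\<forall>\<^sub>F n in sequentially. norm (log 2 (real C * (real n + 1))) \<le>
      ((ln (real C) / ln 2 + 2) / ln 2) * norm (ln (real n))"
  \<comment> \<open>From 2 on, \<open>ln n\<close> is at least \<open>ln 2\<close>, so constants are
    bounded by multiples of it, and n + 1 \<le> n * n.\<close>
  proof (rule eventually_sequentiallyI[of 2])
    fix n :: nat assume n: "2 \<le> n"
    have ln2: "ln 2 \<le> ln (real n)" "0 < ln (2::real)" using n by auto
    have C: "0 \<le> ln (real C)" using assms by simp
    have "real n + 1 \<le> real n * real n"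
    proof -
      have "2 * real n \<le> real n * real n" using n by (intro mult_right_mono) auto
      moreover have "real n + 1 \<le> 2 * real n" using n by simp
      ultimately show ?thesis by linarith
    qed
    then have "ln (real n + 1) \<le> ln (real n * real n)" using n by (subst ln_le_cancel_iff) auto
    also have "\<dots> = 2 * ln (real n)" using n by (simp add: ln_mult)
    finally have 1: "ln (real n + 1) \<le> 2 * ln (real n)" .
    have "ln (real C) * ln 2 \<le> ln (real C) * ln (real n)" using ln2 C by (intro mult_left_mono) auto
    then have 2: "ln (real C) \<le> ln (real C) / ln 2 * ln (real n)" using ln2 by (simp add: field_simps)
    have "log 2 (real C * (real n + 1)) = (ln (real C) + ln (real n + 1)) / ln 2"
      using assms by (simp add: log_def ln_mult)
    moreover have "0 \<le> ln (real n + 1)" by simp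
    moreover have "(ln (real C) + ln (real n + 1)) / ln 2 \<le> ((ln (real C) / ln 2 + 2) * ln (real n)) / ln 2"
      using 1 2 ln2 by (intro divide_right_mono) (auto simp: algebra_simps)
    moreover have "\<bar>ln (real n)\<bar> = ln (real n)" using ln2 by linarith
    moreover have "0 \<le> (ln (real C) + ln (real n + 1)) / ln 2" using C ln2 by simp
    ultimately show "norm (log 2 (real C * (real n + 1))) \<le>
      ((ln (real C) / ln 2 + 2) / ln 2) * norm (ln (real n))" by simp
  qed
qed

text \<open>A round makes at most one call, so a linear bound on \<open>2 ^ r w\<close> is a
  logarithmic bound on the calls.\<close>

theorem log_query_machine:
  fixes init :: "word \<Rightarrow> 'a::enc"
  assumes "ptime init" "ptime out" "ptime upd" "1 \<le> C"
    and inv: "\<And>w. ainv out upd X False (poly s (length w)) (r w) (init w)"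
    and r: "\<And>w. 2 ^ r w \<le> C * (length w + 1)"
    and A: "\<And>w. w \<in> A \<longleftrightarrow> arun out upd X (r w) (init w)"
  shows "\<exists>M. is_tm M \<and> deterministic M \<and> poly_time M X \<and> log_queries M X \<and> decides M X A"
proof -
  obtain M p where M: "is_tm M" "\<not> False \<Longrightarrow> deterministic M"
    "\<And>X w S n. ainv out upd X False S n (init w) \<Longrightarrow>
       bounded_from M X (initial M w) (poly p (length w) + Suc n * poly p S) n \<and>
       (accepts M X w \<longleftrightarrow> arun out upd X n (init w))"
    using interactive_machine[OF assms(1-3), of False] by metis
  note M' = M(3)[OF inv]
  have "bounded_from M X (initial M w) (poly (p + [:C + 1, C:] * pcompose p s) (length w)) (r w)" for w
  proof -
    \<comment> \<open>For the running time a linear bound on the number of rounds is enough.\<close>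
    have "r w < 2 ^ r w" by (rule less_exp)
    then have "r w \<le> C * (length w + 1)" using r[of w] by linarith
    then have "Suc (r w) \<le> C + 1 + length w * C" by (simp add: algebra_simps)
    then have "Suc (r w) * poly p (poly s (length w)) \<le> (C + 1 + length w * C) * poly p (poly s (length w))"
      by (rule mult_le_mono1)
    then have "poly p (length w) + Suc (r w) * poly p (poly s (length w)) \<le>
        poly (p + [:C + 1, C:] * pcompose p s) (length w)"
      by (simp add: poly_pcompose algebra_simps)
    then show ?thesis using M'[of w] bounded_from_mono by blast
  qed
  note b = this
  then have "poly_time M X" by (rule poly_time_machine)
  moreover have "log_queries M X" unfolding log_queries_def
  proof (intro exI conjI allI impI)
    show "(\<lambda>n. log 2 (real C * (real n + 1))) \<in> O(\<lambda>n. ln (real n))" by (rule log_bigo) fact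
    fix w n k c assume "computation M X (initial M w) n k c"
    then have "k \<le> r w" using b unfolding bounded_from_def by blast
    moreover have "real (r w) \<le> log 2 (real C * (real (length w) + 1))"
    proof -
      have "real (2 ^ r w) \<le> real (C * (length w + 1))" using r[of w] of_nat_le_iff by blast
      then have "2 powr real (r w) \<le> real C * (real (length w) + 1)"
        by (simp add: powr_realpow algebra_simps)
      then show ?thesis using assms(4) by (subst le_log_iff) (auto intro!: mult_pos_pos)
    qed
    ultimately show "real k \<le> log 2 (real C * (real (length w) + 1))" by simp
  qed
  moreover have "decides M X A" unfolding decides_def using A M' by blast
  ultimately show ?thesis using M(1,2) by blast
qed

section \<open>Polynomial-time simulation of Turing machines\<close>

primrec symbol_nat :: "symbol \<Rightarrow> nat" where
  "symbol_nat Blank = 0"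
| "symbol_nat (Bit b) = (if b then 1 else 2)"
| "symbol_nat (Mark n) = n + 3"

primrec state_nat :: "state \<Rightarrow> nat" where
  "state_nat Start = 0"
| "state_nat Accept = 1"
| "state_nat Query = 2"
| "state_nat Yes = 3"
| "state_nat No = 4"
| "state_nat (State n) = n + 5"

instantiation symbol :: enc
begin
definition tr_symbol :: "symbol \<Rightarrow> tree" where "tr_symbol a = tr (symbol_nat a)"
lemma symbol_nat_inject: "symbol_nat a = symbol_nat b \<longleftrightarrow> a = b"
  by (cases a; cases b) auto
instance by standard (simp add: tr_symbol_def symbol_nat_inject)
end

instantiation state :: enc
begin
definition tr_state :: "state \<Rightarrow> tree" where "tr_state q = tr (state_nat q)"
lemma state_nat_inject: "state_nat p = state_nat q \<longleftrightarrow> p = q"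
  by (cases p; cases q) auto
instance by standard (simp add: tr_state_def state_nat_inject)
end

lemma ptime_Bit [ptime_intros]:
  assumes "ptime f"
  shows "ptime (\<lambda>x. Bit (f x))"
proof -
  have "ptime (\<lambda>x. if f x then Bit True else Bit False)" by (intro ptime_intros assms)
  then show ?thesis by (rule ptime_same) simp
qed

text \<open>A tape is represented by the cells left of its head (in reverse order) and the remaining
  cells; missing cells are blank.\<close>

type_synonym ztape = "symbol list \<times> symbol list"
type_synonym zconf = "state \<times> ztape list"

definition cell :: "symbol list \<Rightarrow> nat \<Rightarrow> symbol" where
  "cell xs n = (if n < length xs then xs ! n else Blank)"

definition head :: "symbol list \<Rightarrow> symbol" where
  "head xs = (if xs = [] then Blank else hd xs)"

definition tape_of :: "ztape \<Rightarrow> tape" where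
  "tape_of z i = (if 0 \<le> i then cell (snd z) (nat i) else cell (fst z) (nat (- i - 1)))"

lemma head_Cons [simp]: "head (x # xs) = x"
  by (simp add: head_def)

lemma cell_simps: "cell [] n = Blank" "cell (x # xs) 0 = x" "cell (x # xs) (Suc n) = cell xs n"
  "cell (tl xs) n = cell xs (Suc n)" "cell xs 0 = head xs"
  by (auto simp: cell_def head_def hd_conv_nth nth_tl)

text \<open>\<open>head\<close> and \<open>tl\<close> treat missing cells as blank, so the lists
  never have to be padded.\<close>

definition zact :: "symbol \<times> symbol \<times> move \<Rightarrow> ztape \<Rightarrow> ztape" where
  "zact x z = (case x of (a, b, m) \<Rightarrow>
     if m = Stay then (fst z, b # tl (snd z))
     else if m = MoveRight then (b # fst z, tl (snd z))
     else (tl (fst z), head (fst z) # b # tl (snd z)))"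

lemma tape_of_zact: "tape_of (zact x z) = act x (tape_of z)"
proof
  fix i
  obtain a b m where x: "x = (a, b, m)" by (cases x)
  obtain l r where z: "z = (l, r)" by (cases z)
  have S: "nat i = Suc (nat (i - 1))" if "0 < i" for i using that by simp
  show "tape_of (zact x z) i = act x (tape_of z) i"
  proof (cases m)
    case MoveLeft
    consider "i = 0" | "i = 1" | "1 < i" | "i < 0" by linarith
    then show ?thesis
    proof cases
      case 3
      then have "nat i = Suc (Suc (nat (i - 2)))" "nat (i - 1) = Suc (nat (i - 2))" by auto
      then show ?thesis using x z MoveLeft 3 by (auto simp: tape_of_def zact_def cell_simps)
    next
      case 4
      then have "nat (- (i - 1) - 1) = Suc (nat (- i - 1))" by auto
      then show ?thesis using x z MoveLeft 4 by (auto simp: tape_of_def zact_def cell_simps)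
    qed (use x z MoveLeft in \<open>auto simp: tape_of_def zact_def cell_simps\<close>)
  next
    case Stay
    show ?thesis
    proof (cases "0 < i")
      case True
      then show ?thesis using x z Stay S[OF True] by (auto simp: tape_of_def zact_def cell_simps)
    qed (use x z Stay in \<open>auto simp: tape_of_def zact_def cell_simps\<close>)
  next
    case MoveRight
    consider "0 \<le> i" | "i = -1" | "i < -1" by linarith
    then show ?thesis
    proof cases
      case 1
      then have "nat (i + 1) = Suc (nat i)" by auto
      then show ?thesis using x z MoveRight 1 by (auto simp: tape_of_def zact_def cell_simps)
    next
      case 3
      then have "nat (- i - 1) = Suc (nat (- (i + 1) - 1))" by auto
      then show ?thesis using x z MoveRight 3 by (auto simp: tape_of_def zact_def cell_simps)
    qed (use x z MoveRight in \<open>auto simp: tape_of_def zact_def cell_simps\<close>)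
  qed
qed

fun zacts :: "(symbol \<times> symbol \<times> move) list \<Rightarrow> ztape list \<Rightarrow> ztape list" where
  "zacts [] zs = []"
| "zacts (x # xs) zs = zact x (hd zs) # zacts xs (tl zs)"

lemma zacts_map2: "length zs = length xs \<Longrightarrow> zacts xs zs = map2 zact xs zs"
proof (induction xs arbitrary: zs)
  case (Cons x xs)
  then show ?case by (cases zs) auto
qed simp

definition zcur :: "ztape \<Rightarrow> symbol" where "zcur z = head (snd z)"

lemma tape_of_0: "tape_of z 0 = zcur z"
  by (simp add: tape_of_def zcur_def cell_simps)

definition conf_of :: "zconf \<Rightarrow> config" where
  "conf_of c = (fst c, map tape_of (snd c))"

text \<open>The index selects a rule and thereby resolves the nondeterminism. The rule list is a
  constant of the simulation, so the recursion over it can be unfolded when its running time is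
  bounded.\<close>

fun zstep :: "rule list \<Rightarrow> nat \<Rightarrow> zconf \<Rightarrow> bool \<times> zconf" where
  "zstep [] i c = (False, c)"
| "zstep ((q, acts, q') # rs) i c = (if i = 0
     then if fst c = q \<and> map zcur (snd c) = map fst acts then (True, q', zacts acts (snd c)) else (False, c)
     else zstep rs (i - 1) c)"

lemma zstep_nth:
  "zstep rs i c = (if i < length rs then (case rs ! i of (q, acts, q') \<Rightarrow>
     if fst c = q \<and> map zcur (snd c) = map fst acts then (True, q', zacts acts (snd c)) else (False, c)) else (False, c))"
proof (induction rs arbitrary: i)
  case (Cons r rs)
  then show ?case by (cases r; cases i) auto
qed simp

lemma map_eq_length: "map f xs = map g ys \<Longrightarrow> length xs = length ys"
  by (metis length_map)

lemma map_tape_of_zacts: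
  "length zs = length acts \<Longrightarrow> map tape_of (zacts acts zs) = map2 act acts (map tape_of zs)"
  by (rule nth_equalityI) (auto simp: zacts_map2 tape_of_zact simp del: act.simps)

lemma step_zstep:
  assumes "set rs = rules M" "fst c \<noteq> Query"
  shows "step M X (conf_of c) d \<longleftrightarrow> (\<exists>i c'. zstep rs i c = (True, c') \<and> i < length rs \<and> d = conf_of c')"
proof
  assume "step M X (conf_of c) d"
  then show "\<exists>i c'. zstep rs i c = (True, c') \<and> i < length rs \<and> d = conf_of c'"
  proof cases
    case (rule q acts q' ts)
    then have q: "fst c = q" "ts = map tape_of (snd c)" by (auto simp: conf_of_def)
    obtain i where i: "i < length rs" "rs ! i = (q, acts, q')"
      using rule(3) assms(1) by (metis in_set_conv_nth)
    have m: "map zcur (snd c) = map fst acts" using rule(4) q by (simp add: comp_def tape_of_0)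
    have "zstep rs i c = (True, q', zacts acts (snd c))" using i q m by (simp add: zstep_nth)
    moreover have "d = conf_of (q', zacts acts (snd c))"
      using rule(2) q map_tape_of_zacts[of "snd c" acts] map_eq_length[OF m] by (simp add: conf_of_def)
    ultimately show ?thesis using i by blast
  next
    case (query ts w)
    then show ?thesis using assms(2) by (simp add: conf_of_def)
  qed
next
  assume "\<exists>i c'. zstep rs i c = (True, c') \<and> i < length rs \<and> d = conf_of c'"
  then obtain i c' where i: "zstep rs i c = (True, c')" "i < length rs" "d = conf_of c'" by blast
  obtain q acts q' where r: "rs ! i = (q, acts, q')" by (cases "rs ! i")
  then have m: "fst c = q" "map zcur (snd c) = map fst acts" "c' = (q', zacts acts (snd c))"
    using i by (auto simp: zstep_nth split: if_splits)
  have "(q, acts, q') \<in> rules M" using r i(2) assms(1) nth_mem by metis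
  moreover have "map fst acts = map (\<lambda>t. t 0) (map tape_of (snd c))"
    using m(2) by (simp add: comp_def tape_of_0)
  ultimately have "step M X (q, map tape_of (snd c)) (q', map2 act acts (map tape_of (snd c)))"
    by (rule step.rule)
  then show "step M X (conf_of c) d"
    using m i(3) map_tape_of_zacts[of "snd c" acts] map_eq_length[OF m(2)] by (simp add: conf_of_def)
qed

definition zshows :: "ztape \<Rightarrow> word \<Rightarrow> bool" where
  "zshows z q \<longleftrightarrow> take (length q) (snd z) = map Bit q \<and>
     head (drop (length q) (snd z)) \<noteq> Bit True \<and> head (drop (length q) (snd z)) \<noteq> Bit False"

lemma range_Bit: "a \<in> range Bit \<longleftrightarrow> a = Bit True \<or> a = Bit False"
  by (metis (full_types) rangeE rangeI)

lemma zshows: "zshows z q \<longleftrightarrow> shows_word (tape_of z) q"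
proof -
  have "tape_of z (int (length q)) = head (drop (length q) (snd z))"
    by (auto simp: tape_of_def cell_def head_def hd_drop_conv_nth)
  moreover have "take (length q) (snd z) = map Bit q \<longleftrightarrow> (\<forall>i<length q. tape_of z (int i) = Bit (q ! i))"
  proof
    assume t: "take (length q) (snd z) = map Bit q"
    then have "length (take (length q) (snd z)) = length q" by simp
    then have l: "length q \<le> length (snd z)" by simp
    show "\<forall>i<length q. tape_of z (int i) = Bit (q ! i)"
    proof (intro allI impI)
      fix i assume i: "i < length q"
      have "take (length q) (snd z) ! i = Bit (q ! i)" using t i by simp
      then show "tape_of z (int i) = Bit (q ! i)" using l i by (simp add: tape_of_def cell_def)
    qed
  next
    assume a: "\<forall>i<length q. tape_of z (int i) = Bit (q ! i)"
    have c: "cell (snd z) i = Bit (q ! i)" if "i < length q" for i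
      using a that by (auto simp: tape_of_def)
    have l: "length q \<le> length (snd z)"
    proof (rule ccontr)
      assume "\<not> length q \<le> length (snd z)"
      then show False using c[of "length (snd z)"] by (simp add: cell_def)
    qed
    show "take (length q) (snd z) = map Bit q"
      by (rule nth_equalityI) (use l c in \<open>auto simp: cell_def\<close>)
  qed
  ultimately show ?thesis unfolding zshows_def shows_word_def range_Bit by auto
qed

subsection \<open>Transcripts\<close>

text \<open>A transcript entry \<open>(i, q, b, z)\<close> names the rule to be applied or, in the query state, the
  query \<open>q\<close>, its answer \<open>b\<close> and a certificate \<open>z\<close> for a positive answer. Queries with negative
  answers are collected.\<close>

definition gstep :: "(word \<times> 'c \<Rightarrow> bool) \<Rightarrow> rule list \<Rightarrow> bool \<times> zconf \<times> word list \<Rightarrow>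
    nat \<times> word \<times> bool \<times> 'c \<Rightarrow> bool \<times> zconf \<times> word list" where
  "gstep chk rs a e = (if fst (fst (snd a)) = Query
     then (fst a \<and> zshows (hd (tl (snd (fst (snd a))))) (fst (snd e)) \<and>
             (fst (snd (snd e)) \<longrightarrow> chk (fst (snd e), snd (snd (snd e)))),
           (if fst (snd (snd e)) then Yes else No, snd (fst (snd a))),
           if fst (snd (snd e)) then snd (snd a) else fst (snd e) # snd (snd a))
     else (fst a \<and> fst (zstep rs (fst e) (fst (snd a))), snd (zstep rs (fst e) (fst (snd a))), snd (snd a)))"

lemma ptime_head [ptime_intros]: "ptime f \<Longrightarrow> ptime (\<lambda>x. head (f x))"
  unfolding head_def by (intro ptime_intros)

lemma ptime_zact [ptime_intros]:
  assumes "ptime f"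
  shows "ptime (\<lambda>x. zact (a, b, m) (f x))"
  unfolding zact_def prod.case by (intro ptime_intros assms)

lemma ptime_zacts [ptime_intros]:
  assumes "ptime f"
  shows "ptime (\<lambda>x. zacts acts (f x))"
  using assms
proof (induction acts arbitrary: f)
  case (Cons x xs)
  obtain a b m where x: "x = (a, b, m)" by (cases x)
  show ?case unfolding zacts.simps x by (intro ptime_intros Cons)
qed (simp add: ptime_const)

lemma ptime_zstep [ptime_intros]:
  assumes "ptime f" "ptime g"
  shows "ptime (\<lambda>x. zstep rs (f x) (g x))"
  using assms
proof (induction rs arbitrary: f)
  case Nil
  then show ?case unfolding zstep.simps by (intro ptime_intros)
next
  case (Cons r rs)
  obtain q acts q' where r: "r = (q, acts, q')" by (cases r)
  show ?case unfolding r zstep.simps zcur_def by (intro ptime_intros Cons)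
qed

lemma ptime_zshows [ptime_intros]:
  assumes "ptime f" "ptime g"
  shows "ptime (\<lambda>x. zshows (f x) (g x))"
  unfolding zshows_def by (intro ptime_intros assms)

lemma ptime_gstep:
  assumes "ptime chk"
  shows "ptime (\<lambda>p. gstep chk rs (fst (snd p)) (snd (snd p)))"
  unfolding gstep_def by (intro ptime_intros ptime_comp[OF _ assms])

text \<open>A move uncovers at most one cell that was not yet represented; hence the summand for
  \<open>Blank\<close>.\<close>

lemma tsz_zact: "tsz (zact (a, b, m) z) \<le> tsz z + (tsz b + tsz Blank + 2)"
proof -
  obtain l r where z: "z = (l, r)" by (cases z)
  have 1: "tsz (tl r) \<le> tsz r" by (rule tsz_tl)
  have 2: "tsz (tl l) + tsz (head l) \<le> tsz l + tsz Blank" by (cases l) (auto simp: head_def)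
  show ?thesis
  proof (cases m)
    case MoveLeft
    then show ?thesis using 1 2 z by (simp add: zact_def)
  qed (use 1 2 z in \<open>auto simp: zact_def\<close>)
qed

lemma tsz_zacts: "\<exists>C. \<forall>zs. length zs = length acts \<longrightarrow> tsz (zacts acts zs) \<le> tsz zs + C"
proof (induction acts)
  case (Cons x xs)
  then obtain C where C: "\<And>zs. length zs = length xs \<Longrightarrow> tsz (zacts xs zs) \<le> tsz zs + C" by blast
  obtain a b m where x: "x = (a, b, m)" by (cases x)
  have "tsz (zacts (x # xs) zs) \<le> tsz zs + (C + (tsz b + tsz Blank + 2))" if len: "length zs = length (x # xs)" for zs
  proof -
    obtain y ys where "zs = y # ys" using len by (cases zs) auto
    then show ?thesis using len C[of ys] tsz_zact[of a b m y] x by simp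
  qed
  then show ?case by blast
qed auto

lemma tsz_zstep: "\<exists>C. \<forall>i c. tsz (snd (zstep rs i c)) \<le> tsz c + C"
proof (induction rs)
  case (Cons r rs)
  then obtain C where C: "\<And>i c. tsz (snd (zstep rs i c)) \<le> tsz c + C" by blast
  obtain q acts q' where r: "r = (q, acts, q')" by (cases r)
  obtain D where D: "\<And>zs. length zs = length acts \<Longrightarrow> tsz (zacts acts zs) \<le> tsz zs + D"
    using tsz_zacts by blast
  have "tsz (snd (zstep (r # rs) i c)) \<le> tsz c + (C + D + tsz q')" for i c
  proof -
    have "tsz (zacts acts (snd c)) \<le> tsz (snd c) + D" if "map zcur (snd c) = map fst acts"
      using D map_eq_length[OF that] by simp
    then show ?thesis using C[of "i - 1" c] by (cases c) (auto simp: r)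
  qed
  then show ?case by blast
qed auto

text \<open>The whole state also grows by collected queries, as long as the transcript entry makes
  them; the simulated configuration alone grows by a constant per step. The second bound limits the
  size of transcripts of real runs.\<close>

lemma tsz_gstep:
  obtains C where "\<And>a e. tsz (gstep chk rs a e) \<le> tsz a + (tsz (fst (snd e)) + C)"
    "\<And>a e. tsz (fst (snd (gstep chk rs a e))) \<le> tsz (fst (snd a)) + C"
proof -
  obtain C where C: "\<And>i c. tsz (snd (zstep rs i c)) \<le> tsz c + C" using tsz_zstep by blast
  have 2: "tsz (fst (snd (gstep chk rs a e))) \<le> tsz (fst (snd a)) + (C + tsz Yes + tsz No)" for a e
    using C[of "fst e" "fst (snd a)"] by (cases "fst (snd a)") (auto simp: gstep_def)
  have 3: "tsz (snd (snd (gstep chk rs a e))) \<le> tsz (snd (snd a)) + (tsz (fst (snd e)) + 1)" for a e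
    by (auto simp: gstep_def)
  have 4: "tsz p = 2 + tsz (fst p) + tsz (fst (snd p)) + tsz (snd (snd p))" for p :: "bool \<times> zconf \<times> word list"
    by (cases p; simp)
  have "tsz (gstep chk rs a e) \<le> tsz a + (tsz (fst (snd e)) + (C + tsz Yes + tsz No + 4))" for a e
    using 2[of a e] 3[of a e] tsz_bool[of "fst (gstep chk rs a e)"] unfolding 4 by linarith
  then show ?thesis using 2 that by (meson add_le_mono le_add1 order_refl order_trans)
qed

definition gsim :: "(word \<times> 'c \<Rightarrow> bool) \<Rightarrow> rule list \<Rightarrow> zconf \<Rightarrow> (nat \<times> word \<times> bool \<times> 'c) list \<Rightarrow>
    bool \<times> zconf \<times> word list" where
  "gsim chk rs c es = foldl (gstep chk rs) (True, c, []) es"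

lemma ptime_gsim [ptime_intros]:
  fixes chk :: "word \<times> 'c::enc \<Rightarrow> bool" and f :: "'a::enc \<Rightarrow> zconf"
  assumes "ptime chk" "ptime f" "ptime g"
  shows "ptime (\<lambda>x. gsim chk rs (f x) (g x))"
  unfolding gsim_def
proof -
  obtain C where C: "\<And>a e. tsz (gstep chk rs a e) \<le> tsz a + (tsz (fst (snd e)) + C)"
    using tsz_gstep by metis
  show "ptime (\<lambda>x. foldl (gstep chk rs) (True, f x, []) (g x))"
  proof (rule ptime_foldl[where c="[:C, 1:]"])
    show "tsz (gstep chk rs a y) \<le> tsz a + poly [:C, 1:] (tsz x + tsz y)" for x :: 'a and a y
    proof -
      have "tsz (fst (snd y)) \<le> tsz y" by (cases y) auto
      then show ?thesis using C[of a y] by simp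
    qed
  qed (intro ptime_gstep ptime_intros assms)+
qed

lemma length_zstep:
  "length (snd (snd (zstep rs i c))) = length (snd c)"
proof (induction rs arbitrary: i)
  case (Cons r rs)
  have "length (zacts acts zs) = length acts" for acts zs by (induction acts arbitrary: zs) auto
  then show ?case using Cons by (cases r) (auto dest: map_eq_length)
qed simp

lemma gsim_length: "length (snd (fst (snd (gsim chk rs c es)))) = length (snd c)"
  by (induction es rule: rev_induct) (auto simp: gsim_def gstep_def length_zstep)

text \<open>Positive answers are backed by certificates and negative ones by the assumption on
  \<open>Qs\<close>, so every recorded answer is that of the oracle.\<close>

lemma gsim_sound:
  assumes M: "set rs = rules M" and chk: "\<And>q z. chk (q, z) \<Longrightarrow> q \<in> X" and c: "2 \<le> length (snd c)"
    and g: "gsim chk rs c es = (True, d, Qs)" "\<forall>q\<in>set Qs. q \<notin> X"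
  shows "\<exists>k. computation M X (conf_of c) (length es) k (conf_of d)"
  using g
proof (induction es arbitrary: d Qs rule: rev_induct)
  case Nil
  then show ?case using computation.refl[of M X "conf_of d"] by (auto simp: gsim_def)
next
  case (snoc e es)
  obtain ok d' Qs' where g': "gsim chk rs c es = (ok, d', Qs')" by (cases "gsim chk rs c es")
  have s: "gstep chk rs (ok, d', Qs') e = (True, d, Qs)" using snoc.prems(1) g' by (simp add: gsim_def)
  then have ok: "ok" by (auto simp: gstep_def split: if_splits)
  have sub: "set Qs' \<subseteq> set Qs" using s by (auto simp: gstep_def split: if_splits)
  obtain k where k: "computation M X (conf_of c) (length es) k (conf_of d')"
    using snoc.IH[of d' Qs'] g' ok sub snoc.prems(2) by auto
  have "step M X (conf_of d') (conf_of d)"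
  proof (cases "fst d' = Query")
    case False
    then have "zstep rs (fst e) d' = (True, d)" using s by (cases "zstep rs (fst e) d'") (auto simp: gstep_def)
    moreover from this have "fst e < length rs" by (auto simp: zstep_nth split: if_splits)
    ultimately show ?thesis using step_zstep[OF M False, of X "conf_of d"] by blast
  next
    case True
    obtain i q b z where e: "e = (i, q, b, z)" by (cases e)
    have l: "2 \<le> length (snd d')" using gsim_length[of chk rs c es] g' c by simp
    then obtain z0 z1 zs where d': "d' = (Query, z0 # z1 # zs)"
      using True by (cases d'; cases "snd d'" rule: list.exhaust[case_product list.exhaust[of "tl (snd d')"]]) auto
    have q: "zshows z1 q" "b \<longrightarrow> chk (q, z)" "d = (if b then Yes else No, snd d')" "\<not> b \<longrightarrow> q \<in> set Qs"
      using s e d' by (auto simp: gstep_def split: if_splits)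
    have "b \<longleftrightarrow> q \<in> X" using q chk snoc.prems(2) by auto
    moreover have "step M X (Query, map tape_of (snd d')) (if q \<in> X then Yes else No, map tape_of (snd d'))"
      by (rule step.query) (use q(1) d' in \<open>simp add: zshows\<close>)
    ultimately show ?thesis using q(3) d' by (simp add: conf_of_def)
  qed
  from computation.step[OF k this] show ?case by (auto simp del: fst_conv)
qed

text \<open>A run is recorded step by step. Its configurations grow by at most \<open>C\<close> per
  step, which bounds the queries that stand on the tape and, through \<open>r\<close>, their
  certificates.\<close>

lemma gsim_complete:
  fixes chk :: "word \<times> 'c::enc \<Rightarrow> bool"
  assumes M: "set rs = rules M" "is_tm M" and c: "2 \<le> length (snd c)"
    and chk: "\<And>q. q \<in> X \<Longrightarrow> \<exists>z. chk (q, z) \<and> tsz z \<le> poly r (length q)"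
    and C: "\<And>a e. tsz (fst (snd (gstep chk rs a e))) \<le> tsz (fst (snd a)) + C"
    and comp: "computation M X (conf_of c) n k d"
  shows "\<exists>es d' Qs. length es = n \<and> gsim chk rs c es = (True, d', Qs) \<and> d = conf_of d' \<and> (\<forall>q\<in>set Qs. q \<notin> X) \<and>
    tsz d' \<le> tsz c + n * C \<and>
    (\<forall>e\<in>set es. tsz e \<le> 2 * length rs + 8 + 4 * (tsz c + n * C) + tsz (undefined :: 'c) + poly r (tsz c + n * C) + tsz (undefined::word))"
  using comp
proof (induction rule: computation.induct)
  case refl
  show ?case by (intro exI[of _ "[]"] exI[of _ c]) (auto simp: gsim_def)
next
  case (step n k d d')
  let ?E = "\<lambda>n. 2 * length rs + 8 + 4 * (tsz c + n * C) + tsz (undefined :: 'c) + poly r (tsz c + n * C) + tsz (undefined::word)"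
  have mono: "?E n \<le> ?E (Suc n)" by (intro add_mono mult_le_mono poly_mono_nat order_refl) auto
  from step.IH obtain es c1 Qs where IH: "length es = n" "gsim chk rs c es = (True, c1, Qs)" "d = conf_of c1"
    "\<forall>q\<in>set Qs. q \<notin> X" "tsz c1 \<le> tsz c + n * C" "\<forall>e\<in>set es. tsz e \<le> ?E n" by blast
  have "\<exists>e c2 Qs'. gstep chk rs (True, c1, Qs) e = (True, c2, Qs') \<and> d' = conf_of c2 \<and>
      (\<forall>q\<in>set Qs'. q \<notin> X) \<and> tsz e \<le> ?E n"
  proof (cases "fst c1 = Query")
    case False
    obtain i c2 where i: "zstep rs i c1 = (True, c2)" "i < length rs" "d' = conf_of c2"
      using step.hyps(2) step_zstep[OF M(1) False, of X d'] IH(3) by blast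
    \<comment> \<open>An ordinary step reads only the rule index; the other components are filled
      with defaults, whose sizes are the constants in \<open>?E\<close>.\<close>
    have "gstep chk rs (True, c1, Qs) (i, undefined, False, undefined) = (True, c2, Qs)"
      using i False by (simp add: gstep_def)
    moreover have "tsz (i, undefined :: word, False, undefined :: 'c) \<le> ?E n" using i(2) by simp
    ultimately show ?thesis using i(3) IH(4) by blast
  next
    case True
    have l: "2 \<le> length (snd c1)" using gsim_length[of chk rs c es] IH(2) c by simp
    then obtain z0 z1 zs where c1: "c1 = (Query, z0 # z1 # zs)"
      using True by (cases c1; cases "snd c1" rule: list.exhaust[case_product list.exhaust[of "tl (snd c1)"]]) auto
    have "step M X (conf_of c1) d'" using step.hyps(2) IH(3) by simp
    then obtain q where q: "shows_word (tape_of z1) q" "d' = (if q \<in> X then Yes else No, map tape_of (snd c1))"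
    proof cases
      case (rule q acts q' ts)
      then have "(Query, acts, q') \<in> rules M" using c1 by (simp add: conf_of_def)
      then show ?thesis using M(2) unfolding is_tm_def by auto
    next
      case (query ts w)
      then show ?thesis using that[of w] c1 by (auto simp: conf_of_def)
    qed
    have zs: "zshows z1 q" using q(1) by (simp add: zshows)
    \<comment> \<open>The query stands on tape 1, so the size of the configuration bounds its
      length.\<close>
    then have "length q \<le> length (snd z1)"
      unfolding zshows_def by (metis length_map length_take min.absorb_iff2 min.commute)
    also have "\<dots> \<le> tsz c1" using length_le_tsz[of "snd z1"] by (cases z1) (simp add: c1)
    finally have lq: "length q \<le> tsz c + n * C" using IH(5) by simp
    obtain z where z: "q \<in> X \<Longrightarrow> chk (q, z)" "tsz z \<le> tsz (undefined :: 'c) + poly r (length q)"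
    proof (cases "q \<in> X")
      case True
      then show ?thesis using chk[OF True] that by (auto intro: trans_le_add2)
    next
      case False
      then show ?thesis using that[of undefined] by simp
    qed
    let ?e = "(0 :: nat, q, q \<in> X, z)"
    have "gstep chk rs (True, c1, Qs) ?e = (True, (if q \<in> X then Yes else No, snd c1), if q \<in> X then Qs else q # Qs)"
      using zs z(1) c1 by (simp add: gstep_def)
    moreover have "tsz ?e \<le> ?E n"
      using z(2) lq poly_mono_nat[OF lq, of r] tsz_word[of q] tsz_bool[of "q \<in> X"] by simp
    moreover have "d' = conf_of (if q \<in> X then Yes else No, snd c1)" using q(2) by (simp add: conf_of_def)
    moreover have "\<forall>x\<in>set (if q \<in> X then Qs else q # Qs). x \<notin> X" using IH(4) by simp
    ultimately show ?thesis by blast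
  qed
  then obtain e c2 Qs' where e: "gstep chk rs (True, c1, Qs) e = (True, c2, Qs')" "d' = conf_of c2"
    "\<forall>q\<in>set Qs'. q \<notin> X" "tsz e \<le> ?E n" by blast
  have 1: "gsim chk rs c (es @ [e]) = (True, c2, Qs')" using IH(2) e(1) by (simp add: gsim_def)
  have 2: "tsz c2 \<le> tsz c + Suc n * C" using C[of "(True, c1, Qs)" e] e(1) IH(5) by simp
  have 3: "\<forall>x\<in>set (es @ [e]). tsz x \<le> ?E (Suc n)" using IH(6) e(4) mono by fastforce
  have 4: "length (es @ [e]) = Suc n" using IH(1) by simp
  show ?case using 1 2 3 4 e(2,3) by blast
qed

definition zinit :: "nat \<Rightarrow> word \<Rightarrow> zconf" where
  "zinit K w = (Start, ([], map Bit w) # replicate (K - 1) ([], []))"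

lemma zinit: "conf_of (zinit (tapes M) w) = initial M w"
proof -
  have "tape_of ([], map Bit w) = word_tape w" for w
    by (auto simp: tape_of_def cell_def word_tape_def fun_eq_iff)
  from this this[of "[]"] show ?thesis by (simp add: conf_of_def zinit_def initial_def)
qed

lemma ptime_zinit [ptime_intros]:
  assumes "ptime f"
  shows "ptime (\<lambda>x. zinit K (f x))"
  unfolding zinit_def by (intro ptime_intros assms)

lemma accepts_gsim:
  fixes chk :: "word \<times> 'c::enc \<Rightarrow> bool"
  assumes M: "is_tm M" "poly_time M X" and chk: "\<And>q z. chk (q, z) \<Longrightarrow> q \<in> X"
    "\<And>q. q \<in> X \<Longrightarrow> \<exists>z. chk (q, z) \<and> tsz z \<le> poly r (length q)"
  obtains rs s where
    "\<And>w es d Qs. gsim chk rs (zinit (tapes M) w) es = (True, (Accept, d), Qs) \<Longrightarrow> \<forall>q\<in>set Qs. q \<notin> X \<Longrightarrow> accepts M X w"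
    "\<And>w. accepts M X w \<Longrightarrow> \<exists>es d Qs. tsz es \<le> poly s (length w) \<and>
       gsim chk rs (zinit (tapes M) w) es = (True, (Accept, d), Qs) \<and> (\<forall>q\<in>set Qs. q \<notin> X)"
proof -
  have "finite (rules M)" using M(1) by (simp add: is_tm_def)
  then obtain rs where rs: "set rs = rules M" using finite_list by blast
  have K: "2 \<le> length (snd (zinit (tapes M) w))" for w using M(1) by (simp add: is_tm_def zinit_def)
  obtain C where C: "\<And>a e. tsz (fst (snd (gstep chk rs a e))) \<le> tsz (fst (snd a)) + C"
    using tsz_gstep by metis
  obtain p where p: "\<And>w n k c. computation M X (initial M w) n k c \<Longrightarrow> n \<le> poly p (length w)"
    using M(2) unfolding poly_time_def by blast
  have "ptime (zinit (tapes M))" by (intro ptime_intros)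
  then obtain p0 where p0: "\<And>w. tsz (zinit (tapes M) w) \<le> poly p0 (tsz w)" using ptime_tsz by blast
  \<comment> \<open>\<open>B\<close> bounds the size of configurations and \<open>E\<close> that of
    transcript entries; the inner polynomial 4 n + 1 bounds the code of a word of length n.\<close>
  define B where "B = pcompose p0 [:1, 4:] + smult C p"
  define E where "E = [:2 * length rs + 8 + tsz (undefined :: 'c) + tsz (undefined::word):] + smult 4 B + pcompose r B"
  have "accepts M X w" if "gsim chk rs (zinit (tapes M) w) es = (True, (Accept, d), Qs)" "\<forall>q\<in>set Qs. q \<notin> X" for w es d Qs
  proof -
    have "\<exists>k. computation M X (conf_of (zinit (tapes M) w)) (length es) k (conf_of (Accept, d))"
      by (rule gsim_sound[OF rs _ K that]) (use chk(1) in auto)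
    moreover have "conf_of (Accept, d) = (Accept, map tape_of d)" by (simp add: conf_of_def)
    ultimately show ?thesis unfolding accepts_def zinit by metis
  qed
  moreover have "\<exists>es d Qs. tsz es \<le> poly (p * (E + 1) + 1) (length w) \<and>
       gsim chk rs (zinit (tapes M) w) es = (True, (Accept, d), Qs) \<and> (\<forall>q\<in>set Qs. q \<notin> X)"
    if acc: "accepts M X w" for w
  proof -
    obtain n k ts where comp: "computation M X (conf_of (zinit (tapes M) w)) n k (Accept, ts)"
      using acc unfolding accepts_def zinit by blast
    obtain es d Qs where es: "length es = n" "gsim chk rs (zinit (tapes M) w) es = (True, d, Qs)"
      "(Accept, ts) = conf_of d" "\<forall>q\<in>set Qs. q \<notin> X"
      "\<forall>e\<in>set es. tsz e \<le> 2 * length rs + 8 + 4 * (tsz (zinit (tapes M) w) + n * C) + tsz (undefined :: 'c) +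
        poly r (tsz (zinit (tapes M) w) + n * C) + tsz (undefined::word)"
      using gsim_complete[OF rs M(1) K chk(2) C comp] by blast
    have n: "n \<le> poly p (length w)" using p comp unfolding zinit by blast
    have "poly p0 (tsz w) \<le> poly p0 (4 * length w + 1)" by (rule poly_mono_nat[OF tsz_word])
    moreover have "n * C \<le> poly p (length w) * C" by (rule mult_le_mono1[OF n])
    moreover have "poly B (length w) = poly p0 (4 * length w + 1) + poly p (length w) * C"
      by (simp add: B_def poly_pcompose algebra_simps)
    ultimately have B: "tsz (zinit (tapes M) w) + n * C \<le> poly B (length w)"
      using p0[of w] by linarith
    have "tsz e \<le> poly E (length w)" if "e \<in> set es" for e
    proof -
      have "tsz e \<le> 2 * length rs + 8 + 4 * (tsz (zinit (tapes M) w) + n * C) + tsz (undefined :: 'c) +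
        poly r (tsz (zinit (tapes M) w) + n * C) + tsz (undefined::word)" using es(5) that by blast
      also have "\<dots> \<le> 2 * length rs + 8 + 4 * poly B (length w) + tsz (undefined :: 'c) +
        poly r (poly B (length w)) + tsz (undefined::word)"
        by (intro add_mono mult_le_mono poly_mono_nat B order_refl)
      finally show ?thesis by (simp add: E_def poly_pcompose)
    qed
    then have "tsz es \<le> length es * Suc (poly E (length w)) + 1" by (rule tsz_list_le)
    also have "\<dots> \<le> poly p (length w) * Suc (poly E (length w)) + 1"
      using n es(1) by (simp del: mult_Suc_right)
    finally have "tsz es \<le> poly (p * (E + 1) + 1) (length w)" by simp
    moreover have "d = (Accept, snd d)" using es(3) by (cases d) (simp add: conf_of_def)
    ultimately show ?thesis using es(2,4) by metis
  qed
  ultimately show ?thesis using that by blast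
qed

subsection \<open>Normal forms\<close>

text \<open>The certificate is the padded transcript of an accepting run. With the empty oracle no
  positive answer can be certified, and all negative answers are correct.\<close>

lemma NP_bits:
  assumes "A \<in> NP"
  obtains R :: "word \<times> word \<Rightarrow> bool" and q where "ptime R" "\<And>w. w \<in> A \<longleftrightarrow> (\<exists>y. length y = poly q (length w) \<and> R (w, y))"
proof -
  obtain M where M: "is_tm M" "poly_time M {}" "decides M {} A" using assms unfolding NP_def by blast
  let ?chk = "\<lambda>x :: word \<times> unit. False"
  obtain rs s where
    s1: "\<And>w es d Qs. gsim ?chk rs (zinit (tapes M) w) es = (True, (Accept, d), Qs) \<Longrightarrow> \<forall>q\<in>set Qs. q \<notin> {} \<Longrightarrow> accepts M {} w"
    and s2: "\<And>w. accepts M {} w \<Longrightarrow> \<exists>es d Qs. tsz es \<le> poly s (length w) \<and>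
       gsim ?chk rs (zinit (tapes M) w) es = (True, (Accept, d), Qs) \<and> (\<forall>q\<in>set Qs. q \<notin> {})"
    using accepts_gsim[OF M(1,2), of ?chk 0] by blast
  define g where "g p = gsim ?chk rs (zinit (tapes M) (fst p)) (unt (parse (snd p)))" for p :: "word \<times> word"
  define R where "R p \<longleftrightarrow> fst (g p) \<and> fst (fst (snd (g p))) = Accept" for p
  have "ptime R" unfolding R_def g_def by (intro ptime_intros)
  moreover have "w \<in> A \<longleftrightarrow> (\<exists>y. length y = poly s (length w) \<and> R (w, y))" for w
  proof
    assume "w \<in> A"
    then obtain es d Qs where es: "tsz es \<le> poly s (length w)"
      "gsim ?chk rs (zinit (tapes M) w) es = (True, (Accept, d), Qs)"
      using M(3) s2 unfolding decides_def by blast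
    let ?y = "cd es @ replicate (poly s (length w) - tsz es) False"
    have "length ?y = poly s (length w)" "R (w, ?y)" using es by (simp_all add: R_def g_def parse_code)
    then show "\<exists>y. length y = poly s (length w) \<and> R (w, y)" by blast
  next
    assume "\<exists>y. length y = poly s (length w) \<and> R (w, y)"
    then obtain y where "R (w, y)" by blast
    then have "gsim ?chk rs (zinit (tapes M) w) (unt (parse y)) =
        (True, (Accept, snd (fst (snd (g (w, y))))), snd (snd (g (w, y))))"
      by (simp add: R_def g_def prod_eq_iff)
    from s1[OF this] show "w \<in> A" using M(3) unfolding decides_def by simp
  qed
  ultimately show ?thesis using that by blast
qed

text \<open>\<open>y\<close> is a transcript that certifies its positive answers. A negative answer
  means that no certificate exists; as \<open>z\<close>, cut to the right length, runs through all
  possible certificates of every collected query, one universal quantifier covers all negative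
  answers.\<close>

lemma Sigma2_bits:
  assumes "A \<in> NP_oracle NP"
  obtains R :: "word \<times> word \<times> word \<Rightarrow> bool" and p q where "ptime R" "\<And>w. w \<in> A \<longleftrightarrow>
    (\<exists>y. length y = poly p (length w) \<and> (\<forall>z. length z = poly q (length w) \<longrightarrow> \<not> R (w, y, z)))"
proof -
  obtain X M where X: "X \<in> NP" and M: "is_tm M" "poly_time M X" "decides M X A"
    using assms unfolding NP_oracle_def by blast
  obtain S :: "word \<times> word \<Rightarrow> bool" and r where S: "ptime S" "\<And>w. w \<in> X \<longleftrightarrow> (\<exists>y. length y = poly r (length w) \<and> S (w, y))"
    using NP_bits[OF X] by metis
  define chk where "chk p \<longleftrightarrow> length (snd p) = poly r (length (fst p)) \<and> S p" for p :: "word \<times> word"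
  have chk: "ptime chk" unfolding chk_def by (intro ptime_intros ptime_comp[OF _ S(1)])
  have c1: "q \<in> X" if "chk (q, z)" for q z using that S(2) by (auto simp: chk_def)
  have c2: "\<exists>z. chk (q, z) \<and> tsz z \<le> poly (smult 4 r + 1) (length q)" if q: "q \<in> X" for q
  proof -
    obtain z where z: "length z = poly r (length q)" "S (q, z)" using S(2) q by blast
    have "tsz z \<le> poly (smult 4 r + 1) (length q)" using tsz_word[of z] z(1) by simp
    then show ?thesis using z by (auto simp: chk_def)
  qed
  obtain rs s where
    s1: "\<And>w es d Qs. gsim chk rs (zinit (tapes M) w) es = (True, (Accept, d), Qs) \<Longrightarrow> \<forall>q\<in>set Qs. q \<notin> X \<Longrightarrow> accepts M X w"
    and s2: "\<And>w. accepts M X w \<Longrightarrow> \<exists>es d Qs. tsz es \<le> poly s (length w) \<and>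
       gsim chk rs (zinit (tapes M) w) es = (True, (Accept, d), Qs) \<and> (\<forall>q\<in>set Qs. q \<notin> X)"
    by (rule accepts_gsim[OF M(1,2), of chk "smult 4 r + 1"]) (erule c1 | erule c2 | blast)+
  define g where "g p = gsim chk rs (zinit (tapes M) (fst p)) (unt (parse (snd p)))" for p :: "word \<times> word"
  define Q where "Q p = snd (snd (g p))" for p
  have g: "ptime g" unfolding g_def by (intro ptime_intros chk)
  have "ptime Q" unfolding Q_def by (intro ptime_intros g)
  then obtain l where l: "\<And>p. tsz (Q p) \<le> poly l (tsz p)" using ptime_tsz by blast
  \<comment> \<open>Certificates of collected queries are at most this long: the inner polynomial
    bounds the size of the pair of input and transcript, \<open>l\<close> the list of collected
    queries, and \<open>r\<close> a certificate.\<close>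
  define L where "L = pcompose r (pcompose l ([:3, 4:] + smult 4 s))"
  define R where "R p \<longleftrightarrow> \<not> fst (g (fst p, fst (snd p))) \<or> fst (fst (snd (g (fst p, fst (snd p))))) \<noteq> Accept \<or>
     (\<exists>q\<in>set (Q (fst p, fst (snd p))). S (q, take (poly r (length q)) (snd (snd p))))" for p
  have gc: "ptime f \<Longrightarrow> ptime (\<lambda>x. g (f x))" "ptime f \<Longrightarrow> ptime (\<lambda>x. Q (f x))" "ptime h \<Longrightarrow> ptime (\<lambda>x. S (h x))"
    for f :: "'a::enc \<Rightarrow> word \<times> word" and h :: "'b::enc \<Rightarrow> word \<times> word"
    using ptime_comp[OF _ g] ptime_comp[OF _ \<open>ptime Q\<close>] ptime_comp[OF _ S(1)] by blast+
  have "ptime R" unfolding R_def by (intro ptime_intros gc)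
  moreover have "w \<in> A \<longleftrightarrow> (\<exists>y. length y = poly s (length w) \<and> (\<forall>z. length z = poly L (length w) \<longrightarrow> \<not> R (w, y, z)))" for w
  proof -
    have len: "poly r (length q) \<le> poly L (length w)" if "length y = poly s (length w)" "q \<in> set (Q (w, y))" for y q
    proof -
      have "length q \<le> tsz (Q (w, y))" using length_le_tsz_word[of q] tsz_mem[OF that(2)] by simp
      also have "\<dots> \<le> poly l (tsz (w, y))" by (rule l)
      also have "\<dots> \<le> poly l (3 + 4 * length w + 4 * poly s (length w))"
        by (rule poly_mono_nat) (use tsz_word[of w] tsz_word[of y] that(1) in simp)
      finally have "poly r (length q) \<le> poly r (poly l (3 + 4 * length w + 4 * poly s (length w)))"
        by (rule poly_mono_nat)
      then show ?thesis by (simp add: L_def poly_pcompose algebra_simps)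
    qed
    have noX: "(\<forall>z. length z = poly L (length w) \<longrightarrow> (\<forall>q\<in>set (Q (w, y)). \<not> S (q, take (poly r (length q)) z))) \<longleftrightarrow>
       (\<forall>q\<in>set (Q (w, y)). q \<notin> X)" if y: "length y = poly s (length w)" for y
    proof
      assume a: "\<forall>z. length z = poly L (length w) \<longrightarrow> (\<forall>q\<in>set (Q (w, y)). \<not> S (q, take (poly r (length q)) z))"
      show "\<forall>q\<in>set (Q (w, y)). q \<notin> X"
      proof (intro ballI notI)
        fix q assume q: "q \<in> set (Q (w, y))" "q \<in> X"
        then obtain z where z: "length z = poly r (length q)" "S (q, z)" using S(2) by blast
        let ?z = "z @ replicate (poly L (length w) - length z) False"
        have "length ?z = poly L (length w)" using len[OF y q(1)] z(1) by simp
        then show False using a q(1) z by (metis append_eq_conv_conj)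
      qed
    next
      assume "\<forall>q\<in>set (Q (w, y)). q \<notin> X"
      then show "\<forall>z. length z = poly L (length w) \<longrightarrow> (\<forall>q\<in>set (Q (w, y)). \<not> S (q, take (poly r (length q)) z))"
        using len[OF y] S(2) by (metis length_take min.absorb2)
    qed
    have ex: "\<exists>z :: word. length z = poly L (length w)" using Ex_list_of_length by blast
    show ?thesis
    proof
      assume "w \<in> A"
      then obtain es d Qs where es: "tsz es \<le> poly s (length w)"
        "gsim chk rs (zinit (tapes M) w) es = (True, (Accept, d), Qs)" "\<forall>q\<in>set Qs. q \<notin> X"
        using M(3) s2 unfolding decides_def by blast
      let ?y = "cd es @ replicate (poly s (length w) - tsz es) False"
      have y: "length ?y = poly s (length w)" "g (w, ?y) = (True, (Accept, d), Qs)"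
        using es by (simp_all add: g_def parse_code)
      then have "\<forall>z. length z = poly L (length w) \<longrightarrow> \<not> R (w, ?y, z)"
        using noX[OF y(1)] es(3) by (simp add: R_def Q_def)
      with y(1) show "\<exists>y. length y = poly s (length w) \<and> (\<forall>z. length z = poly L (length w) \<longrightarrow> \<not> R (w, y, z))"
        by blast
    next
      assume "\<exists>y. length y = poly s (length w) \<and> (\<forall>z. length z = poly L (length w) \<longrightarrow> \<not> R (w, y, z))"
      then obtain y where y: "length y = poly s (length w)" "\<And>z. length z = poly L (length w) \<Longrightarrow> \<not> R (w, y, z)" by blast
      \<comment> \<open>Validity of the transcript does not depend on \<open>z\<close>, but some
        word of the right length is needed to read it off.\<close>
      obtain z0 :: word where "length z0 = poly L (length w)" using ex by blast
      then have g': "fst (g (w, y))" "fst (fst (snd (g (w, y)))) = Accept" using y(2)[of z0] by (auto simp: R_def)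
      have "\<forall>q\<in>set (Q (w, y)). q \<notin> X" using y(2) noX[OF y(1)] by (simp add: R_def)
      moreover have "gsim chk rs (zinit (tapes M) w) (unt (parse y)) =
        (True, (Accept, snd (fst (snd (g (w, y))))), Q (w, y))"
        using g' by (simp add: g_def Q_def prod_eq_iff)
      ultimately show "w \<in> A" using s1 M(3) unfolding decides_def by blast
    qed
  qed
  ultimately show ?thesis using that by blast
qed

section \<open>Propositional formulas for polynomial-time functions\<close>

text \<open>The recursion of \<open>code\<close> is turned into an iteration on a list of pending
  trees, so that the size of the state stays linear in that of the input.\<close>

definition code_step :: "tree list \<times> word \<Rightarrow> tree list \<times> word" where
  "code_step p = (if fst p = [] then p
     else if hd (fst p) = Lf then (tl (fst p), False # snd p)
     else (lft (hd (fst p)) # rgt (hd (fst p)) # tl (fst p), True # snd p))"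

lemma code_step_code: "(code_step ^^ csize t) (t # ts, u) = (ts, rev (code t) @ u)"
proof (induction t arbitrary: ts u)
  case (Nd l r)
  have "csize (Nd l r) = csize r + csize l + 1" by simp
  then have "(code_step ^^ csize (Nd l r)) (Nd l r # ts, u) =
     (code_step ^^ csize r) ((code_step ^^ csize l) (code_step (Nd l r # ts, u)))"
    by (simp only: funpow_add comp_def) simp
  also have "code_step (Nd l r # ts, u) = (l # r # ts, True # u)" by (simp add: code_step_def)
  finally show ?case using Nd by simp
qed (simp add: code_step_def)

lemma code_step_Nil: "(code_step ^^ n) ([], u) = ([], u)"
  by (induction n) (auto simp: code_step_def)

lemma code_step_size:
  "nodes (tr (fst (code_step p))) \<le> nodes (tr (fst p)) \<and> length (snd (code_step p)) \<le> Suc (length (snd p))"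
proof -
  obtain ts u where p: "p = (ts, u)" by (cases p)
  show ?thesis
  proof (cases ts)
    case (Cons t ts')
    then show ?thesis using p by (cases t) (auto simp: code_step_def)
  qed (auto simp: p code_step_def)
qed

lemma ptime_code [ptime_intros]:
  assumes "ptime f"
  shows "ptime (\<lambda>x. code (f x))"
proof -
  have s: "ptime code_step" unfolding code_step_def
    by (intro ptime_intros ptime_lft' ptime_rgt')
  have size: "nodes (tr (fst ((code_step ^^ i) p))) \<le> nodes (tr (fst p)) \<and>
     length (snd ((code_step ^^ i) p)) \<le> i + length (snd p)" for i p
  proof (induction i)
    case (Suc i)
    then show ?case using code_step_size[of "(code_step ^^ i) p"] by auto
  qed simp
  \<comment> \<open>The triple \<open>(t, t, ())\<close> is a counter: it has
    \<open>csize t + 1\<close> nodes, one more than the steps needed, and the last step is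
    idle.\<close>
  have "ptime (\<lambda>t. (code_step ^^ nodes (tr (t, t, ()))) ([t], []))"
  proof (rule ptime_funpow[where B="\<lambda>n. 10 * n + 20"])
    fix t :: tree and i assume i: "i \<le> nodes (tr (t, t, ()))"
    obtain ts u where p: "(code_step ^^ i) ([t], []) = (ts, u)" by (cases "(code_step ^^ i) ([t], [])")
    have "nodes (tr ts) \<le> Suc (nodes t)" "length u \<le> i" using size[of i "([t], [])"] p by auto
    moreover have "tsz ts = 2 * nodes (tr ts) + 1" by (rule csize_nodes)
    moreover have "tsz t = 2 * nodes t + 1" using csize_nodes[of t] by simp
    ultimately show "tsz ((code_step ^^ i) ([t], [])) \<le> 10 * tsz t + 20"
      using tsz_word[of u] i p by simp
  qed (intro ptime_intros s | intro polyb_add polyb_mult polyb_id polyb_const)+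
  then have "ptime (\<lambda>t. rev (snd ((code_step ^^ nodes (tr (t, t, ()))) ([t], []))))" by (intro ptime_intros)
  moreover have "rev (snd ((code_step ^^ nodes (tr (t, t, ()))) ([t], []))) = code t" for t
  proof -
    have "nodes (tr (t, t, ())) = 1 + csize t" using csize_nodes[of t] by simp
    then have "(code_step ^^ nodes (tr (t, t, ()))) ([t], []) = (code_step ^^ 1) ((code_step ^^ csize t) ([t], []))"
      by (simp only: funpow_add comp_def)
    then show ?thesis unfolding code_step_code code_step_Nil by simp
  qed
  ultimately have "ptime code" by simp
  from ptime_comp[OF assms this] show ?thesis .
qed

text \<open>\<open>ys\<close> is fixed, so no bound uniform in \<open>y\<close> is required. The
  lists of instructions, stacks and cell contents of a fixed program are of this kind.\<close>

lemma ptime_concat_map_const [ptime_intros]: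
  assumes "\<And>y. y \<in> set ys \<Longrightarrow> ptime (\<lambda>x. f x y)"
  shows "ptime (\<lambda>x. concat (map (f x) ys))"
  using assms
proof (induction ys)
  case (Cons y ys)
  have "ptime (\<lambda>x. f x y @ concat (map (f x) ys))" by (intro ptime_append Cons) auto
  then show ?case by simp
qed (simp add: ptime_const)

section \<open>Variables and clauses of the tableau\<close>

type_synonym var = "nat \<times> nat \<times> nat \<times> nat \<times> nat"
type_synonym lit = "var \<times> bool"
type_synonym cnf = "lit list list"

definition sat :: "(var \<Rightarrow> bool) \<Rightarrow> cnf \<Rightarrow> bool" where
  "sat \<alpha> \<phi> \<longleftrightarrow> (\<forall>c\<in>set \<phi>. \<exists>l\<in>set c. \<alpha> (fst l) = snd l)"

lemma sat_append: "sat \<alpha> (\<phi> @ \<psi>) \<longleftrightarrow> sat \<alpha> \<phi> \<and> sat \<alpha> \<psi>"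
  by (auto simp: sat_def)

lemma sat_concat_map: "sat \<alpha> (concat (map f xs)) \<longleftrightarrow> (\<forall>x\<in>set xs. sat \<alpha> (f x))"
  by (auto simp: sat_def)

lemma sat_Nil: "sat \<alpha> []" and sat_Cons: "sat \<alpha> (c # \<phi>) \<longleftrightarrow> (\<exists>l\<in>set c. \<alpha> (fst l) = snd l) \<and> sat \<alpha> \<phi>"
  by (auto simp: sat_def)

text \<open>The first component separates the kinds of variables: a bit of the unknown input,
  program counter \<open>p\<close> at time \<open>t\<close>, and content \<open>a\<close> of cell
  \<open>i\<close> on stack \<open>j\<close> at time \<open>t\<close>.\<close>

definition bitv :: "nat \<Rightarrow> var" where "bitv i = (0, i, 0, 0, 0)"
definition pcv :: "nat \<Rightarrow> nat \<Rightarrow> var" where "pcv t p = (1, t, p, 0, 0)"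
definition cellv :: "nat \<Rightarrow> nat \<Rightarrow> nat \<Rightarrow> nat \<Rightarrow> var" where "cellv t j i a = (2, t, j, i, a)"

lemma ptime_vars [ptime_intros]:
  "ptime f \<Longrightarrow> ptime (\<lambda>x. bitv (f x))"
  "ptime f \<Longrightarrow> ptime (\<lambda>x. pcv (f x) p)"
  "ptime f \<Longrightarrow> ptime g \<Longrightarrow> ptime (\<lambda>x. cellv (f x) j (g x) a)"
  unfolding bitv_def pcv_def cellv_def by (intro ptime_intros; assumption)+

text \<open>Cell contents of a stack are coded by 0 (empty), 1 (true) and 2 (false).\<close>

definition bcode :: "bool \<Rightarrow> nat" where "bcode b = (if b then 1 else 2)"

definition val :: "word \<Rightarrow> nat \<Rightarrow> nat" where
  "val u i = (if i < length u then bcode (u ! i) else 0)"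

fun next_pc :: "instr \<Rightarrow> nat \<Rightarrow> nat \<Rightarrow> nat" where
  "next_pc (ICase k x y z) p a = (if a = 1 then y else if a = 2 then z else x)"
| "next_pc IStop p a = p"
| "next_pc _ p a = p + 1"

lemma next_pc: "fst (effect ins (p, s)) = next_pc ins p (val (s (istack ins)) 0)"
proof (cases ins)
  case (ICase k x y z)
  show ?thesis unfolding ICase
    by (cases "(s k, x, y, z)" rule: jump.cases) (auto simp: val_def bcode_def)
qed auto

lemma val_Cons: "val (b # u) i = (if i = 0 then bcode b else val u (i - 1))"
  by (cases i) (auto simp: val_def)

lemma val_tl: "val (tl u) i = val u (i + 1)"
  by (auto simp: val_def nth_tl)

text \<open>While the counter is \<open>p\<close>, cell \<open>i\<close> takes over the content of
  cell \<open>i'\<close>, with one implication for each possible content; a push or pop shifts the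
  index.\<close>

definition copy_clauses :: "nat \<Rightarrow> nat \<Rightarrow> nat \<Rightarrow> nat \<Rightarrow> nat \<Rightarrow> cnf" where
  "copy_clauses t p j i i' =
     map (\<lambda>a. [(pcv t p, False), (cellv t j i' a, False), (cellv (t + 1) j i a, True)]) [0, 1, 2]"

fun cell_clauses :: "instr \<Rightarrow> nat \<Rightarrow> nat \<Rightarrow> nat \<Rightarrow> nat \<Rightarrow> cnf" where
  "cell_clauses (IPush k b) p j t i = (if j = k
     then if i = 0 then [[(pcv t p, False), (cellv (t + 1) j i (bcode b), True)]] else copy_clauses t p j i (i - 1)
     else copy_clauses t p j i i)"
| "cell_clauses (IPop k) p j t i = (if j = k then copy_clauses t p j i (i + 1) else copy_clauses t p j i i)"
| "cell_clauses _ p j t i = copy_clauses t p j i i"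

definition pc_clauses :: "instr \<Rightarrow> nat \<Rightarrow> nat \<Rightarrow> cnf" where
  "pc_clauses ins p t = concat (map (\<lambda>a.
     [[(pcv t p, False), (cellv t (istack ins) 0 a, False), (pcv (t + 1) (next_pc ins p a), True)]]) [0, 1, 2])"

text \<open>Stack 0 holds the known word, stack 1 the \<open>m\<close> unknown bits. The expression
  \<open>hd (drop i u)\<close> is \<open>u ! i\<close> in a form covered by
  \<open>ptime_intros\<close>.\<close>

definition init_clauses :: "nat \<Rightarrow> word \<Rightarrow> nat \<Rightarrow> nat \<Rightarrow> cnf" where
  "init_clauses j u m i = (if j = 1 \<and> i < m
     then [[(bitv i, False), (cellv 0 j i 1, True)], [(bitv i, True), (cellv 0 j i 2, True)]]
     else if j = 0 \<and> i < length u then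
       if hd (drop i u) then [[(cellv 0 j i 1, True)]] else [[(cellv 0 j i 2, True)]]
     else [[(cellv 0 j i 0, True)]])"

text \<open>The appended \<open>IStop\<close> is where the run rests until time \<open>T\<close>. On
  each stack \<open>T + 1\<close> cells suffice, as contents move by at most one cell per step and
  only the top cell matters at the end.\<close>

definition tableau :: "instr list \<Rightarrow> nat \<Rightarrow> word \<Rightarrow> nat \<Rightarrow> nat \<Rightarrow> cnf" where
  "tableau P K u m T =
     [[(pcv 0 0, True)], [(cellv T 0 0 0, False)], [(cellv T 0 0 2, False)]] @
     concat (map (\<lambda>j. concat (map (init_clauses j u m) [0..<T + 1])) [0..<K]) @
     concat (map (\<lambda>p. concat (map (\<lambda>t. pc_clauses ((P @ [IStop]) ! p) p t) [0..<T]) @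
       concat (map (\<lambda>j. concat (map (\<lambda>t.
         concat (map (cell_clauses ((P @ [IStop]) ! p) p j t) [0..<T + 1])) [0..<T])) [0..<K])) [0..<Suc (length P)])"

lemma ptime_copy_clauses [ptime_intros]:
  assumes "ptime t" "ptime i" "ptime i'"
  shows "ptime (\<lambda>x. copy_clauses (t x) p j (i x) (i' x))"
  unfolding copy_clauses_def list.map by (intro ptime_intros assms)

lemma ptime_cell_clauses [ptime_intros]:
  assumes "ptime t" "ptime i"
  shows "ptime (\<lambda>x. cell_clauses ins p j (t x) (i x))"
proof (cases ins)
  case (IPush k b)
  show ?thesis unfolding IPush cell_clauses.simps by (cases "j = k"; simp; intro ptime_intros assms)
next
  case (IPop k)
  show ?thesis unfolding IPop cell_clauses.simps by (cases "j = k"; simp; intro ptime_intros assms)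
qed (simp; intro ptime_intros assms)+

lemma ptime_pc_clauses [ptime_intros]:
  assumes "ptime t"
  shows "ptime (\<lambda>x. pc_clauses ins p (t x))"
  unfolding pc_clauses_def by (intro ptime_intros assms)

lemma ptime_init_clauses [ptime_intros]:
  assumes "ptime u" "ptime m" "ptime i"
  shows "ptime (\<lambda>x. init_clauses j (u x) (m x) (i x))"
  unfolding init_clauses_def by (intro ptime_intros assms)

lemma ptime_tableau:
  assumes "ptime u" "ptime m" "ptime T"
  shows "ptime (\<lambda>x. tableau P K (u x) (m x) (T x))"
  unfolding tableau_def
  by (intro ptime_intros assms ptime_comp[OF _ assms(1)] ptime_comp[OF _ assms(2)] ptime_comp[OF _ assms(3)])

lemma sat_copy_clauses: "sat \<alpha> (copy_clauses t p j i i') \<longleftrightarrow>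
   (\<alpha> (pcv t p) \<longrightarrow> (\<forall>a\<in>{0,1,2}. \<alpha> (cellv t j i' a) \<longrightarrow> \<alpha> (cellv (t + 1) j i a)))"
  by (auto simp: copy_clauses_def sat_Cons sat_Nil)

lemma sat_pc_clauses: "sat \<alpha> (pc_clauses ins p t) \<longleftrightarrow>
   (\<alpha> (pcv t p) \<longrightarrow> (\<forall>a\<in>{0,1,2}. \<alpha> (cellv t (istack ins) 0 a) \<longrightarrow> \<alpha> (pcv (t + 1) (next_pc ins p a))))"
  by (auto simp: pc_clauses_def sat_Cons sat_Nil)

lemma val_range: "val u i \<in> {0, 1, 2}"
  by (simp add: val_def bcode_def)

lemma sat_tableau: "sat \<alpha> (tableau P K u m T) \<longleftrightarrow>
    \<alpha> (pcv 0 0) \<and> \<not> \<alpha> (cellv T 0 0 0) \<and> \<not> \<alpha> (cellv T 0 0 2) \<and>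
    (\<forall>j\<in>{0..<K}. \<forall>i\<in>{0..<T + 1}. sat \<alpha> (init_clauses j u m i)) \<and>
    (\<forall>p\<in>{0..<Suc (length P)}. (\<forall>t\<in>{0..<T}. sat \<alpha> (pc_clauses ((P @ [IStop]) ! p) p t)) \<and>
       (\<forall>j\<in>{0..<K}. \<forall>t\<in>{0..<T}. \<forall>i\<in>{0..<T + 1}. sat \<alpha> (cell_clauses ((P @ [IStop]) ! p) p j t i)))"
  unfolding tableau_def sat_append sat_concat_map sat_Cons set_upt by (simp add: sat_Nil)

context
  fixes P :: "instr list" and K :: nat and u y :: word and T :: nat and conf :: "nat \<Rightarrow> nat \<times> store"
  assumes K: "\<And>i. i \<in> istack ` set (P @ [IStop]) \<Longrightarrow> i < K" "2 \<le> K"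
    and conf0: "conf 0 = (0, (\<lambda>i. [])(0 := u, 1 := y))"
    and conf: "\<And>t. t < T \<Longrightarrow> fst (conf t) \<le> length P \<and> conf (Suc t) = effect ((P @ [IStop]) ! fst (conf t)) (conf t)"
begin

text \<open>The transition clauses only force variables to be true and never exclude additional
  ones; propagation from time 0 puts the actual run into every model. At time \<open>t\<close> the
  cells up to \<open>T - t\<close> are controlled, because a pop pulls in the content of the next
  cell.\<close>

lemma tableau_forced:
  assumes s: "sat \<alpha> (tableau P K u (length y) T)" and y: "\<And>i. i < length y \<Longrightarrow> \<alpha> (bitv i) = y ! i"
    and t: "t \<le> T"
  shows "\<alpha> (pcv t (fst (conf t))) \<and> (\<forall>j<K. \<forall>i. i + t < T + 1 \<longrightarrow> \<alpha> (cellv t j i (val (snd (conf t) j) i)))"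
  using t
proof (induction t)
  case 0
  have "\<alpha> (cellv 0 j i (val (snd (conf 0) j) i))" if "j < K" "i < T + 1" for j i
  proof -
    have "sat \<alpha> (init_clauses j u (length y) i)"
      using s that unfolding sat_tableau by auto
    then show ?thesis using y[of i] conf0
      by (auto simp: init_clauses_def sat_Cons sat_Nil val_def bcode_def hd_drop_conv_nth split: if_splits)
  qed
  moreover have "\<alpha> (pcv 0 0)" using s unfolding sat_tableau by simp
  ultimately show ?case using conf0 by simp
next
  case (Suc t)
  then have t: "t < T" by simp
  obtain p st where c: "conf t = (p, st)" by (cases "conf t")
  define ins where "ins = (P @ [IStop]) ! p"
  have p: "p \<le> length P" and c': "conf (Suc t) = effect ins (p, st)" using conf[OF t] c by (auto simp: ins_def)
  have IH: "\<alpha> (pcv t p)" "\<And>j i. j < K \<Longrightarrow> i + t < T + 1 \<Longrightarrow> \<alpha> (cellv t j i (val (st j) i))"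
    using Suc.IH t c by auto
  have s1: "sat \<alpha> (pc_clauses ins p t)"
    using s t p unfolding sat_tableau ins_def by auto
  have s2: "sat \<alpha> (cell_clauses ins p j t i)" if "j < K" "i < T + 1" for j i
    using s t p that unfolding sat_tableau ins_def by auto
  have "ins \<in> set (P @ [IStop])" using p unfolding ins_def by (intro nth_mem) simp
  then have k: "istack ins < K" using K by blast
  have "\<alpha> (pcv (Suc t) (fst (conf (Suc t))))"
  proof -
    have "\<alpha> (cellv t (istack ins) 0 (val (st (istack ins)) 0))" using IH(2)[OF k, of 0] t by simp
    moreover have *: "\<forall>a\<in>{0, 1, 2}. \<alpha> (cellv t (istack ins) 0 a) \<longrightarrow> \<alpha> (pcv (t + 1) (next_pc ins p a))"
      using s1 IH(1) unfolding sat_pc_clauses by blast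
    note bspec[OF * val_range[of "st (istack ins)" 0]]
    ultimately show ?thesis unfolding c' next_pc by simp
  qed
  moreover have "\<alpha> (cellv (Suc t) j i (val (snd (conf (Suc t)) j) i))" if "j < K" "i + Suc t < T + 1" for j i
  proof -
    have copy: "\<alpha> (cellv (Suc t) j i (val (st j) i'))"
      if "sat \<alpha> (copy_clauses t p j i i')" "i' + t < T + 1" for i'
    proof -
      have "\<forall>a\<in>{0, 1, 2}. \<alpha> (cellv t j i' a) \<longrightarrow> \<alpha> (cellv (t + 1) j i a)"
        using that(1) IH(1) unfolding sat_copy_clauses by blast
      from bspec[OF this val_range[of "st j" i']] show ?thesis using IH(2)[OF \<open>j < K\<close> that(2)] by simp
    qed
    have "sat \<alpha> (cell_clauses ins p j t i)" using s2 that by simp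
    then show ?thesis using copy that IH(1) unfolding c'
      by (cases ins) (auto simp: val_Cons val_tl sat_Cons sat_Nil split: if_splits)
  qed
  ultimately show ?case by blast
qed

lemma tableau_sat:
  assumes "\<And>a. a \<in> {0, 2} \<Longrightarrow> val (snd (conf T) 0) 0 \<noteq> a"
  defines "\<alpha> \<equiv> \<lambda>v. case v of (k, t, j, i, a) \<Rightarrow> if k = 0 then t < length y \<and> y ! t
     else if k = 1 then fst (conf t) = j else val (snd (conf t) j) i = a"
  shows "sat \<alpha> (tableau P K u (length y) T)"
proof -
  have v: "\<alpha> (bitv i) \<longleftrightarrow> i < length y \<and> y ! i" "\<alpha> (pcv t p) \<longleftrightarrow> fst (conf t) = p"
    "\<alpha> (cellv t j i a) \<longleftrightarrow> val (snd (conf t) j) i = a" for t p j i a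
    by (auto simp: \<alpha>_def bitv_def pcv_def cellv_def)
  have "sat \<alpha> (init_clauses j u (length y) i)" for j i
    using conf0 by (auto simp: init_clauses_def sat_Cons sat_Nil v val_def bcode_def hd_drop_conv_nth)
  moreover have "sat \<alpha> (pc_clauses ((P @ [IStop]) ! p) p t)" if "t < T" for p t
    unfolding sat_pc_clauses v
  proof (intro impI ballI)
    fix a assume "fst (conf t) = p" "val (snd (conf t) (istack ((P @ [IStop]) ! p))) 0 = a"
    then show "fst (conf (t + 1)) = next_pc ((P @ [IStop]) ! p) p a"
      using conf[OF that] next_pc[of "(P @ [IStop]) ! p" p "snd (conf t)"] by (cases "conf t") auto
  qed
  moreover have "sat \<alpha> (cell_clauses ((P @ [IStop]) ! p) p j t i)" if "t < T" for p t j i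
  proof (cases "fst (conf t) = p")
    case False
    then have "\<not> \<alpha> (pcv t p)" by (simp add: v)
    then show ?thesis
      by (cases "(P @ [IStop]) ! p") (auto simp: sat_copy_clauses sat_Cons sat_Nil)
  next
    case True
    then have c: "conf t = (p, snd (conf t))" by (cases "conf t") auto
    have "conf (Suc t) = effect ((P @ [IStop]) ! p) (p, snd (conf t))" using conf[OF that] c True by simp
    then show ?thesis
      by (cases "(P @ [IStop]) ! p") (auto simp: sat_copy_clauses sat_Cons sat_Nil v val_Cons val_tl)
  qed
  moreover have "\<alpha> (pcv 0 0)" "\<not> \<alpha> (cellv T 0 0 0)" "\<not> \<alpha> (cellv T 0 0 2)"
    using assms(1) conf0 by (auto simp: v)
  ultimately show ?thesis unfolding sat_tableau by simp
qed

text \<open>Some content of the top cell is forced at time \<open>T\<close>, and the two negative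
  unit clauses leave only 1, the first bit of the code of \<open>True\<close>.\<close>

lemma tableau_iff:
  "(\<exists>\<alpha>. sat \<alpha> (tableau P K u (length y) T) \<and> (\<forall>i<length y. \<alpha> (bitv i) = y ! i)) \<longleftrightarrow>
   val (snd (conf T) 0) 0 = 1"
proof
  assume "\<exists>\<alpha>. sat \<alpha> (tableau P K u (length y) T) \<and> (\<forall>i<length y. \<alpha> (bitv i) = y ! i)"
  then obtain \<alpha> where a: "sat \<alpha> (tableau P K u (length y) T)" "\<And>i. i < length y \<Longrightarrow> \<alpha> (bitv i) = y ! i" by blast
  have "\<alpha> (cellv T 0 0 (val (snd (conf T) 0) 0))"
    using tableau_forced[OF a order_refl] K(2) by simp
  moreover have "\<not> \<alpha> (cellv T 0 0 0)" "\<not> \<alpha> (cellv T 0 0 2)"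
    using a(1) unfolding sat_tableau by simp_all
  ultimately show "val (snd (conf T) 0) 0 = 1" using val_range[of "snd (conf T) 0" 0] by auto
next
  assume 1: "val (snd (conf T) 0) 0 = 1"
  show "\<exists>\<alpha>. sat \<alpha> (tableau P K u (length y) T) \<and> (\<forall>i<length y. \<alpha> (bitv i) = y ! i)"
    by (rule exI, rule conjI, rule tableau_sat) (use 1 in \<open>auto simp: bitv_def\<close>)
qed

end

text \<open>\<open>y\<close> arrives as a raw word on its own stack, so that in the tableau each of
  its bits is one cell with one variable.\<close>

lemma pair_program:
  fixes R :: "word \<times> word \<Rightarrow> bool"
  assumes "ptime R"
  obtains c p where "\<And>w y. run c ((\<lambda>i. [])(0 := cd w, 1 := y)) (poly p (tsz w + length y)) (only (cd (R (w, y))))"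
proof -
  obtain c m p where c: "computes c m p R" using assms unfolding ptime_def by blast
  let ?c = "move 0 3 ;; move 1 2 ;; move 2 0 ;; read_word ;; move 3 0 ;; Push 0 True ;; c"
  let ?p = "[:8, 50:] + pcompose p [:2, 4:]"
  have "run ?c ((\<lambda>i. [])(0 := cd w, 1 := y)) (poly ?p (tsz w + length y)) (only (cd (R (w, y))))" for w y
  proof -
    let ?s0 = "(\<lambda>i. [])(0 := cd w, 1 := y) :: store" let ?s1 = "(\<lambda>i. [])(1 := y, 3 := rev (cd w)) :: store"
    let ?s2 = "(\<lambda>i. [])(2 := rev y, 3 := rev (cd w)) :: store" let ?s3 = "(only y)(3 := rev (cd w))"
    let ?s4 = "(only (cd y))(3 := rev (cd w))" let ?s5 = "only (cd w @ cd y)"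
    have 1: "run (move 0 3) ?s0 (6 * tsz w + 1) ?s1"
    proof -
      have "?s0(0 := [], 3 := rev (cd w)) = ?s1" by (simp add: fun_eq_iff)
      then show ?thesis using run_move[of 0 3 ?s0] by simp
    qed
    have 2: "run (move 1 2) ?s1 (6 * length y + 1) ?s2"
    proof -
      have "?s1(1 := [], 2 := rev y) = ?s2" by (simp add: fun_eq_iff)
      then show ?thesis using run_move[of 1 2 ?s1] by simp
    qed
    have 3: "run (move 2 0) ?s2 (6 * length y + 1) ?s3"
    proof -
      have "?s2(2 := [], 0 := y) = ?s3" by (simp add: fun_eq_iff)
      then show ?thesis using run_move[of 2 0 ?s2] by simp
    qed
    have 4: "run read_word ?s3 (15 * length y + 3) ?s4"
    proof -
      have "?s3(0 := cd y) = ?s4" by (simp add: fun_eq_iff)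
      then show ?thesis using run_read_word[of ?s3 y] by simp
    qed
    have 5: "run (move 3 0) ?s4 (6 * tsz w + 1) ?s5"
    proof -
      have "?s4(3 := [], 0 := cd w @ cd y) = ?s5" by (simp add: fun_eq_iff)
      then show ?thesis using run_move[of 3 0 ?s4] by simp
    qed
    have 6: "run (Push 0 True) ?s5 1 (only (cd (w, y)))" by (rule run_Push_upd) (simp add: fun_eq_iff)
    have 7: "run c (only (cd (w, y))) (poly p (tsz (w, y))) (only (cd (R (w, y))))"
    proof -
      have "(only (cd (w, y)))(0 := cd (R (w, y))) = only (cd (R (w, y)))" by (simp add: fun_eq_iff)
      then show ?thesis using computesD[OF c, of "only (cd (w, y))" "(w, y)"] by simp
    qed
    have "poly p (tsz (w, y)) \<le> poly p (2 + 4 * (tsz w + length y))"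
      by (rule poly_mono_nat) (use tsz_word[of y] in simp)
    then show ?thesis
      using run_Seq[OF 1 run_Seq[OF 2 run_Seq[OF 3 run_Seq[OF 4 run_Seq[OF 5 run_Seq[OF 6 7]]]]]]
      by (auto elim!: run_mono simp: poly_pcompose algebra_simps)
  qed
  then show ?thesis using that by blast
qed

text \<open>The time bound depends on sizes only, so the formula can be built from \<open>w\<close>
  and the length of \<open>y\<close>; \<open>y\<close> itself enters through the bit
  variables.\<close>

theorem cook_levin:
  fixes R :: "word \<times> word \<Rightarrow> bool"
  assumes "ptime R"
  obtains \<Phi> :: "word \<times> nat \<Rightarrow> cnf" where "ptime \<Phi>"
    "\<And>w y. R (w, y) \<longleftrightarrow> (\<exists>\<alpha>. sat \<alpha> (\<Phi> (w, length y)) \<and> (\<forall>i<length y. \<alpha> (bitv i) = y ! i))"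
proof -
  obtain c p where c: "\<And>w y. run c ((\<lambda>i. [])(0 := cd w, 1 := y)) (poly p (tsz w + length y)) (only (cd (R (w, y))))"
    using pair_program[OF assms] by blast
  define P where "P = comp c 0"
  have "finite (istack ` set (P @ [IStop]))" by simp
  then obtain K0 where K0: "\<And>i. i \<in> istack ` set (P @ [IStop]) \<Longrightarrow> i < K0"
    using finite_nat_set_iff_bounded by meson
  have K: "i < K0 + 2" if "i \<in> istack ` set (P @ [IStop])" for i using K0[OF that] by simp
  define \<Phi> where "\<Phi> x = tableau P (K0 + 2) (cd (fst x)) (snd x) (poly p (length (cd (fst x)) + snd x))" for x :: "word \<times> nat"
  have "ptime \<Phi>" unfolding \<Phi>_def by (intro ptime_tableau ptime_intros ptime_tr)
  moreover have "R (w, y) \<longleftrightarrow> (\<exists>\<alpha>. sat \<alpha> (\<Phi> (w, length y)) \<and> (\<forall>i<length y. \<alpha> (bitv i) = y ! i))" for w y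
  proof -
    let ?T = "poly p (tsz w + length y)"
    obtain n where n: "n \<le> ?T" "exec c ((\<lambda>i. [])(0 := cd w, 1 := y)) n (only (cd (R (w, y))))"
      using c[of w y] unfolding run_def by blast
    have "located P 0 (comp c 0)" using located_mid[of "[]" "comp c 0" "[]"] by (simp add: P_def)
    from exec_istep[OF n(2) this] have "(istep P ^^ n) (0, (\<lambda>i. [])(0 := cd w, 1 := y)) (length P, only (cd (R (w, y))))"
      by (simp add: P_def)
    then obtain f where f: "f 0 = (0, (\<lambda>i. [])(0 := cd w, 1 := y))" "f n = (length P, only (cd (R (w, y))))"
      "\<And>i. i < n \<Longrightarrow> istep P (f i) (f (Suc i))" unfolding relpowp_fun_conv by blast
    \<comment> \<open>The run is frozen after its last step, when the counter points to the appended
      \<open>IStop\<close>.\<close>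
    define conf where "conf t = f (min t n)" for t
    have "conf 0 = (0, (\<lambda>i. [])(0 := cd w, 1 := y))" by (simp add: conf_def f(1))
    moreover have "fst (conf t) \<le> length P \<and> conf (Suc t) = effect ((P @ [IStop]) ! fst (conf t)) (conf t)" for t
    proof (cases "t < n")
      case True
      then show ?thesis using f(3)[OF True] by (auto simp: conf_def istep_def nth_append min_def)
    next
      case False
      then show ?thesis using f(2) by (simp add: conf_def min_def)
    qed
    ultimately have "(\<exists>\<alpha>. sat \<alpha> (tableau P (K0 + 2) (cd w) (length y) ?T) \<and> (\<forall>i<length y. \<alpha> (bitv i) = y ! i)) \<longleftrightarrow>
       val (snd (conf ?T) 0) 0 = 1"
      by (intro tableau_iff) (use K in auto)
    moreover have "conf ?T = (length P, only (cd (R (w, y))))" using f(2) n(1) by (simp add: conf_def min_def)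
    moreover have "val (cd (R (w, y))) 0 = 1 \<longleftrightarrow> R (w, y)"
      by (cases "R (w, y)") (auto simp: val_def bcode_def)
    ultimately show ?thesis by (simp add: \<Phi>_def)
  qed
  ultimately show ?thesis using that by blast
qed

section \<open>Encoded instances\<close>

lemma code_list_append_inject:
  assumes f: "\<And>x y u v. f x @ u = f y @ v \<Longrightarrow> x = y \<and> u = v"
    and "code_list f xs @ u = code_list f ys @ v"
  shows "xs = ys \<and> u = v"
  using assms(2)
proof (induction xs arbitrary: ys)
  case Nil
  then show ?case by (cases ys) (auto simp: code_list_def)
next
  case (Cons x xs)
  then obtain y ys' where ys: "ys = y # ys'" by (cases ys) (auto simp: code_list_def)
  have "f x @ (code_list f xs @ u) = f y @ (code_list f ys' @ v)"
    using Cons.prems ys by (simp add: code_list_def)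
  from f[OF this] Cons.IH[of ys'] ys show ?case by simp
qed

lemma code_word_append_inject: "code_word x @ u = code_word y @ v \<Longrightarrow> x = y \<and> u = v"
  unfolding code_word_def by (rule code_list_append_inject) auto

lemma code_label_append_inject: "code_label x @ u = code_label y @ v \<Longrightarrow> x = y \<and> u = v"
  by (cases x; cases y) auto

text \<open>All components have prefix-free codes and can be read off one after the other. The
  labelling is determined on the arguments only.\<close>

lemma encodes_unique:
  assumes "encodes w \<Lambda> g L h" "encodes w \<Lambda>' g' L' h'"
  shows "args \<Lambda> = args \<Lambda>'" "attacks \<Lambda> = attacks \<Lambda>'" "g = g'" "h = h'" "\<forall>a\<in>args \<Lambda>. L a = L' a"
proof -
  let ?f = "\<lambda>(a, l). code_word a @ code_label l"
  let ?g = "\<lambda>(a, b). code_word a @ code_word b"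
  obtain as rs where 1: "set as = args \<Lambda>" "set rs = attacks \<Lambda>"
    "w = code_list (\<lambda>a. code_word a @ code_label (L a)) as @ code_list ?g rs @ code_word g @ code_word h"
    using assms(1) unfolding encodes_def by blast
  obtain as' rs' where 2: "set as' = args \<Lambda>'" "set rs' = attacks \<Lambda>'"
    "w = code_list (\<lambda>a. code_word a @ code_label (L' a)) as' @ code_list ?g rs' @ code_word g' @ code_word h'"
    using assms(2) unfolding encodes_def by blast
  have c: "code_list (\<lambda>a. code_word a @ code_label (L a)) as = code_list ?f (map (\<lambda>a. (a, L a)) as)" for L as
    by (simp add: code_list_def comp_def)
  have f: "?f x @ u = ?f y @ v \<Longrightarrow> x = y \<and> u = v" for x y u v
    by (cases x; cases y) (auto dest!: code_word_append_inject code_label_append_inject)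
  have g: "?g x @ u = ?g y @ v \<Longrightarrow> x = y \<and> u = v" for x y u v
    by (cases x; cases y) (auto dest!: code_word_append_inject)
  have "code_list ?f (map (\<lambda>a. (a, L a)) as) @ code_list ?g rs @ code_word g @ code_word h =
      code_list ?f (map (\<lambda>a. (a, L' a)) as') @ code_list ?g rs' @ code_word g' @ code_word h'"
    using 1(3) 2(3) unfolding c by (rule trans[OF sym])
  note 3 = code_list_append_inject[of ?f, OF f this]
  have m: "map (\<lambda>a. (a, L a)) as = map (\<lambda>a. (a, L' a)) as'" by (rule conjunct1[OF 3])
  have r: "code_list ?g rs @ code_word g @ code_word h = code_list ?g rs' @ code_word g' @ code_word h'"
    by (rule conjunct2[OF 3])
  note 4 = code_list_append_inject[of ?g, OF g r]
  have rs: "rs = rs'" by (rule conjunct1[OF 4])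
  have gh: "code_word g @ code_word h = code_word g' @ code_word h'" by (rule conjunct2[OF 4])
  have "g = g'" "code_word h @ [] = code_word h' @ []" using code_word_append_inject[OF gh] by auto
  from this(1) code_word_append_inject[OF this(2)] show "g = g'" "h = h'" by auto
  have "map fst (map (\<lambda>a. (a, L a)) as) = map fst (map (\<lambda>a. (a, L' a)) as')" using m by simp
  then have as: "as = as'" by (simp add: comp_def)
  then show "args \<Lambda> = args \<Lambda>'" using 1 2 by simp
  show "attacks \<Lambda> = attacks \<Lambda>'" using rs 1 2 by simp
  show "\<forall>a\<in>args \<Lambda>. L a = L' a" using m as 1(1) by auto
qed

text \<open>Arguments, attacks, accepted arguments, and the two goals. A labelling that comes from
  an extension is represented by its accepted arguments; the other labels are recomputed.\<close>

type_synonym inst = "word list \<times> (word \<times> word) list \<times> word list \<times> word \<times> word"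

definition af_of :: "inst \<Rightarrow> word af" where
  "af_of D = \<lparr>args = set (fst D), attacks = set (fst (snd D))\<rparr>"

abbreviation in_list :: "inst \<Rightarrow> word list" where "in_list D \<equiv> fst (snd (snd D))"
abbreviation goal :: "inst \<Rightarrow> word" where "goal D \<equiv> fst (snd (snd (snd D)))"
abbreviation goal' :: "inst \<Rightarrow> word" where "goal' D \<equiv> snd (snd (snd (snd D)))"

definition lab_of :: "inst \<Rightarrow> word labelling" where
  "lab_of D = labelling_of (af_of D) (set (in_list D))"

definition wf_inst :: "inst \<Rightarrow> bool" where
  "wf_inst D \<longleftrightarrow> distinct (fst D) \<and> distinct (fst (snd D)) \<and>
     (\<forall>r\<in>set (fst (snd D)). fst r \<in> set (fst D) \<and> snd r \<in> set (fst D)) \<and>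
     goal D \<in> set (fst D) \<and> goal' D \<in> set (fst D)"

definition label_word :: "inst \<Rightarrow> word \<Rightarrow> word" where
  "label_word D a = (if a \<in> set (in_list D) then [True, True]
     else if \<exists>b\<in>set (in_list D). (b, a) \<in> set (fst (snd D)) then [True, False] else [False, False])"

definition enc_inst :: "inst \<Rightarrow> word" where
  "enc_inst D = code_list (\<lambda>a. code_word a @ label_word D a) (fst D) @
     code_list (\<lambda>r. code_word (fst r) @ code_word (snd r)) (fst (snd D)) @
     code_word (goal D) @ code_word (goal' D)"

lemma label_word: "a \<in> set (fst D) \<Longrightarrow> label_word D a = code_label (lab_of D a)"
  by (auto simp: label_word_def lab_of_def labelling_of_def af_of_def Def_def)

lemma code_list_cong: "(\<And>x. x \<in> set xs \<Longrightarrow> f x = g x) \<Longrightarrow> code_list f xs = code_list g xs"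
  unfolding code_list_def by (metis (mono_tags, lifting) map_eq_conv)

lemma enc_inst_eq: "enc_inst D = code_list (\<lambda>a. code_word a @ code_label (lab_of D a)) (fst D) @
     code_list (\<lambda>(a, b). code_word a @ code_word b) (fst (snd D)) @ code_word (goal D) @ code_word (goal' D)"
proof -
  have "code_list (\<lambda>a. code_word a @ label_word D a) (fst D) =
      code_list (\<lambda>a. code_word a @ code_label (lab_of D a)) (fst D)"
    by (rule code_list_cong) (simp add: label_word)
  moreover have "(\<lambda>(a, b). code_word a @ code_word b) = (\<lambda>r. code_word (fst r) @ code_word (snd r))"
    by (simp add: fun_eq_iff)
  ultimately show ?thesis unfolding enc_inst_def by simp
qed

lemma encodes_enc_inst:
  assumes "wf_inst D"
  shows "encodes (enc_inst D) (af_of D) (goal D) (lab_of D) (goal' D)"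
  unfolding encodes_def enc_inst_eq using assms
  by (intro exI[of _ "fst D"] exI[of _ "fst (snd D)"]) (auto simp: wf_inst_def af_of_def)

lemma is_instance_inst:
  assumes "wf_inst D" "extension \<sigma> (af_of D) (set (in_list D))"
  shows "is_instance \<sigma> (af_of D) (goal D) (lab_of D) (goal' D)"
  using assms unfolding is_instance_def is_af_def wf_inst_def labellings_def lab_of_def
  by (fastforce simp: af_of_def)

lemma extension_complete: "extension \<sigma> \<Lambda> S \<Longrightarrow> complete_ext \<Lambda> S"
  by (cases \<sigma>) (auto simp: stable_ext_def semi_stable_ext_def preferred_ext_def)

lemma complete_extD:
  assumes "complete_ext \<Lambda> S"
  shows "S \<subseteq> args \<Lambda>" "S \<inter> Def \<Lambda> S = {}" "Acc \<Lambda> S = S"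
proof -
  have *: "S \<subseteq> args \<Lambda> \<and> S \<inter> Def \<Lambda> S = {} \<and> S = Acc \<Lambda> S"
    using assms unfolding complete_ext_def admissible_def conflict_free_def by (elim conjE) (intro conjI)
  show "S \<subseteq> args \<Lambda>" "S \<inter> Def \<Lambda> S = {}" "Acc \<Lambda> S = S"
    by (rule conjunct1[OF *], rule conjunct1[OF conjunct2[OF *]], rule sym[OF conjunct2[OF conjunct2[OF *]]])
qed

lemma extension_subset: "extension \<sigma> \<Lambda> S \<Longrightarrow> S \<subseteq> args \<Lambda>"
  by (rule complete_extD(1)[OF extension_complete])

lemma instance_inst:
  assumes "encodes w \<Lambda> g L h" "is_instance \<sigma> \<Lambda> g L h"
  obtains D where "wf_inst D" "extension \<sigma> (af_of D) (set (in_list D))" "w = enc_inst D"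
    "\<Lambda> = af_of D" "g = goal D" "L = lab_of D" "h = goal' D"
proof -
  obtain as rs where 1: "distinct as" "set as = args \<Lambda>" "distinct rs" "set rs = attacks \<Lambda>"
    "w = code_list (\<lambda>a. code_word a @ code_label (L a)) as @
         code_list (\<lambda>(a, b). code_word a @ code_word b) rs @ code_word g @ code_word h"
    using assms(1) unfolding encodes_def by blast
  obtain E where E: "extension \<sigma> \<Lambda> E" "L = labelling_of \<Lambda> E"
    using assms(2) unfolding is_instance_def labellings_def by blast
  have "finite E" using extension_subset[OF E(1)] assms(2) finite_subset unfolding is_instance_def is_af_def by blast
  then obtain es where es: "set es = E" using finite_list by blast
  let ?D = "(as, rs, es, g, h) :: inst"
  have af: "af_of ?D = \<Lambda>" using 1 by (simp add: af_of_def)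
  have L: "L = lab_of ?D" unfolding lab_of_def af using es E(2) by simp
  have "wf_inst ?D" using 1 assms(2) by (auto simp: wf_inst_def is_instance_def is_af_def)
  moreover have "w = enc_inst ?D" unfolding enc_inst_eq 1(5) L by simp
  moreover have "extension \<sigma> (af_of ?D) (set (in_list ?D))" unfolding af using E(1) es by simp
  moreover have "g = goal ?D" "h = goal' ?D" by simp_all
  ultimately show ?thesis using that[of ?D] af[symmetric] L by blast
qed

lemma enc_inst_in_instances:
  "wf_inst D \<Longrightarrow> extension \<sigma> (af_of D) (set (in_list D)) \<Longrightarrow> enc_inst D \<in> SF_SA_instances \<sigma>"
  unfolding SF_SA_instances_def using encodes_enc_inst is_instance_inst by blast

definition skeptical :: "semantics \<Rightarrow> inst \<Rightarrow> bool" where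
  "skeptical \<sigma> D \<longleftrightarrow> (\<forall>L'\<in>semifactuals \<sigma> (af_of D) (goal D) (lab_of D). L' (goal' D) = In)"

lemma labelling_outside: "E \<subseteq> args \<Lambda> \<Longrightarrow> a \<notin> args \<Lambda> \<Longrightarrow> labelling_of \<Lambda> E a = Und"
  by (auto simp: labelling_of_def Def_def)

lemma enc_inst_inject:
  assumes "wf_inst D" "extension \<sigma> (af_of D) (set (in_list D))" "wf_inst D'"
    "extension \<sigma> (af_of D') (set (in_list D'))" "enc_inst D = enc_inst D'"
  shows "af_of D = af_of D'" "goal D = goal D'" "lab_of D = lab_of D'" "goal' D = goal' D'"
proof -
  note u = encodes_unique[OF encodes_enc_inst[OF assms(1)] encodes_enc_inst[OF assms(3), folded assms(5)]]
  then show "af_of D = af_of D'" "goal D = goal D'" "goal' D = goal' D'" by simp_all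
  show "lab_of D = lab_of D'"
  proof
    fix a show "lab_of D a = lab_of D' a"
    proof (cases "a \<in> args (af_of D)")
      case False
      \<comment> \<open>Outside the framework both labellings are constantly
        \<open>Und\<close>.\<close>
      then show ?thesis using u(1) labelling_outside extension_subset[OF assms(2)] extension_subset[OF assms(4)]
        unfolding lab_of_def by metis
    qed (use u(5) in simp)
  qed
qed

lemma SF_SA_iff:
  "w \<in> SF_SA \<sigma> \<longleftrightarrow> (\<exists>D. wf_inst D \<and> extension \<sigma> (af_of D) (set (in_list D)) \<and>
     w = enc_inst D \<and> skeptical \<sigma> D)"
proof
  assume "w \<in> SF_SA \<sigma>"
  then obtain \<Lambda> g L h where *: "encodes w \<Lambda> g L h" "is_instance \<sigma> \<Lambda> g L h"
    "\<forall>L'\<in>semifactuals \<sigma> \<Lambda> g L. L' h = In" unfolding SF_SA_def by blast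
  from instance_inst[OF *(1,2)] obtain D where D: "wf_inst D" "extension \<sigma> (af_of D) (set (in_list D))"
    "w = enc_inst D" "\<Lambda> = af_of D" "g = goal D" "L = lab_of D" "h = goal' D" .
  then have "skeptical \<sigma> D" using *(3) unfolding skeptical_def by simp
  with D show "\<exists>D. wf_inst D \<and> extension \<sigma> (af_of D) (set (in_list D)) \<and> w = enc_inst D \<and> skeptical \<sigma> D"
    by blast
next
  assume "\<exists>D. wf_inst D \<and> extension \<sigma> (af_of D) (set (in_list D)) \<and> w = enc_inst D \<and> skeptical \<sigma> D"
  then show "w \<in> SF_SA \<sigma>" unfolding SF_SA_def skeptical_def using encodes_enc_inst is_instance_inst by blast
qed

lemma enc_inst_SF_SA:
  assumes "wf_inst D" "extension \<sigma> (af_of D) (set (in_list D))"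
  shows "enc_inst D \<in> SF_SA \<sigma> \<longleftrightarrow> skeptical \<sigma> D"
proof
  assume "enc_inst D \<in> SF_SA \<sigma>"
  then obtain D' where D': "wf_inst D'" "extension \<sigma> (af_of D') (set (in_list D'))" "enc_inst D = enc_inst D'"
    "skeptical \<sigma> D'" unfolding SF_SA_iff by blast
  then show "skeptical \<sigma> D" using enc_inst_inject[OF assms D'(1-3)] unfolding skeptical_def by simp
next
  assume "skeptical \<sigma> D"
  then show "enc_inst D \<in> SF_SA \<sigma>" unfolding SF_SA_def skeptical_def
    using encodes_enc_inst[OF assms(1)] is_instance_inst[OF assms] by blast
qed

section \<open>Argumentation frameworks\<close>

lemma Def_iff: "is_af \<Lambda> \<Longrightarrow> a \<in> Def \<Lambda> S \<longleftrightarrow> (\<exists>b\<in>S. (b, a) \<in> attacks \<Lambda>)"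
  by (auto simp: Def_def is_af_def)

lemma complete_in_iff:
  "complete_ext \<Lambda> S \<Longrightarrow> a \<in> S \<longleftrightarrow> a \<in> args \<Lambda> \<and> (\<forall>b. (b, a) \<in> attacks \<Lambda> \<longrightarrow> b \<in> Def \<Lambda> S)"
  using complete_extD(3)[of \<Lambda> S] unfolding Acc_def by blast

lemma complete_conflict:
  "is_af \<Lambda> \<Longrightarrow> complete_ext \<Lambda> S \<Longrightarrow> a \<in> S \<Longrightarrow> b \<in> S \<Longrightarrow> (a, b) \<notin> attacks \<Lambda>"
  using complete_extD(2)[of \<Lambda> S] Def_iff[of \<Lambda> b S] by blast

text \<open>Every outside argument is attacked by \<open>S\<close> or attacks itself, so no
  conflict-free set properly contains \<open>S\<close>, and \<open>S\<close> defends nothing outside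
  itself.\<close>

lemma preferred_extI:
  assumes af: "is_af \<Lambda>" and S: "S \<subseteq> args \<Lambda>" and cf: "\<And>a b. a \<in> S \<Longrightarrow> b \<in> S \<Longrightarrow> (a, b) \<notin> attacks \<Lambda>"
    and adm: "\<And>a b. a \<in> S \<Longrightarrow> (b, a) \<in> attacks \<Lambda> \<Longrightarrow> \<exists>c\<in>S. (c, b) \<in> attacks \<Lambda>"
    and rest: "\<And>a. a \<in> args \<Lambda> \<Longrightarrow> a \<notin> S \<Longrightarrow> (\<exists>b\<in>S. (b, a) \<in> attacks \<Lambda>) \<or> (a, a) \<in> attacks \<Lambda>"
  shows "preferred_ext \<Lambda> S"
proof -
  have c: "complete_ext \<Lambda> S"
    unfolding complete_ext_def admissible_def conflict_free_def
  proof (intro conjI S)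
    show "S \<inter> Def \<Lambda> S = {}" using cf Def_iff[OF af] by blast
    show sub: "S \<subseteq> Acc \<Lambda> S" using S adm Def_iff[OF af] unfolding Acc_def by blast
    have "Acc \<Lambda> S \<subseteq> S"
    proof
      fix a assume a: "a \<in> Acc \<Lambda> S"
      then have at: "b \<in> Def \<Lambda> S" if "(b, a) \<in> attacks \<Lambda>" for b using that unfolding Acc_def by blast
      show "a \<in> S"
      proof (rule ccontr)
        assume "a \<notin> S"
        then have "(\<exists>b\<in>S. (b, a) \<in> attacks \<Lambda>) \<or> (a, a) \<in> attacks \<Lambda>" using rest a unfolding Acc_def by blast
        then obtain b where "b \<in> S" "(b, a) \<in> attacks \<Lambda>" using at Def_iff[OF af] by blast
        then show False using at Def_iff[OF af] cf by blast
      qed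
    qed
    with sub show "S = Acc \<Lambda> S" by blast
  qed
  moreover have False if T: "complete_ext \<Lambda> T" "S \<subset> T" for T
  proof -
    obtain a where a: "a \<in> T" "a \<notin> S" using T by blast
    then have "(\<exists>b\<in>S. (b, a) \<in> attacks \<Lambda>) \<or> (a, a) \<in> attacks \<Lambda>"
      using rest complete_extD(1)[OF T(1)] by blast
    then show False using complete_conflict[OF af T(1)] a T(2) by blast
  qed
  ultimately show ?thesis unfolding preferred_ext_def by blast
qed

lemma stable_extI:
  assumes "is_af \<Lambda>" "S \<subseteq> args \<Lambda>" "\<And>a b. a \<in> S \<Longrightarrow> b \<in> S \<Longrightarrow> (a, b) \<notin> attacks \<Lambda>"
    and "\<And>a. a \<in> args \<Lambda> \<Longrightarrow> a \<notin> S \<Longrightarrow> \<exists>b\<in>S. (b, a) \<in> attacks \<Lambda>"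
  shows "stable_ext \<Lambda> S"
proof -
  have "preferred_ext \<Lambda> S"
  proof (rule preferred_extI[OF assms(1-3)])
    fix a b assume "a \<in> S" "(b, a) \<in> attacks \<Lambda>"
    then have "b \<notin> S" "b \<in> args \<Lambda>" using assms(1,3) unfolding is_af_def by blast+
    then show "\<exists>c\<in>S. (c, b) \<in> attacks \<Lambda>" using assms(4) by blast
  qed (use assms(4) in auto)
  moreover have "Def \<Lambda> S \<subseteq> args \<Lambda>" by (auto simp: Def_def)
  moreover have "args \<Lambda> \<subseteq> S \<union> Def \<Lambda> S" using assms(4) Def_iff[OF assms(1)] by blast
  ultimately show ?thesis unfolding stable_ext_def using assms(2) by blast
qed

lemma ex_preferred:
  assumes "is_af \<Lambda>" "complete_ext \<Lambda> S"
  obtains T where "preferred_ext \<Lambda> T" "S \<subseteq> T"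
proof -
  have "{T. complete_ext \<Lambda> T \<and> S \<subseteq> T} \<subseteq> Pow (args \<Lambda>)" using complete_extD(1) by blast
  moreover have "finite (Pow (args \<Lambda>))" using assms(1) unfolding is_af_def by simp
  ultimately have "finite {T. complete_ext \<Lambda> T \<and> S \<subseteq> T}" by (rule finite_subset)
  moreover have "S \<in> {T. complete_ext \<Lambda> T \<and> S \<subseteq> T}" using assms(2) by simp
  ultimately obtain T where T: "T \<in> {T. complete_ext \<Lambda> T \<and> S \<subseteq> T}"
    "\<forall>U\<in>{T. complete_ext \<Lambda> T \<and> S \<subseteq> T}. T \<subseteq> U \<longrightarrow> T = U"
    using finite_has_maximal2[of "{T. complete_ext \<Lambda> T \<and> S \<subseteq> T}" S] by blast
  then have "preferred_ext \<Lambda> T" unfolding preferred_ext_def by blast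
  moreover have "S \<subseteq> T" using T(1) by blast
  ultimately show ?thesis by (rule that)
qed

text \<open>The arguments in \<open>D\<close> outweigh all others, so the most distant labellings reject \<open>h\<close> whenever
  this is possible at all.\<close>

lemma semifactuals_skeptical:
  assumes af: "is_af \<Lambda>" and D: "D \<subseteq> args \<Lambda>" "card (args \<Lambda>) \<le> 2 * card D" and h: "h \<in> args \<Lambda>" "h \<notin> D" "L h = In"
    and yes: "\<And>L' d. L' \<in> labellings \<sigma> \<Lambda> \<Longrightarrow> L g = L' g \<Longrightarrow> L' h = In \<Longrightarrow> d \<in> D \<Longrightarrow> L' d = L d"
    and no: "\<And>L' d. L' \<in> labellings \<sigma> \<Lambda> \<Longrightarrow> L g = L' g \<Longrightarrow> L' h \<noteq> In \<Longrightarrow> d \<in> D \<Longrightarrow> L' d \<noteq> L d"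
  shows "(\<forall>L'\<in>semifactuals \<sigma> \<Lambda> g L. L' h = In) \<longleftrightarrow> (\<forall>L'\<in>labellings \<sigma> \<Lambda>. L g = L' g \<longrightarrow> L' h = In)"
proof
  assume R: "\<forall>L'\<in>semifactuals \<sigma> \<Lambda> g L. L' h = In"
  show "\<forall>L'\<in>labellings \<sigma> \<Lambda>. L g = L' g \<longrightarrow> L' h = In"
  proof (intro ballI impI, rule ccontr)
    fix L0 assume L0: "L0 \<in> labellings \<sigma> \<Lambda>" "L g = L0 g" "L0 h \<noteq> In"
    have fin: "finite (args \<Lambda>)" using af unfolding is_af_def by blast
    let ?P = "\<lambda>L'. L' \<in> labellings \<sigma> \<Lambda> \<and> L g = L' g"
    have "\<forall>L'. ?P L' \<longrightarrow> distance \<Lambda> L L' < Suc (card (args \<Lambda>))"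
      unfolding distance_def using fin by (auto simp: less_Suc_eq_le intro: card_mono)
    from ex_has_greatest_nat[of ?P L0 "distance \<Lambda> L", OF _ this]
    obtain L1 where L1: "?P L1" "\<And>L'. ?P L' \<Longrightarrow> distance \<Lambda> L L' \<le> distance \<Lambda> L L1" using L0 by auto
    then have "L1 \<in> semifactuals \<sigma> \<Lambda> g L" unfolding semifactuals_def by (auto simp: not_less)
    then have "L1 h = In" using R by blast
    \<comment> \<open>A most distant labelling that accepts \<open>h\<close> agrees with
      \<open>L\<close> on \<open>D\<close> and at \<open>h\<close>. The additional argument
      \<open>h\<close> is what makes its distance strictly smaller than
      \<open>card D\<close>.\<close>
    have "{a \<in> args \<Lambda>. L a \<noteq> L1 a} \<subseteq> args \<Lambda> - insert h D"
    proof
      fix a assume a: "a \<in> {a \<in> args \<Lambda>. L a \<noteq> L1 a}"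
      then have "a \<noteq> h" using h(3) \<open>L1 h = In\<close> by auto
      moreover have "a \<notin> D" using yes[OF conjunct1[OF L1(1)] conjunct2[OF L1(1)] \<open>L1 h = In\<close>, of a] a by auto
      ultimately show "a \<in> args \<Lambda> - insert h D" using a by blast
    qed
    then have "distance \<Lambda> L L1 \<le> card (args \<Lambda> - insert h D)"
      unfolding distance_def using fin by (intro card_mono) auto
    also have "\<dots> = card (args \<Lambda>) - Suc (card D)"
      using fin D(1) h(1,2) finite_subset[OF D(1) fin] by (subst card_Diff_subset) auto
    also have "\<dots> < card D"
    proof -
      have "0 < card (args \<Lambda>)" using h(1) fin by (auto simp: card_gt_0_iff)
      then show ?thesis using D(2) by linarith
    qed
    also have "card D \<le> distance \<Lambda> L L0"
    proof -
      have "D \<subseteq> {a \<in> args \<Lambda>. L a \<noteq> L0 a}"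
      proof
        fix d assume d: "d \<in> D"
        then have "L d \<noteq> L0 d" using no[OF L0 d] by (rule_tac not_sym)
        then show "d \<in> {a \<in> args \<Lambda>. L a \<noteq> L0 a}" using d D(1) by blast
      qed
      then show ?thesis unfolding distance_def using fin by (intro card_mono) simp_all
    qed
    finally show False using L1(2)[of L0] L0 by simp
  qed
qed (auto simp: semifactuals_def)

section \<open>Reductions from satisfiability\<close>

text \<open>Variables are tuples, which the simplifier should not take apart.\<close>

declare split_paired_All [simp del] split_paired_Ex [simp del]

text \<open>The first component is a tag for the kind of argument, so different kinds have different
  names by injectivity. Equal clauses share a name; hence the removal of duplicates in the
  instances.\<close>

definition nm :: "nat \<times> lit list \<times> nat \<Rightarrow> word" where "nm x = cd x"

lemma nm_inject [simp]: "nm x = nm y \<longleftrightarrow> x = y"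
  by (simp add: nm_def)

definition "argL l = nm (0, [l], 0)"
definition "argC c = nm (1, c, 0)"
definition "argPhi = nm (2, [], 0)"
definition "argB = nm (3, [], 0)"
definition "argE = nm (4, [], 0)"
definition "argE' = nm (5, [], 0)"
definition "argG = nm (6, [], 0)"
definition "argD i = nm (7, [], i)"
definition "argLS l = nm (8, [l], 0)"
definition "argPhiS = nm (9, [], 0)"
definition "argES = nm (10, [], 0)"
definition "argES' = nm (11, [], 0)"
definition "argGS = nm (12, [], 0)"

lemmas arg_defs = argL_def argC_def argPhi_def argB_def argE_def argE'_def argG_def argD_def argLS_def
  argPhiS_def argES_def argES'_def argGS_def

lemma argL_assign: "argL l \<in> {argL (v, \<alpha> v) | v. v \<in> V} \<longleftrightarrow> fst l \<in> V \<and> snd l = \<alpha> (fst l)"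
proof
  assume "argL l \<in> {argL (v, \<alpha> v) | v. v \<in> V}"
  then obtain v where "argL l = argL (v, \<alpha> v)" "v \<in> V" by blast
  then show "fst l \<in> V \<and> snd l = \<alpha> (fst l)" by (simp add: argL_def)
next
  assume l: "fst l \<in> V \<and> snd l = \<alpha> (fst l)"
  then have "argL l = argL (fst l, \<alpha> (fst l))" by (intro arg_cong[of _ _ argL]) (simp add: prod_eq_iff)
  then show "argL l \<in> {argL (v, \<alpha> v) | v. v \<in> V}" using l by blast
qed

definition neg :: "lit \<Rightarrow> lit" where "neg l = (fst l, \<not> snd l)"

lemma neg_simps [simp]: "neg (neg l) = l" "neg l \<noteq> l" "fst (neg l) = fst l" "snd (neg l) = (\<not> snd l)" "neg (v, b) = (v, \<not> b)"
  by (auto simp: neg_def prod_eq_iff)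

lemma eq_neg: "l = neg l' \<longleftrightarrow> l' = neg l"
  by (metis neg_simps(1))

definition lits :: "var list \<Rightarrow> lit list" where
  "lits X = concat (map (\<lambda>v. [(v, True), (v, False)]) X)"

lemma set_lits: "set (lits X) = {l. fst l \<in> set X}"
proof -
  have "l \<in> set (lits X) \<longleftrightarrow> fst l \<in> set X" for l
    by (cases l) (auto simp: lits_def)
  then show ?thesis by blast
qed

text \<open>The arguments \<open>argL l\<close> choose an assignment and attack the clauses that they satisfy, while
  unsatisfied clauses attack \<open>argPhi\<close>. The argument \<open>argE\<close> attacks all clauses and thus
  provides the solution that has to be known in advance.\<close>

definition common_args :: "var list \<Rightarrow> cnf \<Rightarrow> nat \<Rightarrow> word list" where
  "common_args X \<phi> k = map argL (lits X) @ map argC \<phi> @ [argPhi, argE, argE'] @ map argD [0..<k]"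

text \<open>Clause arguments attack themselves and are never accepted; \<open>argPhi\<close> can be
  accepted only if each of them is attacked from the accepted set.\<close>

definition common_attacks :: "var list \<Rightarrow> cnf \<Rightarrow> (word \<times> word) list" where
  "common_attacks X \<phi> = map (\<lambda>l. (argL l, argL (neg l))) (lits X) @
     concat (map (\<lambda>c. map (\<lambda>l. (argL l, argC c)) c @ [(argE, argC c), (argC c, argC c), (argC c, argPhi)]) \<phi>) @
     [(argE, argE'), (argE', argE)]"

definition vars :: "cnf \<Rightarrow> var list" where "vars \<phi> = map fst (concat \<phi>)"

lemma vars: "c \<in> set \<phi> \<Longrightarrow> l \<in> set c \<Longrightarrow> fst l \<in> set (vars \<phi>)"
  by (auto simp: vars_def)

lemma common_args: "a \<in> set (common_args X \<phi> k) \<longleftrightarrow> (\<exists>l. fst l \<in> set X \<and> a = argL l) \<or> (\<exists>c\<in>set \<phi>. a = argC c) \<or>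
    a = argPhi \<or> a = argE \<or> a = argE' \<or> (\<exists>i<k. a = argD i)"
proof -
  have "a \<in> argD ` {0..<k} \<longleftrightarrow> (\<exists>i<k. a = argD i)" by auto
  moreover have "a \<in> argL ` set (lits X) \<longleftrightarrow> (\<exists>l. fst l \<in> set X \<and> a = argL l)" unfolding set_lits by blast
  moreover have "a \<in> argC ` set \<phi> \<longleftrightarrow> (\<exists>c\<in>set \<phi>. a = argC c)" by blast
  ultimately show ?thesis unfolding common_args_def set_append set_map set_upt Un_iff list.set insert_iff empty_iff
    by (simp only: disj_ac simp_thms)
qed

lemma common_attacks: "p \<in> set (common_attacks X \<phi>) \<longleftrightarrow>
   (\<exists>l. fst l \<in> set X \<and> p = (argL l, argL (neg l))) \<or>
   (\<exists>c\<in>set \<phi>. (\<exists>l\<in>set c. p = (argL l, argC c)) \<or> p = (argE, argC c) \<or> p = (argC c, argC c) \<or> p = (argC c, argPhi)) \<or>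
   p = (argE, argE') \<or> p = (argE', argE)"
proof -
  have "p \<in> set (map (\<lambda>l. (argL l, argL (neg l))) (lits X)) \<longleftrightarrow> (\<exists>l. fst l \<in> set X \<and> p = (argL l, argL (neg l)))"
    unfolding set_map set_lits by blast
  moreover have "p \<in> set (concat (map (\<lambda>c. map (\<lambda>l. (argL l, argC c)) c @ [(argE, argC c), (argC c, argC c), (argC c, argPhi)]) \<phi>))
    \<longleftrightarrow> (\<exists>c\<in>set \<phi>. (\<exists>l\<in>set c. p = (argL l, argC c)) \<or> p = (argE, argC c) \<or> p = (argC c, argC c) \<or> p = (argC c, argPhi))"
    unfolding set_concat set_map set_append by (simp add: image_iff) blast
  ultimately show ?thesis unfolding common_attacks_def set_append Un_iff by simp
qed

text \<open>The goal \<open>argPhi\<close> must stay accepted, so all clauses are defeated, by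
  \<open>argE\<close> or by chosen literals. The copies \<open>argD\<close> are attacked by
  \<open>argE\<close> only and are out exactly if it is accepted. In the given labelling all
  variables are true and \<open>argE\<close> is accepted.\<close>

definition inst1 :: "cnf \<Rightarrow> nat \<Rightarrow> inst" where
  "inst1 \<phi> k = (remdups (common_args (vars \<phi>) \<phi> k),
     remdups (common_attacks (vars \<phi>) \<phi> @ map (\<lambda>i. (argE, argD i)) [0..<k]),
     map (\<lambda>v. argL (v, True)) (vars \<phi>) @ [argPhi, argE], argPhi, argE)"

section \<open>The framework for satisfiability, under complete and stable semantics\<close>

context
  fixes \<phi> :: cnf and k :: nat
begin

abbreviation (input) "A1 \<equiv> af_of (inst1 \<phi> k)"

lemma args1: "a \<in> args A1 \<longleftrightarrow> (\<exists>l. fst l \<in> set (vars \<phi>) \<and> a = argL l) \<or> (\<exists>c\<in>set \<phi>. a = argC c) \<or>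
    a = argPhi \<or> a = argE \<or> a = argE' \<or> (\<exists>i<k. a = argD i)"
  by (simp add: af_of_def inst1_def common_args)

lemma attacks1: "p \<in> attacks A1 \<longleftrightarrow> p \<in> set (common_attacks (vars \<phi>) \<phi>) \<or> (\<exists>i<k. p = (argE, argD i))"
  by (auto simp: af_of_def inst1_def)

lemma args1I:
  "fst l \<in> set (vars \<phi>) \<Longrightarrow> argL l \<in> args A1" "c \<in> set \<phi> \<Longrightarrow> argC c \<in> args A1"
  "i < k \<Longrightarrow> argD i \<in> args A1" "argPhi \<in> args A1" "argE \<in> args A1" "argE' \<in> args A1"
  unfolding args1 by blast+

lemma wf_inst1: "wf_inst (inst1 \<phi> k)"
proof -
  have "fst p \<in> args A1 \<and> snd p \<in> args A1" if "p \<in> attacks A1" for p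
    using that unfolding attacks1 common_attacks
    by (elim disjE exE bexE conjE) (simp_all add: args1I vars)
  moreover have "goal (inst1 \<phi> k) \<in> args A1" "goal' (inst1 \<phi> k) \<in> args A1"
    unfolding args1 by (simp_all add: inst1_def)
  ultimately show ?thesis by (simp add: wf_inst_def af_of_def inst1_def)
qed

lemma is_af1: "is_af A1"
  using wf_inst1 by (auto simp: is_af_def wf_inst_def af_of_def)

text \<open>With \<open>e\<close> the argument \<open>argE\<close> defeats all clauses and the
  assignment is arbitrary; otherwise the true literals defeat them. In both cases
  \<open>argPhi\<close> survives.\<close>

lemma stable1:
  assumes sat: "e \<or> sat \<alpha> \<phi>"
  shows "stable_ext A1 ({argL (v, \<alpha> v) | v. v \<in> set (vars \<phi>)} \<union> {argPhi} \<union>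
    (if e then {argE} else insert argE' {argD i | i. i < k}))" (is "stable_ext A1 ?S")
proof (rule stable_extI[OF is_af1])
  show "?S \<subseteq> args A1" by (auto simp: args1I)
  show "(a, b) \<notin> attacks A1" if "a \<in> ?S" "b \<in> ?S" for a b
    using that by (auto simp: attacks1 common_attacks arg_defs split: if_splits)
  show "\<exists>b\<in>?S. (b, a) \<in> attacks A1" if a: "a \<in> args A1" "a \<notin> ?S" for a
  proof -
    from a(1)[unfolded args1] consider l where "fst l \<in> set (vars \<phi>)" "a = argL l" | c where "c \<in> set \<phi>" "a = argC c"
      | "a = argPhi" | "a = argE" | "a = argE'" | i where "i < k" "a = argD i" by blast
    then show ?thesis
    proof cases
      case 1
      then have "snd l \<noteq> \<alpha> (fst l)" using a(2) argL_assign[of l \<alpha> "set (vars \<phi>)"] by blast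
      then have "neg (fst l, \<alpha> (fst l)) = l" by (simp add: neg_def prod_eq_iff)
      then have "(argL (fst l, \<alpha> (fst l)), a) \<in> attacks A1"
        unfolding attacks1 common_attacks using 1 by (intro disjI1 exI[of _ "(fst l, \<alpha> (fst l))"]) simp
      then show ?thesis using 1 by blast
    next
      case 2
      show ?thesis
      proof (cases e)
        case True
        then show ?thesis using 2 by (intro bexI[of _ argE]) (auto simp: attacks1 common_attacks)
      next
        case False
        then obtain l where l: "l \<in> set c" "\<alpha> (fst l) = snd l" using sat 2 unfolding sat_def by blast
        then have "argL l \<in> ?S" using argL_assign[of l \<alpha> "set (vars \<phi>)"] vars[OF 2(1) l(1)] by blast
        moreover have "(argL l, a) \<in> attacks A1" unfolding attacks1 common_attacks using 2 l(1) by blast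
        ultimately show ?thesis by blast
      qed
    next
      case 4
      then show ?thesis using a(2) by (intro bexI[of _ argE']) (auto simp: attacks1 common_attacks)
    next
      case 5
      then show ?thesis using a(2) by (intro bexI[of _ argE]) (auto simp: attacks1 common_attacks split: if_splits)
    next
      case 6
      then show ?thesis using a(2) by (intro bexI[of _ argE]) (auto simp: attacks1 split: if_splits)
    qed (use a(2) in auto)
  qed
qed

lemma extension1: "\<sigma> \<in> {Co, St} \<Longrightarrow> extension \<sigma> A1 (set (in_list (inst1 \<phi> k)))"
proof -
  have "stable_ext A1 (set (in_list (inst1 \<phi> k)))"
  proof -
    have "set (in_list (inst1 \<phi> k)) = {argL (v, True) | v. v \<in> set (vars \<phi>)} \<union> {argPhi} \<union> {argE}"
      by (auto simp: inst1_def)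
    then show ?thesis using stable1[of True "\<lambda>v. True"] by simp
  qed
  then show "\<sigma> \<in> {Co, St} \<Longrightarrow> extension \<sigma> A1 (set (in_list (inst1 \<phi> k)))"
    by (auto simp: stable_ext_def preferred_ext_def)
qed

text \<open>\<open>argPhi\<close> needs every clause to be defeated; the clause itself cannot do it,
  nor can \<open>argE\<close>, so an accepted literal of the clause does. Variables left undecided
  by a complete extension are read as false.\<close>

lemma sat1:
  assumes S: "complete_ext A1 S" "argPhi \<in> S" "argE \<notin> S"
  shows "sat (\<lambda>v. argL (v, True) \<in> S) \<phi>"
  unfolding sat_def
proof
  fix c assume c: "c \<in> set \<phi>"
  then have "(argC c, argPhi) \<in> attacks A1" "(argC c, argC c) \<in> attacks A1" by (auto simp: attacks1 common_attacks)
  then have "argC c \<in> Def A1 S" "argC c \<notin> S"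
    using complete_in_iff[OF S(1), of argPhi] S(2) complete_conflict[OF is_af1 S(1)] by blast+
  then obtain b where b: "b \<in> S" "(b, argC c) \<in> attacks A1" using Def_iff[OF is_af1] by blast
  then obtain l where l: "l \<in> set c" "b = argL l"
    using S(3) \<open>argC c \<notin> S\<close> by (auto simp: attacks1 common_attacks arg_defs)
  have "(argL (fst l, True) \<in> S) = snd l"
  proof (cases "snd l")
    case True
    then have "(fst l, True) = l" by (simp add: prod_eq_iff)
    then show ?thesis using b l True by simp
  next
    case False
    then have "neg l = (fst l, True)" by (simp add: neg_def)
    then have "(argL l, argL (fst l, True)) \<in> attacks A1"
      using vars[OF c l(1)] by (auto simp: attacks1 common_attacks intro!: exI[of _ l])
    then show ?thesis using complete_conflict[OF is_af1 S(1), of "argL l"] b l False by blast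
  qed
  then show "\<exists>l\<in>set c. (argL (fst l, True) \<in> S) = snd l" using l(1) by blast
qed

text \<open>The bound on \<open>k\<close> counts the arguments besides the copies: two literals per
  variable occurrence, the clauses, and \<open>argPhi\<close>, \<open>argE\<close>,
  \<open>argE'\<close>.\<close>

lemma skeptical1:
  assumes \<sigma>: "\<sigma> \<in> {Co, St}" and k: "2 * length (vars \<phi>) + length \<phi> + 3 \<le> k"
  shows "skeptical \<sigma> (inst1 \<phi> k) \<longleftrightarrow> \<not> (\<exists>\<alpha>. sat \<alpha> \<phi>)"
proof -
  let ?D = "{argD i | i. i < k}"
  have cD: "card ?D = k"
  proof -
    have "?D = argD ` {..<k}" by auto
    then show ?thesis by (simp add: card_image inj_on_def argD_def)
  qed
  have "card (args A1) \<le> length (common_args (vars \<phi>) \<phi> k)"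
    by (simp add: af_of_def inst1_def card_length)
  also have "\<dots> = 2 * length (vars \<phi>) + length \<phi> + 3 + k"
  proof -
    have "length (lits X) = 2 * length X" for X by (induction X) (auto simp: lits_def)
    then show ?thesis by (simp add: common_args_def)
  qed
  finally have card: "card (args A1) \<le> 2 * card ?D" using k cD by simp
  have L: "lab_of (inst1 \<phi> k) argPhi = In" "lab_of (inst1 \<phi> k) argE = In"
    by (auto simp: lab_of_def labelling_of_def inst1_def)
  have lab: "labelling_of A1 S d = Out \<longleftrightarrow> argE \<in> S" if S: "complete_ext A1 S" and d: "d \<in> ?D" for S d
  proof -
    have "d \<in> Def A1 S \<longleftrightarrow> argE \<in> S"
      using d Def_iff[OF is_af1] by (auto simp: attacks1 common_attacks arg_defs)
    moreover have "d \<in> Def A1 S \<Longrightarrow> d \<notin> S"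
      using complete_extD(2)[OF S] by blast
    ultimately show ?thesis by (auto simp: labelling_of_def)
  qed
  have In: "labelling_of A1 S a = In \<longleftrightarrow> a \<in> S" for S a by (simp add: labelling_of_def)
  have cI: "complete_ext A1 (set (in_list (inst1 \<phi> k)))" using extension1[of Co] by simp
  have LD: "lab_of (inst1 \<phi> k) d = Out" if "d \<in> ?D" for d
    unfolding lab_of_def using lab[OF cI that] by (simp add: inst1_def)
  have "skeptical \<sigma> (inst1 \<phi> k) \<longleftrightarrow> (\<forall>L'\<in>semifactuals \<sigma> A1 argPhi (lab_of (inst1 \<phi> k)). L' argE = In)"
    by (simp add: skeptical_def inst1_def)
  also have "\<dots> \<longleftrightarrow> (\<forall>L'\<in>labellings \<sigma> A1. lab_of (inst1 \<phi> k) argPhi = L' argPhi \<longrightarrow> L' argE = In)"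
  proof (rule semifactuals_skeptical[OF is_af1 _ card])
    show "?D \<subseteq> args A1" "argE \<in> args A1" by (auto simp: args1I)
    show "argE \<notin> ?D" by (auto simp: arg_defs)
    have LO: "L' d = Out \<longleftrightarrow> L' argE = In" if L': "L' \<in> labellings \<sigma> A1" and d: "d \<in> ?D" for L' d
    proof -
      obtain S where S: "extension \<sigma> A1 S" "L' = labelling_of A1 S" using L' unfolding labellings_def by blast
      show ?thesis unfolding S(2) In by (rule lab[OF extension_complete[OF S(1)] d])
    qed
    show "L' d = lab_of (inst1 \<phi> k) d" if "L' \<in> labellings \<sigma> A1" "L' argE = In" "d \<in> ?D" for L' d
      unfolding LD[OF that(3)] using LO[OF that(1,3)] that(2) by blast
    show "L' d \<noteq> lab_of (inst1 \<phi> k) d" if "L' \<in> labellings \<sigma> A1" "L' argE \<noteq> In" "d \<in> ?D" for L' d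
      unfolding LD[OF that(3)] using LO[OF that(1,3)] that(2) by blast
  qed (rule L)
  also have "\<dots> \<longleftrightarrow> (\<forall>S. extension \<sigma> A1 S \<longrightarrow> argPhi \<in> S \<longrightarrow> argE \<in> S)"
    unfolding L labellings_def using In by (auto simp: eq_commute[of In])
  also have "\<dots> \<longleftrightarrow> \<not> (\<exists>\<alpha>. sat \<alpha> \<phi>)"
  proof
    assume a: "\<forall>S. extension \<sigma> A1 S \<longrightarrow> argPhi \<in> S \<longrightarrow> argE \<in> S"
    show "\<not> (\<exists>\<alpha>. sat \<alpha> \<phi>)"
    proof
      assume "\<exists>\<alpha>. sat \<alpha> \<phi>"
      then obtain \<alpha> where "sat \<alpha> \<phi>" by blast
      let ?S = "{argL (v, \<alpha> v) | v. v \<in> set (vars \<phi>)} \<union> {argPhi} \<union> insert argE' ?D"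
      have "stable_ext A1 ?S" using stable1[of False \<alpha>] \<open>sat \<alpha> \<phi>\<close> by simp
      then have "extension \<sigma> A1 ?S" using \<sigma> by (auto simp: stable_ext_def preferred_ext_def)
      moreover have "argE \<notin> ?S" by (auto simp: arg_defs)
      ultimately show False using a by blast
    qed
  next
    assume "\<not> (\<exists>\<alpha>. sat \<alpha> \<phi>)"
    then show "\<forall>S. extension \<sigma> A1 S \<longrightarrow> argPhi \<in> S \<longrightarrow> argE \<in> S" using sat1 extension_complete by blast
  qed
  finally show ?thesis .
qed

end

text \<open>In the second reduction \<open>argB\<close> blocks the choice of an assignment to the variables outside
  \<open>Y\<close> unless \<open>argPhi\<close> is accepted. The self-attacking copies \<open>argLS\<close>, \<open>argPhiS\<close>, \<open>argES\<close>, \<open>argES'\<close>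
  and \<open>argGS\<close> make the ranges of different preferred extensions incomparable.\<close>

definition starred :: "var list \<Rightarrow> (word \<times> word) list" where
  "starred X = map (\<lambda>l. (argL l, argLS l)) (lits X) @
     [(argPhi, argPhiS), (argE, argES), (argE', argES'), (argG, argGS)]"

text \<open>The goal \<open>argG\<close> is unattacked and thus in every complete extension, so the
  condition on the goal is empty. The copies \<open>argD\<close> are now attacked by
  \<open>argPhi\<close>. The variables of \<open>Y\<close> are listed separately because they are
  quantified universally and may be missing in the formula.\<close>

definition inst2 :: "var list \<Rightarrow> cnf \<Rightarrow> nat \<Rightarrow> inst" where
  "inst2 Y \<phi> k = (let X = Y @ vars \<phi> in
     (remdups (common_args X \<phi> k @ [argB, argG] @ map snd (starred X)),
      remdups (common_attacks X \<phi> @ [(argPhi, argB), (argB, argB)] @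
        map (\<lambda>l. (argB, argL l)) (lits (filter (\<lambda>v. v \<notin> set Y) (vars \<phi>))) @
        map (\<lambda>i. (argPhi, argD i)) [0..<k] @ starred X @ map (\<lambda>p. (snd p, snd p)) (starred X)),
      map (\<lambda>v. argL (v, True)) X @ [argPhi, argE, argG], argG, argPhi))"

lemma starred: "p \<in> set (starred X) \<longleftrightarrow> (\<exists>l. fst l \<in> set X \<and> p = (argL l, argLS l)) \<or>
   p = (argPhi, argPhiS) \<or> p = (argE, argES) \<or> p = (argE', argES') \<or> p = (argG, argGS)"
  unfolding starred_def set_append set_map set_lits by (simp add: image_iff) blast

lemma Bex_snd_starred: "(\<exists>a\<in>snd ` set (starred X). P a) \<longleftrightarrow> (\<exists>l. fst l \<in> set X \<and> P (argLS l)) \<or>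
   P argPhiS \<or> P argES \<or> P argES' \<or> P argGS"
proof -
  have "snd ` set (starred X) = argLS ` set (lits X) \<union> {argPhiS, argES, argES', argGS}"
    by (simp add: starred_def image_Un image_image)
  then show ?thesis unfolding set_lits by (simp add: bex_Un) (simp only: disj_ac)
qed

section \<open>The framework for quantified formulas, under preferred and semi-stable
  semantics\<close>

context
  fixes Y :: "var list" and \<phi> :: cnf and k :: nat
begin

abbreviation (input) "A2 \<equiv> af_of (inst2 Y \<phi> k)"
abbreviation (input) "X2 \<equiv> set Y \<union> set (vars \<phi>)"

lemma args2: "a \<in> args A2 \<longleftrightarrow> (\<exists>l. fst l \<in> X2 \<and> a = argL l) \<or> (\<exists>c\<in>set \<phi>. a = argC c) \<or>
    a = argPhi \<or> a = argE \<or> a = argE' \<or> (\<exists>i<k. a = argD i) \<or> a = argB \<or> a = argG \<or> (\<exists>l. fst l \<in> X2 \<and> a = argLS l) \<or>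
    a = argPhiS \<or> a = argES \<or> a = argES' \<or> a = argGS"
proof -
  have "a \<in> args A2 \<longleftrightarrow> a \<in> set (common_args (Y @ vars \<phi>) \<phi> k) \<or> a = argB \<or> a = argG \<or>
      (\<exists>b\<in>snd ` set (starred (Y @ vars \<phi>)). a = b)"
    by (simp add: af_of_def inst2_def Let_def) blast
  also have "\<dots> \<longleftrightarrow> a \<in> set (common_args (Y @ vars \<phi>) \<phi> k) \<or> a = argB \<or> a = argG \<or> (\<exists>l. fst l \<in> X2 \<and> a = argLS l) \<or>
      a = argPhiS \<or> a = argES \<or> a = argES' \<or> a = argGS"
    unfolding Bex_snd_starred by simp
  finally show ?thesis by (simp only: common_args set_append Un_iff disj_ac)
qed

lemma args2I:
  "fst l \<in> X2 \<Longrightarrow> argL l \<in> args A2" "fst l \<in> X2 \<Longrightarrow> argLS l \<in> args A2"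
  "c \<in> set \<phi> \<Longrightarrow> argC c \<in> args A2" "i < k \<Longrightarrow> argD i \<in> args A2"
  "argPhi \<in> args A2" "argE \<in> args A2" "argE' \<in> args A2" "argB \<in> args A2" "argG \<in> args A2"
  "argPhiS \<in> args A2" "argES \<in> args A2" "argES' \<in> args A2" "argGS \<in> args A2"
  unfolding args2 by blast+

lemma attacks2: "p \<in> attacks A2 \<longleftrightarrow>
   (\<exists>l. fst l \<in> X2 \<and> p = (argL l, argL (neg l))) \<or>
   (\<exists>c\<in>set \<phi>. (\<exists>l\<in>set c. p = (argL l, argC c)) \<or> p = (argE, argC c) \<or> p = (argC c, argC c) \<or> p = (argC c, argPhi)) \<or>
   p = (argE, argE') \<or> p = (argE', argE) \<or> p = (argPhi, argB) \<or> p = (argB, argB) \<or>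
   (\<exists>l. fst l \<in> set (vars \<phi>) \<and> fst l \<notin> set Y \<and> p = (argB, argL l)) \<or> (\<exists>i<k. p = (argPhi, argD i)) \<or>
   (\<exists>l. fst l \<in> X2 \<and> p = (argL l, argLS l)) \<or>
   p = (argPhi, argPhiS) \<or> p = (argE, argES) \<or> p = (argE', argES') \<or> p = (argG, argGS) \<or>
   (\<exists>l. fst l \<in> X2 \<and> p = (argLS l, argLS l)) \<or>
   p = (argPhiS, argPhiS) \<or> p = (argES, argES) \<or> p = (argES', argES') \<or> p = (argGS, argGS)"
proof -
  have "p \<in> attacks A2 \<longleftrightarrow> p \<in> set (common_attacks (Y @ vars \<phi>) \<phi>) \<or> p = (argPhi, argB) \<or> p = (argB, argB) \<or>
     (\<exists>l. fst l \<in> set (vars \<phi>) \<and> fst l \<notin> set Y \<and> p = (argB, argL l)) \<or> (\<exists>i<k. p = (argPhi, argD i)) \<or>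
     p \<in> set (starred (Y @ vars \<phi>)) \<or> (\<exists>a\<in>snd ` set (starred (Y @ vars \<phi>)). p = (a, a))"
  proof -
    have "p \<in> (\<lambda>l. (argB, argL l)) ` set (lits (filter (\<lambda>v. v \<notin> set Y) (vars \<phi>))) \<longleftrightarrow>
        (\<exists>l. fst l \<in> set (vars \<phi>) \<and> fst l \<notin> set Y \<and> p = (argB, argL l))"
      unfolding set_lits set_filter by blast
    moreover have "p \<in> (\<lambda>i. (argPhi, argD i)) ` {0..<k} \<longleftrightarrow> (\<exists>i<k. p = (argPhi, argD i))" by auto
    moreover have "p \<in> (\<lambda>p. (snd p, snd p)) ` set (starred (Y @ vars \<phi>)) \<longleftrightarrow> (\<exists>a\<in>snd ` set (starred (Y @ vars \<phi>)). p = (a, a))"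
      by blast
    ultimately show ?thesis
      unfolding af_of_def inst2_def Let_def fst_conv snd_conv af.simps set_remdups set_append set_map set_upt Un_iff
        list.set insert_iff empty_iff
      by (simp only: disj_ac simp_thms)
  qed
  also have "(\<exists>a\<in>snd ` set (starred (Y @ vars \<phi>)). p = (a, a)) \<longleftrightarrow> (\<exists>l. fst l \<in> X2 \<and> p = (argLS l, argLS l)) \<or>
   p = (argPhiS, argPhiS) \<or> p = (argES, argES) \<or> p = (argES', argES') \<or> p = (argGS, argGS)"
    unfolding Bex_snd_starred set_append by simp
  finally show ?thesis unfolding common_attacks starred set_append by (simp only: disj_ac)
qed

lemma attackers2:
  "(b, argL l) \<in> attacks A2 \<longleftrightarrow> fst l \<in> X2 \<and> b = argL (neg l) \<or> fst l \<in> set (vars \<phi>) \<and> fst l \<notin> set Y \<and> b = argB"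
  "(b, argC c) \<in> attacks A2 \<longleftrightarrow> c \<in> set \<phi> \<and> ((\<exists>l\<in>set c. b = argL l) \<or> b = argE \<or> b = argC c)"
  "(b, argPhi) \<in> attacks A2 \<longleftrightarrow> (\<exists>c\<in>set \<phi>. b = argC c)"
  "(b, argE) \<in> attacks A2 \<longleftrightarrow> b = argE'"
  "(b, argE') \<in> attacks A2 \<longleftrightarrow> b = argE"
  "(b, argB) \<in> attacks A2 \<longleftrightarrow> b = argPhi \<or> b = argB"
  "(b, argG) \<notin> attacks A2"
  "(b, argD i) \<in> attacks A2 \<longleftrightarrow> i < k \<and> b = argPhi"
  "(b, argLS l) \<in> attacks A2 \<longleftrightarrow> fst l \<in> X2 \<and> (b = argL l \<or> b = argLS l)"
  "(b, argPhiS) \<in> attacks A2 \<longleftrightarrow> b = argPhi \<or> b = argPhiS"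
  "(b, argES) \<in> attacks A2 \<longleftrightarrow> b = argE \<or> b = argES"
  "(b, argES') \<in> attacks A2 \<longleftrightarrow> b = argE' \<or> b = argES'"
  "(b, argGS) \<in> attacks A2 \<longleftrightarrow> b = argG \<or> b = argGS"
proof -
  have "(b, argL l) \<in> attacks A2 \<longleftrightarrow> (\<exists>l'. fst l' \<in> X2 \<and> b = argL l' \<and> l = neg l') \<or>
      (\<exists>l'. fst l' \<in> set (vars \<phi>) \<and> fst l' \<notin> set Y \<and> b = argB \<and> l = l')"
    unfolding attacks2 by (simp add: arg_defs)
  then show "(b, argL l) \<in> attacks A2 \<longleftrightarrow> fst l \<in> X2 \<and> b = argL (neg l) \<or> fst l \<in> set (vars \<phi>) \<and> fst l \<notin> set Y \<and> b = argB"
    unfolding eq_neg[of l] by simp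
qed (unfold attacks2, simp_all add: arg_defs, blast+)

lemma wf_inst2: "wf_inst (inst2 Y \<phi> k)"
proof -
  have "fst p \<in> args A2 \<and> snd p \<in> args A2" if "p \<in> attacks A2" for p
    using that unfolding attacks2
    by (elim disjE exE bexE conjE) (simp_all add: args2I vars)
  moreover have "distinct (fst (inst2 Y \<phi> k))" "distinct (fst (snd (inst2 Y \<phi> k)))"
    unfolding inst2_def Let_def fst_conv snd_conv by (rule distinct_remdups)+
  moreover have "goal (inst2 Y \<phi> k) \<in> args A2" "goal' (inst2 Y \<phi> k) \<in> args A2"
    unfolding args2 by (simp_all add: inst2_def Let_def)
  ultimately show ?thesis by (simp add: wf_inst_def af_of_def)
qed

lemma is_af2: "is_af A2"
  using wf_inst2 by (auto simp: is_af_def wf_inst_def af_of_def)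

definition assign_set :: "(var \<Rightarrow> bool) \<Rightarrow> bool \<Rightarrow> word set" where
  "assign_set \<alpha> e = {argL (v, \<alpha> v) | v. v \<in> X2} \<union> {argPhi, argG, if e then argE else argE'}"

text \<open>Accepting \<open>argPhi\<close> defeats \<open>argB\<close>, which frees the variables
  outside \<open>Y\<close>. Every argument that is left over is attacked or attacks itself, so the
  set is maximal.\<close>

lemma preferred2:
  assumes sat: "e \<or> sat \<alpha> \<phi>"
  shows "preferred_ext A2 (assign_set \<alpha> e)" (is "preferred_ext A2 ?S")
proof (rule preferred_extI[OF is_af2])
  show "?S \<subseteq> args A2" unfolding assign_set_def by (auto simp: args2I)
  have inS: "argL l \<in> ?S \<longleftrightarrow> fst l \<in> X2 \<and> snd l = \<alpha> (fst l)" "argC c \<notin> ?S" "argB \<notin> ?S"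
    "argE \<in> ?S \<longleftrightarrow> e" "argE' \<in> ?S \<longleftrightarrow> \<not> e" "argPhi \<in> ?S" "argG \<in> ?S" for l c
  proof -
    show "argL l \<in> ?S \<longleftrightarrow> fst l \<in> X2 \<and> snd l = \<alpha> (fst l)"
    proof -
      have "argL l \<notin> {argPhi, argG, if e then argE else argE'}" by (simp add: arg_defs)
      then show ?thesis using argL_assign[of l \<alpha> X2] unfolding assign_set_def by blast
    qed
    show "argC c \<notin> ?S" "argB \<notin> ?S" "argE \<in> ?S \<longleftrightarrow> e" "argE' \<in> ?S \<longleftrightarrow> \<not> e" "argPhi \<in> ?S" "argG \<in> ?S"
      unfolding assign_set_def by (simp_all add: arg_defs)
  qed
  have in_S: "(\<exists>l. fst l \<in> X2 \<and> a = argL l) \<or> a = argE \<or> a = argE' \<or> a = argPhi \<or> a = argG" if "a \<in> ?S" for a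
  proof -
    from that consider v where "v \<in> X2" "a = argL (v, \<alpha> v)" | "a = argPhi" | "a = argG" | "a = (if e then argE else argE')"
      unfolding assign_set_def by blast
    then show ?thesis
    proof cases
      case 1
      then show ?thesis by (intro disjI1 exI[of _ "(v, \<alpha> v)"]) simp
    qed (simp_all split: if_splits)
  qed
  show cf: "(b, a) \<notin> attacks A2" if "b \<in> ?S" "a \<in> ?S" for a b
  proof
    assume att: "(b, a) \<in> attacks A2"
    from in_S[OF that(2)] show False
    proof (elim disjE exE conjE)
      fix l assume "a = argL l" "fst l \<in> X2"
      then show False using att that by (auto simp: attackers2 inS)
    qed (use att that inS in \<open>simp_all only: attackers2, blast+\<close>)
  qed
  have C: "\<exists>b\<in>?S. (b, argC c) \<in> attacks A2" if c: "c \<in> set \<phi>" for c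
  proof (cases e)
    case True
    have "(argE, argC c) \<in> attacks A2" unfolding attackers2 using c by blast
    then show ?thesis using True unfolding assign_set_def by auto
  next
    case False
    then obtain l where l: "l \<in> set c" "\<alpha> (fst l) = snd l" using sat c unfolding sat_def by blast
    then have "argL l \<in> ?S" using argL_assign[of l \<alpha> X2] vars[OF c l(1)] unfolding assign_set_def by blast
    moreover have "(argL l, argC c) \<in> attacks A2" unfolding attackers2 using c l(1) by blast
    ultimately show ?thesis by blast
  qed
  have l: "\<exists>b\<in>?S. (b, argL l) \<in> attacks A2" if "fst l \<in> X2" "argL l \<notin> ?S" for l
  proof -
    have "snd l \<noteq> \<alpha> (fst l)" using that argL_assign[of l \<alpha> X2] unfolding assign_set_def by blast
    then have "neg (fst l, \<alpha> (fst l)) = l" by (simp add: neg_def prod_eq_iff)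
    then have "(fst l, \<alpha> (fst l)) = neg l" by (subst eq_neg) (rule sym)
    then have "(argL (fst l, \<alpha> (fst l)), argL l) \<in> attacks A2" unfolding attackers2 using that(1) by simp
    then show ?thesis using that(1) unfolding assign_set_def by blast
  qed
  have B: "\<exists>b\<in>?S. (b, argB) \<in> attacks A2" by (intro bexI[OF _ inS(6)]) (simp add: attackers2)
  have E: "\<exists>b\<in>?S. (b, argE) \<in> attacks A2" if "argE \<notin> ?S"
  proof -
    have "\<not> e" using that unfolding assign_set_def by auto
    moreover have "(argE', argE) \<in> attacks A2" unfolding attackers2 by blast
    ultimately show ?thesis unfolding assign_set_def by auto
  qed
  have E': "\<exists>b\<in>?S. (b, argE') \<in> attacks A2" if "argE' \<notin> ?S"
  proof -
    have "e" using that unfolding assign_set_def by (auto split: if_splits)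
    moreover have "(argE, argE') \<in> attacks A2" unfolding attackers2 by blast
    ultimately show ?thesis unfolding assign_set_def by auto
  qed
  show rest: "(\<exists>b\<in>?S. (b, a) \<in> attacks A2) \<or> (a, a) \<in> attacks A2" if "a \<in> args A2" "a \<notin> ?S" for a
  proof -
    have D: "\<exists>b\<in>?S. (b, argD i) \<in> attacks A2" if "i < k" for i
      using that by (intro bexI[OF _ inS(6)]) (simp add: attackers2)
    have self: "(argB, argB) \<in> attacks A2" "fst l \<in> X2 \<Longrightarrow> (argLS l, argLS l) \<in> attacks A2"
      "(argPhiS, argPhiS) \<in> attacks A2" "(argES, argES) \<in> attacks A2" "(argES', argES') \<in> attacks A2"
      "(argGS, argGS) \<in> attacks A2" for l by (simp_all add: attackers2)
    from that(1)[unfolded args2] show ?thesis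
      using that(2) C l D E E' self inS(6,7) by (elim disjE exE bexE conjE) blast+
  qed
  show "\<exists>c\<in>?S. (c, b) \<in> attacks A2" if a: "a \<in> ?S" "(b, a) \<in> attacks A2" for a b
  proof -
    have nb: "b \<notin> ?S" using cf a by blast
    from in_S[OF a(1)] show ?thesis
    proof (elim disjE exE conjE)
      fix l' assume "a = argL l'" "fst l' \<in> X2"
      then have "b = argL (neg l') \<and> fst (neg l') \<in> X2 \<or> b = argB" using a(2) by (simp add: attackers2) blast
      then show ?thesis using B l nb by blast
    qed (use a(2) C E E' nb in \<open>auto simp: attackers2\<close>)
  qed
qed

lemma extension2_in: "preferred_ext A2 (set (in_list (inst2 Y \<phi> k)))"
proof -
  have "set (in_list (inst2 Y \<phi> k)) = assign_set (\<lambda>v. True) True"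
    unfolding inst2_def Let_def assign_set_def by auto
  then show ?thesis using preferred2[of True] by simp
qed

lemma complete2:
  assumes S: "complete_ext A2 S"
  shows "argC c \<in> S \<Longrightarrow> c \<notin> set \<phi>" "argB \<notin> S" "fst l \<in> X2 \<Longrightarrow> argLS l \<notin> S"
    "argPhiS \<notin> S" "argES \<notin> S" "argES' \<notin> S" "argGS \<notin> S"
  using complete_conflict[OF is_af2 S] by (metis attackers2)+

text \<open>An accepted copy would need an accepted attacker of \<open>argPhi\<close>, that is a
  clause, and clauses attack themselves.\<close>

lemma no_D: "complete_ext A2 S \<Longrightarrow> i < k \<Longrightarrow> argD i \<notin> S"
proof
  assume S: "complete_ext A2 S" and i: "i < k" "argD i \<in> S"
  have "(argPhi, argD i) \<in> attacks A2" unfolding attackers2 using i by blast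
  then have "argPhi \<in> Def A2 S" using complete_in_iff[OF S, of "argD i"] i(2) by blast
  then obtain b where "b \<in> S" "(b, argPhi) \<in> attacks A2" using Def_iff[OF is_af2] by blast
  then obtain c where "c \<in> set \<phi>" "argC c \<in> S" unfolding attackers2 by blast
  then show False using complete2(1)[OF S] by blast
qed

lemma in_complete2:
  assumes S: "complete_ext A2 S" "a \<in> S"
  shows "(\<exists>l. fst l \<in> X2 \<and> a = argL l) \<or> a = argPhi \<or> a = argE \<or> a = argE' \<or> a = argG"
proof -
  have "a \<in> args A2" using S(2) complete_extD(1)[OF S(1)] by blast
  then show ?thesis using S(2) complete2[OF S(1)] no_D[OF S(1)] unfolding args2 by blast
qed

text \<open>Every accepted argument attacks a starred copy that only this argument and the copy
  itself attack. A range that contains the copy thus betrays the argument, so inclusion of ranges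
  implies inclusion of the extensions.\<close>

lemma semi_stable2:
  assumes S: "preferred_ext A2 S"
  shows "semi_stable_ext A2 S"
  unfolding semi_stable_ext_def
proof (intro conjI S notI)
  assume "\<exists>T. preferred_ext A2 T \<and> S \<union> Def A2 S \<subset> T \<union> Def A2 T"
  then obtain T where T: "preferred_ext A2 T" "S \<union> Def A2 S \<subset> T \<union> Def A2 T" by blast
  have cS: "complete_ext A2 S" and cT: "complete_ext A2 T" using S T(1) unfolding preferred_ext_def by auto
  have "a \<in> T" if a: "a \<in> S" for a
  proof -
    obtain a' where a': "(a, a') \<in> attacks A2" "a' \<notin> T" "\<And>b. (b, a') \<in> attacks A2 \<Longrightarrow> b = a \<or> b = a'"
    proof -
      from in_complete2[OF cS a] consider l where "fst l \<in> X2" "a = argL l" | "a = argPhi" | "a = argE" | "a = argE'" | "a = argG"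
        by blast
      then show ?thesis
      proof cases
        case 1
        then show ?thesis using complete2(3)[OF cT, of l] that[of "argLS l"] unfolding attackers2 by blast
      next
        case 2
        then show ?thesis using complete2(4)[OF cT] that[of "argPhiS"] unfolding attackers2 by blast
      next
        case 3
        then show ?thesis using complete2(5)[OF cT] that[of "argES"] unfolding attackers2 by blast
      next
        case 4
        then show ?thesis using complete2(6)[OF cT] that[of "argES'"] unfolding attackers2 by blast
      next
        case 5
        then show ?thesis using complete2(7)[OF cT] that[of "argGS"] unfolding attackers2 by blast
      qed
    qed
    have "a' \<in> Def A2 S" using a a'(1) Def_iff[OF is_af2] by blast
    then have "a' \<in> Def A2 T" using T(2) a'(2) by blast
    then obtain b where "b \<in> T" "(b, a') \<in> attacks A2" using Def_iff[OF is_af2] by blast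
    then show ?thesis using a'(2,3) by blast
  qed
  then have "S = T" using S cT unfolding preferred_ext_def by blast
  then show False using T(2) by blast
qed

lemma extension2: "\<sigma> \<in> {Pr, Sst} \<Longrightarrow> extension \<sigma> A2 S \<longleftrightarrow> preferred_ext A2 S"
  using semi_stable2[of S] by (auto simp: semi_stable_ext_def)

text \<open>A complete extension without \<open>argPhi\<close> fixes values on \<open>Y\<close>
  only. If they extend to a model, it can be enlarged by \<open>argPhi\<close>; if they do not and
  \<open>argE'\<close> is chosen, no enlargement contains \<open>argPhi\<close>. Maximality thus
  expresses the inner existential quantifier.\<close>

lemma preferred2_iff:
  "(\<forall>S. preferred_ext A2 S \<longrightarrow> argPhi \<in> S) \<longleftrightarrow> (\<forall>\<beta>. \<exists>\<alpha>. sat \<alpha> \<phi> \<and> (\<forall>v\<in>set Y. \<alpha> v = \<beta> v))"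
proof
  assume R: "\<forall>S. preferred_ext A2 S \<longrightarrow> argPhi \<in> S"
  show "\<forall>\<beta>. \<exists>\<alpha>. sat \<alpha> \<phi> \<and> (\<forall>v\<in>set Y. \<alpha> v = \<beta> v)"
  proof (rule ccontr)
    assume "\<not> (\<forall>\<beta>. \<exists>\<alpha>. sat \<alpha> \<phi> \<and> (\<forall>v\<in>set Y. \<alpha> v = \<beta> v))"
    then obtain \<beta> where no: "\<not> (\<exists>\<alpha>. sat \<alpha> \<phi> \<and> (\<forall>v\<in>set Y. \<alpha> v = \<beta> v))" unfolding not_all by (rule exE)
    then have \<beta>: "\<exists>v\<in>set Y. \<alpha> v \<noteq> \<beta> v" if "sat \<alpha> \<phi>" for \<alpha> using that by metis
    \<comment> \<open>Only \<beta> on \<open>Y\<close> is chosen: without \<open>argPhi\<close> the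
      argument \<open>argB\<close> stays undefeated and blocks all other literals, and
      \<open>argE'\<close> excludes \<open>argE\<close>.\<close>
    define S0 where "S0 = {argL (v, \<beta> v) | v. v \<in> set Y} \<union> {argE', argG}"
    have D: "a \<in> Def A2 S0 \<longleftrightarrow> (\<exists>b\<in>S0. (b, a) \<in> attacks A2)" for a
      by (rule Def_iff[OF is_af2])
    have inL: "argL l \<in> S0 \<longleftrightarrow> fst l \<in> set Y \<and> snd l = \<beta> (fst l)" for l
    proof -
      have "argL l \<notin> {argE', argG}" by (simp add: arg_defs)
      then show ?thesis using argL_assign[of l \<beta> "set Y"] unfolding S0_def by blast
    qed
    have inS: "argC c \<notin> S0" "argPhi \<notin> S0" "argB \<notin> S0" "argE \<notin> S0" "argE' \<in> S0" "argG \<in> S0" for c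
      by (simp_all add: S0_def arg_defs)
    have in_S: "(\<exists>l. fst l \<in> set Y \<and> a = argL l) \<or> a = argE' \<or> a = argG" if "a \<in> S0" for a
    proof -
      from that consider v where "v \<in> set Y" "a = argL (v, \<beta> v)" | "a = argE'" | "a = argG" unfolding S0_def by blast
      then show ?thesis
      proof cases
        case 1
        then show ?thesis by (intro disjI1 exI[of _ "(v, \<beta> v)"]) simp
      qed simp_all
    qed
    \<comment> \<open>\<beta> itself falsifies some clause. As \<open>S0\<close> does not defeat
      this clause, \<open>argPhi\<close> is not defended.\<close>
    have "\<not> sat \<beta> \<phi>" using \<beta>[of \<beta>] by blast
    then obtain c where c: "c \<in> set \<phi>" "\<And>l. l \<in> set c \<Longrightarrow> \<beta> (fst l) \<noteq> snd l" unfolding sat_def by blast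
    have cf: "(b, a) \<notin> attacks A2" if "a \<in> S0" "b \<in> S0" for a b
    proof
      assume att: "(b, a) \<in> attacks A2"
      from in_S[OF that(1)] show False
      proof (elim disjE exE conjE)
        fix l assume l: "a = argL l" "fst l \<in> set Y"
        then have "b = argL (neg l)" using att inS that(2) unfolding l attackers2 by blast
        then show False using that l inL[of l] inL[of "neg l"] by simp
      next
        assume "a = argE'"
        then have "b = argE" using att attackers2(5) by simp
        then show False using that(2) inS(4) by simp
      next
        assume "a = argG"
        then show False using att attackers2(7) by simp
      qed
    qed
    have conf: "S0 \<inter> Def A2 S0 = {}" using cf D by blast
    have "complete_ext A2 S0" unfolding complete_ext_def admissible_def conflict_free_def
    proof (intro conjI)
      show "S0 \<subseteq> args A2" by (auto simp: args2I S0_def)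
      show "S0 \<inter> Def A2 S0 = {}" by (rule conf)
      have "a \<in> S0 \<longleftrightarrow> a \<in> Acc A2 S0" for a
      proof
        assume a: "a \<in> S0"
        have "b \<in> Def A2 S0" if b: "(b, a) \<in> attacks A2" for b
        proof -
          from in_S[OF a] show ?thesis
          proof (elim disjE exE conjE)
            fix l assume l: "a = argL l" "fst l \<in> set Y"
            then have "b = argL (neg l)" using b unfolding l attackers2 by blast
            then have "(a, b) \<in> attacks A2" using l by (simp add: attackers2)
            then show ?thesis using D a by blast
          next
            assume "a = argE'"
            then have "(argE', b) \<in> attacks A2" using b by (simp add: attackers2)
            then show ?thesis using D inS(5) by blast
          next
            assume "a = argG"
            then show ?thesis using b attackers2(7) by simp
          qed
        qed
        moreover have "a \<in> args A2" using a by (auto simp: args2I S0_def)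
        ultimately show "a \<in> Acc A2 S0" unfolding Acc_def by blast
      next
        assume a: "a \<in> Acc A2 S0"
        then have at: "\<And>b. (b, a) \<in> attacks A2 \<Longrightarrow> b \<in> Def A2 S0" and aA: "a \<in> args A2" unfolding Acc_def by auto
        have Phi: "argPhi \<notin> Def A2 S0" using inS unfolding D attackers2 by blast
        have B: "argB \<notin> Def A2 S0" using inS unfolding D attackers2 by blast
        have E': "argE' \<notin> Def A2 S0" using inS unfolding D attackers2 by blast
        have self: "False" if aa: "(a, a) \<in> attacks A2"
        proof -
          obtain b where b: "b \<in> S0" "(b, a) \<in> attacks A2" using at[OF aa] D by blast
          then have "b \<in> Def A2 S0" using at by blast
          then show False using b(1) conf by blast
        qed
        have L: "argL l \<in> S0" if l: "a = argL l" "fst l \<in> X2" for l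
        proof -
          have Y: "fst l \<in> set Y"
          proof (rule ccontr)
            assume "fst l \<notin> set Y"
            then have "(argB, a) \<in> attacks A2" using l unfolding l attackers2 by blast
            then show False using at B by blast
          qed
          have "(argL (neg l), a) \<in> attacks A2" using l unfolding l attackers2 by blast
          then have "argL (neg l) \<in> Def A2 S0" by (rule at)
          then obtain b where "b \<in> S0" "(b, argL (neg l)) \<in> attacks A2" unfolding D by blast
          then show ?thesis using inS by (auto simp: attackers2)
        qed
        have Cc: "argC c \<notin> Def A2 S0"
        proof
          assume "argC c \<in> Def A2 S0"
          then obtain b where b: "b \<in> S0" "(b, argC c) \<in> attacks A2" unfolding D by blast
          then obtain l where "l \<in> set c" "b = argL l" using inS unfolding attackers2 by blast
          then show False using b(1) inL[of l] c(2)[of l] by simp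
        qed
        have nPhi: "a \<noteq> argPhi"
        proof
          assume "a = argPhi"
          then have "(argC c, a) \<in> attacks A2" using c(1) attackers2(3) by blast
          then show False using at Cc by blast
        qed
        have nE: "a \<noteq> argE"
        proof
          assume "a = argE"
          then have "(argE', a) \<in> attacks A2" using attackers2(4) by blast
          then show False using at E' by blast
        qed
        have nD: "a \<noteq> argD i" if "i < k" for i
        proof
          assume "a = argD i"
          then have "(argPhi, a) \<in> attacks A2" using that attackers2(8) by blast
          then show False using at Phi by blast
        qed
        have nS: "c' \<in> set \<phi> \<Longrightarrow> a \<noteq> argC c'" "a \<noteq> argB" "fst l \<in> X2 \<Longrightarrow> a \<noteq> argLS l" "a \<noteq> argPhiS" "a \<noteq> argES"
          "a \<noteq> argES'" "a \<noteq> argGS" for c' l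
          using self by (auto simp: attackers2)
        from aA[unfolded args2] show "a \<in> S0"
          using nPhi nE nD nS L inS(5,6) by (elim disjE exE bexE conjE) blast+
      qed
      then show "S0 \<subseteq> Acc A2 S0" "S0 = Acc A2 S0" by blast+
    qed
    \<comment> \<open>A preferred extension above \<open>S0\<close> keeps \<beta> on
      \<open>Y\<close> and contains \<open>argPhi\<close> by assumption. As it lacks
      \<open>argE\<close>, its literals satisfy the formula, against the choice of \<beta>.\<close>
    then obtain T where T: "preferred_ext A2 T" "S0 \<subseteq> T" using ex_preferred[OF is_af2] by blast
    have cT: "complete_ext A2 T" using T(1) unfolding preferred_ext_def by blast
    have "argPhi \<in> T" using R T(1) by blast
    have nE: "argE \<notin> T"
    proof
      assume "argE \<in> T"
      moreover have "(argE', argE) \<in> attacks A2" unfolding attackers2 by blast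
      ultimately show False using complete_conflict[OF is_af2 cT, of argE' argE] T(2) inS(5) by blast
    qed
    let ?\<alpha> = "\<lambda>v. argL (v, True) \<in> T"
    have lT: "?\<alpha> (fst l) = snd l" if "argL l \<in> T" "fst l \<in> X2" for l
    proof (cases "snd l")
      case True
      then have "(fst l, True) = l" by (simp add: prod_eq_iff)
      then show ?thesis using that True by simp
    next
      case False
      then have n: "neg l = (fst l, True)" by (simp add: neg_def)
      have "(argL l, argL (neg l)) \<in> attacks A2" unfolding attackers2 using that(2) by simp
      then have "(argL l, argL (fst l, True)) \<in> attacks A2" unfolding n .
      then show ?thesis using complete_conflict[OF is_af2 cT] that(1) False by blast
    qed
    have "sat ?\<alpha> \<phi>" unfolding sat_def
    proof
      fix c assume c: "c \<in> set \<phi>"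
      then have "(argC c, argPhi) \<in> attacks A2" unfolding attackers2 by blast
      then have "argC c \<in> Def A2 T" using complete_in_iff[OF cT, of argPhi] \<open>argPhi \<in> T\<close> by blast
      then obtain b where b: "b \<in> T" "(b, argC c) \<in> attacks A2" using Def_iff[OF is_af2] by blast
      then obtain l where l: "l \<in> set c" "b = argL l"
        using nE complete2(1)[OF cT] c unfolding attackers2 by blast
      then show "\<exists>l\<in>set c. ?\<alpha> (fst l) = snd l" using lT[of l] b vars[OF c l(1)] by blast
    qed
    moreover have "?\<alpha> v = \<beta> v" if v: "v \<in> set Y" for v
    proof -
      have "argL (v, \<beta> v) \<in> S0" using inL[of "(v, \<beta> v)"] v by simp
      then have "argL (v, \<beta> v) \<in> T" using T(2) by blast
      then show ?thesis using lT[of "(v, \<beta> v)"] v by simp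
    qed
    ultimately show False using \<beta> by blast
  qed
next
  assume R: "\<forall>\<beta>. \<exists>\<alpha>. sat \<alpha> \<phi> \<and> (\<forall>v\<in>set Y. \<alpha> v = \<beta> v)"
  show "\<forall>S. preferred_ext A2 S \<longrightarrow> argPhi \<in> S"
  proof (intro allI impI, rule ccontr)
    fix S assume S: "preferred_ext A2 S" "argPhi \<notin> S"
    have cS: "complete_ext A2 S" using S(1) unfolding preferred_ext_def by blast
    obtain \<alpha> where "sat \<alpha> \<phi> \<and> (\<forall>v\<in>set Y. \<alpha> v = (argL (v, True) \<in> S))"
      using R[rule_format, of "\<lambda>v. argL (v, True) \<in> S"] by (rule exE)
    then have \<alpha>: "sat \<alpha> \<phi>" "\<And>v. v \<in> set Y \<Longrightarrow> \<alpha> v \<longleftrightarrow> argL (v, True) \<in> S" by auto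
    have noB: "argB \<notin> Def A2 S"
      using Def_iff[OF is_af2, of argB S] S(2) complete2(2)[OF cS] unfolding attackers2 by blast
    \<comment> \<open>While \<open>argB\<close> is undefeated, \<open>S\<close> contains literals
      over \<open>Y\<close> only, and \<alpha> extends these choices. The flag keeps
      \<open>argE\<close> if it was chosen; otherwise \<open>argE'\<close> is put in.\<close>
    have sub: "S \<subseteq> assign_set \<alpha> (argE \<in> S)"
    proof
      fix a assume a: "a \<in> S"
      from in_complete2[OF cS a] consider l where "fst l \<in> X2" "a = argL l" | "a = argE" | "a = argE'" | "a = argG"
        using S(2) a by blast
      then show "a \<in> assign_set \<alpha> (argE \<in> S)"
      proof cases
        case 1
        have Y: "fst l \<in> set Y"
        proof (rule ccontr)
          assume "fst l \<notin> set Y"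
          then have "(argB, a) \<in> attacks A2" using 1 unfolding 1 attackers2 by blast
          then show False using noB complete_in_iff[OF cS, of a] a by blast
        qed
        have "\<alpha> (fst l) = snd l"
        proof (cases "snd l")
          case True
          then have "(fst l, True) = l" by (simp add: prod_eq_iff)
          then show ?thesis using \<alpha>(2)[OF Y] a 1 True by simp
        next
          case False
          then have n: "neg l = (fst l, True)" by (simp add: neg_def)
          have "(argL l, argL (neg l)) \<in> attacks A2" unfolding attackers2 using 1 by simp
          then have "(argL l, argL (fst l, True)) \<in> attacks A2" unfolding n .
          then show ?thesis using complete_conflict[OF is_af2 cS] a 1 False \<alpha>(2)[OF Y] by blast
        qed
        then have "argL l = argL (fst l, \<alpha> (fst l))" by (intro arg_cong[of _ _ argL]) (simp add: prod_eq_iff)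
        then have "a = argL (fst l, \<alpha> (fst l))" using 1 by simp
        then show ?thesis using 1(1) unfolding assign_set_def by blast
      next
        case 2
        then show ?thesis using a unfolding assign_set_def by simp
      next
        case 3
        have "(argE', argE) \<in> attacks A2" unfolding attackers2 by blast
        then have "argE \<notin> S" using complete_conflict[OF is_af2 cS] a 3 by blast
        then show ?thesis using 3 unfolding assign_set_def by simp
      next
        case 4
        then show ?thesis unfolding assign_set_def by simp
      qed
    qed
    have "complete_ext A2 (assign_set \<alpha> (argE \<in> S))"
      using preferred2[of "argE \<in> S" \<alpha>] \<alpha>(1) unfolding preferred_ext_def by blast
    moreover have "argPhi \<in> assign_set \<alpha> (argE \<in> S)" unfolding assign_set_def by blast
    ultimately show False using S sub unfolding preferred_ext_def by blast
  qed
qed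

text \<open>The bound on \<open>k\<close> counts the arguments besides the copies
  \<open>argD\<close>: two literals and their two starred versions for each entry of
  \<open>Y @ vars \<phi>\<close>, the clauses, and nine single arguments, four of them
  starred.\<close>

lemma skeptical2:
  assumes \<sigma>: "\<sigma> \<in> {Pr, Sst}" and k: "4 * length (Y @ vars \<phi>) + length \<phi> + 9 \<le> k"
  shows "skeptical \<sigma> (inst2 Y \<phi> k) \<longleftrightarrow> (\<forall>\<beta>. \<exists>\<alpha>. sat \<alpha> \<phi> \<and> (\<forall>v\<in>set Y. \<alpha> v = \<beta> v))"
proof -
  let ?D = "{argD i | i. i < k}"
  have cD: "card ?D = k"
  proof -
    have "?D = argD ` {..<k}" by auto
    then show ?thesis by (simp add: card_image inj_on_def argD_def)
  qed
  have "card (args A2) \<le> length (common_args (Y @ vars \<phi>) \<phi> k @ [argB, argG] @ map snd (starred (Y @ vars \<phi>)))"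
    unfolding af_of_def inst2_def Let_def by (simp only: af.simps fst_conv set_remdups card_length)
  also have "\<dots> = 4 * length (Y @ vars \<phi>) + length \<phi> + 9 + k"
  proof -
    have "length (lits X) = 2 * length X" for X by (induction X) (auto simp: lits_def)
    then show ?thesis by (simp add: common_args_def starred_def)
  qed
  finally have card: "card (args A2) \<le> 2 * card ?D" using k cD by simp
  have g: "goal (inst2 Y \<phi> k) = argG" "goal' (inst2 Y \<phi> k) = argPhi" by (simp_all add: inst2_def Let_def)
  have iL: "argPhi \<in> set (in_list (inst2 Y \<phi> k))" by (simp add: inst2_def Let_def)
  have In: "labelling_of A2 S a = In \<longleftrightarrow> a \<in> S" for S a by (simp add: labelling_of_def)
  have lab: "labelling_of A2 S d = Out \<longleftrightarrow> argPhi \<in> S" if S: "complete_ext A2 S" and d: "d \<in> ?D" for S d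
  proof -
    obtain i where i: "i < k" "d = argD i" using d by blast
    have "d \<in> Def A2 S \<longleftrightarrow> argPhi \<in> S"
      using i(1) unfolding Def_iff[OF is_af2] i(2) attackers2 by simp
    then show ?thesis using no_D[OF S i(1)] i(2) by (simp add: labelling_of_def)
  qed
  have G: "argG \<in> S" if S: "complete_ext A2 S" for S
  proof -
    have "argG \<in> args A2" unfolding args2 by blast
    moreover have "(b, argG) \<notin> attacks A2" for b by (rule attackers2)
    ultimately show ?thesis using complete_in_iff[OF S, of argG] by blast
  qed
  have cI: "complete_ext A2 (set (in_list (inst2 Y \<phi> k)))" using extension2_in unfolding preferred_ext_def by blast
  have L: "lab_of (inst2 Y \<phi> k) argPhi = In" "lab_of (inst2 Y \<phi> k) argG = In"
    unfolding lab_of_def In using iL G[OF cI] by auto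
  have LD: "lab_of (inst2 Y \<phi> k) d = Out" if "d \<in> ?D" for d
    unfolding lab_of_def using lab[OF cI that] iL by blast
  have "skeptical \<sigma> (inst2 Y \<phi> k) \<longleftrightarrow> (\<forall>L'\<in>semifactuals \<sigma> A2 argG (lab_of (inst2 Y \<phi> k)). L' argPhi = In)"
    by (simp add: skeptical_def g)
  also have "\<dots> \<longleftrightarrow> (\<forall>L'\<in>labellings \<sigma> A2. lab_of (inst2 Y \<phi> k) argG = L' argG \<longrightarrow> L' argPhi = In)"
  proof (rule semifactuals_skeptical[OF is_af2 _ card])
    show "?D \<subseteq> args A2" "argPhi \<in> args A2" by (auto simp: args2I)
    show "argPhi \<notin> ?D" by (auto simp: arg_defs)
    have LO: "L' d = Out \<longleftrightarrow> L' argPhi = In" if L': "L' \<in> labellings \<sigma> A2" and d: "d \<in> ?D" for L' d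
    proof -
      obtain S where S: "extension \<sigma> A2 S" "L' = labelling_of A2 S" using L' unfolding labellings_def by blast
      show ?thesis unfolding S(2) In by (rule lab[OF extension_complete[OF S(1)] d])
    qed
    show "L' d = lab_of (inst2 Y \<phi> k) d" if "L' \<in> labellings \<sigma> A2" "L' argPhi = In" "d \<in> ?D" for L' d
      unfolding LD[OF that(3)] using LO[OF that(1,3)] that(2) by blast
    show "L' d \<noteq> lab_of (inst2 Y \<phi> k) d" if "L' \<in> labellings \<sigma> A2" "L' argPhi \<noteq> In" "d \<in> ?D" for L' d
      unfolding LD[OF that(3)] using LO[OF that(1,3)] that(2) by blast
  qed (rule L)
  also have "\<dots> \<longleftrightarrow> (\<forall>S. extension \<sigma> A2 S \<longrightarrow> argPhi \<in> S)"
  proof -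
    have "labelling_of A2 S argG = In" if "extension \<sigma> A2 S" for S
      unfolding In by (rule G[OF extension_complete[OF that]])
    then have "lab_of (inst2 Y \<phi> k) argG = L' argG" if "L' \<in> labellings \<sigma> A2" for L'
      using that unfolding L labellings_def by auto
    then have "(\<forall>L'\<in>labellings \<sigma> A2. lab_of (inst2 Y \<phi> k) argG = L' argG \<longrightarrow> L' argPhi = In) \<longleftrightarrow>
        (\<forall>L'\<in>labellings \<sigma> A2. L' argPhi = In)" by blast
    also have "\<dots> \<longleftrightarrow> (\<forall>S. extension \<sigma> A2 S \<longrightarrow> argPhi \<in> S)"
      unfolding labellings_def using In by auto
    finally show ?thesis .
  qed
  also have "\<dots> \<longleftrightarrow> (\<forall>S. preferred_ext A2 S \<longrightarrow> argPhi \<in> S)" using extension2[OF \<sigma>] by simp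
  finally show ?thesis unfolding preferred2_iff .
qed

end

section \<open>Hardness\<close>

text \<open>\<open>remdups\<close> keeps last occurrences, hence the fold over the reversed
  list.\<close>

lemma ptime_remdups [ptime_intros]:
  assumes "ptime l"
  shows "ptime (\<lambda>x. remdups (l x))"
proof -
  have eq: "foldl (\<lambda>a y. if y \<in> set a then a else y # a) [] (rev xs) = remdups xs" for xs :: "'b list"
    by (induction xs) auto
  have "tsz (if y \<in> set a then a else y # a) \<le> tsz a + poly [:2,1:] (tsz x + tsz y)" for x :: 'a and a :: "'b list" and y
    by simp
  then have "ptime (\<lambda>x. foldl (\<lambda>a y. if y \<in> set a then a else y # a) [] (rev (l x)))"
    by (intro ptime_foldl[where c="[:2,1:]"] ptime_intros assms) 
  then show ?thesis unfolding eq .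
qed

lemma ptime_code_list [ptime_intros]:
  assumes "ptime (\<lambda>p. f (fst p) (snd p))" "ptime l"
  shows "ptime (\<lambda>x. code_list (f x) (l x))"
  unfolding code_list_def by (intro ptime_intros assms)

lemma ptime_code_word [ptime_intros]: "ptime f \<Longrightarrow> ptime (\<lambda>x. code_word (f x))"
  unfolding code_word_def by (intro ptime_intros)

lemma ptime_enc_inst: "ptime enc_inst"
proof -
  have "ptime (\<lambda>D. enc_inst D)"
    unfolding enc_inst_def label_word_def by (intro ptime_intros)
  then show ?thesis .
qed

lemma ptime_nm [ptime_intros]: "ptime f \<Longrightarrow> ptime (\<lambda>x. nm (f x))"
  unfolding nm_def by (intro ptime_intros ptime_tr)

lemma ptime_args [ptime_intros]:
  "ptime f \<Longrightarrow> ptime (\<lambda>x. argL (f x))" "ptime f \<Longrightarrow> ptime (\<lambda>x. argLS (f x))"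
  "ptime c \<Longrightarrow> ptime (\<lambda>x. argC (c x))" "ptime i \<Longrightarrow> ptime (\<lambda>x. argD (i x))"
  unfolding argL_def argLS_def argC_def argD_def by (intro ptime_intros; assumption)+

lemma ptime_lits [ptime_intros]: "ptime f \<Longrightarrow> ptime (\<lambda>x. lits (f x))"
  unfolding lits_def by (intro ptime_intros)

lemma ptime_cnf_vars [ptime_intros]: "ptime f \<Longrightarrow> ptime (\<lambda>x. vars (f x))"
  unfolding vars_def by (intro ptime_intros)

lemma ptime_neg [ptime_intros]: "ptime f \<Longrightarrow> ptime (\<lambda>x. neg (f x))"
  unfolding neg_def by (intro ptime_intros)

lemma ptime_common_args [ptime_intros]:
  "ptime X \<Longrightarrow> ptime \<phi> \<Longrightarrow> ptime k \<Longrightarrow> ptime (\<lambda>x. common_args (X x) (\<phi> x) (k x))"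
  unfolding common_args_def by (intro ptime_intros)

lemma ptime_common_attacks [ptime_intros]:
  "ptime X \<Longrightarrow> ptime \<phi> \<Longrightarrow> ptime (\<lambda>x. common_attacks (X x) (\<phi> x))"
  unfolding common_attacks_def by (intro ptime_intros)

lemma ptime_starred [ptime_intros]: "ptime X \<Longrightarrow> ptime (\<lambda>x. starred (X x))"
  unfolding starred_def by (intro ptime_intros)

lemma ptime_inst1 [ptime_intros]: "ptime \<phi> \<Longrightarrow> ptime k \<Longrightarrow> ptime (\<lambda>x. inst1 (\<phi> x) (k x))"
  unfolding inst1_def by (intro ptime_intros)

lemma ptime_inst2 [ptime_intros]:
  assumes "ptime Y" "ptime \<phi>" "ptime k"
  shows "ptime (\<lambda>x. inst2 (Y x) (\<phi> x) (k x))"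
  unfolding inst2_def Let_def by (intro ptime_intros ptime_comp[OF ptime_fst[OF ptime_id] assms(1)] assms)

text \<open>The tableau is taken for the exact certificate length and its bit variables are left
  free, so that a model spells out an accepted certificate.\<close>

lemma hard_coNP:
  assumes \<sigma>: "\<sigma> \<in> {Co, St}"
  shows "hard_for coNP (SF_SA_instances \<sigma>) (SF_SA \<sigma>)"
  unfolding hard_for_def
proof
  fix A assume "A \<in> coNP"
  then obtain B where "B \<in> NP" and A: "A = - B" unfolding co_class_def by blast
  then obtain R :: "word \<times> word \<Rightarrow> bool" and q where R: "ptime R"
    "\<And>w. w \<in> B \<longleftrightarrow> (\<exists>y. length y = poly q (length w) \<and> R (w, y))" by (metis NP_bits)
  obtain \<Phi> where \<Phi>: "ptime \<Phi>" and cl: "\<And>w y. R (w, y) \<longleftrightarrow>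
      (\<exists>\<alpha>. sat \<alpha> (\<Phi> (w, length y)) \<and> (\<forall>i<length y. \<alpha> (bitv i) = y ! i))" using cook_levin[OF R(1)] by metis
  define \<phi> where "\<phi> w = \<Phi> (w, poly q (length w))" for w
  define D where "D w = inst1 (\<phi> w) (2 * length (vars (\<phi> w)) + length (\<phi> w) + 3)" for w
  have "ptime \<phi>" unfolding \<phi>_def by (intro ptime_intros ptime_comp[OF _ \<Phi>])
  then have "ptime D" unfolding D_def by (intro ptime_intros)
  then have "ptime (\<lambda>w. enc_inst (D w))" by (rule ptime_comp[OF _ ptime_enc_inst])
  then have "poly_time_computable (\<lambda>w. enc_inst (D w))" by (rule poly_time_computable_ptime)
  moreover have "enc_inst (D w) \<in> SF_SA_instances \<sigma>" for w
    unfolding D_def by (intro enc_inst_in_instances wf_inst1 extension1 \<sigma>)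
  moreover have "w \<in> A \<longleftrightarrow> enc_inst (D w) \<in> SF_SA \<sigma>" for w
  proof -
    have "(\<exists>\<alpha>. sat \<alpha> (\<phi> w)) \<longleftrightarrow> w \<in> B"
    proof
      assume "\<exists>\<alpha>. sat \<alpha> (\<phi> w)"
      then obtain \<alpha> where "sat \<alpha> (\<phi> w)" by blast
      then have "R (w, map (\<lambda>i. \<alpha> (bitv i)) [0..<poly q (length w)])" unfolding cl \<phi>_def by (intro exI[of _ \<alpha>]) simp
      then show "w \<in> B" unfolding R(2) by (intro exI[of _ "map (\<lambda>i. \<alpha> (bitv i)) [0..<poly q (length w)]"]) simp
    next
      assume "w \<in> B"
      then obtain y where "length y = poly q (length w)" "R (w, y)" unfolding R(2) by blast
      then show "\<exists>\<alpha>. sat \<alpha> (\<phi> w)" unfolding cl \<phi>_def by auto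
    qed
    moreover have "enc_inst (D w) \<in> SF_SA \<sigma> \<longleftrightarrow> skeptical \<sigma> (D w)"
      unfolding D_def by (intro enc_inst_SF_SA wf_inst1 extension1 \<sigma>)
    moreover have "skeptical \<sigma> (D w) \<longleftrightarrow> \<not> (\<exists>\<alpha>. sat \<alpha> (\<phi> w))"
      unfolding D_def by (rule skeptical1[OF \<sigma>]) simp
    ultimately show ?thesis unfolding A by simp
  qed
  ultimately show "\<exists>f. poly_time_computable f \<and> (\<forall>w. f w \<in> SF_SA_instances \<sigma>) \<and> (\<forall>w. w \<in> A \<longleftrightarrow> f w \<in> SF_SA \<sigma>)"
    by blast
qed

lemma hard_Pi2:
  assumes \<sigma>: "\<sigma> \<in> {Pr, Sst}"
  shows "hard_for (Pi_p 2) (SF_SA_instances \<sigma>) (SF_SA \<sigma>)"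
  unfolding hard_for_def
proof
  fix A assume "A \<in> Pi_p 2"
  then obtain B where "B \<in> NP_oracle NP" and A: "A = - B" unfolding Pi_p_def Sigma_p_2 co_class_def by blast
  then obtain R :: "word \<times> word \<times> word \<Rightarrow> bool" and p q where R: "ptime R"
    "\<And>w. w \<in> B \<longleftrightarrow> (\<exists>y. length y = poly p (length w) \<and> (\<forall>z. length z = poly q (length w) \<longrightarrow> \<not> R (w, y, z)))"
    by (metis Sigma2_bits)
  \<comment> \<open>The two quantified words are glued to one input; cutting it at the known length
    of the first recovers both.\<close>
  define R' :: "word \<times> word \<Rightarrow> bool" where
    "R' x = R (fst x, take (poly p (length (fst x))) (snd x), drop (poly p (length (fst x))) (snd x))" for x
  have "ptime R'" unfolding R'_def by (intro ptime_intros ptime_comp[OF _ R(1)])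
  then obtain \<Phi> where \<Phi>: "ptime \<Phi>" and cl: "\<And>w y. R' (w, y) \<longleftrightarrow>
      (\<exists>\<alpha>. sat \<alpha> (\<Phi> (w, length y)) \<and> (\<forall>i<length y. \<alpha> (bitv i) = y ! i))" using cook_levin[of R'] by metis
  define P where "P w = poly p (length w)" for w :: word
  define Q where "Q w = poly q (length w)" for w :: word
  define \<phi> where "\<phi> w = \<Phi> (w, P w + Q w)" for w
  \<comment> \<open>The bit variables of the first word are the universally quantified ones; those
    of the second word and of the run are existential.\<close>
  define Y where "Y w = map bitv [0..<P w]" for w
  define D where "D w = inst2 (Y w) (\<phi> w) (4 * length (Y w @ vars (\<phi> w)) + length (\<phi> w) + 9)" for w
  have "ptime \<phi>" unfolding \<phi>_def P_def Q_def by (intro ptime_intros ptime_comp[OF _ \<Phi>])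
  moreover have "ptime Y" unfolding Y_def P_def bitv_def by (intro ptime_intros)
  ultimately have "ptime D" unfolding D_def by (intro ptime_intros)
  then have "ptime (\<lambda>w. enc_inst (D w))" by (rule ptime_comp[OF _ ptime_enc_inst])
  then have "poly_time_computable (\<lambda>w. enc_inst (D w))" by (rule poly_time_computable_ptime)
  moreover have "enc_inst (D w) \<in> SF_SA_instances \<sigma>" for w
    unfolding D_def by (intro enc_inst_in_instances wf_inst2) (use \<sigma> extension2 extension2_in in blast)
  moreover have "w \<in> A \<longleftrightarrow> enc_inst (D w) \<in> SF_SA \<sigma>" for w
  proof -
    have R': "R' (w, y) \<longleftrightarrow> R (w, take (P w) y, drop (P w) y)" for y unfolding R'_def P_def by simp
    have "(\<forall>\<beta>. \<exists>\<alpha>. sat \<alpha> (\<phi> w) \<and> (\<forall>v\<in>set (Y w). \<alpha> v = \<beta> v)) \<longleftrightarrow>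
        (\<forall>y. length y = P w \<longrightarrow> (\<exists>z. length z = Q w \<and> R (w, y, z)))"
    proof (intro iffI allI impI)
      fix y :: word assume l: "length y = P w" and *: "\<forall>\<beta>. \<exists>\<alpha>. sat \<alpha> (\<phi> w) \<and> (\<forall>v\<in>set (Y w). \<alpha> v = \<beta> v)"
      obtain \<alpha> where \<alpha>: "sat \<alpha> (\<phi> w) \<and> (\<forall>v\<in>set (Y w). \<alpha> v = (\<exists>i<P w. v = bitv i \<and> y ! i))"
        using *[rule_format, of "\<lambda>v. \<exists>i<P w. v = bitv i \<and> y ! i"] by (rule exE)
      let ?z = "map (\<lambda>i. \<alpha> (bitv (P w + i))) [0..<Q w]"
      have "\<alpha> (bitv i) = y ! i" if i: "i < P w" for i
      proof -
        have "bitv i \<in> set (Y w)" using i unfolding Y_def by simp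
        then have "\<alpha> (bitv i) = (\<exists>j<P w. bitv i = bitv j \<and> y ! j)" using \<alpha> by blast
        also have "\<dots> = y ! i" using i by (auto simp: bitv_def)
        finally show ?thesis .
      qed
      then have "R' (w, y @ ?z)" unfolding cl using \<alpha> l by (intro exI[of _ \<alpha>]) (auto simp: \<phi>_def nth_append)
      then have "R (w, y, ?z)" unfolding R' using l by simp
      then show "\<exists>z. length z = Q w \<and> R (w, y, z)" by (intro exI[of _ ?z]) simp
    next
      fix \<beta> :: "var \<Rightarrow> bool" assume *: "\<forall>y. length y = P w \<longrightarrow> (\<exists>z. length z = Q w \<and> R (w, y, z))"
      let ?y = "map (\<lambda>i. \<beta> (bitv i)) [0..<P w]"
      obtain z where z: "length z = Q w" "R (w, ?y, z)" using *[rule_format, of ?y] by auto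
      then have "R' (w, ?y @ z)" unfolding R' by simp
      then obtain \<alpha> where \<alpha>: "sat \<alpha> (\<phi> w)" "\<And>i. i < P w + Q w \<Longrightarrow> \<alpha> (bitv i) = (?y @ z) ! i"
        unfolding cl \<phi>_def using z(1) by auto
      have "\<alpha> v = \<beta> v" if v: "v \<in> set (Y w)" for v
      proof -
        obtain i where "i < P w" "v = bitv i" using v unfolding Y_def by auto
        then show ?thesis using \<alpha>(2)[of i] by (simp add: nth_append)
      qed
      then show "\<exists>\<alpha>. sat \<alpha> (\<phi> w) \<and> (\<forall>v\<in>set (Y w). \<alpha> v = \<beta> v)" using \<alpha>(1) by blast
    qed
    also have "\<dots> \<longleftrightarrow> w \<notin> B" unfolding R(2) P_def Q_def by blast
    finally have "(\<forall>\<beta>. \<exists>\<alpha>. sat \<alpha> (\<phi> w) \<and> (\<forall>v\<in>set (Y w). \<alpha> v = \<beta> v)) \<longleftrightarrow> w \<notin> B" .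
    moreover have "enc_inst (D w) \<in> SF_SA \<sigma> \<longleftrightarrow> skeptical \<sigma> (D w)"
      unfolding D_def by (intro enc_inst_SF_SA wf_inst2) (use \<sigma> extension2 extension2_in in blast)
    moreover have "skeptical \<sigma> (D w) \<longleftrightarrow> (\<forall>\<beta>. \<exists>\<alpha>. sat \<alpha> (\<phi> w) \<and> (\<forall>v\<in>set (Y w). \<alpha> v = \<beta> v))"
      unfolding D_def by (rule skeptical2[OF \<sigma>]) simp
    ultimately show ?thesis unfolding A by simp
  qed
  ultimately show "\<exists>f. poly_time_computable f \<and> (\<forall>w. f w \<in> SF_SA_instances \<sigma>) \<and> (\<forall>w. w \<in> A \<longleftrightarrow> f w \<in> SF_SA \<sigma>)"
    by blast
qed

section \<open>Binary search with an oracle\<close>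

lemma ptime_half [ptime_intros]:
  assumes "ptime f"
  shows "ptime (\<lambda>x. f x div 2 :: nat)"
proof -
  have "{i. i < n \<and> 2 * i + 2 \<le> n} = {..<n div 2}" for n :: nat by auto
  then have "length (filter (\<lambda>i. 2 * i + 2 \<le> n) [0..<n]) = n div 2" for n :: nat
    by (simp add: length_filter_conv_card cong: conj_cong)
  then have eq: "f x div 2 = length (filter (\<lambda>i. 2 * i + 2 \<le> f x) [0..<f x])" for x by simp
  show ?thesis unfolding eq by (intro ptime_intros ptime_comp[OF ptime_fst[OF ptime_id] assms] assms)
qed

text \<open>Whichever half is chosen, the new length is that of the larger half, so the number of
  rounds does not depend on the answers.\<close>

fun rounds :: "nat \<Rightarrow> nat" where
  "rounds n = (if n \<le> 1 then 0 else Suc (rounds (n - n div 2)))"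

declare rounds.simps [simp del]

text \<open>The form \<open>n - 1\<close> carries the induction: the larger half of \<open>n\<close>
  minus one is at most half of \<open>n - 1\<close>.\<close>

lemma rounds_le: "2 \<le> n \<Longrightarrow> 2 ^ rounds n \<le> 2 * (n - 1)"
proof (induction n rule: less_induct)
  case (less n)
  show ?case
  proof (cases "n = 2")
    case True
    then show ?thesis by (simp add: rounds.simps)
  next
    case False
    then have "2 ^ rounds (n - n div 2) \<le> 2 * (n - n div 2 - 1)" using less by (intro less.IH) auto
    moreover have "2 * (2 * (n - n div 2 - 1)) \<le> 2 * (n - 1)" using less.prems by simp
    moreover have "rounds n = Suc (rounds (n - n div 2))" using less.prems by (simp add: rounds.simps[of n])
    ultimately show ?thesis by simp
  qed
qed

text \<open>A state \<open>(w, lo, n, i)\<close> with \<open>i = 1\<close> searches for a number in \<open>{lo..<lo + n}\<close>; the final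
  states \<open>2\<close> and \<open>3\<close> accept and reject.\<close>

type_synonym search = "word \<times> nat \<times> nat \<times> nat"

text \<open>The initial state 0 asks whether the word is an instance. The last component of a query
  is its mode: 0 for this question, 1 for a search step, 2 for the final question.\<close>

definition search_out :: "search \<Rightarrow> word" where
  "search_out x = (let w = fst x; lo = fst (snd x); n = fst (snd (snd x)); i = snd (snd (snd x)) in
     if i = 0 then False # True # cd (w, 0 :: nat, 0 :: nat)
     else if i = 1 then if n \<le> 1 then False # True # cd (w, lo, 2 :: nat) else False # True # cd (w, lo + n div 2, 1 :: nat)
     else if i = 2 then [True] else [])"

definition search_upd :: "search \<times> bool \<Rightarrow> search" where
  "search_upd p = (let x = fst p; b = snd p; w = fst x; lo = fst (snd x); n = fst (snd (snd x)); i = snd (snd (snd x)) in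
     if i = 0 then (w, 0, n, if b then 1 else 3)
     else if n \<le> 1 then (w, 0, 0, if b then 3 else 2)
     else (w, if b then lo + n div 2 else lo, n - n div 2, 1))"

lemma search_simps:
  "search_out (w, lo, n, 0) = False # True # cd (w, 0 :: nat, 0 :: nat)"
  "n \<le> 1 \<Longrightarrow> search_out (w, lo, n, 1) = False # True # cd (w, lo, 2 :: nat)"
  "\<not> n \<le> 1 \<Longrightarrow> search_out (w, lo, n, 1) = False # True # cd (w, lo + n div 2, 1 :: nat)"
  "search_out (w, lo, n, 2) = [True]" "search_out (w, lo, n, 3) = []"
  "search_upd ((w, lo, n, 0), b) = (w, 0, n, if b then 1 else 3)"
  "n \<le> 1 \<Longrightarrow> search_upd ((w, lo, n, 1), b) = (w, 0, 0, if b then 3 else 2)"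
  "\<not> n \<le> 1 \<Longrightarrow> search_upd ((w, lo, n, 1), b) = (w, if b then lo + n div 2 else lo, n - n div 2, 1)"
  by (simp_all add: search_out_def search_upd_def Let_def)

lemma ainv_query: "out x = False # True # q \<Longrightarrow> tsz x \<le> S \<Longrightarrow> ainv out upd X nd S n (upd (x, q \<in> X)) \<Longrightarrow>
    ainv out upd X nd S (Suc n) x"
  by simp

lemma arun_query: "out x = False # True # q \<Longrightarrow> arun out upd X (Suc n) x \<longleftrightarrow> arun out upd X n (upd (x, q \<in> X))"
  by simp

lemma search_inv:
  assumes "lo + n \<le> length w + 1"
  shows "ainv search_out search_upd X False (10 * length w + 20) (Suc (rounds n)) (w, lo, n, 1)"
  using assms
proof (induction n arbitrary: lo rule: less_induct)
  case (less n)
  have s: "tsz (w, lo, n, 1 :: nat) \<le> 10 * length w + 20" using tsz_word[of w] less.prems by simp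
  show ?case
  proof (cases "n \<le> 1")
    case True
    have "tsz (w, 0 :: nat, 0 :: nat, if b then 3 else 2 :: nat) \<le> 10 * length w + 20" for b
      using tsz_word[of w] by simp
    moreover have "rounds n = 0" using True by (simp add: rounds.simps)
    ultimately show ?thesis using True s by (simp add: search_simps del: One_nat_def)
  next
    case False
    have "ainv search_out search_upd X False (10 * length w + 20) (Suc (rounds (n - n div 2)))
        (w, if b then lo + n div 2 else lo, n - n div 2, 1)" for b
      using less.prems False by (intro less.IH) auto
    moreover have r: "rounds n = Suc (rounds (n - n div 2))" using False by (simp add: rounds.simps[of n])
    ultimately show ?thesis unfolding r
      by (intro ainv_query[of search_out, OF search_simps(3)[OF False] s]) (simp only: search_simps(8)[OF False])
  qed
qed

lemma search_run:
  assumes "\<And>t. cd (w, t, 1 :: nat) \<in> X \<longleftrightarrow> t \<le> d" "lo \<le> d" "d < lo + n"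
  shows "arun search_out search_upd X (Suc (rounds n)) (w, lo, n, 1) \<longleftrightarrow> cd (w, d, 2 :: nat) \<notin> X"
  using assms(2,3)
proof (induction n arbitrary: lo rule: less_induct)
  case (less n)
  show ?case
  proof (cases "n \<le> 1")
    case True
    then have "rounds n = 0" "lo = d" using less.prems by (simp_all add: rounds.simps)
    then show ?thesis using True by (simp add: search_simps del: One_nat_def)
  next
    case False
    have r: "rounds n = Suc (rounds (n - n div 2))" using False by (simp add: rounds.simps[of n])
    have "arun search_out search_upd X (Suc (rounds (n - n div 2)))
        (w, if lo + n div 2 \<le> d then lo + n div 2 else lo, n - n div 2, 1) \<longleftrightarrow> cd (w, d, 2 :: nat) \<notin> X"
      using less.prems False by (intro less.IH) auto
    then show ?thesis unfolding r arun_query[of search_out, OF search_simps(3)[OF False]] search_simps(8)[OF False] assms(1) .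
  qed
qed

text \<open>The rounds are the question for an instance, the halvings of the interval of candidates
  from 0 to \<open>length w\<close>, and the final question, whose negative answer accepts.\<close>

theorem Theta_search:
  assumes X: "X \<in> Sigma_p (h - 1)"
    and A: "\<And>w. w \<in> A \<Longrightarrow> cd (w, 0 :: nat, 0 :: nat) \<in> X"
    and d: "\<And>w. cd (w, 0 :: nat, 0 :: nat) \<in> X \<Longrightarrow>
      \<exists>d\<le>length w. (\<forall>t. cd (w, t, 1 :: nat) \<in> X \<longleftrightarrow> t \<le> d) \<and> (w \<in> A \<longleftrightarrow> cd (w, d, 2 :: nat) \<notin> X)"
  shows "A \<in> Theta_p h"
proof -
  define init :: "word \<Rightarrow> search" where "init w = (w, 0, length w + 1, 0)" for w
  define r where "r w = Suc (Suc (rounds (length w + 1)))" for w :: word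
  have 1: "ptime init" unfolding init_def by (intro ptime_intros)
  have 2: "ptime search_out" unfolding search_out_def Let_def by (intro ptime_intros ptime_tr)
  have 3: "ptime search_upd" unfolding search_upd_def Let_def by (intro ptime_intros)
  have inv: "ainv search_out search_upd X False (poly [:20, 10:] (length w)) (r w) (init w)" for w
  proof -
    have t: "tsz (w, 0 :: nat, length w + 1, i :: nat) \<le> 10 * length w + 20" if "i \<le> 3" for i
      using tsz_word[of w] that by simp
    have "ainv search_out search_upd X False (10 * length w + 20) (Suc n) (w, 0, length w + 1, 3)" for n
      using t[of 3] by (simp add: search_simps)
    note rej = this
    have "ainv search_out search_upd X False (10 * length w + 20) (Suc (rounds (length w + 1)))
        (w, 0, length w + 1, if b then 1 else 3)" for b
      using search_inv[of 0 "length w + 1" w X] rej[of "rounds (length w + 1)"] by (cases b) (simp_all del: ainv.simps)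
    then have "ainv search_out search_upd X False (10 * length w + 20) (r w) (init w)" unfolding r_def init_def
      by (intro ainv_query[of search_out, OF search_simps(1) t]) (simp_all only: search_simps le0)
    then show ?thesis by (simp add: algebra_simps)
  qed
  \<comment> \<open>The two queries besides the halvings contribute the factor 4 and
    \<open>rounds_le\<close> the factor 2; for the empty word there are no halvings.\<close>
  have "2 ^ r w \<le> 8 * (length w + 1)" for w
  proof (cases w)
    case (Cons x xs)
    have "2 ^ rounds (length w + 1) \<le> 2 * (length w + 1 - 1)" by (rule rounds_le) (simp add: Cons)
    then show ?thesis by (simp add: r_def)
  qed (simp add: r_def rounds.simps)
  moreover have "w \<in> A \<longleftrightarrow> arun search_out search_upd X (r w) (init w)" for w
  proof (cases "cd (w, 0 :: nat, 0 :: nat) \<in> X")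
    case True
    then obtain d where d: "d \<le> length w" "\<And>t. cd (w, t, 1 :: nat) \<in> X \<longleftrightarrow> t \<le> d" "w \<in> A \<longleftrightarrow> cd (w, d, 2 :: nat) \<notin> X"
      using assms(3) by blast
    then have "arun search_out search_upd X (Suc (rounds (length w + 1))) (w, 0, length w + 1, 1) \<longleftrightarrow> w \<in> A"
      by (subst search_run[OF d(2)]) auto
    then show ?thesis unfolding r_def init_def arun_query[of search_out, OF search_simps(1)] search_simps(6)
      using True by (simp only: if_True)
  next
    case False
    then have "w \<notin> A" using A by blast
    moreover have "\<not> arun search_out search_upd X (Suc (rounds (length w + 1))) (w, 0, length w + 1, 3)"
      by (simp add: search_simps)
    ultimately show ?thesis unfolding r_def init_def arun_query[of search_out, OF search_simps(1)] search_simps(6)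
      using False by (simp only: if_False)
  qed
  ultimately have "\<exists>M. is_tm M \<and> deterministic M \<and> poly_time M X \<and> log_queries M X \<and> decides M X A"
    using log_query_machine[OF 1 2 3, of 8, OF _ inv] by simp
  then show ?thesis unfolding Theta_p_def using X by blast
qed

section \<open>Membership\<close>

lemma tsz_filter: "tsz (filter P xs) \<le> tsz xs"
  by (induction xs) auto

lemma tsz_code_list:
  assumes "\<And>x. tsz x \<le> 2 * length (f x)"
  shows "tsz xs \<le> 2 * length (code_list f xs)"
proof (induction xs)
  case (Cons x xs)
  then show ?case using assms[of x] by (simp add: code_list_def)
qed (simp add: code_list_def)

lemma length_code_word: "length (code_word a) = 2 * length a + 1"
  unfolding code_word_def code_list_def by (induction a) auto

lemma length_le_code_list: "length xs \<le> length (code_list f xs)"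
  unfolding code_list_def by (induction xs) auto

text \<open>Putting another set in place of the accepted arguments lets \<open>label_word\<close>
  compute the labels of a second labelling of the same framework.\<close>

definition upd_in :: "inst \<Rightarrow> word list \<Rightarrow> inst" where
  "upd_in D E = (fst D, fst (snd D), E, snd (snd (snd D)))"

lemma upd_in_simps [simp]:
  "af_of (upd_in D E) = af_of D" "in_list (upd_in D E) = E" "goal (upd_in D E) = goal D" "goal' (upd_in D E) = goal' D"
  "fst (upd_in D E) = fst D" "fst (snd (upd_in D E)) = fst (snd D)" "wf_inst (upd_in D E) = wf_inst D"
  by (simp_all add: upd_in_def af_of_def wf_inst_def)

text \<open>A list with the same elements, but a sublist of the argument list; this bounds the size
  of certificates, which could otherwise contain repetitions.\<close>

definition norm_list :: "inst \<Rightarrow> word list \<Rightarrow> word list" where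
  "norm_list D E = filter (\<lambda>a. a \<in> set E) (fst D)"

lemma set_norm_list: "set E \<subseteq> args (af_of D) \<Longrightarrow> set (norm_list D E) = set E"
  by (auto simp: norm_list_def af_of_def)

lemma lab_of_upd_in: "lab_of (upd_in D E) = labelling_of (af_of D) (set E)"
  by (simp add: lab_of_def)

lemma enc_inst_upd_in: "set E = set (in_list D) \<Longrightarrow> enc_inst (upd_in D E) = enc_inst D"
proof -
  assume E: "set E = set (in_list D)"
  have "label_word (upd_in D E) a = label_word D a" for a unfolding label_word_def upd_in_simps E by simp
  then show ?thesis unfolding enc_inst_def by simp
qed

lemma tsz_inst: "tsz (fst D) \<le> 2 * length (enc_inst D)" "tsz (upd_in D (norm_list D E)) \<le> 4 * length (enc_inst D) + 2"
proof -
  have w: "tsz (a :: word) \<le> 2 * length (code_word a)" for a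
    using tsz_word[of a] by (simp add: length_code_word)
  have "tsz a \<le> 2 * length (code_word a @ label_word D a)" for a using w[of a] by simp
  from tsz_code_list[of "\<lambda>a. code_word a @ label_word D a", OF this, of "fst D"]
  have 1: "tsz (fst D) \<le> 2 * length (code_list (\<lambda>a. code_word a @ label_word D a) (fst D))" .
  then show a: "tsz (fst D) \<le> 2 * length (enc_inst D)" unfolding enc_inst_def by simp
  have "tsz r \<le> 2 * length (code_word (fst r) @ code_word (snd r))" for r :: "word \<times> word"
    using tsz_word[of "fst r"] tsz_word[of "snd r"] by (cases r) (simp add: length_code_word)
  from tsz_code_list[of "\<lambda>r. code_word (fst r) @ code_word (snd r)", OF this, of "fst (snd D)"]
  have 2: "tsz (fst (snd D)) \<le> 2 * length (code_list (\<lambda>r. code_word (fst r) @ code_word (snd r)) (fst (snd D)))" .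
  have 3: "tsz (norm_list D E) \<le> 2 * length (enc_inst D)"
    using a tsz_filter[of "\<lambda>a. a \<in> set E" "fst D"] unfolding norm_list_def by linarith
  have "tsz (upd_in D (norm_list D E)) =
      tsz (fst D) + (tsz (fst (snd D)) + (tsz (norm_list D E) + (tsz (goal D) + tsz (goal' D) + 1) + 1) + 1) + 1"
    unfolding upd_in_def by (cases "snd (snd (snd D))") simp
  moreover have "tsz (goal D) \<le> 4 * length (goal D) + 1" "tsz (goal' D) \<le> 4 * length (goal' D) + 1" by (rule tsz_word)+
  moreover have "length (enc_inst D) = length (code_list (\<lambda>a. code_word a @ label_word D a) (fst D)) +
      (length (code_list (\<lambda>r. code_word (fst r) @ code_word (snd r)) (fst (snd D))) +
      (2 * length (goal D) + 1 + (2 * length (goal' D) + 1)))"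
    unfolding enc_inst_def by (simp add: length_code_word)
  ultimately show "tsz (upd_in D (norm_list D E)) \<le> 4 * length (enc_inst D) + 2" using 1 2 3 by linarith
qed

lemma card_args_le: "wf_inst D \<Longrightarrow> card (args (af_of D)) \<le> length (enc_inst D)"
  unfolding wf_inst_def af_of_def enc_inst_def
  using length_le_code_list[of "fst D" "\<lambda>a. code_word a @ label_word D a"] by (simp add: distinct_card)

definition dist_list :: "inst \<times> word list \<Rightarrow> nat" where
  "dist_list p = length (filter (\<lambda>a. label_word (fst p) a \<noteq> label_word (upd_in (fst p) (snd p)) a) (fst (fst p)))"

lemma label_word_eq:
  assumes "a \<in> set (fst D)"
  shows "label_word D a = label_word (upd_in D E) a \<longleftrightarrow> lab_of D a = labelling_of (af_of D) (set E) a"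
proof -
  have "label_word (upd_in D E) a = code_label (labelling_of (af_of D) (set E) a)"
    using label_word[of a "upd_in D E"] assms by (simp add: lab_of_upd_in)
  moreover have "code_label x = code_label y \<longleftrightarrow> x = y" for x y by (cases x; cases y) auto
  ultimately show ?thesis using label_word[OF assms] by simp
qed

lemma dist_list:
  assumes "wf_inst D"
  shows "dist_list (D, E) = distance (af_of D) (lab_of D) (labelling_of (af_of D) (set E))"
proof -
  let ?f = "filter (\<lambda>a. label_word D a \<noteq> label_word (upd_in D E) a) (fst D)"
  have "distinct ?f" using assms unfolding wf_inst_def by simp
  then have "length ?f = card (set ?f)" by (rule distinct_card[symmetric])
  also have "set ?f = {a \<in> args (af_of D). lab_of D a \<noteq> labelling_of (af_of D) (set E) a}"
    using label_word_eq[of _ D E] by (auto simp: af_of_def)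
  finally show ?thesis unfolding dist_list_def distance_def by simp
qed

section \<open>Polynomial-time tests for extensions\<close>

definition complete_list :: "inst \<times> word list \<Rightarrow> bool" where
  "complete_list p \<longleftrightarrow> (\<forall>a\<in>set (snd p). a \<in> set (fst (fst p))) \<and>
     (\<forall>a\<in>set (snd p). \<not> (\<exists>b\<in>set (snd p). (b, a) \<in> set (fst (snd (fst p))))) \<and>
     (\<forall>a\<in>set (fst (fst p)). a \<in> set (snd p) \<longleftrightarrow>
        (\<forall>r\<in>set (fst (snd (fst p))). snd r = a \<longrightarrow> (\<exists>b\<in>set (snd p). (b, fst r) \<in> set (fst (snd (fst p))))))"

lemma is_af_inst: "wf_inst D \<Longrightarrow> is_af (af_of D)"
  by (auto simp: is_af_def wf_inst_def af_of_def)

lemma complete_list: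
  assumes "wf_inst D"
  shows "complete_list (D, E) \<longleftrightarrow> complete_ext (af_of D) (set E)"
proof -
  note D = Def_iff[OF is_af_inst[OF assms]]
  have at: "attacks (af_of D) = set (fst (snd D))" and ar: "args (af_of D) = set (fst D)" by (simp_all add: af_of_def)
  have 1: "set E \<inter> Def (af_of D) (set E) = {} \<longleftrightarrow> (\<forall>a\<in>set E. \<not> (\<exists>b\<in>set E. (b, a) \<in> set (fst (snd D))))"
    unfolding at[symmetric] using D by blast
  have 2: "a \<in> Acc (af_of D) (set E) \<longleftrightarrow> a \<in> set (fst D) \<and>
      (\<forall>r\<in>set (fst (snd D)). snd r = a \<longrightarrow> (\<exists>b\<in>set E. (b, fst r) \<in> set (fst (snd D))))" for a
  proof -
    have "a \<in> Acc (af_of D) (set E) \<longleftrightarrow> a \<in> set (fst D) \<and>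
        (\<forall>c. (c, a) \<in> set (fst (snd D)) \<longrightarrow> (\<exists>b\<in>set E. (b, c) \<in> set (fst (snd D))))"
      unfolding Acc_def using D by (simp add: at ar)
    also have "\<dots> \<longleftrightarrow> a \<in> set (fst D) \<and>
        (\<forall>r\<in>set (fst (snd D)). snd r = a \<longrightarrow> (\<exists>b\<in>set E. (b, fst r) \<in> set (fst (snd D))))"
      by force
    finally show ?thesis .
  qed
  show ?thesis unfolding complete_ext_def admissible_def conflict_free_def 1 ar complete_list_def fst_conv snd_conv
    using 2 by blast
qed

text \<open>Maximality is automatic: an argument added to a set whose range is everything would be
  attacked from inside.\<close>

lemma stable_ext_iff: "is_af \<Lambda> \<Longrightarrow> stable_ext \<Lambda> S \<longleftrightarrow> complete_ext \<Lambda> S \<and> (\<forall>a\<in>args \<Lambda>. a \<in> S \<or> a \<in> Def \<Lambda> S)"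
proof
  assume af: "is_af \<Lambda>" and S: "complete_ext \<Lambda> S \<and> (\<forall>a\<in>args \<Lambda>. a \<in> S \<or> a \<in> Def \<Lambda> S)"
  have "\<not> (\<exists>T. complete_ext \<Lambda> T \<and> S \<subset> T)"
  proof
    assume "\<exists>T. complete_ext \<Lambda> T \<and> S \<subset> T"
    then obtain T a where T: "complete_ext \<Lambda> T" "S \<subseteq> T" "a \<in> T" "a \<notin> S" by blast
    then have "a \<in> Def \<Lambda> S" using S complete_extD(1) by blast
    then show False using complete_conflict[OF af T(1)] T(2,3) unfolding Def_iff[OF af] by blast
  qed
  moreover have "S \<union> Def \<Lambda> S = args \<Lambda>" using S complete_extD(1) unfolding Def_def by blast
  ultimately show "stable_ext \<Lambda> S" using S unfolding stable_ext_def preferred_ext_def by blast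
qed (auto simp: stable_ext_def preferred_ext_def)

text \<open>Enlarging a complete extension to a preferred one only enlarges its range, and a proper
  complete superset has a properly larger range. Comparison with all complete extensions, refuted by
  a single witness, thus replaces the nested maximality.\<close>

lemma semi_stable_ext_iff:
  assumes af: "is_af \<Lambda>"
  shows "semi_stable_ext \<Lambda> S \<longleftrightarrow> complete_ext \<Lambda> S \<and> \<not> (\<exists>T. complete_ext \<Lambda> T \<and> S \<union> Def \<Lambda> S \<subset> T \<union> Def \<Lambda> T)"
proof
  assume S: "semi_stable_ext \<Lambda> S"
  have "\<not> (\<exists>T. complete_ext \<Lambda> T \<and> S \<union> Def \<Lambda> S \<subset> T \<union> Def \<Lambda> T)"
  proof
    assume "\<exists>T. complete_ext \<Lambda> T \<and> S \<union> Def \<Lambda> S \<subset> T \<union> Def \<Lambda> T"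
    then obtain T where T: "complete_ext \<Lambda> T" "S \<union> Def \<Lambda> S \<subset> T \<union> Def \<Lambda> T" by blast
    obtain U where U: "preferred_ext \<Lambda> U" "T \<subseteq> U" using ex_preferred[OF af T(1)] .
    have "Def \<Lambda> T \<subseteq> Def \<Lambda> U" using U(2) unfolding Def_def by blast
    then have "S \<union> Def \<Lambda> S \<subset> U \<union> Def \<Lambda> U" using T(2) U(2) by blast
    then show False using S U(1) unfolding semi_stable_ext_def by blast
  qed
  then show "complete_ext \<Lambda> S \<and> \<not> (\<exists>T. complete_ext \<Lambda> T \<and> S \<union> Def \<Lambda> S \<subset> T \<union> Def \<Lambda> T)"
    using S unfolding semi_stable_ext_def preferred_ext_def by blast
next
  assume S: "complete_ext \<Lambda> S \<and> \<not> (\<exists>T. complete_ext \<Lambda> T \<and> S \<union> Def \<Lambda> S \<subset> T \<union> Def \<Lambda> T)"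
  have "False" if T: "complete_ext \<Lambda> T" "S \<subset> T" for T
  proof -
    have "Def \<Lambda> S \<subseteq> Def \<Lambda> T" using T(2) unfolding Def_def by blast
    moreover obtain a where a: "a \<in> T" "a \<notin> S" using T(2) by blast
    then have "a \<notin> Def \<Lambda> S" using complete_conflict[OF af T(1)] T(2) unfolding Def_iff[OF af] by blast
    ultimately have "S \<union> Def \<Lambda> S \<subset> T \<union> Def \<Lambda> T" using T(2) a by blast
    then show False using S T(1) by blast
  qed
  then show "semi_stable_ext \<Lambda> S" using S unfolding semi_stable_ext_def preferred_ext_def by blast
qed

definition range_list :: "inst \<times> word list \<Rightarrow> word list" where
  "range_list p = filter (\<lambda>a. a \<in> set (snd p) \<or> (\<exists>b\<in>set (snd p). (b, a) \<in> set (fst (snd (fst p))))) (fst (fst p))"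

lemma range_list:
  assumes "set E \<subseteq> args (af_of D)"
  shows "set (range_list (D, E)) = set E \<union> Def (af_of D) (set E)"
  using assms by (auto simp: range_list_def Def_def af_of_def)

definition sub_list :: "word list \<times> word list \<Rightarrow> bool" where
  "sub_list p \<longleftrightarrow> (\<forall>a\<in>set (fst p). a \<in> set (snd p)) \<and> (\<exists>a\<in>set (snd p). a \<notin> set (fst p))"

lemma sub_list: "sub_list (xs, ys) \<longleftrightarrow> set xs \<subset> set ys"
  by (auto simp: sub_list_def)

text \<open>The third component is a witness against the maximality of the second one: of the set
  itself for preferred, of its range for semi-stable extensions.\<close>

definition better :: "semantics \<Rightarrow> inst \<times> word list \<times> word list \<Rightarrow> bool" where
  "better \<sigma> p \<longleftrightarrow> complete_list (fst p, snd (snd p)) \<and>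
     (if \<sigma> = Pr then sub_list (snd p) else sub_list (range_list (fst p, fst (snd p)), range_list (fst p, snd (snd p))))"

definition candidate :: "semantics \<Rightarrow> inst \<times> word list \<Rightarrow> bool" where
  "candidate \<sigma> p \<longleftrightarrow> complete_list p \<and> (\<sigma> = St \<longrightarrow> (\<forall>a\<in>set (fst (fst p)). a \<in> set (range_list p)))"

text \<open>The polynomial-time test \<open>candidate\<close> settles \<open>Co\<close> and
  \<open>St\<close>; for the other two semantics the absence of a witness against maximality is
  added.\<close>

lemma extension_candidate:
  assumes D: "wf_inst D"
  shows "extension \<sigma> (af_of D) (set E) \<longleftrightarrow> candidate \<sigma> (D, E) \<and> (\<sigma> \<in> {Pr, Sst} \<longrightarrow> \<not> (\<exists>T. better \<sigma> (D, E, T)))"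
proof -
  note af = is_af_inst[OF D]
  have ex: "(\<exists>T. complete_ext (af_of D) T \<and> P T) \<longleftrightarrow> (\<exists>T. complete_ext (af_of D) (set T) \<and> P (set T))" for P
  proof
    assume "\<exists>T. complete_ext (af_of D) T \<and> P T"
    then obtain T where T: "complete_ext (af_of D) T" "P T" by blast
    then have "finite T" using complete_extD(1)[OF T(1)] af finite_subset unfolding is_af_def by blast
    then obtain t where "set t = T" using finite_list by blast
    then show "\<exists>T. complete_ext (af_of D) (set T) \<and> P (set T)" using T by blast
  qed blast
  show ?thesis
  proof (cases "complete_ext (af_of D) (set E)")
    case False
    then show ?thesis using extension_complete complete_list[OF D] unfolding candidate_def by blast
  next
    case True
    have r: "set (range_list (D, T)) = set T \<union> Def (af_of D) (set T)" if "complete_ext (af_of D) (set T)" for T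
      by (rule range_list) (rule complete_extD(1)[OF that])
    have args: "args (af_of D) = set (fst D)" by (simp add: af_of_def)
    show ?thesis
    proof (cases \<sigma>)
      case Co
      then show ?thesis using True complete_list[OF D] by (simp add: candidate_def)
    next
      case St
      then show ?thesis using True complete_list[OF D] r[OF True] stable_ext_iff[OF af]
        by (auto simp: candidate_def args)
    next
      case Pr
      have "better Pr (D, E, T) \<longleftrightarrow> complete_ext (af_of D) (set T) \<and> set E \<subset> set T" for T
        by (simp add: better_def complete_list[OF D] sub_list)
      then show ?thesis using Pr True complete_list[OF D] ex[of "\<lambda>T. set E \<subset> T"]
        by (simp add: candidate_def preferred_ext_def)
    next
      case Sst
      have "better Sst (D, E, T) \<longleftrightarrow> complete_ext (af_of D) (set T) \<and>
          set E \<union> Def (af_of D) (set E) \<subset> set T \<union> Def (af_of D) (set T)" for T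
        using r[of T] r[OF True] by (auto simp: better_def complete_list[OF D] sub_list)
      then show ?thesis using Sst True complete_list[OF D] ex[of "\<lambda>T. set E \<union> Def (af_of D) (set E) \<subset> T \<union> Def (af_of D) T"]
        by (simp add: candidate_def semi_stable_ext_iff[OF af])
    qed
  qed
qed

lemma better_norm_list:
  assumes "better \<sigma> (D, E, T)"
  shows "better \<sigma> (D, E, norm_list D T)"
proof -
  have "set T \<subseteq> args (af_of D)" using assms by (auto simp: better_def complete_list_def af_of_def)
  then have "set (norm_list D T) = set T" by (rule set_norm_list)
  then have "complete_list (D, norm_list D T) = complete_list (D, T)" "range_list (D, norm_list D T) = range_list (D, T)"
    "sub_list (E, norm_list D T) = sub_list (E, T)"
    by (simp_all add: complete_list_def sub_list range_list_def)
  then show ?thesis using assms unfolding better_def by (simp split: if_splits)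
qed

lemma ptime_list_tests:
  "ptime complete_list" "ptime range_list" "ptime sub_list" "ptime dist_list"
proof -
  have "ptime (\<lambda>p. complete_list p)" unfolding complete_list_def by (intro ptime_intros)
  then show "ptime complete_list" .
  have "ptime (\<lambda>p. range_list p)" unfolding range_list_def by (intro ptime_intros)
  then show "ptime range_list" .
  have "ptime (\<lambda>p. sub_list p)" unfolding sub_list_def by (intro ptime_intros)
  then show "ptime sub_list" .
  have "ptime (\<lambda>p. dist_list p)" unfolding dist_list_def label_word_def upd_in_def by (intro ptime_intros)
  then show "ptime dist_list" .
qed

lemma ptime_candidate: "ptime (candidate \<sigma>)"
proof -
  have "ptime (\<lambda>p. candidate \<sigma> p)" unfolding candidate_def by (intro ptime_intros ptime_comp[OF _ ptime_list_tests(1)] ptime_comp[OF _ ptime_list_tests(2)])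
  then show ?thesis .
qed

lemma ptime_better: "ptime (better \<sigma>)"
proof -
  have "ptime (\<lambda>p. better \<sigma> p)" unfolding better_def
    by (cases \<sigma>; simp; intro ptime_intros ptime_comp[OF _ ptime_list_tests(1)] ptime_comp[OF _ ptime_list_tests(2)] ptime_comp[OF _ ptime_list_tests(3)])
  then show ?thesis .
qed

text \<open>A query \<open>(w, t, m)\<close> with \<open>m = 1\<close> or \<open>m = 2\<close> asks for a labelling at distance at least \<open>t\<close>
  that agrees on the goal and, for \<open>m = 2\<close>, does not accept \<open>goal'\<close>; with \<open>m = 0\<close> it asks
  whether \<open>w\<close> encodes an instance.\<close>

definition query_test :: "(word \<times> nat \<times> nat) \<times> inst \<times> word list \<Rightarrow> bool" where
  "query_test y \<longleftrightarrow> wf_inst (fst (snd y)) \<and> fst (fst y) = enc_inst (fst (snd y)) \<and>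
     (snd (snd (fst y)) = 0 \<or>
       label_word (fst (snd y)) (goal (fst (snd y))) = label_word (upd_in (fst (snd y)) (snd (snd y))) (goal (fst (snd y))) \<and>
       fst (snd (fst y)) \<le> dist_list (snd y) \<and>
       (snd (snd (fst y)) = 1 \<or> goal' (fst (snd y)) \<notin> set (snd (snd y))))"

text \<open>The instance \<open>D\<close> is guessed and compared through its encoding, so no parser
  for instances is required. The given labelling is checked to be a \<sigma>-labelling along with
  the requested one.\<close>

definition queries :: "semantics \<Rightarrow> lang" where
  "queries \<sigma> = {u. \<exists>q D E. u = cd q \<and> query_test (q, D, E) \<and>
     extension \<sigma> (af_of D) (set (in_list D)) \<and> extension \<sigma> (af_of D) (set E)}"

lemma ptime_query_test: "ptime query_test"
proof -
  have "ptime (\<lambda>y. query_test y)"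
    unfolding query_test_def label_word_def upd_in_def wf_inst_def remdups_id_iff_distinct[symmetric]
    by (intro ptime_intros ptime_comp[OF _ ptime_list_tests(4)] ptime_comp[OF _ ptime_enc_inst])
  then show ?thesis .
qed

text \<open>Lists with repetitions could make certificates arbitrarily long. Both lists of accepted
  arguments are replaced by sublists of the argument list, which changes neither the sets nor the
  labels.\<close>

lemma queries_bounded:
  assumes "u \<in> queries \<sigma>"
  obtains q D E where "u = cd q" "query_test (q, D, E)" "extension \<sigma> (af_of D) (set (in_list D))"
    "extension \<sigma> (af_of D) (set E)" "tsz (q, D, E) \<le> poly [:4, 7:] (length u)"
proof -
  obtain q D E where q: "u = cd q" "query_test (q, D, E)" "extension \<sigma> (af_of D) (set (in_list D))"
    "extension \<sigma> (af_of D) (set E)" using assms unfolding queries_def by blast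
  define D' where "D' = upd_in D (norm_list D (in_list D))"
  define E' where "E' = norm_list D E"
  have I: "set (norm_list D (in_list D)) = set (in_list D)" and E: "set E' = set E"
    unfolding E'_def using extension_subset[OF q(3)] extension_subset[OF q(4)] by (simp_all only: set_norm_list)
  have l: "label_word D' a = label_word D a" "label_word (upd_in D' E') a = label_word (upd_in D E) a" for a
    unfolding label_word_def D'_def upd_in_simps I E by simp_all
  have e: "enc_inst D' = enc_inst D" unfolding D'_def by (rule enc_inst_upd_in[OF I])
  have "query_test (q, D', E')" using q(2) unfolding query_test_def dist_list_def fst_conv snd_conv l e E
    by (simp add: D'_def)
  moreover have "extension \<sigma> (af_of D') (set (in_list D'))" "extension \<sigma> (af_of D') (set E')"
    unfolding D'_def upd_in_simps I E by fact+
  moreover have "tsz (q, D', E') \<le> poly [:4, 7:] (length u)"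
  proof -
    have "length (fst q) \<le> tsz (fst q)" by (rule length_le_tsz_word)
    also have "\<dots> \<le> length u" unfolding q(1) by (cases q) simp
    finally have "length (enc_inst D) \<le> length u" using q(2) unfolding query_test_def by simp
    moreover have "tsz D' \<le> 4 * length (enc_inst D) + 2" unfolding D'_def by (rule tsz_inst)
    moreover have "tsz E' \<le> 2 * length (enc_inst D)"
      unfolding E'_def norm_list_def by (rule le_trans[OF tsz_filter tsz_inst(1)])
    ultimately show ?thesis using q(1) by simp
  qed
  ultimately show ?thesis using q(1) that by blast
qed

lemma queries_NP:
  assumes \<sigma>: "\<sigma> \<in> {Co, St}"
  shows "queries \<sigma> \<in> NP"
proof (rule NP_I)
  define R :: "word \<times> (word \<times> nat \<times> nat) \<times> inst \<times> word list \<Rightarrow> bool" where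
    "R x \<longleftrightarrow> fst x = cd (fst (snd x)) \<and> query_test (snd x) \<and>
       candidate \<sigma> (fst (snd (snd x)), in_list (fst (snd (snd x)))) \<and> candidate \<sigma> (snd (snd x))" for x
  have R: "R (u, q, D, E) \<longleftrightarrow> u = cd q \<and> query_test (q, D, E) \<and> extension \<sigma> (af_of D) (set (in_list D)) \<and>
      extension \<sigma> (af_of D) (set E)" for u q D E
    using \<sigma> extension_candidate[of D \<sigma>] by (auto simp: R_def query_test_def)
  show "ptime R" unfolding R_def
    by (intro ptime_intros ptime_tr ptime_comp[OF _ ptime_query_test] ptime_comp[OF _ ptime_candidate])
  show "u \<in> queries \<sigma>" if "R (u, y)" for u y using that unfolding queries_def by (cases y) (auto simp: R)
  show "\<exists>y. tsz y \<le> poly [:4, 7:] (length u) \<and> R (u, y)" if "u \<in> queries \<sigma>" for u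
    using queries_bounded[OF that] R by metis
qed

text \<open>Both the given and the requested extension have to be maximal. Joining the two
  refutations in one language lets a single negative answer confirm both.\<close>

definition improvable :: "semantics \<Rightarrow> lang" where
  "improvable \<sigma> = {v. \<exists>D E E' T. v = cd (D :: inst, E :: word list, E' :: word list) \<and>
     (better \<sigma> (D, E, T) \<or> better \<sigma> (D, E', T))}"

lemma improvable_NP: "improvable \<sigma> \<in> NP"
proof (rule NP_I)
  define R :: "word \<times> (inst \<times> word list \<times> word list) \<times> word list \<Rightarrow> bool" where
    "R x \<longleftrightarrow> fst x = cd (fst (snd x)) \<and>
       (better \<sigma> (fst (fst (snd x)), fst (snd (fst (snd x))), snd (snd x)) \<or>
        better \<sigma> (fst (fst (snd x)), snd (snd (fst (snd x))), snd (snd x)))" for x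
  show "ptime R" unfolding R_def by (intro ptime_intros ptime_tr ptime_comp[OF _ ptime_better])
  show "u \<in> improvable \<sigma>" if "R (u, y)" for u y
  proof -
    obtain D E E' T where y: "y = ((D, E, E'), T)" by (metis surj_pair)
    show ?thesis using that unfolding improvable_def R_def y by auto
  qed
  show "\<exists>y. tsz y \<le> poly [:1, 2:] (length u) \<and> R (u, y)" if u: "u \<in> improvable \<sigma>" for u
  proof -
    obtain D E E' T where v: "u = cd (D, E, E')" "better \<sigma> (D, E, T) \<or> better \<sigma> (D, E', T)"
      using u unfolding improvable_def by blast
    have "better \<sigma> (D, E, norm_list D T) \<or> better \<sigma> (D, E', norm_list D T)"
      using v(2) better_norm_list[of \<sigma> D] by blast
    then have "R (u, (D, E, E'), norm_list D T)" unfolding R_def using v(1) by simp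
    moreover have "tsz (norm_list D T) \<le> length u"
    proof -
      have "tsz (norm_list D T) \<le> tsz (fst D)" unfolding norm_list_def by (rule tsz_filter)
      also have "\<dots> \<le> tsz D" by (cases D) simp
      also have "\<dots> \<le> length u" unfolding v(1) by simp
      finally show ?thesis .
    qed
    ultimately show ?thesis using v(1) by (intro exI[of _ "((D, E, E'), norm_list D T)"]) simp
  qed
qed

text \<open>The verifier tests both sets as candidates, and one negative answer of the NP oracle
  \<open>improvable\<close> confirms their maximality.\<close>

lemma queries_Sigma2:
  assumes \<sigma>: "\<sigma> \<in> {Pr, Sst}"
  shows "queries \<sigma> \<in> NP_oracle NP"
proof (rule NP_oracle_I[OF _ _ improvable_NP])
  define R :: "word \<times> (word \<times> nat \<times> nat) \<times> inst \<times> word list \<Rightarrow> bool" where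
    "R x \<longleftrightarrow> fst x = cd (fst (snd x)) \<and> query_test (snd x) \<and>
       candidate \<sigma> (fst (snd (snd x)), in_list (fst (snd (snd x)))) \<and> candidate \<sigma> (snd (snd x))" for x
  define Q :: "word \<times> (word \<times> nat \<times> nat) \<times> inst \<times> word list \<Rightarrow> word" where
    "Q x = cd (fst (snd (snd x)), in_list (fst (snd (snd x))), snd (snd (snd x)))" for x
  have Q: "Q (u, q, D, E) \<in> improvable \<sigma> \<longleftrightarrow> (\<exists>T. better \<sigma> (D, in_list D, T)) \<or> (\<exists>T. better \<sigma> (D, E, T))" for u q D E
    unfolding improvable_def Q_def by (simp only: code_inject tr_inject mem_Collect_eq prod.inject fst_conv snd_conv) blast
  have R: "R (u, q, D, E) \<and> Q (u, q, D, E) \<notin> improvable \<sigma> \<longleftrightarrow> u = cd q \<and> query_test (q, D, E) \<and>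
      extension \<sigma> (af_of D) (set (in_list D)) \<and> extension \<sigma> (af_of D) (set E)" for u q D E
    using \<sigma> extension_candidate[of D \<sigma>] unfolding Q R_def by (auto simp: query_test_def)
  show "ptime R" unfolding R_def
    by (intro ptime_intros ptime_tr ptime_comp[OF _ ptime_query_test] ptime_comp[OF _ ptime_candidate])
  show "ptime Q" unfolding Q_def by (intro ptime_intros ptime_tr)
  show "u \<in> queries \<sigma>" if "R (u, y)" "Q (u, y) \<notin> improvable \<sigma>" for u y
  proof -
    obtain q D E where "y = (q, D, E)" by (metis surj_pair)
    then show ?thesis using that R unfolding queries_def by blast
  qed
  show "\<exists>y. tsz y \<le> poly [:4, 7:] (length u) \<and> R (u, y) \<and> Q (u, y) \<notin> improvable \<sigma>" if "u \<in> queries \<sigma>" for u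
    using queries_bounded[OF that] R by metis
qed

text \<open>The word determines framework, labelling and both goals, so it does not matter which
  instance \<open>D'\<close> with this encoding has been guessed.\<close>

lemma queries_iff:
  fixes t m :: nat
  assumes D: "wf_inst D" "extension \<sigma> (af_of D) (set (in_list D))"
  shows "cd (enc_inst D, t, m) \<in> queries \<sigma> \<longleftrightarrow> m = 0 \<or> (\<exists>L'\<in>labellings \<sigma> (af_of D). lab_of D (goal D) = L' (goal D) \<and>
    t \<le> distance (af_of D) (lab_of D) L' \<and> (m = 1 \<or> L' (goal' D) \<noteq> In))" (is "_ \<longleftrightarrow> ?R")
proof -
  have test: "query_test ((w, t, m), D, E) \<longleftrightarrow> wf_inst D \<and> w = enc_inst D \<and>
      (m = 0 \<or> lab_of D (goal D) = labelling_of (af_of D) (set E) (goal D) \<and>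
        t \<le> distance (af_of D) (lab_of D) (labelling_of (af_of D) (set E)) \<and>
        (m = 1 \<or> labelling_of (af_of D) (set E) (goal' D) \<noteq> In))" for w D E
  proof (cases "wf_inst D")
    case True
    have "goal D \<in> set (fst D)" using True unfolding wf_inst_def by blast
    note l = label_word_eq[OF this, of E]
    have "labelling_of (af_of D) (set E) a \<noteq> In \<longleftrightarrow> a \<notin> set E" for a by (simp add: labelling_of_def)
    then show ?thesis unfolding query_test_def fst_conv snd_conv dist_list[OF True] l by simp
  qed (simp add: query_test_def)
  show ?thesis
  proof
    assume "cd (enc_inst D, t, m) \<in> queries \<sigma>"
    then obtain q D' E where "cd (enc_inst D, t, m) = cd q" and q: "query_test (q, D', E)"
      "extension \<sigma> (af_of D') (set (in_list D'))" "extension \<sigma> (af_of D') (set E)" unfolding queries_def by blast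
    then have eq: "q = (enc_inst D, t, m)" by (simp only: code_inject tr_inject)
    then have D': "wf_inst D'" "enc_inst D = enc_inst D'" using q(1) unfolding eq test by auto
    note i = enc_inst_inject[OF D D'(1) q(2) D'(2)]
    show ?R using q(1,3) unfolding eq test i labellings_def by auto
  next
    assume R: ?R
    obtain E where "extension \<sigma> (af_of D) (set E)" "m = 0 \<or> lab_of D (goal D) = labelling_of (af_of D) (set E) (goal D) \<and>
        t \<le> distance (af_of D) (lab_of D) (labelling_of (af_of D) (set E)) \<and>
        (m = 1 \<or> labelling_of (af_of D) (set E) (goal' D) \<noteq> In)"
    proof (cases "m = 0")
      case True
      \<comment> \<open>Mode 0 puts no condition on the second set, so the given extension itself
        can be taken.\<close>
      then show ?thesis using that[of "in_list D"] D(2) by blast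
    next
      case False
      then obtain S where S: "extension \<sigma> (af_of D) S" "lab_of D (goal D) = labelling_of (af_of D) S (goal D) \<and>
        t \<le> distance (af_of D) (lab_of D) (labelling_of (af_of D) S) \<and>
        (m = 1 \<or> labelling_of (af_of D) S (goal' D) \<noteq> In)" using R unfolding labellings_def by blast
      have "finite S" using extension_subset[OF S(1)] is_af_inst[OF D(1)] finite_subset unfolding is_af_def by blast
      then obtain E where "set E = S" using finite_list by blast
      then show ?thesis using that[of E] S by blast
    qed
    then show "cd (enc_inst D, t, m) \<in> queries \<sigma>" unfolding queries_def using D test by blast
  qed
qed

lemma SF_SA_Theta:
  assumes "queries \<sigma> \<in> Sigma_p (h - 1)"
  shows "SF_SA \<sigma> \<in> Theta_p h"
proof (rule Theta_search[OF assms])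
  fix w assume "w \<in> SF_SA \<sigma>"
  then show "cd (w, 0 :: nat, 0 :: nat) \<in> queries \<sigma>" unfolding SF_SA_iff using queries_iff by blast
next
  fix w :: word assume w: "cd (w, 0 :: nat, 0 :: nat) \<in> queries \<sigma>"
  then obtain q D E where "cd (w, 0 :: nat, 0 :: nat) = cd q" "query_test (q, D, E)"
    and ext: "extension \<sigma> (af_of D) (set (in_list D))" unfolding queries_def by blast
  then have "query_test ((w, 0, 0), D, E)" by (simp only: code_inject tr_inject)
  then have D: "wf_inst D" "w = enc_inst D" unfolding query_test_def by auto
  let ?\<Lambda> = "af_of D" let ?L = "lab_of D" let ?dist = "distance ?\<Lambda> ?L"
  let ?P = "\<lambda>L'. L' \<in> labellings \<sigma> ?\<Lambda> \<and> ?L (goal D) = L' (goal D)"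
  note q = queries_iff[OF D(1) ext, folded D(2)]
  have le: "?dist L' \<le> length w" for L'
  proof -
    have "?dist L' \<le> card (args ?\<Lambda>)" unfolding distance_def
      using is_af_inst[OF D(1)] unfolding is_af_def by (intro card_mono) auto
    then show ?thesis using card_args_le[OF D(1)] D(2) by simp
  qed
  \<comment> \<open>The given labelling agrees with itself on the goal, so a largest distance
    exists.\<close>
  have PL: "?P ?L" using ext unfolding labellings_def lab_of_def by blast
  have "\<forall>L'. ?P L' \<longrightarrow> ?dist L' < Suc (length w)" using le by (simp add: less_Suc_eq_le)
  from ex_has_greatest_nat[of ?P ?L ?dist, OF PL this]
  obtain L1 where "?P L1 \<and> (\<forall>L'. ?P L' \<longrightarrow> ?dist L' \<le> ?dist L1)" by (rule exE)
  then have L1: "?P L1" "\<And>L'. ?P L' \<Longrightarrow> ?dist L' \<le> ?dist L1" by blast+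
  have "cd (w, t, 1 :: nat) \<in> queries \<sigma> \<longleftrightarrow> t \<le> ?dist L1" for t
  proof
    assume "cd (w, t, 1 :: nat) \<in> queries \<sigma>"
    then obtain L' where "?P L'" "t \<le> ?dist L'" unfolding q by auto
    then show "t \<le> ?dist L1" using L1(2) le_trans by blast
  next
    assume "t \<le> ?dist L1"
    then show "cd (w, t, 1 :: nat) \<in> queries \<sigma>" unfolding q using L1(1) by blast
  qed
  moreover have "w \<in> SF_SA \<sigma> \<longleftrightarrow> cd (w, ?dist L1, 2 :: nat) \<notin> queries \<sigma>"
  proof -
    \<comment> \<open>Semifactuals are the agreeing labellings whose distance is at least the
      maximal one; this is why queries for a distance of at least \<open>t\<close> also serve for
      the final question.\<close>
    have "L' \<in> semifactuals \<sigma> ?\<Lambda> (goal D) ?L \<longleftrightarrow> ?P L' \<and> ?dist L1 \<le> ?dist L'" for L'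
    proof
      assume L': "L' \<in> semifactuals \<sigma> ?\<Lambda> (goal D) ?L"
      then have "?P L'" "\<not> ?dist L1 > ?dist L'" unfolding semifactuals_def using L1(1) by blast+
      then show "?P L' \<and> ?dist L1 \<le> ?dist L'" by simp
    next
      assume L': "?P L' \<and> ?dist L1 \<le> ?dist L'"
      have "\<not> ?dist L'' > ?dist L'" if "?P L''" for L'' using L1(2)[OF that] L' by linarith
      then show "L' \<in> semifactuals \<sigma> ?\<Lambda> (goal D) ?L" unfolding semifactuals_def using L' by blast
    qed
    then have "skeptical \<sigma> D \<longleftrightarrow> (\<forall>L'. ?P L' \<and> ?dist L1 \<le> ?dist L' \<longrightarrow> L' (goal' D) = In)"
      unfolding skeptical_def by blast
    then have "w \<in> SF_SA \<sigma> \<longleftrightarrow> (\<forall>L'. ?P L' \<and> ?dist L1 \<le> ?dist L' \<longrightarrow> L' (goal' D) = In)"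
      unfolding D(2) enc_inst_SF_SA[OF D(1) ext] .
    moreover have "cd (w, ?dist L1, 2 :: nat) \<in> queries \<sigma> \<longleftrightarrow> (\<exists>L'. ?P L' \<and> ?dist L1 \<le> ?dist L' \<and> L' (goal' D) \<noteq> In)"
      unfolding q by (simp add: Bex_def conj_assoc)
    ultimately show ?thesis by blast
  qed
  ultimately show "\<exists>d\<le>length w. (\<forall>t. cd (w, t, 1 :: nat) \<in> queries \<sigma> \<longleftrightarrow> t \<le> d) \<and>
      (w \<in> SF_SA \<sigma> \<longleftrightarrow> cd (w, d, 2 :: nat) \<notin> queries \<sigma>)"
    using le by blast
qed

theorem theorem8:
  shows "(\<forall>\<sigma>\<in>{Co, St}.
            hard_for coNP (SF_SA_instances \<sigma>) (SF_SA \<sigma>) \<and> SF_SA \<sigma> \<in> Theta_p 2) \<and>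
         (\<forall>\<sigma>\<in>{Pr, Sst}.
            hard_for (Pi_p 2) (SF_SA_instances \<sigma>) (SF_SA \<sigma>) \<and> SF_SA \<sigma> \<in> Theta_p 3)"
proof (intro conjI ballI)
  fix \<sigma> assume "\<sigma> \<in> {Co, St}"
  then show "hard_for coNP (SF_SA_instances \<sigma>) (SF_SA \<sigma>)" "SF_SA \<sigma> \<in> Theta_p 2"
    by (rule hard_coNP, intro SF_SA_Theta) (simp add: queries_NP)
next
  fix \<sigma> assume "\<sigma> \<in> {Pr, Sst}"
  then show "hard_for (Pi_p 2) (SF_SA_instances \<sigma>) (SF_SA \<sigma>)" "SF_SA \<sigma> \<in> Theta_p 3"
    by (rule hard_Pi2, intro SF_SA_Theta) (simp add: queries_Sigma2 Sigma_p_2)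
qed

end
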